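(* A graph $G$ is the planar dual of a D3-reducible graph if and only if $G$ can be constructed by gluing together a finite collection of polyhedral graphs, each of which is a wheel graph (the graph of a tetrahedron or of a pyramid).
   Context: All graphs are finite and simple. The D3 reductions are the following two operations on a graph $G$. (D3a) Let $p,q,r$ be three vertices of degree three that induce a triangle in $G$ and whose neighbors outside $\{p,q,r\}$ are three distinct vertices; replace $p,q,r$ by a single new vertex adjacent to exactly those three outside neighbors. (D3b) Let $p,q,r$ be three vertices of degree three that induce a path with middle vertex $q$, and suppose there is a single vertex $s$ adjacent to all three of $p,q,r$; delete $q$ and add a new edge from $p$ to $r$. A graph is D3-reducible if it can be transformed into a graph isomorphic to $K_4$ by a finite sequence of D3 reductions. D3-reducible graphs are planar and 3-vertex-connected, so their planar dual is well defined. A polyhedral graph is a 3-vertex-connected planar graph. Gluing: given two polyhedral graphs $G_1$ and $G_2$ with an explicit isomorphism between a triangular face $uvw$ of $G_1$ and a triangular face $u'v'w'$ of $G_2$, form the disjoint union and identify $u$ with $u'$, $v$ with $v'$, $w$ with $w'$ (keeping the triangle edges, merged). Gluing a collection of polyhedral graphs means performing repeated such gluing steps, where each triangular face of a graph in the collection takes part in at most one gluing step, and a graph is never glued to itself (neither an original graph nor the result of previous gluing steps); gluing $p$ graphs uses $p-1$ steps. A wheel graph consists of a cycle together with one extra vertex adjacent to all cycle vertices (the four-vertex wheel being $K_4$). *)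

theory Defs
  imports
    "Graph_Theory.Pair_Digraph"
    "Graph_Theory.Digraph_Isomorphism"
    "Graph_Theory.Kuratowski"
    "HOL-Combinatorics.Orbits"
    "HOL-Library.Multiset"
begin

text \<open>
  A finite simple graph is a symmetric digraph satisfying the locale predicate
  \<^const>\<open>pair_graph\<close>: every undirected edge is represented by its two arcs, and the degree of
  a vertex is its \<^const>\<open>out_degree\<close>.
\<close>


section \<open>Polyhedral graphs and planar duals\<close>

definition three_connected :: "'a pair_pre_digraph \<Rightarrow> bool" where
  "three_connected G \<longleftrightarrow> card (pverts G) > 3 \<and>
     (\<forall>S \<subseteq> pverts G. card S < 3 \<longrightarrow>
        Digraph_Component.connected (induce_subgraph (with_proj G) (pverts G - S)))"

text \<open>
  Embeddings into the sphere are given combinatorially: \<open>\<sigma>\<close> maps every arc to the next arc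
  around its tail.
\<close>

definition rotation_system :: "'a pair_pre_digraph \<Rightarrow> ('a \<times> 'a \<Rightarrow> 'a \<times> 'a) \<Rightarrow> bool" where
  "rotation_system G \<sigma> \<longleftrightarrow> \<sigma> permutes parcs G \<and>
     (\<forall>v \<in> pverts G. out_arcs (with_proj G) v \<noteq> {} \<longrightarrow> cyclic_on \<sigma> (out_arcs (with_proj G) v))"

text \<open>
  The boundary walk of a face, arriving at \<open>v\<close> along \<open>(u, v)\<close>, leaves it along \<open>\<sigma> (v, u)\<close>.
  A face is identified with the set of arcs on its boundary walk, so every edge lies on the
  faces of its two arcs.
\<close>

definition face_of :: "('a \<times> 'a \<Rightarrow> 'a \<times> 'a) \<Rightarrow> 'a \<times> 'a \<Rightarrow> ('a \<times> 'a) set" where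
  "face_of \<sigma> a = orbit (\<sigma> \<circ> prod.swap) a"

definition faces :: "'a pair_pre_digraph \<Rightarrow> ('a \<times> 'a \<Rightarrow> 'a \<times> 'a) \<Rightarrow> ('a \<times> 'a) set set" where
  "faces G \<sigma> = face_of \<sigma> ` parcs G"

text \<open>
  A rotation system of a connected graph describes an embedding into the sphere iff its genus is
  zero, i.e. iff Euler's formula holds. (The one-vertex graph, whose only face has no arc,
  is not covered.)
\<close>

definition planar_embedding :: "'a pair_pre_digraph \<Rightarrow> ('a \<times> 'a \<Rightarrow> 'a \<times> 'a) \<Rightarrow> bool" where
  "planar_embedding G \<sigma> \<longleftrightarrow> Digraph_Component.connected (with_proj G) \<and> rotation_system G \<sigma> \<and>
     card (pverts G) + card (faces G \<sigma>) = card (parcs G) div 2 + 2"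

definition polyhedral :: "'a pair_pre_digraph \<Rightarrow> bool" where
  "polyhedral G \<longleftrightarrow> pair_graph G \<and> three_connected G \<and> (\<exists>\<sigma>. planar_embedding G \<sigma>)"

text \<open>
  Arcs being pairs, parallel edges of the dual would be merged; the dual of a polyhedral
  graph has neither parallel edges nor loops, so nothing is lost there.
\<close>

definition dual_graph ::
    "'a pair_pre_digraph \<Rightarrow> ('a \<times> 'a \<Rightarrow> 'a \<times> 'a) \<Rightarrow> ('a \<times> 'a) set pair_pre_digraph" where
  "dual_graph G \<sigma> =
     \<lparr> pverts = faces G \<sigma>, parcs = (\<lambda>a. (face_of \<sigma> a, face_of \<sigma> (prod.swap a))) ` parcs G \<rparr>"

text \<open>
  Polyhedral graphs have only one planar embedding up to reflection, so for them the
  existential quantifiers over \<open>\<sigma>\<close> in the next two definitions select nothing.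
\<close>

definition is_planar_dual :: "'a pair_pre_digraph \<Rightarrow> 'b pair_pre_digraph \<Rightarrow> bool" where
  "is_planar_dual H G \<longleftrightarrow>
     (\<exists>\<sigma>. planar_embedding H \<sigma> \<and> digraph_iso (with_proj (dual_graph H \<sigma>)) (with_proj G))"

definition triangular_faces :: "'a pair_pre_digraph \<Rightarrow> 'a set set" where
  "triangular_faces G =
     {{u, v, w} | u v w. \<exists>\<sigma>. planar_embedding G \<sigma> \<and> {(u, v), (v, w), (w, u)} \<in> faces G \<sigma>}"


section \<open>D3 reductions\<close>

inductive d3_step :: "'a pair_pre_digraph \<Rightarrow> 'a pair_pre_digraph \<Rightarrow> bool" where
  D3a: "d3_step G
     \<lparr> pverts = insert x (pverts G - {p, q, r}),
       parcs = {a \<in> parcs G. fst a \<notin> {p, q, r} \<and> snd a \<notin> {p, q, r}} \<union>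
               {(x, p'), (p', x), (x, q'), (q', x), (x, r'), (r', x)} \<rparr>"
  if "{p, q, r} \<subseteq> pverts G" and "\<forall>y \<in> {p, q, r}. out_degree (with_proj G) y = 3"
    and "distinct [p, q, r]" and "{(p, q), (q, r), (p, r)} \<subseteq> parcs G"
    and "{(p, p'), (q, q'), (r, r')} \<subseteq> parcs G" and "{p', q', r'} \<inter> {p, q, r} = {}"
    and "distinct [p', q', r']" and "x \<notin> pverts G"
| D3b: "d3_step G
     \<lparr> pverts = pverts G - {q},
       parcs = {a \<in> parcs G. fst a \<noteq> q \<and> snd a \<noteq> q} \<union> {(p, r), (r, p)} \<rparr>"
  if "{p, q, r} \<subseteq> pverts G" and "\<forall>y \<in> {p, q, r}. out_degree (with_proj G) y = 3"
    and "distinct [p, q, r]" and "{(p, q), (q, r)} \<subseteq> parcs G" and "(p, r) \<notin> parcs G"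
    and "{(s, p), (s, q), (s, r)} \<subseteq> parcs G"

definition d3_reducible :: "'a pair_pre_digraph \<Rightarrow> bool" where
  "d3_reducible G \<longleftrightarrow> pair_graph G \<and> (\<exists>K. d3_step\<^sup>*\<^sup>* G K \<and> complete_digraph 4 (with_proj K))"


section \<open>Wheels\<close>

text \<open>The cycle has the vertices \<open>0, \<dots>, n - 1\<close>; the hub is \<open>n\<close>.\<close>

definition wheel_graph :: "nat \<Rightarrow> nat pair_pre_digraph" where
  "wheel_graph n =
     \<lparr> pverts = {..n},
       parcs = (\<Union>i<n. {(i, (i + 1) mod n), ((i + 1) mod n, i), (i, n), (n, i)}) \<rparr>"

definition is_wheel :: "'a pair_pre_digraph \<Rightarrow> bool" where
  "is_wheel G \<longleftrightarrow> (\<exists>n \<ge> 3. digraph_iso (with_proj (wheel_graph n)) (with_proj G))"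


section \<open>Gluing\<close>

definition map_graph :: "('a \<Rightarrow> 'b) \<Rightarrow> 'a pair_pre_digraph \<Rightarrow> 'b pair_pre_digraph" where
  "map_graph f G = \<lparr> pverts = f ` pverts G, parcs = map_prod f f ` parcs G \<rparr>"

definition identify :: "'a \<times> 'a \<times> 'a \<Rightarrow> 'a \<times> 'a \<times> 'a \<Rightarrow> 'a \<Rightarrow> 'a" where
  "identify = (\<lambda>(u, v, w) (u', v', w'). id(u' := u, v' := v, w' := w))"

definition glue :: "'a pair_pre_digraph \<Rightarrow> 'a \<times> 'a \<times> 'a \<Rightarrow>
    'a pair_pre_digraph \<Rightarrow> 'a \<times> 'a \<times> 'a \<Rightarrow> 'a pair_pre_digraph" where
  "glue G1 T1 G2 T2 =
     \<lparr> pverts = pverts G1 \<union> pverts (map_graph (identify T1 T2) G2),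
       parcs = parcs G1 \<union> parcs (map_graph (identify T1 T2) G2) \<rparr>"

text \<open>
  \<open>gluing M G F\<close>: repeated gluing of the graphs in the collection \<open>M\<close> results in \<open>G\<close>, and
  \<open>F\<close> consists of (the images in \<open>G\<close> of) the triangular faces of graphs in \<open>M\<close> that have not
  yet taken part in a gluing step. In a step the two collections are added as multisets, so no
  graph is glued to itself. Disjointness of the two graphs glued is achieved by relabelling
  vertices; two isomorphic or equal members of \<open>M\<close> are thereby treated as different graphs.
\<close>

inductive gluing :: "'a pair_pre_digraph multiset \<Rightarrow> 'a pair_pre_digraph \<Rightarrow> 'a set set \<Rightarrow> bool" where
  single: "gluing {#G#} G (triangular_faces G)" if "polyhedral G"
| relabel: "gluing M (map_graph f G) ((`) f ` F)" if "gluing M G F" and "inj_on f (pverts G)"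
| step: "gluing (M1 + M2) (glue G1 (u, v, w) G2 (u', v', w'))
     ((F1 - {{u, v, w}}) \<union>
      (`) (identify (u, v, w) (u', v', w')) ` (F2 - {{u', v', w'}}))"
  if "gluing M1 G1 F1" and "gluing M2 G2 F2"
    and "polyhedral G1" and "polyhedral G2" and "pverts G1 \<inter> pverts G2 = {}"
    and "{u, v, w} \<in> triangular_faces G1" and "{u', v', w'} \<in> triangular_faces G2"
    and "{u, v, w} \<in> F1" and "{u', v', w'} \<in> F2"

definition glued_from :: "'a pair_pre_digraph multiset \<Rightarrow> 'b pair_pre_digraph \<Rightarrow> bool" where
  "glued_from M G \<longleftrightarrow> (\<exists>G' F. gluing M G' F \<and> digraph_iso (with_proj G') (with_proj G))"

end

theory Submission
  imports Defs
begin

text \<open>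
  Duality turns the reductions into operations on gluings of wheels. Undoing D3a glues a tetrahedron
  onto the triangle dual to a cubic vertex. Undoing D3b splits a dual vertex of degree three on the
  rim of a wheel in two, which enlarges that wheel by one spoke. The induction over a sequence of reductions
  therefore keeps track of a gluing of wheels together with its unused triangles, one for each
  cubic vertex; the faces that a reduction needs exist because in a planar embedding every triangle
  that does not separate the graph bounds a face, the face boundaries spanning the cycle space.
  Conversely, gluing a wheel onto a triangle replaces the dual cubic vertex by a smaller
  wheel-like piece, which D3b steps and a final D3a step shrink to a cubic vertex again.
\<close>

section \<open>Graphs, connectivity and isomorphism\<close>

text \<open>Both directions pass through \<open>wheel_tree\<close>, a form of gluing without
  disjoint copies and without embeddings: each wheel overlaps the graph built so far in the triangle
  itself. Two obstacles shape the rest. A face is a set of arcs, so a reduction changes the faces it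
  touches as sets, and the duals before and after cannot be compared directly. Numbers therefore
  name the faces, and the names are kept from one graph to the next. An embedding is a rotation
  system satisfying Euler's formula. Each surgery thus has to produce a rotation and a count of
  faces, and topology enters through counting as well: sets of faces that avoid one chosen face have
  distinct boundaries, and Euler's formula leaves no room for further cycles. That a triangle does
  not separate is a consequence of 3-connectivity. A reduction is not shown to preserve this
  property; instead it is carried backwards from \<open>K4\<close>, because undoing a reduction
  preserves it.\<close>

lemma pair_graph_iff:
  "pair_graph G \<longleftrightarrow> finite (pverts G) \<and>
     (\<forall>a b. (a, b) \<in> parcs G \<longrightarrow> a \<in> pverts G \<and> b \<in> pverts G \<and> a \<noteq> b \<and> (b, a) \<in> parcs G)"
proof
  assume "pair_graph G"
  then interpret pair_graph G .
  show "finite (pverts G) \<and>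
     (\<forall>a b. (a, b) \<in> parcs G \<longrightarrow> a \<in> pverts G \<and> b \<in> pverts G \<and> a \<noteq> b \<and> (b, a) \<in> parcs G)"
    using pair_finite_verts in_arcsD1 in_arcsD2 pair_no_loops pair_sym_arcs
    by (fastforce simp: symmetric_def sym_def)
next
  assume *: "finite (pverts G) \<and>
     (\<forall>a b. (a, b) \<in> parcs G \<longrightarrow> a \<in> pverts G \<and> b \<in> pverts G \<and> a \<noteq> b \<and> (b, a) \<in> parcs G)"
  then have "parcs G \<subseteq> pverts G \<times> pverts G" by auto
  then have "finite (parcs G)" using * by (meson finite_SigmaI finite_subset)
  then show "pair_graph G"
    using * by unfold_locales (auto simp: symmetric_def intro!: symI)
qed

lemma pair_graphD:
  assumes "pair_graph G" "(a, b) \<in> parcs G"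
  shows "a \<in> pverts G" "b \<in> pverts G" "a \<noteq> b" "(b, a) \<in> parcs G"
  using assms unfolding pair_graph_iff by blast+

lemma pair_graph_finite:
  assumes "pair_graph G" shows "finite (pverts G)" "finite (parcs G)"
  using assms pair_fin_digraph.pair_finite_arcs pair_fin_digraph.pair_finite_verts
    pair_graph_def pair_digraph_def by blast+

text \<open>Induced connectivity as a closure inside \<open>X\<close>. It holds for
  \<open>X = {}\<close>; nonemptiness is stated separately where
  \<open>Digraph_Component.connected\<close> asks for it.\<close>

definition conn :: "('a \<times> 'a) set \<Rightarrow> 'a set \<Rightarrow> bool" where
  "conn E X \<longleftrightarrow> (\<forall>u\<in>X. \<forall>v\<in>X. (u, v) \<in> (E \<inter> X \<times> X)\<^sup>*)"

lemma reachable_iff_rtrancl: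
  assumes "E \<subseteq> V \<times> V" "u \<in> V"
  shows "u \<rightarrow>\<^sup>*\<^bsub>with_proj \<lparr> pverts = V, parcs = E \<rparr>\<^esub> v \<longleftrightarrow> (u, v) \<in> E\<^sup>*"
proof
  assume "u \<rightarrow>\<^sup>*\<^bsub>with_proj \<lparr> pverts = V, parcs = E \<rparr>\<^esub> v"
  then have "(u, v) \<in> rtrancl_on V E" by (simp add: reachable_def)
  then show "(u, v) \<in> E\<^sup>*" by (induction rule: rtrancl_on_induct) auto
next
  assume "(u, v) \<in> E\<^sup>*"
  then have "(u, v) \<in> rtrancl_on V E"
    by (induction rule: rtrancl_induct) (use assms in \<open>auto intro: rtrancl_on.intros\<close>)
  then show "u \<rightarrow>\<^sup>*\<^bsub>with_proj \<lparr> pverts = V, parcs = E \<rparr>\<^esub> v" by (simp add: reachable_def)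
qed

lemma connected_induce_iff:
  assumes "pair_graph G" "X \<subseteq> pverts G"
  shows "Digraph_Component.connected (induce_subgraph (with_proj G) X) \<longleftrightarrow>
    X \<noteq> {} \<and> conn (parcs G) X"
proof -
  have "mk_symmetric (induce_subgraph (with_proj G) X) =
      \<lparr> pverts = X, parcs = parcs G \<inter> X \<times> X \<rparr>"
    using pair_graphD[OF assms(1)] by (fastforce simp: mk_symmetric_def induce_subgraph_def)
  then show ?thesis
    by (auto simp: Digraph_Component.connected_def strongly_connected_def conn_def
        reachable_iff_rtrancl)
qed

lemma connected_iff:
  assumes "pair_graph G"
  shows "Digraph_Component.connected (with_proj G) \<longleftrightarrow>
    pverts G \<noteq> {} \<and> conn (parcs G) (pverts G)"
proof -
  have "{e \<in> parcs G. fst e \<in> pverts G \<and> snd e \<in> pverts G} = parcs G"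
    using pair_graphD[OF assms] by auto
  then have "with_proj G = induce_subgraph (with_proj G) (pverts G)"
    by (simp add: induce_subgraph_def with_proj_def)
  then show ?thesis using connected_induce_iff[OF assms, of "pverts G"] by simp
qed

lemma three_connected_iff:
  assumes "pair_graph G"
  shows "three_connected G \<longleftrightarrow> card (pverts G) > 3 \<and>
    (\<forall>S \<subseteq> pverts G. card S < 3 \<longrightarrow> conn (parcs G) (pverts G - S))"
proof -
  have "pverts G - S \<noteq> {}" if "card (pverts G) > 3" "card S < 3" "S \<subseteq> pverts G" for S
    using that by (metis Diff_eq_empty_iff less_trans nat_neq_iff subset_antisym)
  moreover have "Digraph_Component.connected (induce_subgraph (with_proj G) (pverts G - S)) \<longleftrightarrow>
      pverts G - S \<noteq> {} \<and> conn (parcs G) (pverts G - S)" for S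
    by (rule connected_induce_iff[OF assms]) blast
  ultimately show ?thesis unfolding three_connected_def by blast
qed

text \<open>\<open>S\<close> may reach outside the graph: in \<open>three_connected_gunion\<close>
  one cut set is applied to both sides of a union.\<close>

lemma three_connectedD:
  assumes "three_connected G" "pair_graph G" "card S < 3" "finite S"
  shows "conn (parcs G) (pverts G - S)"
proof -
  have "card (pverts G \<inter> S) < 3" using assms(3,4) by (meson card_mono inf_le2 le_less_trans)
  moreover have "pverts G - S = pverts G - pverts G \<inter> S" by auto
  ultimately show ?thesis using assms(1,2) three_connected_iff by (metis inf_le1)
qed

lemma three_connected_connected:
  assumes "three_connected G" "pair_graph G"
  shows "Digraph_Component.connected (with_proj G)"
proof -
  have "card (pverts G) > 3" using assms(1) three_connected_iff[OF assms(2)] by blast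
  then have "pverts G \<noteq> {}" by auto
  then show ?thesis
    using three_connectedD[OF assms, of "{}"] connected_iff[OF assms(2)] by simp
qed

lemma connI_hub:
  assumes "sym E" and "\<And>v. v \<in> X \<Longrightarrow> (v, h) \<in> (E \<inter> X \<times> X)\<^sup>*"
  shows "conn E X"
proof -
  have "sym (E \<inter> X \<times> X)" using assms(1) by (auto simp: sym_def)
  then have "sym ((E \<inter> X \<times> X)\<^sup>*)" by (rule sym_rtrancl)
  then show ?thesis unfolding conn_def using assms(2) by (metis rtrancl_trans symD)
qed

lemma pair_graph_sym: "pair_graph G \<Longrightarrow> sym (parcs G)"
  by (auto intro!: symI dest: pair_graphD(4))

text \<open>An arc of a pair digraph is its pair of ends, so the arc map of an isomorphism follows
  from the vertex map, and isomorphism becomes equality with a renamed graph.\<close>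

lemma digraph_iso_iff:
  assumes "pair_wf_digraph G"
  shows "digraph_iso (with_proj G) (with_proj H) \<longleftrightarrow>
    (\<exists>f. inj_on f (pverts G) \<and> H = map_graph f G)"
proof
  assume "digraph_iso (with_proj G) (with_proj H)"
  then obtain f where f: "pre_digraph.digraph_isomorphism (with_proj G) f"
      "with_proj H = app_iso f (with_proj G)"
    unfolding digraph_iso_def by blast
  then have "iso_tail f = fst" "iso_head f = snd"
    "pverts H = iso_verts f ` pverts G" "parcs H = iso_arcs f ` parcs G"
    by (auto simp: with_proj_def app_iso_def)
  moreover have "inj_on (iso_verts f) (pverts G)"
      "\<forall>a\<in>parcs G. iso_verts f (fst a) = iso_tail f (iso_arcs f a) \<and>
        iso_verts f (snd a) = iso_head f (iso_arcs f a)"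
    using f(1) by (auto simp: pre_digraph.digraph_isomorphism_def)
  moreover from calculation
  have "iso_arcs f ` parcs G = map_prod (iso_verts f) (iso_verts f) ` parcs G"
    by (intro image_cong) (auto simp: prod_eq_iff)
  ultimately show "\<exists>f. inj_on f (pverts G) \<and> H = map_graph f G"
    unfolding map_graph_def by (metis (full_types) old.unit.exhaust pair_pre_digraph.surjective)
next
  assume "\<exists>f. inj_on f (pverts G) \<and> H = map_graph f G"
  then obtain f where f: "inj_on f (pverts G)" "H = map_graph f G" by blast
  let ?h = "\<lparr> iso_verts = f, iso_arcs = map_prod f f, iso_head = snd, iso_tail = fst \<rparr>"
  have "wf_digraph (with_proj G)"
    using assms by (simp add: pair_wf_digraph_def wf_digraph_def)
  moreover have "inj_on (map_prod f f) (parcs G)"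
  proof (rule inj_onI)
    fix a b assume "a \<in> parcs G" "b \<in> parcs G" "map_prod f f a = map_prod f f b"
    moreover from calculation(3) have "f (fst a) = f (fst b)" "f (snd a) = f (snd b)"
      by (simp_all add: prod_eq_iff)
    ultimately show "a = b"
      using inj_onD[OF f(1), of "fst a" "fst b"] inj_onD[OF f(1), of "snd a" "snd b"]
        pair_wf_digraph.arc_fst_in_verts[OF assms] pair_wf_digraph.arc_snd_in_verts[OF assms]
      by (simp add: prod_eq_iff)
  qed
  ultimately have "pre_digraph.digraph_isomorphism (with_proj G) ?h"
    using f(1) by (auto simp: pre_digraph.digraph_isomorphism_def)
  moreover have "with_proj H = app_iso ?h (with_proj G)"
    by (simp add: f(2) with_proj_def map_graph_def app_iso_def)
  ultimately show "digraph_iso (with_proj G) (with_proj H)" unfolding digraph_iso_def by blast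
qed

lemma pair_graph_wf: "pair_graph G \<Longrightarrow> pair_wf_digraph G"
  by (simp add: pair_digraph.axioms pair_fin_digraph_def pair_graph_def pair_digraph_def)

section \<open>Renaming vertices\<close>

lemma pverts_map_graph [simp]: "pverts (map_graph f G) = f ` pverts G"
  and parcs_map_graph [simp]: "parcs (map_graph f G) = map_prod f f ` parcs G"
  by (simp_all add: map_graph_def)

lemma map_graph_comp: "map_graph f (map_graph g G) = map_graph (f \<circ> g) G"
  by (simp add: map_graph_def image_comp map_prod.comp)

lemma map_graph_cong:
  assumes "pair_wf_digraph G" "\<And>v. v \<in> pverts G \<Longrightarrow> f v = g v"
  shows "map_graph f G = map_graph g G"
proof -
  have "map_prod f f ` parcs G = map_prod g g ` parcs G"
    using assms pair_wf_digraph.arc_fst_in_verts[OF assms(1)]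
      pair_wf_digraph.arc_snd_in_verts[OF assms(1)]
    by (intro image_cong) (auto simp: prod_eq_iff)
  moreover have "f ` pverts G = g ` pverts G" using assms(2) by simp
  ultimately show ?thesis by (simp add: map_graph_def)
qed

lemma map_graph_ident:
  assumes "pair_wf_digraph G" "\<And>v. v \<in> pverts G \<Longrightarrow> f v = v"
  shows "map_graph f G = G"
  using map_graph_cong[OF assms(1), of f id] assms(2) by (simp add: map_graph_def prod.map_id0)

lemma map_graph_the_inv_into:
  assumes "pair_wf_digraph G" "inj_on f (pverts G)"
  shows "map_graph (the_inv_into (pverts G) f) (map_graph f G) = G"
  unfolding map_graph_comp
  by (rule map_graph_ident[OF assms(1)]) (simp add: the_inv_into_f_f[OF assms(2)])

lemma pair_graph_map_graph:
  assumes "pair_graph G" "inj_on f (pverts G)"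
  shows "pair_graph (map_graph f G)"
  using assms(1,2) pair_graphD[OF assms(1)] pair_graph_finite[OF assms(1)]
  unfolding pair_graph_iff[of "map_graph f G"]
  by (auto simp: inj_on_eq_iff)

lemma map_graph_arc_iff:
  assumes "pair_graph G" "inj_on f (pverts G)" "u \<in> pverts G" "v \<in> pverts G"
  shows "(f u, f v) \<in> parcs (map_graph f G) \<longleftrightarrow> (u, v) \<in> parcs G"
  using assms pair_graphD(1,2)[OF assms(1)] by (fastforce simp: inj_on_eq_iff)

section \<open>Degrees, neighbours and triangles\<close>

lemma out_degree_eq: "out_degree (with_proj G) v = card {w. (v, w) \<in> parcs G}"
proof -
  have "out_arcs (with_proj G) v = Pair v ` {w. (v, w) \<in> parcs G}"
    by (auto simp: out_arcs_def)
  then show ?thesis by (simp add: out_degree_def card_image inj_on_def)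
qed

lemma pair_graph_finite_nbrs: "pair_graph G \<Longrightarrow> finite {w. (v, w) \<in> parcs G}"
  by (rule finite_subset[of _ "pverts G"]) (auto dest: pair_graphD pair_graph_finite)

lemma nbrs_eq_degree3:
  assumes "pair_graph G" "out_degree (with_proj G) v = 3"
    "(v, a) \<in> parcs G" "(v, b) \<in> parcs G" "(v, c) \<in> parcs G" "distinct [a, b, c]"
  shows "(v, w) \<in> parcs G \<longleftrightarrow> w = a \<or> w = b \<or> w = c"
proof -
  have "{a, b, c} = {w. (v, w) \<in> parcs G}"
    by (rule card_subset_eq) (use assms pair_graph_finite_nbrs in \<open>auto simp: out_degree_eq\<close>)
  then show ?thesis by blast
qed

text \<open>Fewer than three neighbours would be a cut: \<open>G\<close> has more than three
  vertices, so some \<open>w\<close> is neither \<open>v\<close> nor a neighbour of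
  \<open>v\<close>, and removing the neighbours separates \<open>v\<close> from
  \<open>w\<close>.\<close>

lemma three_connected_degree:
  assumes "three_connected G" "pair_graph G" "v \<in> pverts G"
  shows "3 \<le> card {w. (v, w) \<in> parcs G}"
proof (rule ccontr)
  let ?N = "{w. (v, w) \<in> parcs G}"
  assume "\<not> ?thesis"
  then have N: "card ?N < 3" by simp
  have fin: "finite ?N" using assms(2) by (rule pair_graph_finite_nbrs)
  have "card (insert v ?N) \<le> 3" using N fin by (simp add: card_insert_if)
  moreover have "card (pverts G) > 3"
    using assms(1) three_connected_iff[OF assms(2)] by blast
  ultimately have "\<not> pverts G \<subseteq> insert v ?N"
    using card_mono[of "insert v ?N" "pverts G"] fin by auto
  then obtain w where w: "w \<in> pverts G" "w \<noteq> v" "w \<notin> ?N" by blast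
  have "v \<notin> ?N" using pair_graphD(3)[OF assms(2)] by blast
  then have "(v, w) \<in> (parcs G \<inter> (pverts G - ?N) \<times> (pverts G - ?N))\<^sup>*"
    using three_connectedD[OF assms(1,2) N fin] w assms(3) by (simp add: conn_def)
  then show False using w(2,3) by (cases rule: converse_rtranclE) auto
qed

definition tris :: "'a pair_pre_digraph \<Rightarrow> 'a set set" where
  "tris G = {{u, v, w} | u v w. (u, v) \<in> parcs G \<and> (v, w) \<in> parcs G \<and> (w, u) \<in> parcs G}"

lemma trisI: "(u, v) \<in> parcs G \<Longrightarrow> (v, w) \<in> parcs G \<Longrightarrow> (w, u) \<in> parcs G \<Longrightarrow> {u, v, w} \<in> tris G"
  unfolding tris_def by blast

lemma trisE:
  assumes "T \<in> tris G"
  obtains u v w where "T = {u, v, w}" "(u, v) \<in> parcs G" "(v, w) \<in> parcs G" "(w, u) \<in> parcs G"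
  using assms unfolding tris_def by blast

lemma tris_map_graph: "(`) f ` tris G \<subseteq> tris (map_graph f G)"
proof
  fix S assume "S \<in> (`) f ` tris G"
  then obtain T where "T \<in> tris G" "S = f ` T" by blast
  then obtain u v w where "S = {f u, f v, f w}"
    "(u, v) \<in> parcs G" "(v, w) \<in> parcs G" "(w, u) \<in> parcs G"
    by (auto elim!: trisE)
  then show "S \<in> tris (map_graph f G)"
    by (auto intro!: trisI intro: rev_image_eqI)
qed

lemma tris_card:
  assumes "pair_graph G" "T \<in> tris G" shows "card T = 3" "T \<subseteq> pverts G"
  using assms(2) pair_graphD[OF assms(1)] by (auto elim!: trisE simp: card_insert_if)

section \<open>Rotation systems and faces\<close>

text \<open>Cyclicity as minimality: no proper nonempty subset is closed under \<open>f\<close>.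
  Cycles are merged and shortened below, and closed subsets are easier to follow through such
  surgery than explicit orbits.\<close>

lemma cyclic_onI:
  assumes "S \<noteq> {}" "\<And>s. s \<in> S \<Longrightarrow> f s \<in> S"
    and "\<And>A. A \<subseteq> S \<Longrightarrow> A \<noteq> {} \<Longrightarrow> (\<And>s. s \<in> A \<Longrightarrow> f s \<in> A) \<Longrightarrow> S \<subseteq> A"
  shows "cyclic_on f S"
proof -
  obtain s where s: "s \<in> S" using assms(1) by blast
  have "orbit f s \<subseteq> S"
  proof
    fix t assume "t \<in> orbit f s"
    then show "t \<in> S" by induction (use s assms(2) in auto)
  qed
  then have "S = orbit f s"
    using assms(3)[of "orbit f s"] orbit_nonempty[of f s] by (auto intro: orbit.step)
  then show ?thesis using s unfolding cyclic_on_def by blast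
qed

text \<open>The way in which cyclicity is used: a closed set built by hand inside a cycle exhausts
  it.\<close>

lemma cyclic_on_subset_eq:
  assumes "cyclic_on f S" "A \<subseteq> S" "A \<noteq> {}" "\<And>s. s \<in> A \<Longrightarrow> f s \<in> A"
  shows "A = S"
proof -
  obtain s where s: "s \<in> A" using assms(3) by blast
  have "orbit f s \<subseteq> A"
  proof
    fix t assume "t \<in> orbit f s"
    then show "t \<in> A" by induction (use s assms(4) in auto)
  qed
  moreover have "orbit f s = S" using orbit_cyclic_eq3[OF assms(1)] s assms(2) by blast
  ultimately show ?thesis using assms(2) by blast
qed

lemma cyclic_on_nonempty: "cyclic_on f S \<Longrightarrow> S \<noteq> {}"
  by (auto simp: cyclic_on_alldef)

lemma cyclic_on_bij:
  assumes "cyclic_on f S" shows "f ` S = S" "inj_on f S"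
proof -
  have "f s \<in> S" if "s \<in> S" for s using cyclic_on_inI[OF assms that] .
  then have sub: "f ` S \<subseteq> S" by blast
  show eq: "f ` S = S"
    by (rule cyclic_on_subset_eq[OF assms sub])
      (use cyclic_on_nonempty[OF assms] sub in blast)+
  show "inj_on f S"
    by (rule eq_card_imp_inj_on[OF finite_cyclic_on[OF assms]]) (simp only: eq)
qed

text \<open>Splicing at a shared pair: the step of the first cycle from \<open>a\<close> to
  \<open>b\<close> gives way to the long way from \<open>a\<close> to \<open>b\<close> in the
  second, and likewise with the roles exchanged. At a corner of a glued triangle the two short steps
  are those across the triangle.\<close>

lemma cyclic_on_merge:
  assumes c1: "cyclic_on f1 S1" and c2: "cyclic_on f2 S2"
    and ab: "{a, b} \<subseteq> S1 \<inter> S2" "a \<noteq> b" "f1 a = b" "f2 b = a"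
    and f1: "\<And>s. s \<in> S1 - {a} \<Longrightarrow> f s = f1 s" and f2: "\<And>s. s \<in> S2 - {b} \<Longrightarrow> f s = f2 s"
  shows "cyclic_on f (S1 \<union> S2)"
proof (rule cyclic_onI)
  show "S1 \<union> S2 \<noteq> {}" using ab by auto
  show "f s \<in> S1 \<union> S2" if "s \<in> S1 \<union> S2" for s
  proof (cases "s \<in> S1 - {a}")
    case True
    then show ?thesis using f1[OF True] cyclic_on_inI[OF c1, of s] by simp
  next
    case False
    then have "s \<in> S2 - {b}" using that ab by auto
    then show ?thesis using f2[of s] cyclic_on_inI[OF c2, of s] by simp
  qed
  fix A assume A: "A \<subseteq> S1 \<union> S2" "A \<noteq> {}" "\<And>s. s \<in> A \<Longrightarrow> f s \<in> A"
  have 1: "a \<in> A" if "A \<inter> S1 \<noteq> {}"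
  proof (rule ccontr)
    assume "a \<notin> A"
    then have "f1 s \<in> A \<inter> S1" if "s \<in> A \<inter> S1" for s
      using that A(3)[of s] f1[of s] cyclic_on_inI[OF c1, of s] by (cases "s = a") auto
    then have "A \<inter> S1 = S1" by (intro cyclic_on_subset_eq[OF c1 _ that]) auto
    then show False using ab \<open>a \<notin> A\<close> by auto
  qed
  have 2: "b \<in> A" if "A \<inter> S2 \<noteq> {}"
  proof (rule ccontr)
    assume "b \<notin> A"
    then have "f2 s \<in> A \<inter> S2" if "s \<in> A \<inter> S2" for s
      using that A(3)[of s] f2[of s] cyclic_on_inI[OF c2, of s] by (cases "s = b") auto
    then have "A \<inter> S2 = S2" by (intro cyclic_on_subset_eq[OF c2 _ that]) auto
    then show False using ab \<open>b \<notin> A\<close> by auto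
  qed
  have abA: "a \<in> A" "b \<in> A" using 1 2 A(1,2) ab by blast+
  have "A \<inter> S1 = S1"
  proof (rule cyclic_on_subset_eq[OF c1])
    show "f1 s \<in> A \<inter> S1" if "s \<in> A \<inter> S1" for s
      using that abA A(3)[of s] f1[of s] cyclic_on_inI[OF c1, of s] ab(3) by (cases "s = a") auto
  qed (use abA ab in auto)
  moreover have "A \<inter> S2 = S2"
  proof (rule cyclic_on_subset_eq[OF c2])
    show "f2 s \<in> A \<inter> S2" if "s \<in> A \<inter> S2" for s
      using that abA A(3)[of s] f2[of s] cyclic_on_inI[OF c2, of s] ab(4) by (cases "s = b") auto
  qed (use abA ab in auto)
  ultimately show "S1 \<union> S2 \<subseteq> A" by blast
qed

lemma cyclic_on_three:
  assumes "f a = b" "f b = c" "f c = a"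
  shows "cyclic_on f {a, b, c}"
proof (rule cyclic_onI)
  fix A assume A: "A \<subseteq> {a, b, c}" "A \<noteq> {}" "\<And>s. s \<in> A \<Longrightarrow> f s \<in> A"
  then have "a \<in> A \<Longrightarrow> b \<in> A" "b \<in> A \<Longrightarrow> c \<in> A" "c \<in> A \<Longrightarrow> a \<in> A" using assms by metis+
  then show "{a, b, c} \<subseteq> A" using A(1,2) by blast
qed (use assms in auto)

section \<open>Rotation systems and face walks\<close>

lemma out_arcs_with_proj: "out_arcs (with_proj G) v = {a \<in> parcs G. fst a = v}"
  by (auto simp: out_arcs_def)

text \<open>The arcs are partitioned by their tails, and on each class a cyclic map is a bijection;
  together these make \<open>\<sigma>\<close> a permutation.\<close>

lemma rotation_systemI:
  assumes "pair_graph G" and "\<And>a. a \<notin> parcs G \<Longrightarrow> \<sigma> a = a"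
    and cyc: "\<And>v. v \<in> pverts G \<Longrightarrow> {a \<in> parcs G. fst a = v} \<noteq> {} \<Longrightarrow>
      cyclic_on \<sigma> {a \<in> parcs G. fst a = v}"
  shows "rotation_system G \<sigma>"
proof -
  have c: "cyclic_on \<sigma> {x \<in> parcs G. fst x = fst a}" if "a \<in> parcs G" for a
  proof (rule cyc)
    show "fst a \<in> pverts G" using pair_graphD(1)[OF assms(1), of "fst a" "snd a"] that by simp
  qed (use that in blast)
  have in1: "\<sigma> a \<in> parcs G \<and> fst (\<sigma> a) = fst a" if "a \<in> parcs G" for a
    using cyclic_on_inI[OF c[OF that], of a] that by auto
  have "inj_on \<sigma> (parcs G)"
  proof (rule inj_onI)
    fix a b assume ab: "a \<in> parcs G" "b \<in> parcs G" "\<sigma> a = \<sigma> b"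
    then have "fst a = fst b" using in1 by metis
    then show "a = b" using cyclic_on_bij(2)[OF c[OF ab(1)]] ab by (auto dest: inj_onD)
  qed
  moreover have "\<sigma> ` parcs G \<subseteq> parcs G" using in1 by auto
  ultimately have "bij_betw \<sigma> (parcs G) (parcs G)"
    using pair_graph_finite(2)[OF assms(1)] by (simp add: bij_betw_def endo_inj_surj)
  then have "\<sigma> permutes parcs G" using assms(2) by (rule bij_imp_permutes) auto
  then show ?thesis using cyc by (simp add: rotation_system_def out_arcs_with_proj)
qed

lemma rotation_systemD:
  assumes "rotation_system G \<sigma>" "pair_graph G" "a \<in> parcs G"
  shows "cyclic_on \<sigma> {x \<in> parcs G. fst x = fst a}" "\<sigma> a \<in> parcs G" "fst (\<sigma> a) = fst a"
proof -
  have "fst a \<in> pverts G" using pair_graphD(1)[OF assms(2), of "fst a" "snd a"] assms(3) by simp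
  moreover have "{x \<in> parcs G. fst x = fst a} \<noteq> {}" using assms(3) by blast
  ultimately show c: "cyclic_on \<sigma> {x \<in> parcs G. fst x = fst a}"
    using assms(1) unfolding rotation_system_def out_arcs_with_proj by blast
  show "\<sigma> a \<in> parcs G" "fst (\<sigma> a) = fst a" using cyclic_on_inI[OF c, of a] assms(3) by auto
qed

lemma swap_parcs: "pair_graph G \<Longrightarrow> a \<in> parcs G \<Longrightarrow> prod.swap a \<in> parcs G"
  using pair_graphD(4)[of G "fst a" "snd a"] by (simp add: prod.swap_def)

lemma face_of_cyclic:
  assumes "rotation_system G \<sigma>" "pair_graph G" "a \<in> parcs G"
  shows "cyclic_on (\<sigma> \<circ> prod.swap) (face_of \<sigma> a)" "a \<in> face_of \<sigma> a" "face_of \<sigma> a \<subseteq> parcs G"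
proof -
  \<comment> \<open>\<open>\<sigma> \<circ> prod.swap\<close> also moves pairs that are not arcs;
    restricted to the finite set of arcs it is a permutation to which the orbit theory
    applies.\<close>
  let ?f = "perm_restrict (\<sigma> \<circ> prod.swap) (parcs G)"
  have \<sigma>: "\<sigma> permutes parcs G" using assms(1) by (simp add: rotation_system_def)
  have "inj_on (\<sigma> \<circ> prod.swap) (parcs G)"
    by (intro comp_inj_on inj_swap inj_on_subset[OF permutes_inj[OF \<sigma>]]) simp
  moreover have sub: "(\<sigma> \<circ> prod.swap) ` parcs G \<subseteq> parcs G"
    using swap_parcs[OF assms(2)] rotation_systemD(2)[OF assms(1,2)] by auto
  ultimately have "bij_betw (\<sigma> \<circ> prod.swap) (parcs G) (parcs G)"
    using endo_inj_surj[OF pair_graph_finite(2)[OF assms(2)] sub] by (simp only: bij_betw_def)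
  then have "bij_betw ?f (parcs G) (parcs G)"
    by (rule bij_betw_cong[THEN iffD1, rotated]) (simp add: perm_restrict_def)
  then have p: "?f permutes parcs G" by (rule bij_imp_permutes) (simp add: perm_restrict_def)
  have perm: "permutation ?f" using p pair_graph_finite(2)[OF assms(2)] permutation_permutes by blast
  have eq: "orbit (\<sigma> \<circ> prod.swap) a = orbit ?f a"
    by (rule orbit_cong0[OF assms(3)]) (use sub in \<open>auto simp: perm_restrict_def\<close>)
  show sub2: "face_of \<sigma> a \<subseteq> parcs G"
    unfolding face_of_def eq by (rule permutes_orbit_subset[OF p assms(3)])
  show a: "a \<in> face_of \<sigma> a"
    unfolding face_of_def eq by (rule permutation_self_in_orbit[OF perm])
  then show "cyclic_on (\<sigma> \<circ> prod.swap) (face_of \<sigma> a)"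
    unfolding face_of_def cyclic_on_def by blast
qed

lemma face_of_eq: "cyclic_on (\<sigma> \<circ> prod.swap) F \<Longrightarrow> a \<in> F \<Longrightarrow> face_of \<sigma> a = F"
  unfolding face_of_def by (rule orbit_cyclic_eq3)

lemma faces_eq_face_of:
  assumes "rotation_system G \<sigma>" "pair_graph G" "F \<in> faces G \<sigma>" "a \<in> F"
  shows "face_of \<sigma> a = F" "cyclic_on (\<sigma> \<circ> prod.swap) F" "F \<subseteq> parcs G"
  using assms face_of_cyclic[OF assms(1,2)] face_of_eq unfolding faces_def by blast+

lemma face_of_eq_iff:
  assumes "rotation_system G \<sigma>" "pair_graph G" "a \<in> parcs G" "b \<in> parcs G"
  shows "face_of \<sigma> a = face_of \<sigma> b \<longleftrightarrow> b \<in> face_of \<sigma> a"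
  using face_of_cyclic[OF assms(1,2)] face_of_eq assms(3,4) by metis

text \<open>The corner between \<open>a\<close> and \<open>\<sigma> a\<close> lies in one face: a
  walk arriving along the reverse of \<open>a\<close> leaves along
  \<open>\<sigma> a\<close>.\<close>

lemma face_of_swap:
  assumes "rotation_system G \<sigma>" "pair_graph G" "a \<in> parcs G"
  shows "face_of \<sigma> (\<sigma> a) = face_of \<sigma> (prod.swap a)"
proof -
  have "\<sigma> a \<in> face_of \<sigma> (prod.swap a)"
    unfolding face_of_def using orbit.base[of "\<sigma> \<circ> prod.swap" "prod.swap a"] by simp
  then show ?thesis
    using face_of_cyclic(1)[OF assms(1,2) swap_parcs[OF assms(2,3)]] face_of_eq by metis
qed

lemma face_of_next:
  assumes "rotation_system G \<sigma>" "pair_graph G" "(u, v) \<in> parcs G"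
  shows "face_of \<sigma> (\<sigma> (v, u)) = face_of \<sigma> (u, v)"
  using face_of_swap[OF assms(1,2), of "(v, u)"] pair_graphD(4)[OF assms(2,3)] by simp

lemma finite_faces: "pair_graph G \<Longrightarrow> finite (faces G \<sigma>)"
  unfolding faces_def by (simp add: pair_graph_finite)

lemma planar_embeddingD:
  assumes "planar_embedding G \<sigma>"
  shows "rotation_system G \<sigma>" "Digraph_Component.connected (with_proj G)"
    "card (pverts G) + card (faces G \<sigma>) = card (parcs G) div 2 + 2"
  using assms by (simp_all add: planar_embedding_def)

text \<open>A face walk of length three determines \<open>\<sigma>\<close> at its corners: the next
  arc lies on the face, its tail is known, and each corner is the tail of one arc only.\<close>

lemma triangle_face_step:
  assumes "rotation_system G \<sigma>" "pair_graph G" "{(u, v), (v, w), (w, u)} \<in> faces G \<sigma>"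
  shows "\<sigma> (v, u) = (v, w)" "\<sigma> (w, v) = (w, u)" "\<sigma> (u, w) = (u, v)"
    and "u \<noteq> v" "v \<noteq> w" "w \<noteq> u" "(u, v) \<in> parcs G" "(v, w) \<in> parcs G" "(w, u) \<in> parcs G"
proof -
  let ?T = "{(u, v), (v, w), (w, u)}"
  have c: "cyclic_on (\<sigma> \<circ> prod.swap) ?T" and sub: "?T \<subseteq> parcs G"
    using faces_eq_face_of(2,3)[OF assms, of "(u, v)"] by auto
  show uvw: "(u, v) \<in> parcs G" "(v, w) \<in> parcs G" "(w, u) \<in> parcs G" using sub by auto
  then show ne: "u \<noteq> v" "v \<noteq> w" "w \<noteq> u" using pair_graphD(3)[OF assms(2)] by blast+
  have "\<sigma> (v, u) \<in> ?T" "\<sigma> (w, v) \<in> ?T" "\<sigma> (u, w) \<in> ?T"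
    using cyclic_on_inI[OF c, of "(u, v)"] cyclic_on_inI[OF c, of "(v, w)"]
      cyclic_on_inI[OF c, of "(w, u)"] by auto
  moreover have "fst (\<sigma> (v, u)) = v" "fst (\<sigma> (w, v)) = w" "fst (\<sigma> (u, w)) = u"
    using rotation_systemD(3)[OF assms(1,2)] uvw pair_graphD(4)[OF assms(2)] by force+
  ultimately show "\<sigma> (v, u) = (v, w)" "\<sigma> (w, v) = (w, u)" "\<sigma> (u, w) = (u, v)"
    using ne by auto
qed

text \<open>Without loops every edge consists of two distinct arcs. This makes the division by two
  in Euler's formula exact.\<close>

lemma card_parcs_eq:
  assumes "pair_graph G"
  shows "card (parcs G) = 2 * card ((\<lambda>(a, b). {a, b}) ` parcs G)"
proof -
  let ?e = "\<lambda>(a, b). {a, b}"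
  have "parcs G = (\<Union>e \<in> ?e ` parcs G. {a \<in> parcs G. ?e a = e})" by auto
  also have "card \<dots> = (\<Sum>e \<in> ?e ` parcs G. card {a \<in> parcs G. ?e a = e})"
    by (rule card_UN_disjoint) (use pair_graph_finite(2)[OF assms] in auto)
  also have "\<dots> = (\<Sum>e \<in> ?e ` parcs G. 2)"
  proof (rule sum.cong[OF refl])
    fix e assume "e \<in> ?e ` parcs G"
    then obtain a b where ab: "(a, b) \<in> parcs G" "e = {a, b}" by auto
    then have "{x \<in> parcs G. ?e x = e} = {(a, b), (b, a)}"
      using pair_graphD(4)[OF assms] by (auto simp: doubleton_eq_iff)
    then show "card {x \<in> parcs G. ?e x = e} = 2" using pair_graphD(3)[OF assms ab(1)] by simp
  qed
  finally show ?thesis by simp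
qed

section \<open>Union of two graphs along a triangle\<close>

lemma conn_mono: "conn E X \<Longrightarrow> E \<subseteq> E' \<Longrightarrow> conn E' X"
  unfolding conn_def by (meson Int_mono order_refl rtrancl_mono subsetD)

lemma conn_Un:
  assumes "conn E X" "conn E Y" "X \<inter> Y \<noteq> {}"
  shows "conn E (X \<union> Y)"
proof -
  obtain h where h: "h \<in> X" "h \<in> Y" using assms(3) by blast
  have *: "(E \<inter> X \<times> X)\<^sup>* \<subseteq> (E \<inter> (X \<union> Y) \<times> (X \<union> Y))\<^sup>*" "(E \<inter> Y \<times> Y)\<^sup>* \<subseteq> (E \<inter> (X \<union> Y) \<times> (X \<union> Y))\<^sup>*"
    by (intro rtrancl_mono; blast)+
  have "(a, h) \<in> (E \<inter> (X \<union> Y) \<times> (X \<union> Y))\<^sup>* \<and> (h, a) \<in> (E \<inter> (X \<union> Y) \<times> (X \<union> Y))\<^sup>*"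
    if "a \<in> X \<union> Y" for a
    using that h assms(1,2) * unfolding conn_def by blast
  then show ?thesis unfolding conn_def by (meson rtrancl_trans)
qed

text \<open>Gluing is a plain union once the second graph has been renamed so as to meet the first
  in the triangle only (\<open>glue_eq\<close>).\<close>

definition gunion :: "'a pair_pre_digraph \<Rightarrow> 'a pair_pre_digraph \<Rightarrow> 'a pair_pre_digraph" where
  "gunion G H = \<lparr> pverts = pverts G \<union> pverts H, parcs = parcs G \<union> parcs H \<rparr>"

lemma gunion_simps [simp]:
  "pverts (gunion G H) = pverts G \<union> pverts H" "parcs (gunion G H) = parcs G \<union> parcs H"
  by (simp_all add: gunion_def)

lemma pair_graph_gunion: "pair_graph G \<Longrightarrow> pair_graph H \<Longrightarrow> pair_graph (gunion G H)"
  unfolding pair_graph_iff by auto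

text \<open>Fewer than three deleted vertices spare a vertex of \<open>T\<close>, which lies in both
  remainders and joins them.\<close>

lemma three_connected_gunion:
  assumes "three_connected G1" "pair_graph G1" "three_connected G2" "pair_graph G2"
    and "pverts G1 \<inter> pverts G2 = T" "card T = 3"
  shows "three_connected (gunion G1 G2)"
  unfolding three_connected_iff[OF pair_graph_gunion[OF assms(2,4)]]
proof (intro conjI allI impI)
  have fin: "finite (pverts G1 \<union> pverts G2)" using assms(2,4) pair_graph_finite by auto
  have "card (pverts G1) > 3" using assms(1,2) three_connected_iff by blast
  then show "3 < card (pverts (gunion G1 G2))"
    using card_mono[OF fin, of "pverts G1"] by simp
  fix S assume S: "S \<subseteq> pverts (gunion G1 G2)" "card S < 3"
  then have fS: "finite S" using fin finite_subset by auto
  have "\<not> T \<subseteq> S" using S(2) fS assms(6) card_mono[of S T] by auto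
  then have "(pverts G1 - S) \<inter> (pverts G2 - S) \<noteq> {}" using assms(5) by blast
  moreover have "conn (parcs (gunion G1 G2)) (pverts G1 - S)"
    by (rule conn_mono[OF three_connectedD[OF assms(1,2) S(2) fS]]) simp
  moreover have "conn (parcs (gunion G1 G2)) (pverts G2 - S)"
    by (rule conn_mono[OF three_connectedD[OF assms(3,4) S(2) fS]]) simp
  ultimately have "conn (parcs (gunion G1 G2)) ((pverts G1 - S) \<union> (pverts G2 - S))"
    by (intro conn_Un)
  then show "conn (parcs (gunion G1 G2)) (pverts (gunion G1 G2) - S)" by (simp add: Un_Diff)
qed

text \<open>The face permutation of the union agrees with the two given ones away from the two triangles,
  one on each side, that the gluing makes disappear.\<close>

lemma planar_embedding_gunion:
  assumes g1: "pair_graph G1" and g2: "pair_graph G2"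
    and e1: "planar_embedding G1 \<sigma>1" and e2: "planar_embedding G2 \<sigma>2"
    and V: "pverts G1 \<inter> pverts G2 = {u, v, w}"
    and T1: "{(u, v), (v, w), (w, u)} \<in> faces G1 \<sigma>1" (is "?T1 \<in> _")
    and T2: "{(v, u), (w, v), (u, w)} \<in> faces G2 \<sigma>2" (is "?T2 \<in> _")
  obtains \<sigma> where "planar_embedding (gunion G1 G2) \<sigma>"
    "\<And>a. a \<in> parcs G1 - ?T1 \<Longrightarrow> face_of \<sigma> a = face_of \<sigma>1 a"
    "\<And>a. a \<in> parcs G2 - ?T2 \<Longrightarrow> face_of \<sigma> a = face_of \<sigma>2 a"
    "faces (gunion G1 G2) \<sigma> = (faces G1 \<sigma>1 - {?T1}) \<union> (faces G2 \<sigma>2 - {?T2})"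
proof -
  let ?G = "gunion G1 G2" and ?E1 = "parcs G1" and ?E2 = "parcs G2"
  note r1 = planar_embeddingD(1)[OF e1] and r2 = planar_embeddingD(1)[OF e2]
  note g = pair_graph_gunion[OF g1 g2]
  have T2': "{(u, w), (w, v), (v, u)} \<in> faces G2 \<sigma>2" using T2 by (simp add: insert_commute)
  note t1 = triangle_face_step[OF r1 g1 T1] and t2 = triangle_face_step[OF r2 g2 T2']
  \<comment> \<open>An arc of both graphs has both ends in the common triangle, hence is one of its
    six arcs.\<close>
  have int: "a \<in> ?T1 \<union> ?T2" if "a \<in> ?E1" "a \<in> ?E2" for a
  proof -
    have "fst a \<in> {u, v, w}" "snd a \<in> {u, v, w}" "fst a \<noteq> snd a"
      using that pair_graphD[OF g1, of "fst a" "snd a"] pair_graphD[OF g2, of "fst a" "snd a"] V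
      by auto
    then show ?thesis by (auto simp: prod_eq_iff)
  qed
  have T1E: "?T1 \<subseteq> ?E1" "?T1 \<subseteq> ?E2" and T2E: "?T2 \<subseteq> ?E1" "?T2 \<subseteq> ?E2"
    using t1 t2 pair_graphD(4)[OF g1] pair_graphD(4)[OF g2] by auto
  have T12: "?T1 \<inter> ?T2 = {}" using t1(4-6) by auto
  \<comment> \<open>The face step from the arriving arc \<open>prod.swap a\<close>: as in
    \<open>G1\<close> if that arc lies in \<open>G1\<close> off \<open>?T1\<close>, else as in
    \<open>G2\<close>. So an arc of \<open>?T1\<close> now continues along its face in
    \<open>G2\<close>, and an arc of \<open>?T2\<close> along its face in \<open>G1\<close>.\<close>
  define \<sigma> where "\<sigma> a = (if prod.swap a \<in> ?E1 - ?T1 then \<sigma>1 a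
    else if prod.swap a \<in> ?E2 - ?T2 then \<sigma>2 a else a)" for a
  have s1: "\<sigma> a = \<sigma>1 a" if "prod.swap a \<in> ?E1 - ?T1" for a
    using that by (simp add: \<sigma>_def)
  have s2: "\<sigma> a = \<sigma>2 a" if "prod.swap a \<in> ?E2 - ?T2" for a
    using that int[of "prod.swap a"] by (auto simp: \<sigma>_def)
  have sw: "prod.swap a \<in> E \<longleftrightarrow> a \<in> E" if "E = ?E1 \<or> E = ?E2" for a E
    using that swap_parcs[OF g1, of a] swap_parcs[OF g2, of a]
      swap_parcs[OF g1, of "prod.swap a"] swap_parcs[OF g2, of "prod.swap a"] by auto
  \<comment> \<open>One corner of the triangle, with \<open>x\<close>, \<open>y\<close>,
    \<open>z\<close> standing for any cyclic shift of \<open>u\<close>, \<open>v\<close>,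
    \<open>w\<close>. The two rotations at \<open>x\<close> are spliced where each steps across the
    lost triangle.\<close>
  have corner: "cyclic_on \<sigma> {a \<in> ?E1 \<union> ?E2. fst a = x}"
    if x: "{(x, y), (y, z), (z, x)} = ?T1" "{(y, x), (z, y), (x, z)} = ?T2"
      "\<sigma>1 (x, z) = (x, y)" "\<sigma>2 (x, y) = (x, z)" "distinct [x, y, z]" for x y z
  proof -
    have mem: "(x, y) \<in> ?T1" "(z, x) \<in> ?T1" "(y, x) \<in> ?T2" "(x, z) \<in> ?T2"
      unfolding x(1,2)[symmetric] by auto
    then have mem': "(x, y) \<notin> ?T2" "(z, x) \<notin> ?T2" "(y, x) \<notin> ?T1" "(x, z) \<notin> ?T1"
      using T12 by blast+
    have "cyclic_on \<sigma> ({a \<in> ?E1. fst a = x} \<union> {a \<in> ?E2. fst a = x})"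
    proof (rule cyclic_on_merge[where a = "(x, z)" and b = "(x, y)"])
      show "cyclic_on \<sigma>1 {a \<in> ?E1. fst a = x}" "cyclic_on \<sigma>2 {a \<in> ?E2. fst a = x}"
        using rotation_systemD(1)[OF r1 g1, of "(x, y)"] rotation_systemD(1)[OF r2 g2, of "(x, y)"]
          T1E mem by auto
      show "{(x, z), (x, y)} \<subseteq> {a \<in> ?E1. fst a = x} \<inter> {a \<in> ?E2. fst a = x}"
        using mem T1E T2E by auto
      show "\<sigma> s = \<sigma>1 s" if "s \<in> {a \<in> ?E1. fst a = x} - {(x, z)}" for s
      proof (rule s1)
        have "prod.swap s \<notin> {(x, y), (y, z), (z, x)}" using that x(5) by (cases s) auto
        then show "prod.swap s \<in> ?E1 - ?T1" using that sw[of ?E1 s] x(1) by simp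
      qed
      show "\<sigma> s = \<sigma>2 s" if "s \<in> {a \<in> ?E2. fst a = x} - {(x, y)}" for s
      proof (rule s2)
        have "prod.swap s \<notin> {(y, x), (z, y), (x, z)}" using that x(5) by (cases s) auto
        then show "prod.swap s \<in> ?E2 - ?T2" using that sw[of ?E2 s] x(2) by simp
      qed
    qed (use x in auto)
    moreover have "{a \<in> ?E1. fst a = x} \<union> {a \<in> ?E2. fst a = x} = {a \<in> ?E1 \<union> ?E2. fst a = x}"
      by auto
    ultimately show ?thesis by simp
  qed
  have rot: "rotation_system ?G \<sigma>"
  proof (rule rotation_systemI[OF g])
    show "\<sigma> a = a" if "a \<notin> parcs ?G" for a
      using that sw[of ?E1 a] sw[of ?E2 a] by (auto simp: \<sigma>_def)
    fix x assume x: "x \<in> pverts ?G" "{a \<in> parcs ?G. fst a = x} \<noteq> {}"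
    consider "x \<in> {u, v, w}" | "x \<in> pverts G1 - pverts G2" | "x \<in> pverts G2 - pverts G1"
      using x(1) V by auto
    then show "cyclic_on \<sigma> {a \<in> parcs ?G. fst a = x}"
    proof cases
      case 1
      have "cyclic_on \<sigma> {a \<in> ?E1 \<union> ?E2. fst a = u}"
        by (rule corner[of u v w]) (use t1 t2 in auto)
      moreover have "cyclic_on \<sigma> {a \<in> ?E1 \<union> ?E2. fst a = v}"
        by (rule corner[of v w u]) (use t1 t2 in auto)
      moreover have "cyclic_on \<sigma> {a \<in> ?E1 \<union> ?E2. fst a = w}"
        by (rule corner[of w u v]) (use t1 t2 in auto)
      ultimately show ?thesis using 1 by auto
    next
      case 2
      have eq: "{a \<in> parcs ?G. fst a = x} = {a \<in> ?E1. fst a = x}"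
        using 2 pair_graphD(1)[OF g2] by auto
      then obtain a where "a \<in> ?E1" "fst a = x" using x(2) by auto
      then have "cyclic_on \<sigma>1 {a \<in> ?E1. fst a = x}" using rotation_systemD(1)[OF r1 g1] by metis
      moreover have "\<sigma> s = \<sigma>1 s" if "s \<in> {a \<in> ?E1. fst a = x}" for s
        by (rule s1) (use that 2 V sw[of ?E1 s] in \<open>auto simp: prod.swap_def\<close>)
      ultimately show ?thesis unfolding eq using cyclic_cong by blast
    next
      case 3
      have eq: "{a \<in> parcs ?G. fst a = x} = {a \<in> ?E2. fst a = x}"
        using 3 pair_graphD(1)[OF g1] by auto
      then obtain a where "a \<in> ?E2" "fst a = x" using x(2) by auto
      then have "cyclic_on \<sigma>2 {a \<in> ?E2. fst a = x}" using rotation_systemD(1)[OF r2 g2] by metis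
      moreover have "\<sigma> s = \<sigma>2 s" if "s \<in> {a \<in> ?E2. fst a = x}" for s
        by (rule s2) (use that 3 V sw[of ?E2 s] in \<open>auto simp: prod.swap_def\<close>)
      ultimately show ?thesis unfolding eq using cyclic_cong by blast
    qed
  qed
  have f1: "face_of \<sigma> a = face_of \<sigma>1 a" and f1': "face_of \<sigma>1 a \<subseteq> ?E1 - ?T1"
    if a: "a \<in> ?E1 - ?T1" for a
  proof -
    show sub: "face_of \<sigma>1 a \<subseteq> ?E1 - ?T1"
    proof -
      have "face_of \<sigma>1 a \<in> faces G1 \<sigma>1" using a by (simp add: faces_def)
      then have "face_of \<sigma>1 a \<inter> ?T1 = {}"
        using faces_eq_face_of(1)[OF r1 g1 T1] faces_eq_face_of(1)[OF r1 g1]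
          face_of_cyclic(2)[OF r1 g1, of a] a by blast
      then show ?thesis using face_of_cyclic(3)[OF r1 g1, of a] a by blast
    qed
    have "cyclic_on (\<sigma> \<circ> prod.swap) (face_of \<sigma>1 a) = cyclic_on (\<sigma>1 \<circ> prod.swap) (face_of \<sigma>1 a)"
    proof (rule cyclic_cong)
      fix x assume "x \<in> face_of \<sigma>1 a"
      then have "prod.swap (prod.swap x) \<in> ?E1 - ?T1" using sub by auto
      then show "(\<sigma> \<circ> prod.swap) x = (\<sigma>1 \<circ> prod.swap) x" using s1[of "prod.swap x"] by simp
    qed
    then show "face_of \<sigma> a = face_of \<sigma>1 a"
      using face_of_cyclic[OF r1 g1, of a] a face_of_eq by blast
  qed
  have f2: "face_of \<sigma> a = face_of \<sigma>2 a" and f2': "face_of \<sigma>2 a \<subseteq> ?E2 - ?T2"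
    if a: "a \<in> ?E2 - ?T2" for a
  proof -
    show sub: "face_of \<sigma>2 a \<subseteq> ?E2 - ?T2"
    proof -
      have "face_of \<sigma>2 a \<in> faces G2 \<sigma>2" using a by (simp add: faces_def)
      then have "face_of \<sigma>2 a \<inter> ?T2 = {}"
        using faces_eq_face_of(1)[OF r2 g2 T2] faces_eq_face_of(1)[OF r2 g2]
          face_of_cyclic(2)[OF r2 g2, of a] a by blast
      then show ?thesis using face_of_cyclic(3)[OF r2 g2, of a] a by blast
    qed
    have "cyclic_on (\<sigma> \<circ> prod.swap) (face_of \<sigma>2 a) = cyclic_on (\<sigma>2 \<circ> prod.swap) (face_of \<sigma>2 a)"
    proof (rule cyclic_cong)
      fix x assume "x \<in> face_of \<sigma>2 a"
      then have "prod.swap (prod.swap x) \<in> ?E2 - ?T2" using sub by auto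
      then show "(\<sigma> \<circ> prod.swap) x = (\<sigma>2 \<circ> prod.swap) x" using s2[of "prod.swap x"] by simp
    qed
    then show "face_of \<sigma> a = face_of \<sigma>2 a"
      using face_of_cyclic[OF r2 g2, of a] a face_of_eq by blast
  qed
  \<comment> \<open>Each of the three common edges leaves one arc to either side, the one that is
    not on the triangle lost there.\<close>
  have E: "?E1 \<union> ?E2 = (?E1 - ?T1) \<union> (?E2 - ?T2)"
  proof -
    have "A \<union> B = (A - S) \<union> (B - T)"
      if "S \<subseteq> A" "S \<subseteq> B" "T \<subseteq> A" "T \<subseteq> B" "S \<inter> T = {}" for A B S T :: "('a \<times> 'a) set"
      using that by blast
    from this[OF T1E T2E T12] show ?thesis .
  qed
  have img1: "face_of \<sigma>1 ` (?E1 - ?T1) = faces G1 \<sigma>1 - {?T1}"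
  proof -
    have "face_of \<sigma>1 a \<noteq> ?T1" if "a \<in> ?E1 - ?T1" for a
      using that face_of_cyclic(2)[OF r1 g1, of a] by blast
    moreover have "face_of \<sigma>1 a = ?T1" if "a \<in> ?T1" for a
      using faces_eq_face_of(1)[OF r1 g1 T1 that] .
    ultimately show ?thesis unfolding faces_def by blast
  qed
  have img2: "face_of \<sigma>2 ` (?E2 - ?T2) = faces G2 \<sigma>2 - {?T2}"
  proof -
    have "face_of \<sigma>2 a \<noteq> ?T2" if "a \<in> ?E2 - ?T2" for a
      using that face_of_cyclic(2)[OF r2 g2, of a] by blast
    moreover have "face_of \<sigma>2 a = ?T2" if "a \<in> ?T2" for a
      using faces_eq_face_of(1)[OF r2 g2 T2 that] .
    ultimately show ?thesis unfolding faces_def by blast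
  qed
  have F: "faces ?G \<sigma> = (faces G1 \<sigma>1 - {?T1}) \<union> (faces G2 \<sigma>2 - {?T2})"
  proof -
    have "face_of \<sigma> ` (?E1 - ?T1) = face_of \<sigma>1 ` (?E1 - ?T1)" by (rule image_cong) (use f1 in auto)
    moreover have "face_of \<sigma> ` (?E2 - ?T2) = face_of \<sigma>2 ` (?E2 - ?T2)"
      by (rule image_cong) (use f2 in auto)
    moreover have "faces ?G \<sigma> = face_of \<sigma> ` (?E1 - ?T1) \<union> face_of \<sigma> ` (?E2 - ?T2)"
      by (simp only: faces_def gunion_simps E image_Un)
    ultimately show ?thesis by (simp only: img1 img2)
  qed
  have disj: "(?E1 - ?T1) \<inter> (?E2 - ?T2) = {}" using int by blast
  have "(faces G1 \<sigma>1 - {?T1}) \<inter> (faces G2 \<sigma>2 - {?T2}) = {}"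
  proof (rule ccontr)
    assume "\<not> ?thesis"
    then obtain a b where ab: "a \<in> ?E1 - ?T1" "b \<in> ?E2 - ?T2" "face_of \<sigma>1 a = face_of \<sigma>2 b"
      unfolding img1[symmetric] img2[symmetric] by blast
    then show False
      using f1'[OF ab(1)] f2'[OF ab(2)] disj face_of_cyclic(2)[OF r1 g1, of a] by blast
  qed
  then have "card (faces ?G \<sigma>) = card (faces G1 \<sigma>1 - {?T1}) + card (faces G2 \<sigma>2 - {?T2})"
    unfolding F by (intro card_Un_disjoint) (simp_all add: finite_faces g1 g2)
  also have "\<dots> = (card (faces G1 \<sigma>1) - 1) + (card (faces G2 \<sigma>2) - 1)"
    using T1 T2 by simp
  finally have cF: "card (faces ?G \<sigma>) = (card (faces G1 \<sigma>1) - 1) + (card (faces G2 \<sigma>2) - 1)" .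
  have pos: "card (faces G1 \<sigma>1) > 0" "card (faces G2 \<sigma>2) > 0"
    using T1 T2 finite_faces[OF g1] finite_faces[OF g2] by (auto simp: card_gt_0_iff)
  have cT: "card ?T1 = 3" "card ?T2 = 3" using t1(4-6) by auto
  have "card (parcs ?G) = card (?E1 - ?T1) + card (?E2 - ?T2)"
    unfolding gunion_simps E
    by (intro card_Un_disjoint) (simp_all add: disj pair_graph_finite g1 g2)
  also have "\<dots> = (card ?E1 - 3) + (card ?E2 - 3)"
    using card_Diff_subset[OF _ T1E(1)] card_Diff_subset[OF _ T2E(2)] cT by simp
  finally have cE: "card (parcs ?G) = (card ?E1 - 3) + (card ?E2 - 3)" .
  have "card ?T1 \<le> card ?E1" "card ?T2 \<le> card ?E2"
    by (intro card_mono pair_graph_finite g1 g2 T1E T2E)+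
  then have ge3: "3 \<le> card ?E1" "3 \<le> card ?E2" unfolding cT .
  have cV: "card (pverts ?G) + 3 = card (pverts G1) + card (pverts G2)"
    using card_Un_Int[of "pverts G1" "pverts G2"] pair_graph_finite(1)[OF g1]
      pair_graph_finite(1)[OF g2] V t1(4-6) by simp
  \<comment> \<open>Compared with the sum of both graphs, three vertices, two faces and three edges
    are lost: 5 = 3 + 2, where 2 is the surplus constant of the second Euler formula.\<close>
  obtain k1 k2 where "card ?E1 = 2 * k1" "card ?E2 = 2 * k2"
    using card_parcs_eq[OF g1] card_parcs_eq[OF g2] by blast
  then have euler: "card (pverts ?G) + card (faces ?G \<sigma>) = card (parcs ?G) div 2 + 2"
    using cV cE cF pos ge3 planar_embeddingD(3)[OF e1] planar_embeddingD(3)[OF e2] by simp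
  have cc: "conn ?E1 (pverts G1)" "conn ?E2 (pverts G2)"
    using planar_embeddingD(2)[OF e1] planar_embeddingD(2)[OF e2] connected_iff[OF g1]
      connected_iff[OF g2] by simp_all
  have "conn (?E1 \<union> ?E2) (pverts G1 \<union> pverts G2)"
    by (rule conn_Un[OF conn_mono[OF cc(1)] conn_mono[OF cc(2)]]) (simp_all add: V)
  then have "Digraph_Component.connected (with_proj ?G)"
    using planar_embeddingD(2)[OF e1] unfolding connected_iff[OF g1] connected_iff[OF g] by simp
  then have "planar_embedding ?G \<sigma>" using rot euler by (simp add: planar_embedding_def)
  from that[OF this f1 f2 F] show ?thesis .
qed

section \<open>Renaming an embedded graph\<close>

lemma inj_on_map_prod_parcs:
  assumes "pair_graph G" "inj_on f (pverts G)"
  shows "inj_on (map_prod f f) (parcs G)"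
proof (rule inj_on_subset[OF map_prod_inj_on[OF assms(2) assms(2)]])
  show "parcs G \<subseteq> pverts G \<times> pverts G" using pair_graphD(1,2)[OF assms(1)] by auto
qed

lemma planar_embedding_map_graph:
  assumes g: "pair_graph G" and f: "inj_on f (pverts G)" and e: "planar_embedding G \<sigma>"
  obtains \<sigma>' where "planar_embedding (map_graph f G) \<sigma>'"
    "\<And>a. a \<in> parcs G \<Longrightarrow> face_of \<sigma>' (map_prod f f a) = map_prod f f ` face_of \<sigma> a"
proof -
  let ?F = "map_prod f f" and ?H = "map_graph f G"
  note r = planar_embeddingD(1)[OF e]
  note h = pair_graph_map_graph[OF g f]
  have F: "inj_on ?F (parcs G)" by (rule inj_on_map_prod_parcs[OF g f])
  define \<sigma>' where "\<sigma>' b = (if b \<in> parcs ?H then ?F (\<sigma> (the_inv_into (parcs G) ?F b)) else b)" for b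
  have s: "\<sigma>' (?F a) = ?F (\<sigma> a)" if "a \<in> parcs G" for a
    using that by (simp add: \<sigma>'_def the_inv_into_f_f[OF F])
  have rot: "rotation_system ?H \<sigma>'"
  proof (rule rotation_systemI[OF h])
    show "\<sigma>' a = a" if "a \<notin> parcs ?H" for a using that by (auto simp: \<sigma>'_def)
    fix y assume "y \<in> pverts ?H" "{a \<in> parcs ?H. fst a = y} \<noteq> {}"
    then obtain a where a: "a \<in> parcs G" "y = f (fst a)" by auto
    have "{b \<in> parcs ?H. fst b = y} = ?F ` {b \<in> parcs G. fst b = fst a}"
    proof -
      have "fst b = fst a" if "b \<in> parcs G" "f (fst b) = f (fst a)" for b
        using that a(1) f pair_graphD(1)[OF g, of "fst b" "snd b"]
          pair_graphD(1)[OF g, of "fst a" "snd a"] by (auto dest: inj_onD)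
      then show ?thesis using a(2) by auto
    qed
    moreover have "cyclic_on \<sigma>' (?F ` {b \<in> parcs G. fst b = fst a})"
      by (rule cyclic_on_image[OF rotation_systemD(1)[OF r g a(1)]]) (use s in auto)
    ultimately show "cyclic_on \<sigma>' {b \<in> parcs ?H. fst b = y}" by simp
  qed
  have face: "face_of \<sigma>' (?F a) = ?F ` face_of \<sigma> a" if a: "a \<in> parcs G" for a
  proof (rule face_of_eq)
    show "cyclic_on (\<sigma>' \<circ> prod.swap) (?F ` face_of \<sigma> a)"
    proof (rule cyclic_on_image[OF face_of_cyclic(1)[OF r g a]])
      fix x assume "x \<in> face_of \<sigma> a"
      then have "prod.swap x \<in> parcs G"
        using face_of_cyclic(3)[OF r g a] swap_parcs[OF g] by blast
      then show "(\<sigma>' \<circ> prod.swap) (?F x) = ?F ((\<sigma> \<circ> prod.swap) x)"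
        using s[of "prod.swap x"] by (cases x) simp
    qed
    show "?F a \<in> ?F ` face_of \<sigma> a" using face_of_cyclic(2)[OF r g a] by blast
  qed
  have "faces ?H \<sigma>' = (`) ?F ` faces G \<sigma>"
    unfolding faces_def parcs_map_graph image_image using face by (intro image_cong) simp_all
  moreover have "inj_on ((`) ?F) (faces G \<sigma>)"
  proof (rule inj_on_subset[OF inj_on_image_Pow[OF F]])
    show "faces G \<sigma> \<subseteq> Pow (parcs G)" using face_of_cyclic(3)[OF r g] by (auto simp: faces_def)
  qed
  ultimately have cF: "card (faces ?H \<sigma>') = card (faces G \<sigma>)" by (simp add: card_image)
  have cc: "conn (parcs ?H) (pverts ?H)"
    unfolding conn_def
  proof (intro ballI)
    fix a b assume "a \<in> pverts ?H" "b \<in> pverts ?H"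
    then obtain x y where xy: "x \<in> pverts G" "y \<in> pverts G" "a = f x" "b = f y" by auto
    then have "(x, y) \<in> (parcs G \<inter> pverts G \<times> pverts G)\<^sup>*"
      using planar_embeddingD(2)[OF e] connected_iff[OF g] by (auto simp: conn_def)
    then have "(f x, f y) \<in> (parcs ?H \<inter> pverts ?H \<times> pverts ?H)\<^sup>*"
    proof induction
      case (step y z)
      then have "(f y, f z) \<in> parcs ?H \<inter> pverts ?H \<times> pverts ?H" by force
      then show ?case using step.IH by (rule rtrancl_into_rtrancl[rotated])
    qed simp
    then show "(a, b) \<in> (parcs ?H \<inter> pverts ?H \<times> pverts ?H)\<^sup>*" using xy by simp
  qed
  have "Digraph_Component.connected (with_proj ?H)"
    using cc planar_embeddingD(2)[OF e] unfolding connected_iff[OF g] connected_iff[OF h] by simp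
  then have "planar_embedding ?H \<sigma>'"
    using rot cF planar_embeddingD(3)[OF e] card_image[OF F] card_image[OF f]
    by (simp add: planar_embedding_def)
  from that[OF this face] show ?thesis .
qed

section \<open>Wheels\<close>

definition cnext :: "nat \<Rightarrow> nat \<Rightarrow> nat" where
  "cnext n i = (i + 1) mod n"

text \<open>By cases, because truncated subtraction would send 0 to itself.\<close>

definition cprev :: "nat \<Rightarrow> nat \<Rightarrow> nat" where
  "cprev n i = (if i = 0 then n - 1 else i - 1)"

lemma cnext_if: "i < n \<Longrightarrow> cnext n i = (if i + 1 = n then 0 else i + 1)"
  by (simp add: cnext_def)

lemma cnext_less: "i < n \<Longrightarrow> cnext n i < n"
  and cprev_less: "i < n \<Longrightarrow> cprev n i < n"
  and cnext_cprev: "i < n \<Longrightarrow> cnext n (cprev n i) = i"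
  and cprev_cnext: "i < n \<Longrightarrow> cprev n (cnext n i) = i"
  by (auto simp: cnext_if cprev_def)

lemma cnext_neq: "3 \<le> n \<Longrightarrow> i < n \<Longrightarrow> cnext n i \<noteq> i"
  "3 \<le> n \<Longrightarrow> i < n \<Longrightarrow> cprev n i \<noteq> i" "3 \<le> n \<Longrightarrow> i < n \<Longrightarrow> cnext n i \<noteq> cprev n i"
  "3 \<le> n \<Longrightarrow> i < n \<Longrightarrow> cnext n (cnext n i) \<noteq> i"
  by (auto simp: cnext_if cprev_def)

lemma pverts_wheel_graph [simp]: "pverts (wheel_graph n) = {..n}"
  by (simp add: wheel_graph_def)

lemma parcs_wheel_graph:
  "parcs (wheel_graph n) = (\<Union>i<n. {(i, cnext n i), (cnext n i, i), (i, n), (n, i)})"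
  by (simp add: wheel_graph_def cnext_def)

lemma wheel_graph_arc_iff:
  "(x, y) \<in> parcs (wheel_graph n) \<longleftrightarrow>
    (x < n \<and> y = cnext n x) \<or> (y < n \<and> x = cnext n y) \<or> (x < n \<and> y = n) \<or> (x = n \<and> y < n)"
  unfolding parcs_wheel_graph by auto

lemma pair_graph_wheel_graph: "3 \<le> n \<Longrightarrow> pair_graph (wheel_graph n)"
  unfolding pair_graph_iff wheel_graph_arc_iff
  by (auto simp: cnext_if split: if_splits)

lemma wheel_graph_rim_arc_iff:
  "x < n \<Longrightarrow> y < n \<Longrightarrow> (x, y) \<in> parcs (wheel_graph n) \<longleftrightarrow> y = cnext n x \<or> x = cnext n y"
  unfolding wheel_graph_arc_iff by auto

lemma out_arcs_Pair: "{a \<in> E. fst a = i} = Pair i ` {y. (i, y) \<in> E}"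
  by auto

lemma wheel_graph_out_arcs:
  assumes "3 \<le> n"
  shows "i < n \<Longrightarrow> {a \<in> parcs (wheel_graph n). fst a = i} = {(i, n), (i, cnext n i), (i, cprev n i)}"
    "{a \<in> parcs (wheel_graph n). fst a = n} = Pair n ` {..<n}"
proof -
  assume i: "i < n"
  have "(i, y) \<in> parcs (wheel_graph n) \<longleftrightarrow> y = n \<or> y = cnext n i \<or> y = cprev n i" for y
  proof
    assume "(i, y) \<in> parcs (wheel_graph n)"
    then show "y = n \<or> y = cnext n i \<or> y = cprev n i"
      unfolding wheel_graph_arc_iff using i by (auto simp: cprev_cnext)
  next
    assume "y = n \<or> y = cnext n i \<or> y = cprev n i"
    then show "(i, y) \<in> parcs (wheel_graph n)"
      unfolding wheel_graph_arc_iff using i by (auto simp: cnext_cprev cprev_less)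
  qed
  then have "{y. (i, y) \<in> parcs (wheel_graph n)} = {n, cnext n i, cprev n i}" by blast
  then show "{a \<in> parcs (wheel_graph n). fst a = i} = {(i, n), (i, cnext n i), (i, cprev n i)}"
    by (simp add: out_arcs_Pair)
next
  have "(n, y) \<in> parcs (wheel_graph n) \<longleftrightarrow> y < n" for y
    unfolding wheel_graph_arc_iff using cnext_less[of y n] by auto
  then have "{y. (n, y) \<in> parcs (wheel_graph n)} = {..<n}" by blast
  then show "{a \<in> parcs (wheel_graph n). fst a = n} = Pair n ` {..<n}"
    by (simp add: out_arcs_Pair)
qed

text \<open>A closed set descends from any member to 0, jumps to \<open>n - 1\<close> and from there
  descends through everything.\<close>

lemma cyclic_on_cprev:
  assumes "3 \<le> n" shows "cyclic_on (cprev n) {..<n}"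
proof (rule cyclic_onI)
  fix A assume A: "A \<subseteq> {..<n}" "A \<noteq> {}" "\<And>s. s \<in> A \<Longrightarrow> cprev n s \<in> A"
  have down: "x - d \<in> A" if "x \<in> A" for x d
  proof (induction d)
    case (Suc d)
    then have "cprev n (x - d) \<in> A" by (rule A(3))
    then show ?case using Suc by (cases "x - d = 0") (auto simp: cprev_def)
  qed (use that in simp)
  obtain x where "x \<in> A" using A(2) by blast
  then have "0 \<in> A" using down[of x x] by simp
  then have "n - 1 \<in> A" using A(3)[of 0] by (simp add: cprev_def)
  show "{..<n} \<subseteq> A"
  proof
    fix y assume "y \<in> {..<n}"
    then show "y \<in> A" using down[OF \<open>n - 1 \<in> A\<close>, of "n - 1 - y"] by simp
  qed
next
  have "0 \<in> {..<n}" using assms by simp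
  then show "{..<n} \<noteq> {}" by blast
qed (use cprev_less[of _ n] in auto)

text \<open>The triangles run along the rim forwards, the outer face backwards.\<close>

definition wheel_tri :: "(nat \<Rightarrow> 'a) \<Rightarrow> nat \<Rightarrow> nat \<Rightarrow> ('a \<times> 'a) set" where
  "wheel_tri k n i = {(k n, k i), (k i, k (cnext n i)), (k (cnext n i), k n)}"

definition wheel_rim :: "(nat \<Rightarrow> 'a) \<Rightarrow> nat \<Rightarrow> ('a \<times> 'a) set" where
  "wheel_rim k n = (\<lambda>i. (k (cnext n i), k i)) ` {..<n}"

lemma wheel_graph_cases:
  assumes "a \<in> parcs (wheel_graph n)"
  obtains i where "i < n" "a \<in> wheel_tri id n i" | "a \<in> wheel_rim id n"
proof -
  obtain i where "i < n" "a \<in> {(i, cnext n i), (cnext n i, i), (i, n), (n, i)}"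
    using assms unfolding parcs_wheel_graph by blast
  \<comment> \<open>The arc \<open>(i, n)\<close> from the rim to the hub closes the triangle of the
    predecessor of \<open>i\<close>.\<close>
  then have "a \<in> wheel_tri id n i \<or> a \<in> wheel_rim id n \<or> a \<in> wheel_tri id n (cprev n i)"
    using cnext_cprev[of i n] by (auto simp: wheel_tri_def wheel_rim_def)
  then show ?thesis using that \<open>i < n\<close> cprev_less[of i n] by blast
qed

section \<open>Embedding and 3-connectivity of the wheel\<close>

lemma card_parcs_wheel_graph:
  assumes "3 \<le> n" shows "card (parcs (wheel_graph n)) = 4 * n"
proof -
  let ?E = "parcs (wheel_graph n)"
  have fin: "finite ?E" by (rule pair_graph_finite(2)[OF pair_graph_wheel_graph[OF assms]])
  have "?E = (\<Union>i\<in>{..n}. {a \<in> ?E. fst a = i})"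
    using pair_graphD(1)[OF pair_graph_wheel_graph[OF assms]] by fastforce
  then have "card ?E = (\<Sum>i\<in>{..n}. card {a \<in> ?E. fst a = i})"
    using card_UN_disjoint[of "{..n}" "\<lambda>i. {a \<in> ?E. fst a = i}"] fin by auto
  also have "\<dots> = card {a \<in> ?E. fst a = n} + (\<Sum>i<n. card {a \<in> ?E. fst a = i})"
    by (simp add: lessThan_Suc_atMost[symmetric])
  also have "(\<Sum>i<n. card {a \<in> ?E. fst a = i}) = (\<Sum>i<n. 3)"
  proof (rule sum.cong[OF refl])
    fix i assume "i \<in> {..<n}"
    then have i: "i < n" by simp
    then have "n \<noteq> cnext n i" "n \<noteq> cprev n i" using cnext_less[OF i] cprev_less[OF i] by auto
    then show "card {a \<in> ?E. fst a = i} = 3"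
      using cnext_neq(3)[OF assms i] by (simp add: wheel_graph_out_arcs(1)[OF assms i])
  qed
  finally show ?thesis by (simp add: wheel_graph_out_arcs(2)[OF assms] card_image inj_on_def)
qed

lemma planar_embedding_wheel_graph:
  assumes n: "3 \<le> n"
  obtains \<sigma> where "planar_embedding (wheel_graph n) \<sigma>"
    "\<And>i a. i < n \<Longrightarrow> a \<in> wheel_tri id n i \<Longrightarrow> face_of \<sigma> a = wheel_tri id n i"
    "\<And>a. a \<in> wheel_rim id n \<Longrightarrow> face_of \<sigma> a = wheel_rim id n"
proof -
  let ?G = "wheel_graph n"
  note g = pair_graph_wheel_graph[OF n]
  \<comment> \<open>At the hub the spokes are taken in decreasing order, at a rim vertex in the
    order hub, successor, predecessor. The last branch is the predecessor, which differs from the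
    successor as \<open>n\<close> is at least 3.\<close>
  define \<sigma> where "\<sigma> a = (let (x, y) = a in if a \<notin> parcs ?G then a else if x = n then (n, cprev n y)
    else if y = n then (x, cnext n x) else if y = cnext n x then (x, cprev n x) else (x, n))" for a
  have s1: "\<sigma> (n, i) = (n, cprev n i)" "\<sigma> (i, n) = (i, cnext n i)"
    "\<sigma> (i, cnext n i) = (i, cprev n i)" "\<sigma> (i, cprev n i) = (i, n)" if i: "i < n" for i
  proof -
    have "(n, i) \<in> parcs ?G" "(i, n) \<in> parcs ?G" "(i, cnext n i) \<in> parcs ?G" "(i, cprev n i) \<in> parcs ?G"
      unfolding wheel_graph_arc_iff using i cnext_cprev[OF i] cprev_less[OF i] by auto
    then show "\<sigma> (n, i) = (n, cprev n i)" "\<sigma> (i, n) = (i, cnext n i)"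
      "\<sigma> (i, cnext n i) = (i, cprev n i)" "\<sigma> (i, cprev n i) = (i, n)"
      using i cnext_less[OF i] cprev_less[OF i] cnext_neq[OF n i] by (auto simp: \<sigma>_def)
  qed
  have rot: "rotation_system ?G \<sigma>"
  proof (rule rotation_systemI[OF g])
    show "\<sigma> a = a" if "a \<notin> parcs ?G" for a using that by (simp add: \<sigma>_def)
    fix v assume "v \<in> pverts ?G"
    then consider "v < n" | "v = n" by fastforce
    then show "cyclic_on \<sigma> {a \<in> parcs ?G. fst a = v}"
    proof cases
      case 1
      show ?thesis unfolding wheel_graph_out_arcs(1)[OF n 1] by (rule cyclic_on_three) (use s1 1 in auto)
    next
      case 2
      have "cyclic_on \<sigma> (Pair n ` {..<n})" by (rule cyclic_on_image[OF cyclic_on_cprev[OF n]]) (use s1 in auto)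
      then show ?thesis unfolding 2 wheel_graph_out_arcs(2)[OF n] .
    qed
  qed
  have tri: "face_of \<sigma> a = wheel_tri id n i" if i: "i < n" and a: "a \<in> wheel_tri id n i" for i a
  proof (rule face_of_eq[OF _ a])
    have "\<sigma> (cnext n i, i) = (cnext n i, n)"
      using s1(4)[OF cnext_less[OF i]] by (simp add: cprev_cnext[OF i])
    moreover have "\<sigma> (n, cnext n i) = (n, i)"
      using s1(1)[OF cnext_less[OF i]] by (simp add: cprev_cnext[OF i])
    ultimately show "cyclic_on (\<sigma> \<circ> prod.swap) (wheel_tri id n i)"
      unfolding wheel_tri_def by (intro cyclic_on_three) (use s1 i in auto)
  qed
  have rim: "face_of \<sigma> a = wheel_rim id n" if a: "a \<in> wheel_rim id n" for a
  proof (rule face_of_eq[OF _ a])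
    show "cyclic_on (\<sigma> \<circ> prod.swap) (wheel_rim id n)"
      unfolding wheel_rim_def
      by (rule cyclic_on_image[OF cyclic_on_cprev[OF n]]) (use s1 cnext_cprev in auto)
  qed
  have "faces ?G \<sigma> = wheel_tri id n ` {..<n} \<union> {wheel_rim id n}"
  proof
    show "faces ?G \<sigma> \<subseteq> wheel_tri id n ` {..<n} \<union> {wheel_rim id n}"
      unfolding faces_def by (auto elim!: wheel_graph_cases simp: tri rim)
    have "wheel_tri id n i \<in> faces ?G \<sigma>" if i: "i < n" for i
    proof -
      have "(i, cnext n i) \<in> wheel_tri id n i" by (simp add: wheel_tri_def)
      moreover have "(i, cnext n i) \<in> parcs ?G" using i by (simp add: wheel_graph_arc_iff)
      ultimately show ?thesis unfolding faces_def using tri[OF i] by (metis image_eqI)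
    qed
    moreover have "wheel_rim id n \<in> faces ?G \<sigma>"
    proof -
      have "(cnext n 0, 0) \<in> wheel_rim id n" using n by (force simp: wheel_rim_def)
      moreover have "(cnext n 0, 0) \<in> parcs ?G" using n by (simp add: wheel_graph_arc_iff)
      ultimately show ?thesis unfolding faces_def using rim by (metis image_eqI)
    qed
    ultimately show "wheel_tri id n ` {..<n} \<union> {wheel_rim id n} \<subseteq> faces ?G \<sigma>" by auto
  qed
  \<comment> \<open>True also for \<open>n = 3\<close>, where the rim is a triangle itself: it
    misses the hub.\<close>
  moreover have "wheel_rim id n \<notin> wheel_tri id n ` {..<n}"
  proof
    assume "wheel_rim id n \<in> wheel_tri id n ` {..<n}"
    then obtain i where "i < n" "wheel_rim id n = wheel_tri id n i" by auto
    then have "(n, i) \<in> wheel_rim id n" by (simp add: wheel_tri_def)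
    then obtain j where "j < n" "n = cnext n j" by (auto simp: wheel_rim_def)
    then show False using cnext_less[of j n] by simp
  qed
  moreover have "inj_on (wheel_tri id n) {..<n}"
  proof (rule inj_onI)
    fix i j assume ij: "i \<in> {..<n}" "j \<in> {..<n}" "wheel_tri id n i = wheel_tri id n j"
    have "(n, i) \<in> wheel_tri id n i" by (simp add: wheel_tri_def)
    then have "(n, i) \<in> wheel_tri id n j" unfolding ij(3) .
    then show "i = j" using ij(1,2) cnext_less[of j n] by (auto simp: wheel_tri_def)
  qed
  ultimately have cF: "card (faces ?G \<sigma>) = n + 1" by (simp add: card_image)
  have "conn (parcs ?G) (pverts ?G)"
  proof (rule connI_hub[where h = n, OF pair_graph_sym[OF g]])
    fix v assume "v \<in> pverts ?G"
    then have "v = n \<or> (v, n) \<in> parcs ?G \<inter> pverts ?G \<times> pverts ?G"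
      by (auto simp: wheel_graph_arc_iff)
    then show "(v, n) \<in> (parcs ?G \<inter> pverts ?G \<times> pverts ?G)\<^sup>*" by auto
  qed
  then have "Digraph_Component.connected (with_proj ?G)" by (auto simp: connected_iff[OF g])
  \<comment> \<open>Euler's formula reads \<open>(n + 1) + (n + 1) = 2 * n + 2\<close>.\<close>
  then have "planar_embedding ?G \<sigma>"
    using rot cF card_parcs_wheel_graph[OF n] by (simp add: planar_embedding_def)
  from that[OF this tri rim] show ?thesis .
qed

text \<open>A surviving hub joins everything. If the hub is deleted, at most one rim vertex goes
  with it, and the rest of the rim contains a spanning path.\<close>

lemma three_connected_wheel_graph:
  assumes n: "3 \<le> n" shows "three_connected (wheel_graph n)"
proof -
  let ?E = "parcs (wheel_graph n)"
  note g = pair_graph_wheel_graph[OF n]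
  have "conn ?E ({..n} - S)" if S: "S \<subseteq> {..n}" "card S < 3" for S
  proof (cases "n \<in> S")
    case False
    show ?thesis
    proof (rule connI_hub[where h = n, OF pair_graph_sym[OF g]])
      fix v assume "v \<in> {..n} - S"
      then have "v = n \<or> (v, n) \<in> ?E \<inter> ({..n} - S) \<times> ({..n} - S)"
        using False by (auto simp: wheel_graph_arc_iff)
      then show "(v, n) \<in> (?E \<inter> ({..n} - S) \<times> ({..n} - S))\<^sup>*" by auto
    qed
  next
    case True
    have "finite S" using S(1) finite_subset by blast
    then have "card (S - {n}) < 2" using True S(2) by (simp add: card_Diff_singleton)
    then have "card (S - {n}) = 0 \<or> card (S - {n}) = 1" by linarith
    \<comment> \<open>If no rim vertex is deleted, \<open>j\<close> is 0 and merely marks where the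
      rim is cut open.\<close>
    then obtain j where j: "S - {n} \<subseteq> {j}" "j < n"
    proof
      assume "card (S - {n}) = 0"
      then have "S - {n} \<subseteq> {0}" using \<open>finite S\<close> by auto
      then show ?thesis using that[of 0] n by simp
    next
      assume "card (S - {n}) = 1"
      then obtain j where j: "S - {n} = {j}" by (rule card_1_singletonE)
      then have "j \<in> S - {n}" by simp
      then have "j \<in> {..n}" "j \<noteq> n" using S(1) by blast+
      then have "j < n" by simp
      then show ?thesis using that[of j] j by simp
    qed
    let ?X = "{..n} - S"
    \<comment> \<open>The rim vertices after \<open>j\<close> in cyclic order, \<open>p 0\<close> up
      to \<open>p (n - 2)\<close>, with \<open>j\<close> left out.\<close>
    define p where "p t = (if j + 1 + t < n then j + 1 + t else j + 1 + t - n)" for t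
    have X: "p t \<in> ?X" if "t < n - 1" for t
    proof -
      have "p t \<noteq> j" "p t < n" using that j(2) by (auto simp: p_def)
      then show ?thesis using j(1) by auto
    qed
    have reach: "t < n - 1 \<Longrightarrow> (p t, p 0) \<in> (?E \<inter> ?X \<times> ?X)\<^sup>*" for t
    proof (induction t)
      case (Suc t)
      have "p t < n" "p (Suc t) = cnext n (p t)"
        using Suc.prems j(2) by (auto simp: p_def cnext_if)
      then have "(p (Suc t), p t) \<in> ?E" by (simp add: wheel_graph_arc_iff)
      then have "(p (Suc t), p t) \<in> ?E \<inter> ?X \<times> ?X" using X Suc.prems by auto
      then show ?case using Suc by (meson Suc_lessD converse_rtrancl_into_rtrancl)
    qed simp
    have reach0: "(v, p 0) \<in> (?E \<inter> ?X \<times> ?X)\<^sup>*" if v: "v < n" "v \<noteq> j" for v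
    proof -
      define t where "t = (if j < v then v - j - 1 else v + n - j - 1)"
      have "t < n - 1" "p t = v" using v j(2) by (auto simp: t_def p_def)
      then show ?thesis using reach[of t] by simp
    qed
    show ?thesis
    proof (cases "j \<in> S")
      case jS: True
      show ?thesis
      proof (rule connI_hub[OF pair_graph_sym[OF g]])
        fix v assume "v \<in> ?X"
        then have "v < n" "v \<noteq> j" using True jS by (auto simp: le_less)
        then show "(v, p 0) \<in> (?E \<inter> ?X \<times> ?X)\<^sup>*" by (rule reach0)
      qed
    next
      \<comment> \<open>A \<open>j\<close> that is not deleted is adjacent to
        \<open>p 0\<close>.\<close>
      case jS: False
      have X: "?X = {..<n}" using jS True j by auto
      have "(j, p 0) \<in> ?E \<inter> ?X \<times> ?X"
        using j(2) n unfolding X by (auto simp: wheel_graph_arc_iff p_def cnext_if)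
      then have "(j, p 0) \<in> (?E \<inter> ?X \<times> ?X)\<^sup>*" by blast
      moreover have "(v, p 0) \<in> (?E \<inter> ?X \<times> ?X)\<^sup>*" if "v \<in> ?X" "v \<noteq> j" for v
        using that reach0[of v] unfolding X by simp
      ultimately show ?thesis by (intro connI_hub[OF pair_graph_sym[OF g], where h = "p 0"]) blast
    qed
  qed
  then show ?thesis using n by (simp add: three_connected_iff[OF g])
qed

section \<open>Wheels on arbitrary vertices\<close>

lemma conn_image: "conn E X \<Longrightarrow> conn (map_prod f f ` E) (f ` X)"
  unfolding conn_def
proof (intro ballI)
  fix a b assume c: "\<forall>u\<in>X. \<forall>v\<in>X. (u, v) \<in> (E \<inter> X \<times> X)\<^sup>*" and "a \<in> f ` X" "b \<in> f ` X"
  then obtain x y where xy: "x \<in> X" "y \<in> X" "a = f x" "b = f y" by blast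
  have "(f x, f y) \<in> (map_prod f f ` E \<inter> f ` X \<times> f ` X)\<^sup>*" if "(x, y) \<in> (E \<inter> X \<times> X)\<^sup>*"
    using that
  proof induction
    case (step y z)
    then have "(f y, f z) \<in> map_prod f f ` E \<inter> f ` X \<times> f ` X" by force
    then show ?case using step.IH by (rule rtrancl_into_rtrancl[rotated])
  qed simp
  then show "(a, b) \<in> (map_prod f f ` E \<inter> f ` X \<times> f ` X)\<^sup>*" using c xy by blast
qed

lemma three_connected_map_graph:
  assumes "three_connected G" "pair_graph G" "inj_on f (pverts G)"
  shows "three_connected (map_graph f G)"
proof -
  note h = pair_graph_map_graph[OF assms(2,3)]
  have "conn (map_prod f f ` parcs G) (f ` pverts G - S)" if S: "S \<subseteq> f ` pverts G" "card S < 3" for S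
  proof -
    let ?S = "{v \<in> pverts G. f v \<in> S}"
    have "f ` ?S = S" using S(1) by auto
    moreover have "inj_on f ?S" using assms(3) by (rule inj_on_subset) auto
    ultimately have "card ?S = card S" by (metis card_image)
    moreover have "finite ?S" using pair_graph_finite(1)[OF assms(2)] by simp
    ultimately have "conn (parcs G) (pverts G - ?S)" using S(2) three_connectedD[OF assms(1,2)] by simp
    then have "conn (map_prod f f ` parcs G) (f ` (pverts G - ?S))" by (rule conn_image)
    moreover have "f ` (pverts G - ?S) = f ` pverts G - S" by auto
    ultimately show ?thesis by simp
  qed
  then show ?thesis
    using assms(1) card_image[OF assms(3)]
    unfolding three_connected_iff[OF h] three_connected_iff[OF assms(2)]
    by (simp only: pverts_map_graph parcs_map_graph) blast
qed

text \<open>A wheel with coordinates: \<open>k\<close> numbers the rim from 0 to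
  \<open>n - 1\<close> and sends \<open>n\<close> to the hub. In \<open>K4\<close> the hub is a
  matter of choice, and the numbering records the choice.\<close>

definition wheel_at :: "nat \<Rightarrow> (nat \<Rightarrow> 'a) \<Rightarrow> 'a pair_pre_digraph \<Rightarrow> bool" where
  "wheel_at n k W \<longleftrightarrow> 3 \<le> n \<and> inj_on k {..n} \<and> W = map_graph k (wheel_graph n)"

lemma is_wheel_iff: "is_wheel W \<longleftrightarrow> (\<exists>n k. wheel_at n k W)"
  unfolding is_wheel_def wheel_at_def
  using digraph_iso_iff[OF pair_graph_wf[OF pair_graph_wheel_graph]] by (metis pverts_wheel_graph)

lemma wheel_at_pair_graph: "wheel_at n k W \<Longrightarrow> pair_graph W"
  unfolding wheel_at_def using pair_graph_map_graph[OF pair_graph_wheel_graph] by auto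

lemma wheel_at_three_connected: "wheel_at n k W \<Longrightarrow> three_connected W"
  unfolding wheel_at_def
  using three_connected_map_graph[OF three_connected_wheel_graph pair_graph_wheel_graph] by auto

lemma wheel_at_pverts: "wheel_at n k W \<Longrightarrow> pverts W = k ` {..n}"
  by (simp add: wheel_at_def)

lemma wheel_at_parcs:
  "wheel_at n k W \<Longrightarrow> parcs W =
    (\<Union>i<n. {(k i, k (cnext n i)), (k (cnext n i), k i), (k i, k n), (k n, k i)})"
  by (auto simp: wheel_at_def parcs_wheel_graph)

lemma wheel_at_arc_iff:
  assumes "wheel_at n k W" "i \<le> n" "j \<le> n"
  shows "(k i, k j) \<in> parcs W \<longleftrightarrow> (i, j) \<in> parcs (wheel_graph n)"
  using assms map_graph_arc_iff[OF pair_graph_wheel_graph, of n k i j] by (simp add: wheel_at_def)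

lemma wheel_at_map_graph:
  assumes "wheel_at n k W" "inj_on f (pverts W)"
  shows "wheel_at n (f \<circ> k) (map_graph f W)"
  using assms by (auto simp: wheel_at_def map_graph_comp intro: comp_inj_on)

lemma is_wheel_map_graph: "is_wheel W \<Longrightarrow> inj_on f (pverts W) \<Longrightarrow> is_wheel (map_graph f W)"
  unfolding is_wheel_iff using wheel_at_map_graph by blast

lemma wheel_at_planar_embedding:
  assumes "wheel_at n k W"
  obtains \<sigma> where "planar_embedding W \<sigma>"
    "\<And>i a. i < n \<Longrightarrow> a \<in> wheel_tri k n i \<Longrightarrow> face_of \<sigma> a = wheel_tri k n i"
    "\<And>a. a \<in> wheel_rim k n \<Longrightarrow> face_of \<sigma> a = wheel_rim k n"
proof -
  have n: "3 \<le> n" and k: "inj_on k {..n}" and W: "W = map_graph k (wheel_graph n)"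
    using assms by (auto simp: wheel_at_def)
  obtain \<sigma> where s: "planar_embedding (wheel_graph n) \<sigma>"
    "\<And>i a. i < n \<Longrightarrow> a \<in> wheel_tri id n i \<Longrightarrow> face_of \<sigma> a = wheel_tri id n i"
    "\<And>a. a \<in> wheel_rim id n \<Longrightarrow> face_of \<sigma> a = wheel_rim id n"
    using planar_embedding_wheel_graph[OF n] by blast
  have k': "inj_on k (pverts (wheel_graph n))" using k by simp
  obtain \<sigma>' where s': "planar_embedding W \<sigma>'"
    "\<And>a. a \<in> parcs (wheel_graph n) \<Longrightarrow> face_of \<sigma>' (map_prod k k a) = map_prod k k ` face_of \<sigma> a"
    unfolding W using planar_embedding_map_graph[OF pair_graph_wheel_graph[OF n] k' s(1)] by blast
  have t: "wheel_tri k n i = map_prod k k ` wheel_tri id n i" for i by (simp add: wheel_tri_def)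
  have r: "wheel_rim k n = map_prod k k ` wheel_rim id n" by (simp add: wheel_rim_def image_image)
  have tri: "face_of \<sigma>' a = wheel_tri k n i" if i: "i < n" "a \<in> wheel_tri k n i" for i a
  proof -
    have "a \<in> map_prod k k ` wheel_tri id n i" using i(2) by (simp only: t[of i])
    then obtain b where b: "b \<in> wheel_tri id n i" "a = map_prod k k b" by (rule imageE)
    have "b \<in> parcs (wheel_graph n)"
      using b(1) i(1) cnext_less[OF i(1)] by (auto simp: wheel_tri_def wheel_graph_arc_iff)
    then show ?thesis by (simp only: b(2) s'(2) s(2)[OF i(1) b(1)] t[of i])
  qed
  have rim: "face_of \<sigma>' a = wheel_rim k n" if a: "a \<in> wheel_rim k n" for a
  proof -
    have "a \<in> map_prod k k ` wheel_rim id n" using a by (simp only: r)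
    then obtain b where b: "b \<in> wheel_rim id n" "a = map_prod k k b" by (rule imageE)
    have "b \<in> parcs (wheel_graph n)" using b(1) by (auto simp: wheel_rim_def wheel_graph_arc_iff)
    then show ?thesis by (simp only: b(2) s'(2) s(3)[OF b(1)] r)
  qed
  from that[OF s'(1) tri rim] show ?thesis .
qed

section \<open>Choosing the numbering of a wheel\<close>

lemma rim_triangle:
  assumes "3 \<le> n" "x < n" "y < n" "z < n"
    "(x, y) \<in> parcs (wheel_graph n)" "(y, z) \<in> parcs (wheel_graph n)" "(z, x) \<in> parcs (wheel_graph n)"
  shows "n = 3"
  using assms by (auto simp: wheel_graph_rim_arc_iff cnext_if split: if_splits)

lemma inj_on_atMostI:
  assumes "inj_on r {..<n}" "\<And>i. i < n \<Longrightarrow> r i < n" "r n = n"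
  shows "inj_on r {..n::nat}"
proof (rule inj_onI)
  fix x y assume xy: "x \<in> {..n}" "y \<in> {..n}" "r x = r y"
  then consider "x = n" "y = n" | "x < n" "y = n" | "x = n" "y < n" | "x < n" "y < n" by fastforce
  then show "x = y"
  proof cases
    case 2 then show ?thesis using xy(3) assms(2)[of x] assms(3) by simp
  next
    case 3 then show ?thesis using xy(3) assms(2)[of y] assms(3) by simp
  next
    case 4 then show ?thesis using xy(3) assms(1) by (simp add: inj_on_eq_iff)
  qed simp
qed

text \<open>An injective self-map that fixes the hub and keeps rim neighbours adjacent is onto by
  finiteness, first on vertices and then on arcs.\<close>

lemma wheel_graph_automorphism:
  assumes n: "3 \<le> n" and r: "r n = n" "\<And>i. i < n \<Longrightarrow> r i < n" "inj_on r {..<n}"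
    and adj: "\<And>i. i < n \<Longrightarrow> r (cnext n i) = cnext n (r i) \<or> r i = cnext n (r (cnext n i))"
  shows "map_graph r (wheel_graph n) = wheel_graph n"
proof -
  note g = pair_graph_wheel_graph[OF n]
  have inj: "inj_on r {..n}" by (rule inj_on_atMostI[OF r(3,2,1)])
  have "r ` {..n} \<subseteq> {..n}" using r(1,2) by (auto simp: le_less)
  then have V: "r ` {..n} = {..n}" using inj by (simp add: endo_inj_surj)
  have "map_prod r r ` parcs (wheel_graph n) \<subseteq> parcs (wheel_graph n)"
  proof
    fix b assume "b \<in> map_prod r r ` parcs (wheel_graph n)"
    then obtain i where i: "i < n" and
      "b \<in> {(r i, r (cnext n i)), (r (cnext n i), r i), (r i, r n), (r n, r i)}"
      unfolding parcs_wheel_graph by auto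
    then show "b \<in> parcs (wheel_graph n)"
      using adj[OF i] r(1) r(2)[OF i] r(2)[OF cnext_less[OF i]] by (auto simp: wheel_graph_arc_iff)
  qed
  then have "map_prod r r ` parcs (wheel_graph n) = parcs (wheel_graph n)"
    using inj_on_map_prod_parcs[OF g, of r] inj pair_graph_finite(2)[OF g] by (simp add: endo_inj_surj)
  then show ?thesis using V by (simp add: map_graph_def)
qed

text \<open>The dihedral symmetries of the rim carry any rim edge, in either direction, to the edge
  that closes the rim, between the numbers \<open>n - 1\<close> and 0. Gluing and splitting are set
  up at this edge only.\<close>

lemma wheel_at_reparam:
  assumes W: "wheel_at n k W" and yz: "y < n" "z < n" "z = cnext n y \<or> y = cnext n z"
  obtains k' where "wheel_at n k' W" "k' n = k n" "k' 0 = k y" "k' (n - 1) = k z"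
proof -
  have n: "3 \<le> n" and k: "inj_on k {..n}" and eq: "W = map_graph k (wheel_graph n)"
    using W by (auto simp: wheel_at_def)
  obtain r where r: "r n = n" "\<And>i. i < n \<Longrightarrow> r i < n" "inj_on r {..<n}"
    "\<And>i. i < n \<Longrightarrow> r (cnext n i) = cnext n (r i) \<or> r i = cnext n (r (cnext n i))"
    "r 0 = y" "r (n - 1) = z"
  proof (cases "y = cnext n z")
    case True
    \<comment> \<open>Here \<open>z\<close> precedes \<open>y\<close>, and a rotation sends 0 to
      \<open>y\<close> and \<open>n - 1\<close> to \<open>z\<close>. In the other case a reflection
      does.\<close>
    define r where "r j = (if j = n then n else if y + j < n then y + j else y + j - n)" for j
    show ?thesis
    proof (rule that[of r])
      show "r n = n" by (simp add: r_def)
      show less: "r i < n" if "i < n" for i using that yz(1) by (simp add: r_def) arith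
      show "inj_on r {..<n}"
      proof (rule inj_onI)
        fix i j assume "i \<in> {..<n}" "j \<in> {..<n}" "r i = r j"
        then show "i = j" using yz(1) by (simp add: r_def split: if_splits)
      qed
      show "r (cnext n i) = cnext n (r i) \<or> r i = cnext n (r (cnext n i))" if "i < n" for i
        unfolding cnext_if[OF that] cnext_if[OF less[OF that]]
        using that yz(1) by (simp add: r_def split: if_splits) arith?
      show "r 0 = y" using yz(1) n by (simp add: r_def)
      show "r (n - 1) = z" using yz(1,2) n True by (auto simp: r_def cnext_if[OF yz(2)] split: if_splits)
    qed
  next
    case False
    then have z: "z = cnext n y" using yz(3) by simp
    define r where "r j = (if j = n then n else if j \<le> y then y - j else y + n - j)" for j
    show ?thesis
    proof (rule that[of r])
      show "r n = n" by (simp add: r_def)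
      show less: "r i < n" if "i < n" for i using that yz(1) by (simp add: r_def) arith?
      show "inj_on r {..<n}"
      proof (rule inj_onI)
        fix i j assume "i \<in> {..<n}" "j \<in> {..<n}" "r i = r j"
        then show "i = j" using yz(1) by (simp add: r_def split: if_splits)
      qed
      show "r (cnext n i) = cnext n (r i) \<or> r i = cnext n (r (cnext n i))" if "i < n" for i
        unfolding cnext_if[OF less[OF cnext_less[OF that]]] unfolding cnext_if[OF that]
        using that yz(1) by (simp add: r_def split: if_splits) arith?
      show "r 0 = y" using yz(1) n by (simp add: r_def)
      show "r (n - 1) = z" using yz(1) n by (simp add: z r_def cnext_if[OF yz(1)]) arith?
    qed
  qed
  have "inj_on r {..n}" by (rule inj_on_atMostI[OF r(3,2,1)])
  moreover have "r ` {..n} \<subseteq> {..n}" using r(1,2) by (auto simp: le_less)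
  ultimately have "inj_on (k \<circ> r) {..n}" using k by (meson comp_inj_on inj_on_subset)
  moreover have "W = map_graph (k \<circ> r) (wheel_graph n)"
    using wheel_graph_automorphism[OF n r(1-4)] eq by (metis map_graph_comp)
  ultimately have "wheel_at n (k \<circ> r) W" using n by (simp add: wheel_at_def)
  then show ?thesis using that r by simp
qed

lemma wheel_graph_3: "parcs (wheel_graph 3) = {(x, y). x \<le> 3 \<and> y \<le> 3 \<and> x \<noteq> y}" (is "_ = ?R")
proof (rule card_subset_eq)
  have R: "?R = {..3} \<times> {..3} - (\<lambda>x. (x, x)) ` {..3}" by auto
  show "finite ?R" unfolding R by simp
  show "parcs (wheel_graph 3) \<subseteq> ?R"
  proof
    fix a assume "a \<in> parcs (wheel_graph 3)"
    then show "a \<in> ?R" using pair_graphD(1-3)[OF pair_graph_wheel_graph[of 3], of "fst a" "snd a"]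
      by (cases a) simp
  qed
  have "card ?R = card ({..3::nat} \<times> {..3::nat}) - card ((\<lambda>x. (x, x)) ` {..3::nat})"
    unfolding R by (rule card_Diff_subset) auto
  also have "\<dots> = 12" by (subst card_image) (simp_all add: inj_on_def)
  finally show "card (parcs (wheel_graph 3)) = card ?R" by (simp add: card_parcs_wheel_graph)
qed

text \<open>The wheel with three spokes is complete, so every bijective numbering of a
  \<open>K4\<close> is a wheel numbering and each of its vertices can be the hub.\<close>

lemma wheel_at_3:
  "wheel_at 3 k W \<longleftrightarrow> inj_on k {..3} \<and> pverts W = k ` {..3} \<and>
    parcs W = {(a, b). a \<in> pverts W \<and> b \<in> pverts W \<and> a \<noteq> b}"
proof (cases "inj_on k {..3}")
  case True
  let ?R = "{(a, b). a \<in> k ` {..3} \<and> b \<in> k ` {..3} \<and> a \<noteq> b}"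
  have "map_prod k k ` {(x, y). x \<le> 3 \<and> y \<le> 3 \<and> x \<noteq> y} = ?R"
  proof
    show "map_prod k k ` {(x, y). x \<le> 3 \<and> y \<le> 3 \<and> x \<noteq> y} \<subseteq> ?R"
      using True by (auto simp: inj_on_eq_iff)
    show "?R \<subseteq> map_prod k k ` {(x, y). x \<le> 3 \<and> y \<le> 3 \<and> x \<noteq> y}"
    proof
      fix a assume "a \<in> ?R"
      then obtain x y where "x \<le> 3" "y \<le> 3" "a = (k x, k y)" "k x \<noteq> k y" by auto
      then show "a \<in> map_prod k k ` {(x, y). x \<le> 3 \<and> y \<le> 3 \<and> x \<noteq> y}"
        by (intro image_eqI[where x = "(x, y)"]) auto
    qed
  qed
  then have "map_graph k (wheel_graph 3) = \<lparr> pverts = k ` {..3}, parcs = ?R \<rparr>"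
    by (simp add: map_graph_def wheel_graph_3)
  moreover have "W = \<lparr> pverts = A, parcs = B \<rparr> \<longleftrightarrow> pverts W = A \<and> parcs W = B" for A B
    by (cases W) simp
  ultimately show ?thesis using True unfolding wheel_at_def by (auto simp del: parcs_map_graph)
qed (simp add: wheel_at_def)

lemma K4_wheel_at:
  assumes "wheel_at 3 k W" "distinct [h, a, b, c]" "{h, a, b, c} \<subseteq> pverts W"
  shows "wheel_at 3 (\<lambda>i. if i = 0 then a else if i = 1 then b else if i = 2 then c else h) W"
proof -
  let ?k = "\<lambda>i::nat. if i = 0 then a else if i = 1 then b else if i = 2 then c else h"
  have three: "{..3} = {0, 1, 2, 3 :: nat}" by (auto simp: numeral_eq_Suc le_Suc_eq)
  have "card (pverts W) = 4" using assms(1) by (auto simp: wheel_at_3 card_image)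
  moreover have "finite (pverts W)" using assms(1) by (auto simp: wheel_at_3)
  moreover have "card {h, a, b, c} = 4" using assms(2) by simp
  ultimately have "{h, a, b, c} = pverts W" using assms(3) by (metis card_subset_eq)
  then have "pverts W = ?k ` {..3}" unfolding three by auto
  moreover have "inj_on ?k {..3}" unfolding three inj_on_def using assms(2) by auto
  ultimately show ?thesis using assms(1) unfolding wheel_at_3 by blast
qed

lemma wheel_at_hub_triangle:
  assumes W: "wheel_at n k W" and "(k n, v) \<in> parcs W" "(v, w) \<in> parcs W" "(w, k n) \<in> parcs W"
  obtains k' where "wheel_at n k' W" "k' n = k n" "k' 0 = v" "k' (n - 1) = w"
proof -
  have n: "3 \<le> n" using W by (simp add: wheel_at_def)
  have "v \<in> k ` {..n}" "w \<in> k ` {..n}"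
    using assms(3) pair_graphD(1,2)[OF wheel_at_pair_graph[OF W]] wheel_at_pverts[OF W] by blast+
  then obtain y z where yz: "y \<le> n" "z \<le> n" "v = k y" "w = k z" by auto
  have arcs: "(n, y) \<in> parcs (wheel_graph n)" "(y, z) \<in> parcs (wheel_graph n)" "(z, n) \<in> parcs (wheel_graph n)"
    using assms(2-4) yz wheel_at_arc_iff[OF W] by simp_all
  have "y \<noteq> n" "z \<noteq> n" using arcs pair_graphD(3)[OF pair_graph_wheel_graph[OF n]] by blast+
  then have lt: "y < n" "z < n" using yz by auto
  then have "z = cnext n y \<or> y = cnext n z" using arcs(2) by (simp add: wheel_graph_rim_arc_iff)
  from wheel_at_reparam[OF W lt this] obtain k' where
    "wheel_at n k' W" "k' n = k n" "k' 0 = k y" "k' (n - 1) = k z" .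
  then show ?thesis using that[of k'] yz(3,4) by simp
qed

text \<open>Puts the triangle in standard position, formed by the hub and the closing rim edge, and
  reverses it: the two sides of a gluing see their common triangle with opposite
  orientations.\<close>

lemma wheel_triangle:
  assumes "is_wheel W" "(u, v) \<in> parcs W" "(v, w) \<in> parcs W" "(w, u) \<in> parcs W"
  obtains n k where "wheel_at n k W"
    "{(v, u), (w, v), (u, w)} = {(k n, k (n - 1)), (k (n - 1), k 0), (k 0, k n)}"
proof -
  note goal = that
  obtain n k where W: "wheel_at n k W" using assms(1) is_wheel_iff by blast
  note g = wheel_at_pair_graph[OF W]
  have n: "3 \<le> n" using W by (simp add: wheel_at_def)
  have *: thesis if xyz: "k n = x" "{(v, u), (w, v), (u, w)} = {(x, z), (z, y), (y, x)}"
    "(x, y) \<in> parcs W" "(y, z) \<in> parcs W" "(z, x) \<in> parcs W" for x y z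
  proof -
    from wheel_at_hub_triangle[OF W] xyz(3-5) obtain k' where
      "wheel_at n k' W" "k' n = x" "k' 0 = y" "k' (n - 1) = z" unfolding xyz(1) by blast
    then show ?thesis using xyz(2) by (intro goal[of n k']) simp_all
  qed
  consider "k n = u" | "k n = v" | "k n = w" | "k n \<notin> {u, v, w}" by blast
  then show ?thesis
  proof cases
    case 1
    show ?thesis by (rule *[OF 1, of w v]) (use assms(2-4) in auto)
  next
    case 2
    show ?thesis by (rule *[OF 2, of u w]) (use assms(2-4) in auto)
  next
    case 3
    show ?thesis by (rule *[OF 3, of v u]) (use assms(2-4) in auto)
  next
    \<comment> \<open>A triangle that misses the hub lies on the rim, so \<open>n = 3\<close>; then
      \<open>u\<close> is made the hub and the old hub becomes a rim vertex.\<close>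
    case 4
    have "u \<in> k ` {..n}" "v \<in> k ` {..n}" "w \<in> k ` {..n}"
      using assms(2-4) pair_graphD(1)[OF g] wheel_at_pverts[OF W] by blast+
    then obtain x y z where xyz: "x \<le> n" "y \<le> n" "z \<le> n" "u = k x" "v = k y" "w = k z" by auto
    then have "x \<noteq> n" "y \<noteq> n" "z \<noteq> n" using 4 by auto
    then have lt: "x < n" "y < n" "z < n" using xyz by auto
    have "(x, y) \<in> parcs (wheel_graph n)" "(y, z) \<in> parcs (wheel_graph n)" "(z, x) \<in> parcs (wheel_graph n)"
      using assms(2-4) xyz wheel_at_arc_iff[OF W] by simp_all
    from rim_triangle[OF n lt this] have n3: "n = 3" .
    have "u \<noteq> v" "v \<noteq> w" "w \<noteq> u" using assms(2-4) pair_graphD(3)[OF g] by blast+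
    then have "distinct [u, v, k n, w]" using 4 by auto
    moreover have "k n \<in> pverts W" using wheel_at_pverts[OF W] by simp
    then have "{u, v, k n, w} \<subseteq> pverts W" using pair_graphD(1)[OF g] assms(2-4) by blast
    ultimately have "wheel_at 3 (\<lambda>i. if i = 0 then v else if i = 1 then k n else if i = 2 then w else u) W"
      using K4_wheel_at[of k W u v "k n" w] W unfolding n3 by simp
    then show ?thesis by (rule that) auto
  qed
qed

text \<open>Subdivides the edge between \<open>f\<close> and \<open>c\<close> by \<open>g\<close>
  and joins \<open>g\<close> to \<open>a\<close>. It has two uses: in the primal graph it undoes D3b
  (\<open>gsplit_d3_step\<close>); in the dual it splits a cubic vertex \<open>f\<close> and gives a
  wheel with hub \<open>a\<close> one more spoke (\<open>wheel_at_gsplit\<close>).\<close>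

definition gsplit :: "'a pair_pre_digraph \<Rightarrow> 'a \<Rightarrow> 'a \<Rightarrow> 'a \<Rightarrow> 'a \<Rightarrow> 'a pair_pre_digraph" where
  "gsplit G f a c g = \<lparr> pverts = insert g (pverts G),
     parcs = (parcs G - {(f, c), (c, f)}) \<union> {(f, g), (g, f), (g, c), (c, g), (g, a), (a, g)} \<rparr>"

lemma UN_lessThan_last: "0 < n \<Longrightarrow> (\<Union>i<n. F i) = (\<Union>i<n - 1. F i) \<union> F (n - 1 :: nat)"
  by (cases n) (simp_all add: lessThan_Suc Un_commute)

text \<open>The rim cut open at its closing edge, the edge that \<open>gsplit\<close> will
  replace.\<close>

lemma wheel_graph_parcs_path:
  assumes "3 \<le> n"
  shows "parcs (wheel_graph n) = (\<Union>i<n - 1. {(i, i + 1), (i + 1, i)}) \<union> (\<Union>i<n. {(i, n), (n, i)}) \<union>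
    {(n - 1, 0), (0, n - 1)}"
proof -
  have "parcs (wheel_graph n) =
      (\<Union>i<n. {(i, cnext n i), (cnext n i, i)}) \<union> (\<Union>i<n. {(i, n), (n, i)})"
    unfolding parcs_wheel_graph UN_Un_distrib[symmetric] by (rule SUP_cong) auto
  moreover have "(\<Union>i<n. {(i, cnext n i), (cnext n i, i)}) =
      (\<Union>i<n - 1. {(i, cnext n i), (cnext n i, i)}) \<union> {(n - 1, 0), (0, n - 1)}"
    using assms by (subst UN_lessThan_last) (simp_all add: cnext_if)
  moreover have "(\<Union>i<n - 1. {(i, cnext n i), (cnext n i, i)}) = (\<Union>i<n - 1. {(i, i + 1), (i + 1, i)})"
  proof (rule SUP_cong[OF refl])
    fix i assume "i \<in> {..<n - 1}"
    then have "cnext n i = i + 1" by (simp add: cnext_if)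
    then show "{(i, cnext n i), (cnext n i, i)} = {(i, i + 1), (i + 1, i)}" by simp
  qed
  ultimately show ?thesis by (simp only: Un_ac)
qed

text \<open>The closing rim edge is replaced by a path through \<open>g\<close>, which takes the
  number \<open>n\<close> of the hub; the hub moves up to \<open>n + 1\<close>.\<close>

lemma wheel_at_gsplit:
  assumes W: "wheel_at n k W" and g: "g \<notin> pverts W"
  shows "wheel_at (n + 1) (\<lambda>i. if i = n then g else if i = n + 1 then k n else k i)
    (gsplit W (k (n - 1)) (k n) (k 0) g)"
proof -
  have n: "3 \<le> n" and k: "inj_on k {..n}" and eq: "W = map_graph k (wheel_graph n)"
    using W by (auto simp: wheel_at_def)
  define k' where "k' i = (if i = n then g else if i = n + 1 then k n else k i)" for i
  have "n - 1 \<noteq> n" "n - 1 \<noteq> n + 1" "0 \<noteq> n" using n by auto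
  then have kl: "k' n = g" "k' (n + 1) = k n" "k' (n - 1) = k (n - 1)" "k' 0 = k 0"
    by (simp_all add: k'_def)
  define R where "R = (\<Union>i<n - 1. {(k i, k (i + 1)), (k (i + 1), k i)})"
  define S where "S = (\<Union>i<n. {(k i, k n), (k n, k i)})"
  have E: "parcs W = R \<union> S \<union> {(k (n - 1), k 0), (k 0, k (n - 1))}"
    unfolding eq parcs_map_graph wheel_graph_parcs_path[OF n] R_def S_def by (simp add: image_Un image_UN)
  have kk: "k i = k j \<longleftrightarrow> i = j" if "i \<le> n" "j \<le> n" for i j
    using that k by (auto simp: inj_on_eq_iff)
  \<comment> \<open>The closing edge is not an edge of the path because \<open>n\<close> is at least
    3.\<close>
  have nR: "(k (n - 1), k 0) \<notin> R" "(k 0, k (n - 1)) \<notin> R"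
    unfolding R_def using n by (auto simp: kk)
  have nS: "(k (n - 1), k 0) \<notin> S" "(k 0, k (n - 1)) \<notin> S"
    unfolding S_def using n by (auto simp: kk)
  have "map_prod k' k' ` parcs (wheel_graph (n + 1)) = (\<Union>i<n. {(k' i, k' (i + 1)), (k' (i + 1), k' i)}) \<union>
      (\<Union>i<n + 1. {(k' i, k' (n + 1)), (k' (n + 1), k' i)}) \<union> {(k' n, k' 0), (k' 0, k' n)}"
  proof -
    have "3 \<le> n + 1" using n by simp
    from wheel_graph_parcs_path[OF this] show ?thesis by (simp add: image_Un image_UN)
  qed
  moreover have "(\<Union>i<n. {(k' i, k' (i + 1)), (k' (i + 1), k' i)}) = R \<union> {(k (n - 1), g), (g, k (n - 1))}"
  proof -
    have "(\<Union>i<n - 1. {(k' i, k' (i + 1)), (k' (i + 1), k' i)}) = R"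
      unfolding R_def by (rule SUP_cong) (auto simp: k'_def)
    moreover have "0 < n" "n - 1 + 1 = n" using n by auto
    ultimately show ?thesis by (simp only: UN_lessThan_last[of n] kl)
  qed
  moreover have "(\<Union>i<n + 1. {(k' i, k' (n + 1)), (k' (n + 1), k' i)}) = S \<union> {(g, k n), (k n, g)}"
  proof -
    have "(\<Union>i<n. {(k' i, k' (n + 1)), (k' (n + 1), k' i)}) = S"
      unfolding S_def by (rule SUP_cong) (auto simp: k'_def)
    moreover have "0 < n + 1" "n + 1 - 1 = n" by auto
    ultimately show ?thesis by (simp only: UN_lessThan_last[of "n + 1"] kl)
  qed
  moreover have "{(k' n, k' 0), (k' 0, k' n)} = {(g, k 0), (k 0, g)}" using n by (simp add: k'_def)
  ultimately have E': "map_prod k' k' ` parcs (wheel_graph (n + 1)) =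
      (R \<union> {(k (n - 1), g), (g, k (n - 1))}) \<union> (S \<union> {(g, k n), (k n, g)}) \<union> {(g, k 0), (k 0, g)}"
    by (simp only:)
  have "parcs W - {(k (n - 1), k 0), (k 0, k (n - 1))} = R \<union> S"
    unfolding E using nR nS by blast
  then have "parcs (gsplit W (k (n - 1)) (k n) (k 0) g) = map_prod k' k' ` parcs (wheel_graph (n + 1))"
    unfolding E' gsplit_def by (simp, blast)
  moreover have "k' ` {..n + 1} = insert g (k ` {..n})"
  proof -
    have "k' ` {..<n} = k ` {..<n}" by (rule image_cong) (auto simp: k'_def)
    moreover have "{..n + 1} = insert (n + 1) (insert n {..<n})" "{..n} = insert n {..<n}" by auto
    ultimately show ?thesis by (simp only: image_insert kl insert_commute)
  qed
  ultimately have "gsplit W (k (n - 1)) (k n) (k 0) g = map_graph k' (wheel_graph (n + 1))"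
    using wheel_at_pverts[OF W] by (simp add: map_graph_def gsplit_def)
  moreover have "inj_on k' {..n + 1}"
  proof (rule inj_onI)
    fix i j assume ij: "i \<in> {..n + 1}" "j \<in> {..n + 1}" "k' i = k' j"
    have gk: "g \<noteq> k i" if "i \<le> n" for i using g that wheel_at_pverts[OF W] by auto
    have "i < n \<or> i = n \<or> i = n + 1" "j < n \<or> j = n \<or> j = n + 1" using ij(1,2) by auto
    then show "i = j"
      using ij(3) gk[of i] gk[of j] gk[of n] by (elim disjE) (simp_all add: k'_def kk)
  qed
  ultimately have "wheel_at (n + 1) k' (gsplit W (k (n - 1)) (k n) (k 0) g)"
    using n by (simp add: wheel_at_def)
  then show ?thesis unfolding k'_def .
qed

text \<open>With four or more spokes \<open>f\<close> is not the hub, having only three neighbours.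
  The hub is one of these and can only be \<open>a\<close>: otherwise \<open>f\<close>,
  \<open>a\<close> and one of \<open>b\<close>, \<open>c\<close> would form a triangle on the rim.
  With three spokes \<open>a\<close> is chosen as the hub.\<close>

lemma is_wheel_gsplit:
  assumes "is_wheel W" and N: "\<And>x. (f, x) \<in> parcs W \<longleftrightarrow> x = a \<or> x = b \<or> x = c"
    and "distinct [a, b, c]" "(a, b) \<in> parcs W" "(a, c) \<in> parcs W" "g \<notin> pverts W"
  shows "is_wheel (gsplit W f a c g)"
proof -
  obtain n k where W: "wheel_at n k W" using assms(1) is_wheel_iff by blast
  note gr = wheel_at_pair_graph[OF W]
  have n: "3 \<le> n" and k: "inj_on k {..n}" using W by (auto simp: wheel_at_def)
  have fN: "(f, a) \<in> parcs W" "(f, b) \<in> parcs W" "(f, c) \<in> parcs W" using N by auto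
  have vs: "f \<in> pverts W" "a \<in> pverts W" "b \<in> pverts W" "c \<in> pverts W" "f \<noteq> a" "f \<noteq> b" "f \<noteq> c"
    using fN pair_graphD[OF gr] by auto
  have "\<exists>m k. wheel_at m k W \<and> k m = a \<and> k (m - 1) = f \<and> k 0 = c"
  proof (cases "n = 3")
    case True
    have "wheel_at 3 (\<lambda>i. if i = 0 then c else if i = 1 then b else if i = 2 then f else a) W"
      by (rule K4_wheel_at) (use W True vs assms(3) in auto)
    then show ?thesis
      by (intro exI[of _ 3] exI[of _ "\<lambda>i. if i = 0 then c else if i = 1 then b else if i = 2 then f else a"])
        simp
  next
    case False
    have "f \<in> k ` {..n}" "a \<in> k ` {..n}" "b \<in> k ` {..n}" "c \<in> k ` {..n}"
      using vs(1-4) by (simp_all only: wheel_at_pverts[OF W])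
    then obtain x y z t where
      idx: "x \<le> n" "y \<le> n" "z \<le> n" "t \<le> n" "f = k x" "a = k y" "b = k z" "c = k t" by auto
    have "x \<noteq> n"
    proof
      assume "x = n"
      have fk: "(f, k i) \<in> parcs W" if "i < n" for i
        using that wheel_at_arc_iff[OF W, of n i] idx(5) \<open>x = n\<close> by (simp add: wheel_graph_arc_iff)
      have "k ` {..<n} \<subseteq> {a, b, c}"
      proof (rule image_subsetI)
        fix i assume "i \<in> {..<n}"
        then show "k i \<in> {a, b, c}" using fk[of i] N[of "k i"] by simp
      qed
      then have "card (k ` {..<n}) \<le> card {a, b, c}" by (intro card_mono) auto
      moreover have "card (k ` {..<n}) = n"
        using card_image[OF inj_on_subset[OF k, of "{..<n}"]] by (simp add: subset_eq)
      ultimately show False using False n assms(3) by simp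
    qed
    then have x: "x < n" using idx by simp
    have arcs: "(x, y) \<in> parcs (wheel_graph n)" "(x, z) \<in> parcs (wheel_graph n)" "(x, t) \<in> parcs (wheel_graph n)"
      "(y, z) \<in> parcs (wheel_graph n)" "(y, t) \<in> parcs (wheel_graph n)"
      using fN assms(4,5) idx wheel_at_arc_iff[OF W] by simp_all
    have "(x, n) \<in> parcs (wheel_graph n)" using x by (simp add: wheel_graph_arc_iff)
    then have "(f, k n) \<in> parcs W" using idx(1,5) wheel_at_arc_iff[OF W, of x n] by simp
    then have "k n = a \<or> k n = b \<or> k n = c" using N by blast
    then have hub: "n = y \<or> n = z \<or> n = t"
      using idx inj_onD[OF k, of n y] inj_onD[OF k, of n z] inj_onD[OF k, of n t] by auto
    have ne: "y \<noteq> z" "y \<noteq> t" "z \<noteq> t" using assms(3) idx by auto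
    have y: "y = n"
    proof (rule ccontr)
      assume "y \<noteq> n"
      then have y: "y < n" using idx by simp
      show False
      proof (cases "z = n")
        case True
        then have "t < n" using ne idx by simp
        then have "n = 3"
          using rim_triangle[OF n x y \<open>t < n\<close>] arcs pair_graphD(4)[OF pair_graph_wheel_graph[OF n]] by blast
        then show ?thesis using False by simp
      next
        case zn: False
        then have "z < n" using idx by simp
        then have "n = 3"
          using rim_triangle[OF n x y \<open>z < n\<close>] arcs pair_graphD(4)[OF pair_graph_wheel_graph[OF n]] by blast
        then show ?thesis using False by simp
      qed
    qed
    then have t: "t < n" using ne idx by simp
    then have "x = cnext n t \<or> t = cnext n x" using arcs(3) x by (auto simp: wheel_graph_rim_arc_iff)
    from wheel_at_reparam[OF W t x this] obtain k' where
      "wheel_at n k' W" "k' n = k n" "k' 0 = k t" "k' (n - 1) = k x" .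
    then show ?thesis using idx y by (intro exI[of _ n] exI[of _ k']) simp
  qed
  then obtain m k' where k': "wheel_at m k' W" "k' m = a" "k' (m - 1) = f" "k' 0 = c" by blast
  from wheel_at_gsplit[OF k'(1) assms(6)] have "is_wheel (gsplit W (k' (m - 1)) (k' m) (k' 0) g)"
    unfolding is_wheel_iff by (intro exI)
  then show ?thesis unfolding k'(2-4) .
qed

section \<open>Reducing wheels\<close>

lemma parcs_gsplit_iff:
  "(x, y) \<in> parcs (gsplit G f a c g) \<longleftrightarrow>
    ((x, y) \<in> parcs G \<and> (x, y) \<noteq> (f, c) \<and> (x, y) \<noteq> (c, f)) \<or>
    (x = g \<and> (y = f \<or> y = c \<or> y = a)) \<or> (y = g \<and> (x = f \<or> x = c \<or> x = a))"
  unfolding gsplit_def by auto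

text \<open>D3b deletes \<open>g\<close> again, with \<open>a\<close> as the common neighbour. The
  vertices \<open>f\<close> and \<open>c\<close> have degree three after the splitting too, because
  each trades the other for \<open>g\<close>.\<close>

lemma gsplit_d3_step:
  assumes G: "pair_graph G" and arcs: "(f, c) \<in> parcs G" "(f, a) \<in> parcs G" "(c, a) \<in> parcs G"
    and deg: "out_degree (with_proj G) f = 3" "out_degree (with_proj G) c = 3" and g: "g \<notin> pverts G"
  shows "d3_step (gsplit G f a c g) G"
proof -
  let ?H = "gsplit G f a c g"
  have vs: "f \<in> pverts G" "c \<in> pverts G" "a \<in> pverts G" "f \<noteq> c" "f \<noteq> a" "c \<noteq> a"
    using arcs pair_graphD[OF G] by blast+
  then have g': "g \<noteq> f" "g \<noteq> c" "g \<noteq> a" using g by auto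
  have ng: "(g, y) \<notin> parcs G" "(y, g) \<notin> parcs G" for y
    using g pair_graphD(1,2)[OF G] by blast+
  have cf: "(c, f) \<in> parcs G" using pair_graphD(4)[OF G arcs(1)] .
  have "{w. (f, w) \<in> parcs ?H} = insert g ({w. (f, w) \<in> parcs G} - {c})"
    using g' vs unfolding parcs_gsplit_iff by auto
  then have 1: "out_degree (with_proj ?H) f = 3"
    using deg(1) arcs(1) ng pair_graph_finite_nbrs[OF G, of f] by (simp add: out_degree_eq)
  have "{w. (c, w) \<in> parcs ?H} = insert g ({w. (c, w) \<in> parcs G} - {f})"
    using g' vs unfolding parcs_gsplit_iff by auto
  then have 2: "out_degree (with_proj ?H) c = 3"
    using deg(2) cf ng pair_graph_finite_nbrs[OF G, of c] by (simp add: out_degree_eq)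
  have "{w. (g, w) \<in> parcs ?H} = {f, c, a}"
    using g' ng unfolding parcs_gsplit_iff by auto
  then have 3: "out_degree (with_proj ?H) g = 3" using vs by (simp add: out_degree_eq)
  have "d3_step ?H \<lparr> pverts = pverts ?H - {g},
      parcs = {a \<in> parcs ?H. fst a \<noteq> g \<and> snd a \<noteq> g} \<union> {(f, c), (c, f)} \<rparr>"
  proof (rule D3b[where s = a])
    show "{f, g, c} \<subseteq> pverts ?H" using vs by (simp add: gsplit_def)
    show "\<forall>y\<in>{f, g, c}. out_degree (with_proj ?H) y = 3" using 1 2 3 by simp
    show "distinct [f, g, c]" using g' vs by simp
    show "{(f, g), (g, c)} \<subseteq> parcs ?H" "{(a, f), (a, g), (a, c)} \<subseteq> parcs ?H" "(f, c) \<notin> parcs ?H"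
      using g' vs arcs pair_graphD(4)[OF G] by (auto simp: parcs_gsplit_iff)
  qed
  moreover have "pverts ?H - {g} = pverts G" using g by (simp add: gsplit_def)
  moreover have "{a \<in> parcs ?H. fst a \<noteq> g \<and> snd a \<noteq> g} \<union> {(f, c), (c, f)} = parcs G"
  proof
    show "{a \<in> parcs ?H. fst a \<noteq> g \<and> snd a \<noteq> g} \<union> {(f, c), (c, f)} \<subseteq> parcs G"
      using arcs(1) cf by (auto simp: gsplit_def)
    have "fst x \<noteq> g \<and> snd x \<noteq> g" if "x \<in> parcs G" for x using ng that by (metis prod.collapse)
    then show "parcs G \<subseteq> {a \<in> parcs ?H. fst a \<noteq> g \<and> snd a \<noteq> g} \<union> {(f, c), (c, f)}"
      by (auto simp: gsplit_def)
  qed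
  moreover have "\<lparr> pverts = pverts G, parcs = parcs G \<rparr> = G" by (cases G) simp
  ultimately show ?thesis by (simp only:)
qed

lemma wheel_at_rim_degree:
  assumes W: "wheel_at n k W" and i: "i < n"
  shows "{w. (k i, w) \<in> parcs W} = {k n, k (cnext n i), k (cprev n i)}" "out_degree (with_proj W) (k i) = 3"
proof -
  have n: "3 \<le> n" and k: "inj_on k {..n}" using W by (auto simp: wheel_at_def)
  have "{a \<in> parcs W. fst a = k i} = map_prod k k ` {a \<in> parcs (wheel_graph n). fst a = i}"
  proof -
    have eq: "parcs W = map_prod k k ` parcs (wheel_graph n)" using W by (simp add: wheel_at_def)
    have "fst b = i" if "b \<in> parcs (wheel_graph n)" "k (fst b) = k i" for b
      using inj_onD[OF k that(2)] pair_graphD(1)[OF pair_graph_wheel_graph[OF n], of "fst b" "snd b"] that i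
      by simp
    then show ?thesis unfolding eq by auto
  qed
  then have "{a \<in> parcs W. fst a = k i} = Pair (k i) ` {k n, k (cnext n i), k (cprev n i)}"
    unfolding wheel_graph_out_arcs(1)[OF n i] by simp
  then show eq: "{w. (k i, w) \<in> parcs W} = {k n, k (cnext n i), k (cprev n i)}"
    unfolding out_arcs_Pair by (rule inj_image_eq_iff[THEN iffD1, rotated]) (simp add: inj_def)
  have "n \<noteq> cnext n i" "n \<noteq> cprev n i" "cnext n i \<noteq> cprev n i"
    using cnext_less[OF i] cprev_less[OF i] cnext_neq(3)[OF n i] by auto
  then have "k n \<noteq> k (cnext n i)" "k n \<noteq> k (cprev n i)" "k (cnext n i) \<noteq> k (cprev n i)"
    using inj_onD[OF k, of n "cnext n i"] inj_onD[OF k, of n "cprev n i"]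
      inj_onD[OF k, of "cnext n i" "cprev n i"] cnext_less[OF i] cprev_less[OF i] by auto
  then show "out_degree (with_proj W) (k i) = 3" unfolding out_degree_eq eq by simp
qed

text \<open>A wheel with at least four spokes is a \<open>gsplit\<close> of a wheel with one spoke
  less. Since wheels are self-dual, this also settles the duals of single wheels in
  \<open>wheel_tree_embedding\<close>.\<close>

lemma wheel_d3_reducible:
  assumes "is_wheel W"
  shows "\<exists>K. d3_step\<^sup>*\<^sup>* W K \<and> complete_digraph 4 (with_proj K)"
proof -
  obtain n k where "wheel_at n k W" using assms is_wheel_iff by blast
  moreover from this have "3 \<le> n" by (simp add: wheel_at_def)
  ultimately show ?thesis
  proof (induction "n - 3" arbitrary: n k W)
    case 0
    then have "n = 3" by simp
    then have W: "inj_on k {..3}" "pverts W = k ` {..3}"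
      "parcs W = {(a, b). a \<in> pverts W \<and> b \<in> pverts W \<and> a \<noteq> b}"
      using 0(2) by (simp_all add: wheel_at_3)
    then have "complete_digraph 4 (with_proj W)"
      unfolding complete_digraph_pair_def by (simp add: card_image)
    then show ?case by blast
  next
    case (Suc m)
    obtain n' where n': "n = n' + 1" "3 \<le> n'" "m = n' - 3"
    proof
      show "n = (n - 1) + 1" "3 \<le> n - 1" "m = n - 1 - 3" using Suc.hyps(2) by simp_all
    qed
    have k: "inj_on k {..n' + 1}" and W: "W = map_graph k (wheel_graph (n' + 1))"
      using Suc.prems(1) n'(1) by (auto simp: wheel_at_def)
    \<comment> \<open>Drops the last rim vertex \<open>k n'\<close> and gives its number to the
      hub.\<close>
    define k' where "k' i = (if i = n' then k (n' + 1) else k i)" for i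
    let ?W = "map_graph k' (wheel_graph n')"
    have inj: "inj_on k' {..n'}"
    proof (rule inj_onI)
      fix i j assume ij: "i \<in> {..n'}" "j \<in> {..n'}" "k' i = k' j"
      then show "i = j"
        using inj_onD[OF k, of i j] inj_onD[OF k, of i "n' + 1"] inj_onD[OF k, of "n' + 1" j]
        by (auto simp: k'_def split: if_splits)
    qed
    then have W': "wheel_at n' k' ?W" using n'(2) by (simp add: wheel_at_def)
    have fresh: "k n' \<notin> pverts ?W"
    proof
      assume "k n' \<in> pverts ?W"
      then obtain i where "i \<le> n'" "k n' = k' i" by auto
      then show False using inj_onD[OF k, of n' i] inj_onD[OF k, of n' "n' + 1"] by (auto simp: k'_def split: if_splits)
    qed
    have "W = gsplit ?W (k' (n' - 1)) (k' n') (k' 0) (k n')"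
    proof -
      have "gsplit ?W (k' (n' - 1)) (k' n') (k' 0) (k n') =
          map_graph (\<lambda>i. if i = n' then k n' else if i = n' + 1 then k' n' else k' i) (wheel_graph (n' + 1))"
        using wheel_at_gsplit[OF W' fresh] by (simp add: wheel_at_def)
      also have "\<dots> = map_graph k (wheel_graph (n' + 1))"
        by (rule map_graph_cong[OF pair_graph_wf[OF pair_graph_wheel_graph]]) (use n' in \<open>auto simp: k'_def\<close>)
      finally show ?thesis using W by simp
    qed
    moreover have "d3_step (gsplit ?W (k' (n' - 1)) (k' n') (k' 0) (k n')) ?W"
    proof (rule gsplit_d3_step[OF wheel_at_pair_graph[OF W'] _ _ _ _ _ fresh])
      have lt: "n' - 1 < n'" "0 < n'" using n'(2) by auto
      show "(k' (n' - 1), k' 0) \<in> parcs ?W" "(k' (n' - 1), k' n') \<in> parcs ?W" "(k' 0, k' n') \<in> parcs ?W"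
        using lt n'(2) by (auto simp: wheel_at_arc_iff[OF W'] wheel_graph_arc_iff cnext_if simp del: parcs_map_graph)
      show "out_degree (with_proj ?W) (k' (n' - 1)) = 3" "out_degree (with_proj ?W) (k' 0) = 3"
        using wheel_at_rim_degree(2)[OF W'] lt by auto
    qed
    moreover obtain K where "d3_step\<^sup>*\<^sup>* ?W K" "complete_digraph 4 (with_proj K)"
      using Suc.hyps(1)[OF n'(3) W' n'(2)] by blast
    ultimately show ?case by (metis converse_rtranclp_into_rtranclp)
  qed
qed

section \<open>Faces of a wheel\<close>

text \<open>Neither loops nor parallel edges in the dual, so that \<open>dual_graph\<close>, whose
  arcs are pairs, merges nothing. The property is an invariant of gluing
  (\<open>dual_simple_glued\<close>).\<close>

definition dual_simple :: "'a pair_pre_digraph \<Rightarrow> ('a \<times> 'a \<Rightarrow> 'a \<times> 'a) \<Rightarrow> bool" where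
  "dual_simple G \<sigma> \<longleftrightarrow> inj_on (\<lambda>a. (face_of \<sigma> a, face_of \<sigma> (prod.swap a))) (parcs G) \<and>
     (\<forall>a \<in> parcs G. face_of \<sigma> a \<noteq> face_of \<sigma> (prod.swap a))"

lemma pverts_dual_graph [simp]: "pverts (dual_graph G \<sigma>) = faces G \<sigma>"
  and parcs_dual_graph: "parcs (dual_graph G \<sigma>) = (\<lambda>a. (face_of \<sigma> a, face_of \<sigma> (prod.swap a))) ` parcs G"
  by (simp_all add: dual_graph_def)

lemma wheel_at_arcs_in_faces:
  assumes "i < n"
  shows "(k n, k i) \<in> wheel_tri k n i" "(k i, k (cnext n i)) \<in> wheel_tri k n i"
    "(k (cnext n i), k n) \<in> wheel_tri k n i" "(k i, k n) \<in> wheel_tri k n (cprev n i)"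
    "(k (cnext n i), k i) \<in> wheel_rim k n"
  using assms by (auto simp: wheel_tri_def wheel_rim_def cnext_cprev)

lemma wheel_tri_inj:
  assumes k: "inj_on k {..n}" and ij: "i < n" "j < n" "wheel_tri k n i = wheel_tri k n j"
  shows "i = j"
proof -
  have "(k n, k i) \<in> wheel_tri k n j" using ij(3) wheel_at_arcs_in_faces(1)[OF ij(1), of k] by simp
  then show ?thesis
    using inj_onD[OF k, of i j] inj_onD[OF k, of n j] inj_onD[OF k, of n "cnext n j"] ij cnext_less[OF ij(2)]
    by (auto simp: wheel_tri_def)
qed

lemma wheel_tri_not_rim:
  assumes k: "inj_on k {..n}" and i: "i < n"
  shows "wheel_tri k n i \<noteq> wheel_rim k n"
proof
  assume "wheel_tri k n i = wheel_rim k n"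
  then have "(k n, k i) \<in> wheel_rim k n" using wheel_at_arcs_in_faces(1)[OF i, of k] by simp
  then obtain j where "j < n" "k n = k (cnext n j)" by (auto simp: wheel_rim_def)
  then show False using inj_onD[OF k, of n "cnext n j"] cnext_less[of j n] by simp
qed

lemma wheel_at_faces:
  assumes W: "wheel_at n k W"
    and tri: "\<And>i a. i < n \<Longrightarrow> a \<in> wheel_tri k n i \<Longrightarrow> face_of \<sigma> a = wheel_tri k n i"
    and rim: "\<And>a. a \<in> wheel_rim k n \<Longrightarrow> face_of \<sigma> a = wheel_rim k n"
  shows "faces W \<sigma> = wheel_tri k n ` {..<n} \<union> {wheel_rim k n}"
proof -
  have n: "3 \<le> n" using W by (simp add: wheel_at_def)
  have f: "face_of \<sigma> (k n, k i) = wheel_tri k n i" "face_of \<sigma> (k i, k (cnext n i)) = wheel_tri k n i"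
    "face_of \<sigma> (k i, k n) = wheel_tri k n (cprev n i)" "face_of \<sigma> (k (cnext n i), k i) = wheel_rim k n"
    if "i < n" for i
    using that tri rim wheel_at_arcs_in_faces[OF that, of k] cprev_less[OF that] by blast+
  show ?thesis
  proof
    show "faces W \<sigma> \<subseteq> wheel_tri k n ` {..<n} \<union> {wheel_rim k n}"
    proof
      fix F assume "F \<in> faces W \<sigma>"
      then obtain a where a: "a \<in> parcs W" "F = face_of \<sigma> a" by (auto simp: faces_def)
      then obtain i where "i < n" "a \<in> {(k i, k (cnext n i)), (k (cnext n i), k i), (k i, k n), (k n, k i)}"
        unfolding wheel_at_parcs[OF W] by blast
      then show "F \<in> wheel_tri k n ` {..<n} \<union> {wheel_rim k n}"
        using a(2) f[of i] cprev_less[of i n] by auto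
    qed
    have arc: "(k i, k (cnext n i)) \<in> parcs W" "(k (cnext n i), k i) \<in> parcs W" if "i < n" for i
      unfolding wheel_at_parcs[OF W] using that by blast+
    have "wheel_tri k n i \<in> faces W \<sigma>" if "i < n" for i
      unfolding faces_def using f(2)[OF that] arc(1)[OF that] by (metis image_eqI)
    moreover have "wheel_rim k n \<in> faces W \<sigma>"
      unfolding faces_def using f(4)[of 0] arc(2)[of 0] n by (metis image_eqI le_zero_eq neq0_conv zero_neq_numeral)
    ultimately show "wheel_tri k n ` {..<n} \<union> {wheel_rim k n} \<subseteq> faces W \<sigma>" by auto
  qed
qed

text \<open>Wheels are self-dual: the triangles in their cyclic order form the new rim, the rim face
  is the new hub. A spoke separates consecutive triangles, and a rim edge separates its triangle
  from the rim face.\<close>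

lemma wheel_at_dual:
  assumes W: "wheel_at n k W"
    and tri: "\<And>i a. i < n \<Longrightarrow> a \<in> wheel_tri k n i \<Longrightarrow> face_of \<sigma> a = wheel_tri k n i"
    and rim: "\<And>a. a \<in> wheel_rim k n \<Longrightarrow> face_of \<sigma> a = wheel_rim k n"
  shows "is_wheel (dual_graph W \<sigma>)" "dual_simple W \<sigma>"
proof -
  have n: "3 \<le> n" and k: "inj_on k {..n}" using W by (auto simp: wheel_at_def)
  define w where "w i = (if i < n then wheel_tri k n i else wheel_rim k n)" for i
  let ?d = "\<lambda>a. (face_of \<sigma> a, face_of \<sigma> (prod.swap a))"
  have w: "w i = wheel_tri k n i" if "i < n" for i using that by (simp add: w_def)
  have wn: "w n = wheel_rim k n" by (simp add: w_def)
  have f: "face_of \<sigma> (k n, k i) = w i" "face_of \<sigma> (k i, k (cnext n i)) = w i"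
    "face_of \<sigma> (k i, k n) = w (cprev n i)" "face_of \<sigma> (k (cnext n i), k i) = w n" if "i < n" for i
    using that tri rim wheel_at_arcs_in_faces[OF that, of k] cprev_less[OF that] w wn by metis+
  have inj: "inj_on w {..n}"
  proof (rule inj_onI)
    fix i j assume ij: "i \<in> {..n}" "j \<in> {..n}" "w i = w j"
    then show "i = j"
      using wheel_tri_inj[OF k, of i j] wheel_tri_not_rim[OF k, of i] wheel_tri_not_rim[OF k, of j]
      by (auto simp: w_def split: if_splits)
  qed
  have sub: "?d ` parcs W \<subseteq> map_prod w w ` parcs (wheel_graph n)"
  proof
    fix b assume "b \<in> ?d ` parcs W"
    then obtain a where a: "a \<in> parcs W" "b = ?d a" by blast
    then obtain i where i: "i < n" "a \<in> {(k i, k (cnext n i)), (k (cnext n i), k i), (k i, k n), (k n, k i)}"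
      unfolding wheel_at_parcs[OF W] by blast
    have "(i, n) \<in> parcs (wheel_graph n)" "(n, i) \<in> parcs (wheel_graph n)"
      "(cprev n i, i) \<in> parcs (wheel_graph n)" "(i, cprev n i) \<in> parcs (wheel_graph n)"
      using i(1) cprev_less[OF i(1)] cnext_cprev[OF i(1)] by (simp_all add: wheel_graph_arc_iff)
    then have m: "(w i, w n) \<in> map_prod w w ` parcs (wheel_graph n)"
      "(w n, w i) \<in> map_prod w w ` parcs (wheel_graph n)"
      "(w (cprev n i), w i) \<in> map_prod w w ` parcs (wheel_graph n)"
      "(w i, w (cprev n i)) \<in> map_prod w w ` parcs (wheel_graph n)"
      by (auto intro: map_prod_imageI)
    have "a = (k i, k (cnext n i)) \<or> a = (k (cnext n i), k i) \<or> a = (k i, k n) \<or> a = (k n, k i)"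
      using i(2) by blast
    then show "b \<in> map_prod w w ` parcs (wheel_graph n)"
      using m by (elim disjE) (simp_all only: a(2) prod.swap_def fst_conv snd_conv f[OF i(1)])
  qed
  have sup: "map_prod w w ` parcs (wheel_graph n) \<subseteq> ?d ` parcs W"
  proof
    fix b assume "b \<in> map_prod w w ` parcs (wheel_graph n)"
    then obtain i where i: "i < n" "b \<in> {(w i, w (cnext n i)), (w (cnext n i), w i), (w i, w n), (w n, w i)}"
      unfolding parcs_wheel_graph by auto
    let ?j = "cnext n i"
    have j: "?j < n" "cprev n ?j = i" using i(1) cnext_less cprev_cnext by auto
    have "(k ?j, k n) \<in> parcs W" "(k n, k ?j) \<in> parcs W" "(k i, k ?j) \<in> parcs W" "(k ?j, k i) \<in> parcs W"
      unfolding wheel_at_parcs[OF W] using i(1) j(1) by blast+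
    moreover have "?d (k ?j, k n) = (w i, w ?j)" "?d (k n, k ?j) = (w ?j, w i)"
      "?d (k i, k ?j) = (w i, w n)" "?d (k ?j, k i) = (w n, w i)"
      using f[OF i(1)] f[OF j(1)] j(2) by simp_all
    ultimately have "{(w i, w ?j), (w ?j, w i), (w i, w n), (w n, w i)} \<subseteq> ?d ` parcs W"
      by (metis (no_types, lifting) empty_subsetI image_eqI insert_subset)
    then show "b \<in> ?d ` parcs W" using i(2) by blast
  qed
  have eq: "?d ` parcs W = map_prod w w ` parcs (wheel_graph n)" using sub sup by blast
  have "w ` {..n} = wheel_tri k n ` {..<n} \<union> {wheel_rim k n}"
  proof -
    have "w ` {..<n} = wheel_tri k n ` {..<n}" by (rule image_cong) (auto simp: w)
    moreover have "{..n} = insert n {..<n}" by auto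
    ultimately show ?thesis using wn by simp
  qed
  then have D: "dual_graph W \<sigma> = map_graph w (wheel_graph n)"
    using wheel_at_faces[OF W tri rim] eq by (simp add: dual_graph_def map_graph_def)
  then have wd: "wheel_at n w (dual_graph W \<sigma>)" using n inj by (simp add: wheel_at_def)
  then show "is_wheel (dual_graph W \<sigma>)" using is_wheel_iff by blast
  \<comment> \<open>Injectivity by counting: the dual is again a wheel with \<open>n\<close> spokes,
    so both arc sets have the same size.\<close>
  have "card (map_prod w w ` parcs (wheel_graph n)) = card (parcs (wheel_graph n))"
    "card (map_prod k k ` parcs (wheel_graph n)) = card (parcs (wheel_graph n))"
    using inj k by (intro card_image inj_on_map_prod_parcs[OF pair_graph_wheel_graph[OF n]]; simp)+
  then have "card (?d ` parcs W) = card (parcs W)" using eq W by (simp add: wheel_at_def)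
  then have "inj_on ?d (parcs W)"
    using pair_graph_finite(2)[OF wheel_at_pair_graph[OF W]] by (simp add: eq_card_imp_inj_on)
  moreover have "face_of \<sigma> a \<noteq> face_of \<sigma> (prod.swap a)" if "a \<in> parcs W" for a
  proof -
    have "?d a \<in> parcs (dual_graph W \<sigma>)" using that by (simp add: parcs_dual_graph)
    then show ?thesis using pair_graphD(3)[OF wheel_at_pair_graph[OF wd]] by blast
  qed
  ultimately show "dual_simple W \<sigma>" by (simp add: dual_simple_def)
qed

text \<open>In a wheel every triangle bounds a face: one through the hub is a
  \<open>wheel_tri\<close>, and one that misses the hub forces \<open>n = 3\<close> and is the
  rim.\<close>

lemma wheel_at_tris:
  assumes W: "wheel_at n k W" and T: "T \<in> tris W"
  obtains u v w where "T = {u, v, w}"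
    "{(u, v), (v, w), (w, u)} \<in> wheel_tri k n ` {..<n} \<union> {wheel_rim k n}"
proof -
  note goal = that and g = wheel_at_pair_graph[OF W]
  have n: "3 \<le> n" and k: "inj_on k {..n}" using W by (auto simp: wheel_at_def)
  obtain u v w where uvw: "T = {u, v, w}" "(u, v) \<in> parcs W" "(v, w) \<in> parcs W" "(w, u) \<in> parcs W"
    using T by (rule trisE)
  have "u \<in> k ` {..n}" "v \<in> k ` {..n}" "w \<in> k ` {..n}"
    using uvw(2-4) pair_graphD(1)[OF g] wheel_at_pverts[OF W] by blast+
  then obtain x y z where xyz: "x \<le> n" "y \<le> n" "z \<le> n" "u = k x" "v = k y" "w = k z" by auto
  have arcs: "(x, y) \<in> parcs (wheel_graph n)" "(y, z) \<in> parcs (wheel_graph n)" "(z, x) \<in> parcs (wheel_graph n)"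
    using uvw(2-4) xyz wheel_at_arc_iff[OF W] by simp_all
  have hub: thesis if h: "T = {k n, k y, k z}" "(n, y) \<in> parcs (wheel_graph n)" "(y, z) \<in> parcs (wheel_graph n)"
    "(z, n) \<in> parcs (wheel_graph n)" "y \<le> n" "z \<le> n" for y z
  proof -
    have "y \<noteq> n" "z \<noteq> n" using h pair_graphD(3)[OF pair_graph_wheel_graph[OF n]] by blast+
    then have lt: "y < n" "z < n" using h by auto
    then consider "z = cnext n y" | "y = cnext n z" using h(3) by (auto simp: wheel_graph_rim_arc_iff)
    then show thesis
    proof cases
      case 1
      show ?thesis
        by (rule goal[OF h(1)]) (use lt 1 in \<open>auto simp: wheel_tri_def\<close>)
    next
      case 2
      have "T = {k n, k z, k y}" using h(1) by auto
      then show ?thesis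
        by (rule goal) (use lt 2 in \<open>auto simp: wheel_tri_def\<close>)
    qed
  qed
  show ?thesis
  proof (cases "x = n \<or> y = n \<or> z = n")
    case True
    have "T = {u, v, w}" "T = {v, w, u}" "T = {w, u, v}" using uvw(1) by auto
    then show ?thesis using True hub[of y z] hub[of z x] hub[of x y] arcs xyz by blast
  next
    case False
    then have lt: "x < n" "y < n" "z < n" using xyz by auto
    have n3: "n = 3" using rim_triangle[OF n lt arcs] .
    have "x \<noteq> y" "y \<noteq> z" "z \<noteq> x" using arcs pair_graphD(3)[OF pair_graph_wheel_graph[OF n]] by blast+
    then have "card {x, y, z} = 3" by simp
    moreover have "{x, y, z} \<subseteq> {1, 0, 2}" using lt n3 by auto
    ultimately have "{x, y, z} = {1, 0, 2}" by (intro card_subset_eq) auto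
    then have "k ` {x, y, z} = k ` {1, 0, 2}" by simp
    then have "T = {k 1, k 0, k 2}" using uvw(1) xyz(4-6) by simp
    moreover have "{..<3} = {0, 1, 2 :: nat}" by auto
    then have "wheel_rim k n = {(k 1, k 0), (k 0, k 2), (k 2, k 1)}"
      unfolding wheel_rim_def n3
      by (simp only: image_insert image_empty) (simp add: cnext_def insert_commute numeral_2_eq_2)
    ultimately show ?thesis using goal[of "k 1" "k 0" "k 2"] by blast
  qed
qed

section \<open>Inserting a wheel in place of a cubic vertex\<close>

text \<open>
  \<open>H\<close> with the vertex \<open>x\<close>, whose neighbours are \<open>\<tau> 0\<close>, \<open>\<tau> (m + 1)\<close> and \<open>c\<close>, replaced by the
  path \<open>\<tau> 1, \<dots>, \<tau> m\<close> and a vertex \<open>s\<close> joined to all of that path.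
\<close>

definition insert_wheel :: "'a pair_pre_digraph \<Rightarrow> 'a \<Rightarrow> 'a \<Rightarrow> (nat \<Rightarrow> 'a) \<Rightarrow> 'a \<Rightarrow> nat \<Rightarrow> 'a pair_pre_digraph" where
  "insert_wheel H x c \<tau> s m =
     \<lparr> pverts = (pverts H - {x}) \<union> \<tau> ` {1..m} \<union> {s},
       parcs = {a \<in> parcs H. fst a \<noteq> x \<and> snd a \<noteq> x} \<union> (\<Union>i\<le>m. {(\<tau> i, \<tau> (i + 1)), (\<tau> (i + 1), \<tau> i)}) \<union>
         (\<Union>i\<in>{1..m}. {(\<tau> i, s), (s, \<tau> i)}) \<union> {(c, s), (s, c)} \<rparr>"

text \<open>\<open>\<tau>\<close> lists the whole path, including the old neighbours at its ends 0
  and \<open>m + 1\<close>. For a glued wheel with \<open>n\<close> spokes \<open>m\<close> will be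
  \<open>n - 1\<close>, whence the bound 2.\<close>

locale wheel_insertion =
  fixes H :: "'a pair_pre_digraph" and x c :: 'a and \<tau> :: "nat \<Rightarrow> 'a" and s :: 'a and m :: nat
  assumes H: "pair_graph H" and x: "x \<in> pverts H"
    and nbrs: "\<And>y. (x, y) \<in> parcs H \<longleftrightarrow> y = \<tau> 0 \<or> y = \<tau> (m + 1) \<or> y = c"
    and inj: "inj_on \<tau> {..m + 1}" and c: "c \<noteq> \<tau> 0" "c \<noteq> \<tau> (m + 1)"
    and fresh: "\<tau> ` {1..m} \<inter> pverts H = {}" "s \<notin> pverts H" "s \<notin> \<tau> ` {1..m}"
    and m: "2 \<le> m"
begin

lemma eq: "i \<le> m + 1 \<Longrightarrow> j \<le> m + 1 \<Longrightarrow> \<tau> i = \<tau> j \<longleftrightarrow> i = j"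
  using inj by (auto simp: inj_on_eq_iff)

lemma ends: "\<tau> 0 \<in> pverts H" "\<tau> (m + 1) \<in> pverts H" "c \<in> pverts H" "\<tau> 0 \<noteq> x" "\<tau> (m + 1) \<noteq> x" "c \<noteq> x"
  using nbrs pair_graphD[OF H] by blast+

lemma fresh_path: "1 \<le> i \<Longrightarrow> i \<le> m \<Longrightarrow> \<tau> i \<notin> pverts H \<and> \<tau> i \<noteq> s \<and> \<tau> i \<noteq> c"
  using fresh ends(3) by force

lemma path_nbrs:
  assumes i: "1 \<le> i" "i \<le> m"
  shows "{y. (\<tau> i, y) \<in> parcs (insert_wheel H x c \<tau> s m)} = {\<tau> (i - 1), \<tau> (i + 1), s}"
proof -
  note fp = fresh_path[OF i]
  have nH: "(\<tau> i, y) \<notin> parcs H" for y using fp pair_graphD(1)[OF H] by blast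
  have "(\<tau> i, y) \<in> (\<Union>j\<le>m. {(\<tau> j, \<tau> (j + 1)), (\<tau> (j + 1), \<tau> j)}) \<longleftrightarrow> y = \<tau> (i - 1) \<or> y = \<tau> (i + 1)" for y
  proof
    assume "(\<tau> i, y) \<in> (\<Union>j\<le>m. {(\<tau> j, \<tau> (j + 1)), (\<tau> (j + 1), \<tau> j)})"
    then obtain j where "j \<le> m" "(\<tau> i = \<tau> j \<and> y = \<tau> (j + 1)) \<or> (\<tau> i = \<tau> (j + 1) \<and> y = \<tau> j)" by auto
    then show "y = \<tau> (i - 1) \<or> y = \<tau> (i + 1)" using eq[of i j] eq[of i "j + 1"] i by auto
  next
    assume "y = \<tau> (i - 1) \<or> y = \<tau> (i + 1)"
    moreover have "i - 1 \<le> m" "\<tau> (i - 1 + 1) = \<tau> i" using i by auto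
    ultimately show "(\<tau> i, y) \<in> (\<Union>j\<le>m. {(\<tau> j, \<tau> (j + 1)), (\<tau> (j + 1), \<tau> j)})"
      using i by (metis (no_types, lifting) UN_iff atMost_iff insert_iff)
  qed
  moreover have "(\<tau> i, y) \<in> (\<Union>j\<in>{1..m}. {(\<tau> j, s), (s, \<tau> j)}) \<longleftrightarrow> y = s" for y
    using i fp by auto
  ultimately show ?thesis using nH fp by (auto simp: insert_wheel_def)
qed

lemma path_degree:
  assumes i: "1 \<le> i" "i \<le> m"
  shows "out_degree (with_proj (insert_wheel H x c \<tau> s m)) (\<tau> i) = 3"
proof -
  have "\<tau> (i - 1) \<noteq> \<tau> (i + 1)" using eq[of "i - 1" "i + 1"] i by auto
  moreover have "\<tau> j \<noteq> s" if "j \<le> m + 1" for j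
    using fresh_path[of j] ends(1,2) fresh(2) that by (metis Suc_eq_plus1 le_SucE less_one not_le)
  ultimately show ?thesis unfolding out_degree_eq path_nbrs[OF i] using i by simp
qed

end

text \<open>D3b is applied to \<open>\<tau> 1\<close>, \<open>\<tau> 2\<close>,
  \<open>\<tau> 3\<close> with common neighbour \<open>s\<close>, which takes three inner path
  vertices. \<open>\<tau>'\<close> closes the gap that \<open>\<tau> 2\<close> leaves in the
  numbering.\<close>

lemma insert_wheel_shorten:
  assumes "wheel_insertion H x c \<tau> s m" "3 \<le> m"
  defines "\<tau>' \<equiv> \<lambda>i. if i \<le> 1 then \<tau> i else \<tau> (i + 1)"
  shows "d3_step (insert_wheel H x c \<tau> s m) (insert_wheel H x c \<tau>' s (m - 1))"
    "wheel_insertion H x c \<tau>' s (m - 1)"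
proof -
  interpret wheel_insertion H x c \<tau> s m by fact
  let ?G = "insert_wheel H x c \<tau> s m" and ?q = "\<tau> 2"
  obtain l where l: "m = l + 3" using assms(2) by (metis add.commute le_Suc_ex)
  have n1: "{y. (\<tau> 1, y) \<in> parcs ?G} = {\<tau> 0, \<tau> 2, s}" and n2: "{y. (\<tau> 2, y) \<in> parcs ?G} = {\<tau> 1, \<tau> 3, s}"
    and n3: "{y. (\<tau> 3, y) \<in> parcs ?G} = {\<tau> 2, \<tau> 4, s}"
    using path_nbrs[of 1] path_nbrs[of 2] path_nbrs[of 3] assms(2) by (simp_all add: numeral_eq_Suc)
  have q: "?q \<notin> pverts H" "?q \<noteq> s" "?q \<noteq> c" using fresh_path[of 2] m by auto
  have sp: "\<tau> j \<noteq> s" if "j \<le> m + 1" for j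
    using fresh_path[of j] ends(1,2) fresh(2) that by (metis Suc_eq_plus1 le_SucE less_one not_le)
  have "d3_step ?G \<lparr> pverts = pverts ?G - {?q},
      parcs = {a \<in> parcs ?G. fst a \<noteq> ?q \<and> snd a \<noteq> ?q} \<union> {(\<tau> 1, \<tau> 3), (\<tau> 3, \<tau> 1)} \<rparr>"
  proof (rule D3b[where s = s])
    show "{\<tau> 1, \<tau> 2, \<tau> 3} \<subseteq> pverts ?G" using assms(2) by (auto simp: insert_wheel_def)
    show "\<forall>y\<in>{\<tau> 1, \<tau> 2, \<tau> 3}. out_degree (with_proj ?G) y = 3" using path_degree assms(2) by auto
    show "distinct [\<tau> 1, \<tau> 2, \<tau> 3]" using assms(2) by (simp add: eq)
    show "{(\<tau> 1, \<tau> 2), (\<tau> 2, \<tau> 3)} \<subseteq> parcs ?G" using n1 n2 by blast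
    show "(\<tau> 1, \<tau> 3) \<notin> parcs ?G"
    proof
      assume "(\<tau> 1, \<tau> 3) \<in> parcs ?G"
      then have "\<tau> 3 \<in> {\<tau> 0, \<tau> 2, s}" using n1 by blast
      then show False using assms(2) sp[of 3] by (simp add: eq)
    qed
    show "{(s, \<tau> 1), (s, \<tau> 2), (s, \<tau> 3)} \<subseteq> parcs ?G" using assms(2) by (auto simp: insert_wheel_def)
  qed
  moreover have "pverts ?G - {?q} = pverts (insert_wheel H x c \<tau>' s (m - 1))"
  proof -
    have "{1..m} - {2} = insert 1 (Suc ` {2..m - 1})"
      unfolding image_Suc_atLeastAtMost using assms(2) by auto
    moreover have "{1..m} - {2} \<subseteq> {..m + 1}" "{2} \<subseteq> {..m + 1}" using assms(2) by auto
    from inj_on_image_set_diff[OF inj this] have "\<tau> ` {1..m} - {?q} = \<tau> ` ({1..m} - {2})" by simp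
    moreover have "\<tau>' ` {1..m - 1} = insert (\<tau> 1) (\<tau> ` Suc ` {2..m - 1})"
    proof -
      have "{1..m - 1} = insert 1 {2..m - 1}" using assms(2) by auto
      moreover have "\<tau>' ` {2..m - 1} = \<tau> ` Suc ` {2..m - 1}"
        unfolding image_image by (rule image_cong) (auto simp: \<tau>'_def)
      moreover have "\<tau>' 1 = \<tau> 1" by (simp add: \<tau>'_def)
      ultimately show ?thesis by (simp only: image_insert)
    qed
    ultimately have "\<tau> ` {1..m} - {?q} = \<tau>' ` {1..m - 1}" by (simp only: image_insert)
    then show ?thesis using q by (auto simp: insert_wheel_def)
  qed
  moreover have "{a \<in> parcs ?G. fst a \<noteq> ?q \<and> snd a \<noteq> ?q} \<union> {(\<tau> 1, \<tau> 3), (\<tau> 3, \<tau> 1)} =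
      parcs (insert_wheel H x c \<tau>' s (m - 1))"
  proof -
    \<comment> \<open>\<open>R\<close> deletes the arcs at \<open>?q\<close>; \<open>p\<close> and
      \<open>e\<close> abbreviate path edges and spokes. From index 3 on nothing is deleted and the
      numbering moves down by one.\<close>
    define R where "R A = {a \<in> A. fst a \<noteq> ?q \<and> snd a \<noteq> ?q}" for A :: "('a \<times> 'a) set"
    define p where "p t i = {(t i, t (i + 1)), (t (i + 1), t i)}" for t :: "nat \<Rightarrow> 'a" and i
    define e where "e t i = {(t i, s), (s, t i)}" for t :: "nat \<Rightarrow> 'a" and i :: nat
    define A where "A = {a \<in> parcs H. fst a \<noteq> x \<and> snd a \<noteq> x}"
    have G: "parcs (insert_wheel H x c t s l) = A \<union> (\<Union>i\<le>l. p t i) \<union> (\<Union>i\<in>{1..l}. e t i) \<union> {(c, s), (s, c)}" for t l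
      by (simp add: insert_wheel_def A_def p_def e_def)
    have RA: "R A = A" using q(1) pair_graphD(1,2)[OF H] by (auto simp: A_def R_def)
    have RU: "R (\<Union>i\<in>I. F i) = (\<Union>i\<in>I. R (F i))" for I :: "nat set" and F by (auto simp: R_def)
    have RUn: "R (A \<union> B) = R A \<union> R B" for A B by (auto simp: R_def)
    have I: "{..m} = {0} \<union> {1} \<union> {2} \<union> {3..m}" "{1..m} = {1} \<union> {2} \<union> {3..m}"
      and I': "{..m - 1} = {0} \<union> {1} \<union> {2..m - 1}" "{1..m - 1} = {1} \<union> {2..m - 1}"
      and IS: "{3..m} = Suc ` {2..m - 1}"
      unfolding image_Suc_atLeastAtMost using assms(2) by auto
    have keep: "R (p \<tau> i) = p \<tau> i" "R (e \<tau> i) = e \<tau> i" if "i \<in> {3..m}" for i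
    proof -
      have "\<tau> i \<noteq> ?q" "\<tau> (i + 1) \<noteq> ?q" using that assms(2) eq[of i 2] eq[of "i + 1" 2] by auto
      then show "R (p \<tau> i) = p \<tau> i" "R (e \<tau> i) = e \<tau> i" using q(2) by (auto simp: R_def p_def e_def)
    qed
    have shift: "(\<Union>i\<in>{3..m}. F i) = (\<Union>i\<in>{2..m - 1}. F (Suc i))" for F :: "nat \<Rightarrow> ('a \<times> 'a) set"
      by (simp only: IS UN_simps)
    have P: "(\<Union>i\<in>{3..m}. R (p \<tau> i)) = (\<Union>i\<in>{2..m - 1}. p \<tau>' i)"
    proof -
      have "(\<Union>i\<in>{3..m}. R (p \<tau> i)) = (\<Union>i\<in>{3..m}. p \<tau> i)" by (rule SUP_cong[OF refl]) (rule keep)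
      also have "\<dots> = (\<Union>i\<in>{2..m - 1}. p \<tau> (Suc i))" by (rule shift)
      also have "\<dots> = (\<Union>i\<in>{2..m - 1}. p \<tau>' i)" by (rule SUP_cong[OF refl]) (simp add: \<tau>'_def p_def)
      finally show ?thesis .
    qed
    have S: "(\<Union>i\<in>{3..m}. R (e \<tau> i)) = (\<Union>i\<in>{2..m - 1}. e \<tau>' i)"
    proof -
      have "(\<Union>i\<in>{3..m}. R (e \<tau> i)) = (\<Union>i\<in>{3..m}. e \<tau> i)" by (rule SUP_cong[OF refl]) (rule keep)
      also have "\<dots> = (\<Union>i\<in>{2..m - 1}. e \<tau> (Suc i))" by (rule shift)
      also have "\<dots> = (\<Union>i\<in>{2..m - 1}. e \<tau>' i)" by (rule SUP_cong[OF refl]) (simp add: \<tau>'_def e_def)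
      finally show ?thesis .
    qed
    have ne: "\<tau> 0 \<noteq> ?q" "\<tau> 1 \<noteq> ?q" "\<tau> 3 \<noteq> ?q"
      using assms(2) eq[of 0 2] eq[of 1 2] eq[of 3 2] by auto
    have small: "R (p \<tau> 0) = p \<tau> 0" "R (p \<tau> 1) = {}" "R (p \<tau> 2) = {}" "R (e \<tau> 1) = e \<tau> 1" "R (e \<tau> 2) = {}"
      "R {(c, s), (s, c)} = {(c, s), (s, c)}"
      using ne q by (auto simp: R_def p_def e_def numeral_eq_Suc)
    have "R (\<Union>i\<le>m. p \<tau> i) = p \<tau> 0 \<union> (\<Union>i\<in>{2..m - 1}. p \<tau>' i)"
      unfolding I(1) UN_Un RUn RU P
      by (simp only: small UN_insert UN_empty Un_empty_right Un_empty_left Un_assoc)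
    moreover have "R (\<Union>i\<in>{1..m}. e \<tau> i) = e \<tau> 1 \<union> (\<Union>i\<in>{2..m - 1}. e \<tau>' i)"
      unfolding I(2) UN_Un RUn RU S
      by (simp only: small UN_insert UN_empty Un_empty_right Un_empty_left Un_assoc)
    ultimately have "R (parcs ?G) = A \<union> (p \<tau> 0 \<union> (\<Union>i\<in>{2..m - 1}. p \<tau>' i)) \<union>
        (e \<tau> 1 \<union> (\<Union>i\<in>{2..m - 1}. e \<tau>' i)) \<union> {(c, s), (s, c)}"
      by (simp only: G RUn RA small)
    moreover have "(\<Union>i\<le>m - 1. p \<tau>' i) = p \<tau> 0 \<union> {(\<tau> 1, \<tau> 3), (\<tau> 3, \<tau> 1)} \<union> (\<Union>i\<in>{2..m - 1}. p \<tau>' i)"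
    proof -
      have "p \<tau>' 0 = p \<tau> 0" "p \<tau>' 1 = {(\<tau> 1, \<tau> 3), (\<tau> 3, \<tau> 1)}" by (simp_all add: p_def \<tau>'_def numeral_eq_Suc)
      then show ?thesis unfolding I'(1) UN_Un by (simp flip: One_nat_def)
    qed
    moreover have "(\<Union>i\<in>{1..m - 1}. e \<tau>' i) = e \<tau> 1 \<union> (\<Union>i\<in>{2..m - 1}. e \<tau>' i)"
    proof -
      have "e \<tau>' 1 = e \<tau> 1" by (simp add: e_def \<tau>'_def)
      then show ?thesis unfolding I'(2) UN_Un by (simp flip: One_nat_def)
    qed
    ultimately have "R (parcs ?G) \<union> {(\<tau> 1, \<tau> 3), (\<tau> 3, \<tau> 1)} = parcs (insert_wheel H x c \<tau>' s (m - 1))"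
      by (simp only: G Un_ac)
    then show ?thesis by (simp only: R_def)
  qed
  ultimately show "d3_step ?G (insert_wheel H x c \<tau>' s (m - 1))" by (simp add: insert_wheel_def)
  have last: "\<tau>' 0 = \<tau> 0" "\<tau>' (m - 1 + 1) = \<tau> (m + 1)" using assms(2) by (auto simp: \<tau>'_def)
  show "wheel_insertion H x c \<tau>' s (m - 1)"
  proof (rule wheel_insertion.intro)
    show "(x, y) \<in> parcs H \<longleftrightarrow> y = \<tau>' 0 \<or> y = \<tau>' (m - 1 + 1) \<or> y = c" for y unfolding last by (rule nbrs)
    show "inj_on \<tau>' {..m - 1 + 1}"
      by (rule inj_onI) (use assms(2) in \<open>auto simp: \<tau>'_def eq split: if_splits\<close>)
    have sub: "\<tau>' ` {1..m - 1} \<subseteq> \<tau> ` {1..m}" by (auto simp: \<tau>'_def)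
    then show "\<tau>' ` {1..m - 1} \<inter> pverts H = {}" "s \<notin> \<tau>' ` {1..m - 1}" using fresh by blast+
    show "c \<noteq> \<tau>' 0" "c \<noteq> \<tau>' (m - 1 + 1)" unfolding last by (rule c)+
    show "2 \<le> m - 1" using assms(2) by simp
  qed (rule H x fresh)+
qed

lemma insert_wheel_2:
  assumes "wheel_insertion H x c \<tau> s 2"
  shows "d3_step (insert_wheel H x c \<tau> s 2) H"
proof -
  interpret wheel_insertion H x c \<tau> s 2 by fact
  let ?G = "insert_wheel H x c \<tau> s 2"
  have n1: "{y. (\<tau> 1, y) \<in> parcs ?G} = {\<tau> 0, \<tau> 2, s}" and n2: "{y. (\<tau> 2, y) \<in> parcs ?G} = {\<tau> 1, \<tau> 3, s}"
    using path_nbrs[of 1] path_nbrs[of 2] by (simp_all add: numeral_eq_Suc)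
  have t: "\<tau> 1 \<notin> pverts H" "\<tau> 2 \<notin> pverts H" "\<tau> 1 \<noteq> s" "\<tau> 2 \<noteq> s" "\<tau> 1 \<noteq> c" "\<tau> 2 \<noteq> c"
    using fresh_path[of 1] fresh_path[of 2] by auto
  have e: "\<tau> 0 \<in> pverts H" "\<tau> 3 \<in> pverts H" "\<tau> 0 \<noteq> x" "\<tau> 3 \<noteq> x" "c \<noteq> \<tau> 3" "c \<noteq> \<tau> 0"
    using ends c by (simp_all add: numeral_eq_Suc)
  have d: "\<tau> 0 \<noteq> \<tau> 3" "\<tau> 1 \<noteq> \<tau> 2" "\<tau> 0 \<noteq> \<tau> 1" "\<tau> 0 \<noteq> \<tau> 2" "\<tau> 3 \<noteq> \<tau> 1" "\<tau> 3 \<noteq> \<tau> 2" by (simp_all add: eq)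
  have U: "{..2} = {0, 1, 2::nat}" "{1..2} = {1, 2 :: nat}" by auto
  have arcs: "parcs ?G = {a \<in> parcs H. fst a \<noteq> x \<and> snd a \<noteq> x} \<union>
      {(\<tau> 0, \<tau> 1), (\<tau> 1, \<tau> 0), (\<tau> 1, \<tau> 2), (\<tau> 2, \<tau> 1), (\<tau> 2, \<tau> 3), (\<tau> 3, \<tau> 2)} \<union>
      {(\<tau> 1, s), (s, \<tau> 1), (\<tau> 2, s), (s, \<tau> 2), (c, s), (s, c)}"
    unfolding insert_wheel_def U by (simp add: numeral_eq_Suc insert_commute)
  have PV: "pverts ?G = (pverts H - {x}) \<union> {\<tau> 1, \<tau> 2} \<union> {s}"
    unfolding insert_wheel_def U by simp
  have nH: "(s, y) \<notin> parcs H" for y using fresh(2) pair_graphD(1)[OF H] by blast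
  have n3: "{y. (s, y) \<in> parcs ?G} = {\<tau> 1, \<tau> 2, c}"
    unfolding arcs using nH t e fresh(2) ends(3) by auto
  have "d3_step ?G \<lparr> pverts = insert x (pverts ?G - {\<tau> 1, \<tau> 2, s}),
       parcs = {a \<in> parcs ?G. fst a \<notin> {\<tau> 1, \<tau> 2, s} \<and> snd a \<notin> {\<tau> 1, \<tau> 2, s}} \<union>
               {(x, \<tau> 0), (\<tau> 0, x), (x, \<tau> 3), (\<tau> 3, x), (x, c), (c, x)} \<rparr>"
  proof (rule D3a)
    show "{\<tau> 1, \<tau> 2, s} \<subseteq> pverts ?G" by (auto simp: insert_wheel_def)
    have "out_degree (with_proj ?G) s = 3" unfolding out_degree_eq n3 using d t by simp
    then show "\<forall>y\<in>{\<tau> 1, \<tau> 2, s}. out_degree (with_proj ?G) y = 3" using path_degree[of 1] path_degree[of 2] by auto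
    show "distinct [\<tau> 1, \<tau> 2, s]" "distinct [\<tau> 0, \<tau> 3, c]" using d t e by auto
    show "{(\<tau> 1, \<tau> 2), (\<tau> 2, s), (\<tau> 1, s)} \<subseteq> parcs ?G" "{(\<tau> 1, \<tau> 0), (\<tau> 2, \<tau> 3), (s, c)} \<subseteq> parcs ?G"
      unfolding arcs by auto
    show "{\<tau> 0, \<tau> 3, c} \<inter> {\<tau> 1, \<tau> 2, s} = {}" using d t e fresh(2) ends(3) by auto
    show "x \<notin> pverts ?G" unfolding PV using x t fresh(2) by auto
  qed
  moreover have "insert x (pverts ?G - {\<tau> 1, \<tau> 2, s}) = pverts H"
    unfolding PV using x t fresh(2) by auto
  moreover have "{a \<in> parcs ?G. fst a \<notin> {\<tau> 1, \<tau> 2, s} \<and> snd a \<notin> {\<tau> 1, \<tau> 2, s}} =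
      {a \<in> parcs H. fst a \<noteq> x \<and> snd a \<noteq> x}"
  proof -
    have "fst a \<notin> {\<tau> 1, \<tau> 2, s} \<and> snd a \<notin> {\<tau> 1, \<tau> 2, s}" if "a \<in> parcs H" for a
      using pair_graphD(1,2)[OF H, of "fst a" "snd a"] that t fresh(2) by auto
    then show ?thesis unfolding arcs by auto
  qed
  moreover have "{a \<in> parcs H. fst a \<noteq> x \<and> snd a \<noteq> x} \<union>
      {(x, \<tau> 0), (\<tau> 0, x), (x, \<tau> 3), (\<tau> 3, x), (x, c), (c, x)} = parcs H" (is "?L \<union> ?M = _")
  proof
    have "(x, \<tau> 0) \<in> parcs H" "(x, \<tau> 3) \<in> parcs H" "(x, c) \<in> parcs H"
      using nbrs by (simp_all add: numeral_eq_Suc)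
    then show "?L \<union> ?M \<subseteq> parcs H" using pair_graphD(4)[OF H] by auto
    show "parcs H \<subseteq> ?L \<union> ?M"
    proof
      fix a assume a: "a \<in> parcs H"
      obtain u v where uv: "a = (u, v)" by (cases a)
      have "v = \<tau> 0 \<or> v = \<tau> 3 \<or> v = c" if "u = x"
        using a nbrs[of v] unfolding uv that by (simp add: numeral_eq_Suc)
      moreover have "u = \<tau> 0 \<or> u = \<tau> 3 \<or> u = c" if "v = x"
        using pair_graphD(4)[OF H, of u v] a nbrs[of u] unfolding uv that by (simp add: numeral_eq_Suc)
      ultimately show "a \<in> ?L \<union> ?M" using a unfolding uv by auto
    qed
  qed
  moreover have "\<lparr> pverts = pverts H, parcs = parcs H \<rparr> = H" by (cases H) simp
  ultimately show ?thesis by (simp only:)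
qed

lemma insert_wheel_reduces:
  assumes "wheel_insertion H x c \<tau> s m"
  shows "d3_step\<^sup>*\<^sup>* (insert_wheel H x c \<tau> s m) H"
  using assms
proof (induction m arbitrary: \<tau>)
  case 0
  then show ?case using wheel_insertion.m by fastforce
next
  case (Suc m)
  show ?case
  proof (cases "3 \<le> Suc m")
    case True
    from insert_wheel_shorten[OF Suc.prems True] Suc.IH show ?thesis
      by (metis converse_rtranclp_into_rtranclp diff_Suc_1)
  next
    case False
    then have "Suc m = 2" using wheel_insertion.m[OF Suc.prems] by simp
    then show ?thesis using insert_wheel_2 Suc.prems by (metis r_into_rtranclp)
  qed
qed

section \<open>Trees of wheels\<close>

lemma faces_disjoint:
  assumes "rotation_system G \<sigma>" "pair_graph G" "F \<in> faces G \<sigma>" "a \<in> parcs G"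
  shows "face_of \<sigma> a = F \<longleftrightarrow> a \<in> F"
  using assms faces_eq_face_of(1)[OF assms(1-3)] face_of_cyclic(2)[OF assms(1,2,4)] by blast

lemma pair_graph_dual_graph:
  assumes "pair_graph G" "dual_simple G \<sigma>"
  shows "pair_graph (dual_graph G \<sigma>)"
  unfolding pair_graph_iff
proof (intro conjI allI impI)
  show "finite (pverts (dual_graph G \<sigma>))" using finite_faces[OF assms(1)] by simp
  fix p q assume "(p, q) \<in> parcs (dual_graph G \<sigma>)"
  then obtain a where a: "a \<in> parcs G" "p = face_of \<sigma> a" "q = face_of \<sigma> (prod.swap a)"
    by (auto simp: parcs_dual_graph)
  note sa = swap_parcs[OF assms(1) a(1)]
  show "p \<in> pverts (dual_graph G \<sigma>)" "q \<in> pverts (dual_graph G \<sigma>)"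
    using a sa by (auto simp: faces_def)
  show "p \<noteq> q" using assms(2) a by (simp add: dual_simple_def)
  show "(q, p) \<in> parcs (dual_graph G \<sigma>)"
    unfolding parcs_dual_graph by (rule image_eqI[OF _ sa]) (simp add: a)
qed

lemma dual_simpleD:
  assumes "dual_simple G \<sigma>" "a \<in> parcs G" "b \<in> parcs G" "face_of \<sigma> a = face_of \<sigma> b"
    "face_of \<sigma> (prod.swap a) = face_of \<sigma> (prod.swap b)"
  shows "a = b"
  using assms unfolding dual_simple_def by (auto dest: inj_onD)

text \<open>The outcome of \<open>planar_embedding_gunion\<close>, kept as a context.
  \<open>S1\<close> and \<open>S2\<close> will be the two orientations of the triangle, each of them
  a face of one side that the union loses.\<close>

locale glued_embedding =
  fixes G1 G2 :: "'a pair_pre_digraph" and \<sigma>1 \<sigma>2 \<sigma> and u v w :: 'a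
  assumes g1: "pair_graph G1" and g2: "pair_graph G2"
    and e1: "planar_embedding G1 \<sigma>1" and e2: "planar_embedding G2 \<sigma>2"
    and V: "pverts G1 \<inter> pverts G2 = {u, v, w}"
    and T1: "{(u, v), (v, w), (w, u)} \<in> faces G1 \<sigma>1"
    and T2: "{(v, u), (w, v), (u, w)} \<in> faces G2 \<sigma>2"
    and e: "planar_embedding (gunion G1 G2) \<sigma>"
    and f1: "\<And>a. a \<in> parcs G1 - {(u, v), (v, w), (w, u)} \<Longrightarrow> face_of \<sigma> a = face_of \<sigma>1 a"
    and f2: "\<And>a. a \<in> parcs G2 - {(v, u), (w, v), (u, w)} \<Longrightarrow> face_of \<sigma> a = face_of \<sigma>2 a"
    and F: "faces (gunion G1 G2) \<sigma> =
      (faces G1 \<sigma>1 - {{(u, v), (v, w), (w, u)}}) \<union> (faces G2 \<sigma>2 - {{(v, u), (w, v), (u, w)}})"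
begin

definition "S1 = {(u, v), (v, w), (w, u)}"
definition "S2 = {(v, u), (w, v), (u, w)}"

lemmas tri1 = T1[folded S1_def] and tri2 = T2[folded S2_def]
  and fc1 = f1[folded S1_def] and fc2 = f2[folded S2_def] and fcs = F[folded S1_def S2_def]

lemmas r1 = planar_embeddingD(1)[OF e1] and r2 = planar_embeddingD(1)[OF e2]

lemma S1_G1: "S1 \<subseteq> parcs G1" and S2_G2: "S2 \<subseteq> parcs G2"
  using faces_eq_face_of(3)[OF r1 g1 tri1] faces_eq_face_of(3)[OF r2 g2 tri2] by blast+

lemma swap_S1: "prod.swap a \<in> S1 \<longleftrightarrow> a \<in> S2" and swap_S2: "prod.swap a \<in> S2 \<longleftrightarrow> a \<in> S1"
  unfolding S1_def S2_def by (cases a; auto)+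

lemma S2_G1: "S2 \<subseteq> parcs G1" and S1_G2: "S1 \<subseteq> parcs G2"
  using S1_G1 S2_G2 pair_graphD(4)[OF g1] pair_graphD(4)[OF g2] unfolding S1_def S2_def by auto

lemma S_disjoint: "S1 \<inter> S2 = {}"
proof -
  have "u \<noteq> v" "v \<noteq> w" "w \<noteq> u" using S1_G1 pair_graphD(3)[OF g1] unfolding S1_def by auto
  then show ?thesis unfolding S1_def S2_def by auto
qed

lemma common_arcs: "a \<in> parcs G1 \<Longrightarrow> a \<in> parcs G2 \<Longrightarrow> a \<in> S1 \<or> a \<in> S2"
proof -
  assume a: "a \<in> parcs G1" "a \<in> parcs G2"
  then have "fst a \<in> {u, v, w}" "snd a \<in> {u, v, w}" "fst a \<noteq> snd a"
    using pair_graphD[OF g1, of "fst a" "snd a"] pair_graphD[OF g2, of "fst a" "snd a"] V by auto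
  then show ?thesis unfolding S1_def S2_def by (auto simp: prod_eq_iff)
qed

text \<open>The arcs of the union fall into two halves: of the triangle, \<open>S2\<close> stays
  with \<open>G1\<close> and \<open>S1\<close> with \<open>G2\<close>.\<close>

lemma side: "a \<in> parcs G1 \<union> parcs G2 \<Longrightarrow> a \<notin> parcs G1 - S1 \<longleftrightarrow> a \<in> parcs G2 - S2"
  using common_arcs[of a] S1_G2 S2_G1 S_disjoint by blast

lemma face_1:
  assumes "a \<in> parcs G1 - S1" shows "face_of \<sigma> a \<in> faces G1 \<sigma>1" "face_of \<sigma> a \<subseteq> parcs G1 - S1"
proof -
  have a: "face_of \<sigma> a = face_of \<sigma>1 a" "a \<in> parcs G1" using fc1[OF assms] assms by auto
  then show "face_of \<sigma> a \<in> faces G1 \<sigma>1" by (simp add: faces_def)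
  have "b \<notin> S1" if "b \<in> face_of \<sigma>1 a" for b
  proof
    assume b: "b \<in> S1"
    have "b \<in> parcs G1" using b S1_G1 by blast
    then have "face_of \<sigma>1 a = face_of \<sigma>1 b" using face_of_eq_iff[OF r1 g1 a(2)] that by blast
    then have "face_of \<sigma>1 a = S1" using faces_eq_face_of(1)[OF r1 g1 tri1 b] by (rule trans)
    then show False using face_of_cyclic(2)[OF r1 g1 a(2)] assms by blast
  qed
  then show "face_of \<sigma> a \<subseteq> parcs G1 - S1" using face_of_cyclic(3)[OF r1 g1 a(2)] a(1) by blast
qed

lemma face_2:
  assumes "a \<in> parcs G2 - S2" shows "face_of \<sigma> a \<in> faces G2 \<sigma>2" "face_of \<sigma> a \<subseteq> parcs G2 - S2"
proof -
  have a: "face_of \<sigma> a = face_of \<sigma>2 a" "a \<in> parcs G2" using fc2[OF assms] assms by auto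
  then show "face_of \<sigma> a \<in> faces G2 \<sigma>2" by (simp add: faces_def)
  have "b \<notin> S2" if "b \<in> face_of \<sigma>2 a" for b
  proof
    assume b: "b \<in> S2"
    have "b \<in> parcs G2" using b S2_G2 by blast
    then have "face_of \<sigma>2 a = face_of \<sigma>2 b" using face_of_eq_iff[OF r2 g2 a(2)] that by blast
    then have "face_of \<sigma>2 a = S2" using faces_eq_face_of(1)[OF r2 g2 tri2 b] by (rule trans)
    then show False using face_of_cyclic(2)[OF r2 g2 a(2)] assms by blast
  qed
  then show "face_of \<sigma> a \<subseteq> parcs G2 - S2" using face_of_cyclic(3)[OF r2 g2 a(2)] a(1) by blast
qed

lemma face_sides_differ:
  assumes "a \<in> parcs G1 - S1" "b \<in> parcs G2 - S2" shows "face_of \<sigma> a \<noteq> face_of \<sigma> b"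
proof
  assume eq: "face_of \<sigma> a = face_of \<sigma> b"
  have "a \<in> face_of \<sigma> a" using assms(1) fc1[OF assms(1)] face_of_cyclic(2)[OF r1 g1] by auto
  then have "a \<in> parcs G1 - S1" "a \<in> parcs G2 - S2"
    using face_1(2)[OF assms(1)] face_2(2)[OF assms(2)] eq by auto
  then show False using common_arcs[of a] by blast
qed

text \<open>The reverses of the arcs in \<open>S2\<close> all bound the face \<open>S1\<close>, so
  two of them with the same face beyond would be parallel in the dual of \<open>G1\<close>.\<close>

lemma S1_dual_inj:
  assumes "dual_simple G1 \<sigma>1" "a \<in> S2" "b \<in> S2" "face_of \<sigma>1 a = face_of \<sigma>1 b" shows "a = b"
proof -
  have s: "prod.swap a \<in> S1" "prod.swap b \<in> S1" using assms(2,3) swap_S1 by blast+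
  have "face_of \<sigma>1 (prod.swap a) = S1" "face_of \<sigma>1 (prod.swap b) = S1"
    using faces_eq_face_of(1)[OF r1 g1 tri1] s by blast+
  moreover have "prod.swap a \<in> parcs G1" "prod.swap b \<in> parcs G1" using s S1_G1 by blast+
  ultimately have "prod.swap a = prod.swap b"
    using dual_simpleD[OF assms(1), of "prod.swap a" "prod.swap b"] assms(4) by simp
  then show ?thesis by (metis swap_swap)
qed

text \<open>An edge has both faces from one side, where simplicity is inherited, or one face from
  each. The latter are the three edges of the triangle, and their faces in \<open>G1\<close> alone
  tell them apart by \<open>S1_dual_inj\<close>.\<close>

lemma dual_simple_glued:
  assumes d1: "dual_simple G1 \<sigma>1" and d2: "dual_simple G2 \<sigma>2"
  shows "dual_simple (gunion G1 G2) \<sigma>"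
proof -
  let ?E = "parcs G1 \<union> parcs G2" and ?L = "face_of \<sigma>"
  have sw: "prod.swap a \<in> ?E" if "a \<in> ?E" for a
    using that swap_parcs[OF g1] swap_parcs[OF g2] by blast
  have mixed: "prod.swap a \<in> S1 \<and> a \<in> S2" if "a \<in> parcs G1 - S1" "prod.swap a \<in> parcs G2 - S2" for a
  proof -
    have "prod.swap a \<in> parcs G1" using that(1) swap_parcs[OF g1] by blast
    then have "prod.swap a \<in> S1" using that(2) common_arcs[of "prod.swap a"] by blast
    then show ?thesis using swap_S1 by blast
  qed
  have same: "a \<in> parcs G1 - S1 \<longleftrightarrow> b \<in> parcs G1 - S1" if "a \<in> ?E" "b \<in> ?E" "?L a = ?L b" for a b
  proof (rule ccontr)
    assume "\<not> ?thesis"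
    then have "a \<in> parcs G1 - S1 \<and> b \<in> parcs G2 - S2 \<or> b \<in> parcs G1 - S1 \<and> a \<in> parcs G2 - S2"
      unfolding side[OF that(1), symmetric] side[OF that(2), symmetric] by argo
    then show False using that(3) face_sides_differ[of a b] face_sides_differ[of b a] by argo
  qed
  have mix: "a = b" if ab: "a \<in> parcs G1 - S1" "prod.swap a \<in> parcs G2 - S2"
    "b \<in> parcs G1 - S1" "prod.swap b \<in> parcs G2 - S2" "?L a = ?L b" for a b
  proof (rule S1_dual_inj[OF d1])
    show "a \<in> S2" "b \<in> S2" using mixed ab by blast+
    show "face_of \<sigma>1 a = face_of \<sigma>1 b" using fc1 ab by metis
  qed
  have "inj_on (\<lambda>a. (?L a, ?L (prod.swap a))) ?E"
  proof (rule inj_onI)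
    fix a b assume ab: "a \<in> ?E" "b \<in> ?E" "(?L a, ?L (prod.swap a)) = (?L b, ?L (prod.swap b))"
    let ?a = "prod.swap a" and ?b = "prod.swap b"
    note sa = sw[OF ab(1)] sw[OF ab(2)]
    have L: "?L a = ?L b" "?L ?a = ?L ?b" using ab(3) by simp_all
    note iff = same[OF ab(1,2) L(1)] same[OF sa L(2)]
    consider "a \<in> parcs G1 - S1" "?a \<in> parcs G1 - S1" | "a \<in> parcs G1 - S1" "?a \<in> parcs G2 - S2"
      | "a \<in> parcs G2 - S2" "?a \<in> parcs G1 - S1" | "a \<in> parcs G2 - S2" "?a \<in> parcs G2 - S2"
      using side[OF ab(1)] side[OF sa(1)] by blast
    then show "a = b"
    proof cases
      case 1
      then have "b \<in> parcs G1 - S1" "?b \<in> parcs G1 - S1" using iff by blast+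
      note b = this
      show ?thesis
      proof (rule dual_simpleD[OF d1])
        show "a \<in> parcs G1" "b \<in> parcs G1" using 1 b by blast+
        show "face_of \<sigma>1 a = face_of \<sigma>1 b" "face_of \<sigma>1 ?a = face_of \<sigma>1 ?b"
          using L fc1[OF 1(1)] fc1[OF 1(2)] fc1[OF b(1)] fc1[OF b(2)] by simp_all
      qed
    next
      case 2
      then have "b \<in> parcs G1 - S1" "?b \<in> parcs G2 - S2" using iff side[OF sa(1)] side[OF sa(2)] by blast+
      then show ?thesis using mix[of a b] 2 L by blast
    next
      case 3
      then have "b \<in> parcs G2 - S2" "?b \<in> parcs G1 - S1" using iff side[OF ab(1)] side[OF ab(2)] by blast+
      then have "?a = ?b" using mix[of ?a ?b] 3 L by simp
      then show ?thesis by (metis swap_swap)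
    next
      case 4
      then have "b \<in> parcs G2 - S2" "?b \<in> parcs G2 - S2"
        using iff side[OF ab(1)] side[OF ab(2)] side[OF sa(1)] side[OF sa(2)] by blast+
      note b = this
      show ?thesis
      proof (rule dual_simpleD[OF d2])
        show "a \<in> parcs G2" "b \<in> parcs G2" using 4 b by blast+
        show "face_of \<sigma>2 a = face_of \<sigma>2 b" "face_of \<sigma>2 ?a = face_of \<sigma>2 ?b"
          using L fc2[OF 4(1)] fc2[OF 4(2)] fc2[OF b(1)] fc2[OF b(2)] by simp_all
      qed
    qed
  qed
  moreover have "?L a \<noteq> ?L (prod.swap a)" if a: "a \<in> ?E" for a
  proof
    assume L: "?L a = ?L (prod.swap a)"
    note iff = same[OF a sw[OF a] L]
    show False
    proof (cases "a \<in> parcs G1 - S1")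
      case True
      then have "face_of \<sigma>1 a = face_of \<sigma>1 (prod.swap a)" using iff L fc1 by metis
      then show False using True d1 by (auto simp: dual_simple_def)
    next
      case False
      then have "a \<in> parcs G2 - S2" "prod.swap a \<in> parcs G2 - S2"
        using iff side[OF a] side[OF sw[OF a]] by blast+
      then have "face_of \<sigma>2 a = face_of \<sigma>2 (prod.swap a)" using L fc2 by metis
      then show False using \<open>a \<in> parcs G2 - S2\<close> d2 by (auto simp: dual_simple_def)
    qed
  qed
  ultimately show ?thesis by (simp add: dual_simple_def)
qed

end

text \<open>The wheel is numbered so that the triangle of the gluing consists of the hub and the
  closing rim edge; the other \<open>m\<close> triangles at the hub then have consecutive
  numbers.\<close>

locale glued_wheel = glued_embedding G W \<sigma>1 \<sigma>2 \<sigma> u v w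
  for G W :: "'a pair_pre_digraph" and \<sigma>1 \<sigma>2 \<sigma> u v w +
  fixes n :: nat and k :: "nat \<Rightarrow> 'a"
  assumes W: "wheel_at n k W"
    and tri: "\<And>i a. i < n \<Longrightarrow> a \<in> wheel_tri k n i \<Longrightarrow> face_of \<sigma>2 a = wheel_tri k n i"
    and rim: "\<And>a. a \<in> wheel_rim k n \<Longrightarrow> face_of \<sigma>2 a = wheel_rim k n"
    and S2: "{(v, u), (w, v), (u, w)} = {(k n, k (n - 1)), (k (n - 1), k 0), (k 0, k n)}"
    and d1: "dual_simple G \<sigma>1"
begin

abbreviation "m \<equiv> n - 1"

lemmas S2e = S2[folded S2_def]

lemma n: "3 \<le> n" and k: "inj_on k {..n}"
  using W by (auto simp: wheel_at_def)

lemma keq: "i \<le> n \<Longrightarrow> j \<le> n \<Longrightarrow> k i = k j \<longleftrightarrow> i = j"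
  using k by (auto simp: inj_on_eq_iff)

lemma S2_tri: "S2 = wheel_tri k n m"
proof -
  have "cnext n m = 0" using n by (simp add: cnext_if)
  then show ?thesis unfolding S2e wheel_tri_def by simp
qed

lemma S2_mem: "(k n, k m) \<in> S2" "(k m, k 0) \<in> S2" "(k 0, k n) \<in> S2"
  unfolding S2e by simp_all

lemma common_verts: "pverts G \<inter> pverts W = {k n, k m, k 0}"
proof -
  have "fst ` S2 = {u, v, w}" unfolding S2_def by auto
  moreover have "fst ` S2 = {k n, k m, k 0}" unfolding S2e by simp
  ultimately show ?thesis using V by simp
qed

lemma tri_face: "i < m \<Longrightarrow> a \<in> wheel_tri k n i \<Longrightarrow> a \<in> parcs W \<Longrightarrow> face_of \<sigma> a = wheel_tri k n i"
proof -
  assume i: "i < m" and a: "a \<in> wheel_tri k n i" "a \<in> parcs W"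
  have ta: "face_of \<sigma>2 a = wheel_tri k n i" using tri[OF _ a(1)] i by simp
  have "a \<notin> S2"
  proof
    assume "a \<in> S2"
    then have "face_of \<sigma>2 a = wheel_tri k n m" using tri[of m a] n unfolding S2_tri by simp
    then show False using ta wheel_tri_inj[OF k, of i m] i n by simp
  qed
  then show ?thesis using fc2[of a] a(2) ta by simp
qed

lemma rim_face: "a \<in> wheel_rim k n \<Longrightarrow> a \<in> parcs W \<Longrightarrow> face_of \<sigma> a = wheel_rim k n"
proof -
  assume a: "a \<in> wheel_rim k n" "a \<in> parcs W"
  have "a \<notin> S2"
  proof
    assume "a \<in> S2"
    then have "face_of \<sigma>2 a = wheel_tri k n m" using tri[of m a] n unfolding S2_tri by simp
    then show False using rim[OF a(1)] wheel_tri_not_rim[OF k, of m] n by simp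
  qed
  then show ?thesis using fc2[of a] a(2) rim[OF a(1)] by simp
qed

text \<open>The faces met in turning around the hub: the face of \<open>G\<close> beyond one spoke
  of the lost triangle, the remaining \<open>m\<close> triangles of the wheel, and the face of
  \<open>G\<close> beyond the other spoke. In the dual this is the path that replaces
  \<open>S1\<close>.\<close>

definition \<tau> :: "nat \<Rightarrow> ('a \<times> 'a) set" where
  "\<tau> i = (if i = 0 then face_of \<sigma>1 (k 0, k n) else if i \<le> m then wheel_tri k n (i - 1)
     else face_of \<sigma>1 (k n, k m))"

lemma W_arcs:
  assumes "i < n"
  shows "(k i, k n) \<in> parcs W" "(k n, k i) \<in> parcs W" "(k i, k (cnext n i)) \<in> parcs W" "(k (cnext n i), k i) \<in> parcs W"
  unfolding wheel_at_parcs[OF W] using assms by blast+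

lemma S2_face: "a \<in> S2 \<Longrightarrow> face_of \<sigma> a = face_of \<sigma>1 a"
  using fc1[of a] S2_G1 S_disjoint by blast

lemma spoke_faces:
  assumes i: "i < n"
  shows "face_of \<sigma> (k n, k i) = \<tau> (i + 1)" "face_of \<sigma> (k i, k n) = \<tau> i"
proof -
  show "face_of \<sigma> (k n, k i) = \<tau> (i + 1)"
  proof (cases "i = m")
    case True
    then show ?thesis using S2_face[OF S2_mem(1)] by (simp add: \<tau>_def)
  next
    case False
    then have "i < m" using i by simp
    then show ?thesis
      using tri_face[OF _ wheel_at_arcs_in_faces(1)[OF i] W_arcs(2)[OF i]] by (simp add: \<tau>_def)
  qed
  show "face_of \<sigma> (k i, k n) = \<tau> i"
  proof (cases "i = 0")
    case True
    then show ?thesis using S2_face[OF S2_mem(3)] by (simp add: \<tau>_def)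
  next
    case False
    then have "cprev n i < m" "i \<le> m" using i by (simp_all add: cprev_def)
    then show ?thesis
      using tri_face[OF _ wheel_at_arcs_in_faces(4)[OF i] W_arcs(1)[OF i]] False
      by (simp add: \<tau>_def cprev_def)
  qed
qed

lemma rim_faces:
  assumes i: "i < m"
  shows "face_of \<sigma> (k i, k (i + 1)) = \<tau> (i + 1)" "face_of \<sigma> (k (i + 1), k i) = wheel_rim k n"
proof -
  have i': "i < n" "cnext n i = i + 1" using i by (simp_all add: cnext_if)
  show "face_of \<sigma> (k i, k (i + 1)) = \<tau> (i + 1)"
    using tri_face[OF i wheel_at_arcs_in_faces(2)[OF i'(1)] W_arcs(3)[OF i'(1)]] i
    unfolding i'(2) by (simp add: \<tau>_def)
  show "face_of \<sigma> (k (i + 1), k i) = wheel_rim k n"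
    using rim_face[OF wheel_at_arcs_in_faces(5)[OF i'(1)] W_arcs(4)[OF i'(1)]] unfolding i'(2) .
qed

lemma last_faces: "face_of \<sigma> (k m, k 0) = face_of \<sigma>1 (k m, k 0)" "face_of \<sigma> (k 0, k m) = wheel_rim k n"
proof -
  have m: "m < n" "cnext n m = 0" using n by (simp_all add: cnext_if)
  show "face_of \<sigma> (k m, k 0) = face_of \<sigma>1 (k m, k 0)" using S2_face[OF S2_mem(2)] .
  show "face_of \<sigma> (k 0, k m) = wheel_rim k n"
    using rim_face[OF wheel_at_arcs_in_faces(5)[OF m(1)] W_arcs(4)[OF m(1)]] unfolding m(2) .
qed

lemma W_parcs_path:
  "parcs W = (\<Union>i<m. {(k i, k (i + 1)), (k (i + 1), k i)}) \<union> (\<Union>i\<le>m. {(k i, k n), (k n, k i)}) \<union>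
    {(k m, k 0), (k 0, k m)}"
proof -
  have "{..<n} = {..m}" using n by auto
  moreover have "parcs W = map_prod k k ` parcs (wheel_graph n)" using W by (simp add: wheel_at_def)
  ultimately show ?thesis unfolding wheel_graph_parcs_path[OF n] by (simp add: image_Un image_UN)
qed

text \<open>Each dual edge is found from the edge it crosses: spokes give the edges of the path
  \<open>\<tau>\<close>, rim edges join the path to the rim face, and the closing rim edge joins the
  rim face to the face of \<open>G\<close> beyond it. The other edges of \<open>G\<close> keep their
  dual edges.\<close>

lemma dual_glued: "dual_graph (gunion G W) \<sigma> =
    insert_wheel (dual_graph G \<sigma>1) S1 (face_of \<sigma>1 (k m, k 0)) \<tau> (wheel_rim k n) m"
proof -
  let ?d = "\<lambda>a. (face_of \<sigma> a, face_of \<sigma> (prod.swap a))" and ?H = "dual_graph G \<sigma>1"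
  let ?s = "wheel_rim k n" and ?c = "face_of \<sigma>1 (k m, k 0)"
  have face1: "face_of \<sigma>1 a = S1 \<longleftrightarrow> a \<in> S1" if "a \<in> parcs G" for a
    using faces_disjoint[OF r1 g1 tri1 that] .
  define E' where "E' = {a \<in> parcs G. a \<notin> S1 \<and> a \<notin> S2}"
  have E: "parcs (gunion G W) = E' \<union> parcs W"
    using S1_G2 S2_G2 by (auto simp: E'_def)
  have d': "?d a = (face_of \<sigma>1 a, face_of \<sigma>1 (prod.swap a))" if "a \<in> E'" for a
  proof -
    have "a \<in> parcs G - S1" "prod.swap a \<in> parcs G - S1"
      using that swap_parcs[OF g1, of a] swap_S1[of a] by (auto simp: E'_def)
    then show ?thesis using fc1 by simp
  qed
  have "?d ` E' = {a \<in> parcs ?H. fst a \<noteq> S1 \<and> snd a \<noteq> S1}"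
  proof
    show "?d ` E' \<subseteq> {a \<in> parcs ?H. fst a \<noteq> S1 \<and> snd a \<noteq> S1}"
    proof
      fix b assume "b \<in> ?d ` E'"
      then obtain a where a: "a \<in> E'" "b = ?d a" by blast
      then have "a \<in> parcs G" "a \<notin> S1" "prod.swap a \<notin> S1" "prod.swap a \<in> parcs G"
        using swap_S1[of a] swap_parcs[OF g1, of a] by (auto simp: E'_def)
      then show "b \<in> {a \<in> parcs ?H. fst a \<noteq> S1 \<and> snd a \<noteq> S1}"
        unfolding a(2) d'[OF a(1)] using face1 by (simp add: parcs_dual_graph)
    qed
    show "{a \<in> parcs ?H. fst a \<noteq> S1 \<and> snd a \<noteq> S1} \<subseteq> ?d ` E'"
    proof
      fix b assume "b \<in> {a \<in> parcs ?H. fst a \<noteq> S1 \<and> snd a \<noteq> S1}"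
      then have b: "b \<in> parcs ?H" "fst b \<noteq> S1" "snd b \<noteq> S1" by simp_all
      obtain a where a: "b = (face_of \<sigma>1 a, face_of \<sigma>1 (prod.swap a))" "a \<in> parcs G"
        using b(1) unfolding parcs_dual_graph by (rule imageE)
      have aE: "a \<in> E'"
        using face1[OF a(2)] face1[OF swap_parcs[OF g1 a(2)]] swap_S1[of a] a b(2,3) by (simp add: E'_def)
      have "b = ?d a" using d'[OF aE] a(1) by simp
      then show "b \<in> ?d ` E'" by (rule image_eqI[OF _ aE])
    qed
  qed
  moreover have "?d ` parcs W = (\<Union>i\<le>m. {(\<tau> i, \<tau> (i + 1)), (\<tau> (i + 1), \<tau> i)}) \<union>
      (\<Union>i\<in>{1..m}. {(\<tau> i, ?s), (?s, \<tau> i)}) \<union> {(?c, ?s), (?s, ?c)}"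
  proof -
    have "?d ` (\<Union>i<m. {(k i, k (i + 1)), (k (i + 1), k i)}) = (\<Union>i<m. {(\<tau> (i + 1), ?s), (?s, \<tau> (i + 1))})"
      unfolding image_UN by (rule SUP_cong[OF refl]) (simp only: image_insert image_empty prod.swap_def
        fst_conv snd_conv rim_faces lessThan_iff)
    also have "\<dots> = (\<Union>i\<in>{1..m}. {(\<tau> i, ?s), (?s, \<tau> i)})"
    proof -
      have "{1..m} = Suc ` {..<m}" by (simp add: image_Suc_lessThan)
      then show ?thesis by (simp only: UN_simps Suc_eq_plus1)
    qed
    finally have 1: "?d ` (\<Union>i<m. {(k i, k (i + 1)), (k (i + 1), k i)}) = (\<Union>i\<in>{1..m}. {(\<tau> i, ?s), (?s, \<tau> i)})" .
    have 2: "?d ` (\<Union>i\<le>m. {(k i, k n), (k n, k i)}) = (\<Union>i\<le>m. {(\<tau> i, \<tau> (i + 1)), (\<tau> (i + 1), \<tau> i)})"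
      unfolding image_UN
    proof (rule SUP_cong[OF refl])
      fix i assume "i \<in> {..m}"
      then have "i < n" using n by simp
      then show "?d ` {(k i, k n), (k n, k i)} = {(\<tau> i, \<tau> (i + 1)), (\<tau> (i + 1), \<tau> i)}"
        by (simp only: image_insert image_empty prod.swap_def fst_conv snd_conv spoke_faces)
    qed
    have 3: "?d ` {(k m, k 0), (k 0, k m)} = {(?c, ?s), (?s, ?c)}"
      by (simp only: image_insert image_empty prod.swap_def fst_conv snd_conv last_faces)
    show ?thesis unfolding W_parcs_path image_Un 1 2 3 by (simp only: Un_ac)
  qed
  ultimately have "parcs (dual_graph (gunion G W) \<sigma>) =
      {a \<in> parcs ?H. fst a \<noteq> S1 \<and> snd a \<noteq> S1} \<union> (\<Union>i\<le>m. {(\<tau> i, \<tau> (i + 1)), (\<tau> (i + 1), \<tau> i)}) \<union>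
      (\<Union>i\<in>{1..m}. {(\<tau> i, ?s), (?s, \<tau> i)}) \<union> {(?c, ?s), (?s, ?c)}"
    unfolding parcs_dual_graph[of "gunion G W"] E image_Un by (simp only: Un_ac)
  moreover have "faces (gunion G W) \<sigma> = (faces G \<sigma>1 - {S1}) \<union> \<tau> ` {1..m} \<union> {?s}"
  proof -
    have "{..<n} = insert m {..<m}" using n by auto
    moreover have "faces W \<sigma>2 = wheel_tri k n ` {..<n} \<union> {?s}"
      by (rule wheel_at_faces[OF W]) (simp_all add: tri rim)
    ultimately have "faces W \<sigma>2 = insert S2 (wheel_tri k n ` {..<m} \<union> {?s})"
      unfolding S2_tri by (simp add: insert_commute)
    moreover have "S2 \<notin> wheel_tri k n ` {..<m} \<union> {?s}"
    proof
      assume "S2 \<in> wheel_tri k n ` {..<m} \<union> {?s}"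
      then consider i where "i < m" "wheel_tri k n m = wheel_tri k n i" | "wheel_tri k n m = ?s"
        unfolding S2_tri by auto
      then show False
      proof cases
        case 1
        moreover from 1 have "m < n" "i < n" by simp_all
        ultimately show ?thesis using wheel_tri_inj[OF k, of m i] by simp
      next
        case 2
        then show ?thesis using wheel_tri_not_rim[OF k, of m] n by simp
      qed
    qed
    ultimately have "faces W \<sigma>2 - {S2} = wheel_tri k n ` {..<m} \<union> {?s}" by simp
    moreover have "\<tau> ` {1..m} = wheel_tri k n ` {..<m}"
    proof -
      have "{1..m} = Suc ` {..<m}" by (simp add: image_Suc_lessThan)
      then have "\<tau> ` {1..m} = (\<lambda>i. \<tau> (Suc i)) ` {..<m}" by (simp only: image_image)
      also have "\<dots> = wheel_tri k n ` {..<m}" by (rule image_cong) (simp_all add: \<tau>_def)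
      finally show ?thesis .
    qed
    ultimately show ?thesis unfolding fcs by (simp only: Un_assoc)
  qed
  ultimately show ?thesis
    by (simp add: insert_wheel_def dual_graph_def[of "gunion G W"] parcs_dual_graph[of "gunion G W"])
qed

lemma interior: "1 \<le> i \<Longrightarrow> i < m \<Longrightarrow> k i \<notin> pverts G"
proof
  assume i: "1 \<le> i" "i < m" and "k i \<in> pverts G"
  moreover have "k i \<in> pverts W" using i wheel_at_pverts[OF W] by simp
  ultimately have "k i \<in> {k n, k m, k 0}" using common_verts by blast
  then show False using i by (simp add: keq)
qed

lemma wheel_insertion_dual:
  "wheel_insertion (dual_graph G \<sigma>1) S1 (face_of \<sigma>1 (k m, k 0)) \<tau> (wheel_rim k n) m"
proof (rule wheel_insertion.intro)
  let ?H = "dual_graph G \<sigma>1" and ?c = "face_of \<sigma>1 (k m, k 0)"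
  show "pair_graph ?H" by (rule pair_graph_dual_graph[OF g1 d1])
  show "S1 \<in> pverts ?H" using tri1 by simp
  have m: "2 \<le> m" using n by simp
  then show "2 \<le> m" .
  have ends: "\<tau> 0 = face_of \<sigma>1 (k 0, k n)" "\<tau> (m + 1) = face_of \<sigma>1 (k n, k m)"
    by (simp_all add: \<tau>_def)
  have path: "\<tau> i = wheel_tri k n (i - 1)" if "1 \<le> i" "i \<le> m" for i
    using that by (simp add: \<tau>_def)
  show "(S1, y) \<in> parcs ?H \<longleftrightarrow> y = \<tau> 0 \<or> y = \<tau> (m + 1) \<or> y = ?c" for y
  proof -
    have "(S1, y) \<in> parcs ?H \<longleftrightarrow> (\<exists>a\<in>parcs G. face_of \<sigma>1 a = S1 \<and> y = face_of \<sigma>1 (prod.swap a))"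
      by (auto simp: parcs_dual_graph)
    also have "\<dots> \<longleftrightarrow> (\<exists>a\<in>S1. y = face_of \<sigma>1 (prod.swap a))"
      using faces_disjoint[OF r1 g1 tri1] S1_G1 by blast
    also have "\<dots> \<longleftrightarrow> (\<exists>a\<in>S2. y = face_of \<sigma>1 a)"
      using swap_S1 swap_S2 by (metis swap_swap)
    also have "\<dots> \<longleftrightarrow> y = face_of \<sigma>1 (k n, k m) \<or> y = ?c \<or> y = face_of \<sigma>1 (k 0, k n)"
      unfolding S2e by simp
    finally show ?thesis unfolding ends by blast
  qed
  have km: "k 0 \<noteq> k m" "k n \<noteq> k m" "k 0 \<noteq> k n" using n by (simp_all add: keq)
  show "?c \<noteq> \<tau> 0" "?c \<noteq> \<tau> (m + 1)"
    unfolding ends using S1_dual_inj[OF d1 S2_mem(2,3)] S1_dual_inj[OF d1 S2_mem(2,1)] km by auto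
  have ends_ne: "\<tau> 0 \<noteq> \<tau> (m + 1)"
    unfolding ends using S1_dual_inj[OF d1 S2_mem(3,1)] km by auto
  have sub: "Q \<subseteq> parcs G" if "Q \<in> faces G \<sigma>1" for Q
    using that face_of_cyclic(3)[OF r1 g1] by (auto simp: faces_def)
  \<comment> \<open>A triangle of the wheel contains a rim vertex outside \<open>G\<close>: of the
    indices \<open>i - 1\<close> and \<open>i\<close> one is interior, since 0 and \<open>m\<close>
    are not consecutive for \<open>m\<close> at least 2.\<close>
  have not_face: "\<tau> i \<notin> faces G \<sigma>1" if i: "1 \<le> i" "i \<le> m" for i
  proof
    let ?j = "i - 1"
    assume "\<tau> i \<in> faces G \<sigma>1"
    moreover have "?j < n" "cnext n ?j = i" using i n by (simp_all add: cnext_if)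
    ultimately have "(k ?j, k i) \<in> parcs G"
      using sub wheel_at_arcs_in_faces(2)[of ?j n k] path[OF i] by auto
    then have "k ?j \<in> pverts G" "k i \<in> pverts G" using pair_graphD(1,2)[OF g1] by blast+
    moreover have "(1 \<le> ?j \<and> ?j < m) \<or> (1 \<le> i \<and> i < m)" using i m by arith
    ultimately show False using interior by blast
  qed
  then show "\<tau> ` {1..m} \<inter> pverts ?H = {}" by auto
  show "wheel_rim k n \<notin> pverts ?H"
  proof
    assume "wheel_rim k n \<in> pverts ?H"
    then have "wheel_rim k n \<subseteq> parcs G" using sub by simp
    moreover have "cnext n 0 = 1" using n by (simp add: cnext_if)
    moreover have "(k (cnext n 0), k 0) \<in> wheel_rim k n" using wheel_at_arcs_in_faces(5)[of 0 n k] n by simp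
    ultimately have "k 1 \<in> pverts G" using pair_graphD(1)[OF g1, of "k 1" "k 0"] by auto
    then show False using interior[of 1] m by simp
  qed
  show "wheel_rim k n \<notin> \<tau> ` {1..m}"
  proof
    assume "wheel_rim k n \<in> \<tau> ` {1..m}"
    then obtain i where i: "1 \<le> i" "i \<le> m" "wheel_rim k n = \<tau> i" by auto
    then have "i - 1 < n" "wheel_rim k n = wheel_tri k n (i - 1)" using path[of i] n by auto
    then show False using wheel_tri_not_rim[OF k, of "i - 1"] by simp
  qed
  have e: "\<tau> 0 \<in> faces G \<sigma>1" "\<tau> (m + 1) \<in> faces G \<sigma>1"
    unfolding ends faces_def using S2_mem S2_G1 by blast+
  show "inj_on \<tau> {..m + 1}"
  proof (rule inj_onI)
    fix i j assume ij: "i \<in> {..m + 1}" "j \<in> {..m + 1}" "\<tau> i = \<tau> j"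
    have "i = 0 \<or> i = m + 1 \<or> (1 \<le> i \<and> i \<le> m)" "j = 0 \<or> j = m + 1 \<or> (1 \<le> j \<and> j \<le> m)"
      using ij by auto
    moreover have "i = j" if "1 \<le> i \<and> i \<le> m" "1 \<le> j \<and> j \<le> m"
    proof -
      have "i - 1 < n" "j - 1 < n" "wheel_tri k n (i - 1) = wheel_tri k n (j - 1)"
        using that n path[of i] path[of j] ij(3) by auto
      then have "i - 1 = j - 1" by (rule wheel_tri_inj[OF k])
      then show ?thesis using that by arith
    qed
    ultimately show "i = j" using e not_face[of i] not_face[of j] ij(3) ends_ne by metis
  qed
qed

lemma dual_glued_reduces: "d3_step\<^sup>*\<^sup>* (dual_graph (gunion G W) \<sigma>) (dual_graph G \<sigma>1)"
  unfolding dual_glued by (rule insert_wheel_reduces[OF wheel_insertion_dual])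

end

inductive wheel_tree :: "'a pair_pre_digraph \<Rightarrow> 'a set set \<Rightarrow> bool" where
  wheel: "is_wheel W \<Longrightarrow> wheel_tree W (tris W)"
| add: "wheel_tree G F \<Longrightarrow> is_wheel W \<Longrightarrow> pverts G \<inter> pverts W = T \<Longrightarrow> T \<in> F \<Longrightarrow> T \<in> tris W \<Longrightarrow>
    wheel_tree (gunion G W) ((F - {T}) \<union> (tris W - {T}))"

lemma tris_gunion: "tris G \<subseteq> tris (gunion G H)" "tris H \<subseteq> tris (gunion G H)"
  by (auto elim!: trisE intro!: trisI)

lemma is_wheel_graph: "is_wheel W \<Longrightarrow> pair_graph W" "is_wheel W \<Longrightarrow> three_connected W"
  using wheel_at_pair_graph wheel_at_three_connected unfolding is_wheel_iff by blast+

lemma wheel_tree_graph: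
  assumes "wheel_tree G F" shows "pair_graph G" "three_connected G" "F \<subseteq> tris G"
  using assms
proof (induction)
  case (wheel W)
  { case 1 then show ?case using wheel is_wheel_graph by blast }
  { case 2 then show ?case using wheel is_wheel_graph by blast }
  { case 3 then show ?case by simp }
next
  case (add G F W T)
  { case 1 then show ?case using add is_wheel_graph pair_graph_gunion by blast }
  { case 2 show ?case
      using three_connected_gunion[OF add.IH(2,1) is_wheel_graph(2,1)] add.hyps
        tris_card(1)[OF is_wheel_graph(1)] by blast }
  { case 3 then show ?case using add.IH(3) tris_gunion by blast }
qed

text \<open>Triangles are tracked as vertex sets, while a face is a set of arcs; which of the two
  orientations is the face stays open.\<close>

definition directed_triangle :: "'a set \<Rightarrow> ('a \<times> 'a) set \<Rightarrow> bool" where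
  "directed_triangle T F \<longleftrightarrow> (\<exists>u v w. T = {u, v, w} \<and> F = {(u, v), (v, w), (w, u)})"

lemma directed_triangleI: "directed_triangle {u, v, w} {(u, v), (v, w), (w, u)}"
  unfolding directed_triangle_def by (intro exI[of _ u] exI[of _ v] exI[of _ w]) simp

lemma directed_triangle_unique:
  assumes "directed_triangle T F" "directed_triangle T' F" shows "T = T'"
proof -
  have "fst ` F = S" if "directed_triangle S F" for S
    using that unfolding directed_triangle_def by auto
  then show ?thesis using assms by blast
qed

lemma wheel_tree_embedding:
  assumes "wheel_tree G F"
  shows "\<exists>\<sigma>. planar_embedding G \<sigma> \<and> dual_simple G \<sigma> \<and>
    (\<exists>K. d3_step\<^sup>*\<^sup>* (dual_graph G \<sigma>) K \<and> complete_digraph 4 (with_proj K)) \<and>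
    (\<forall>T\<in>F. \<exists>Q \<in> faces G \<sigma>. directed_triangle T Q)"
  using assms
proof induction
  case (wheel W)
  then obtain n k where W: "wheel_at n k W" using is_wheel_iff by blast
  obtain \<sigma> where s: "planar_embedding W \<sigma>"
    "\<And>i a. i < n \<Longrightarrow> a \<in> wheel_tri k n i \<Longrightarrow> face_of \<sigma> a = wheel_tri k n i"
    "\<And>a. a \<in> wheel_rim k n \<Longrightarrow> face_of \<sigma> a = wheel_rim k n"
    using wheel_at_planar_embedding[OF W] by blast
  have d: "is_wheel (dual_graph W \<sigma>)" "dual_simple W \<sigma>"
    by (rule wheel_at_dual[OF W]; simp add: s(2,3))+
  have fW: "faces W \<sigma> = wheel_tri k n ` {..<n} \<union> {wheel_rim k n}"
    by (rule wheel_at_faces[OF W]) (simp_all add: s(2,3))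
  have "\<exists>Q\<in>faces W \<sigma>. directed_triangle T Q" if T: "T \<in> tris W" for T
  proof -
    from wheel_at_tris[OF W T] obtain u v w where
      "T = {u, v, w}" "{(u, v), (v, w), (w, u)} \<in> faces W \<sigma>" unfolding fW by metis
    then show ?thesis using directed_triangleI by metis
  qed
  then show ?case using s(1) d wheel_d3_reducible by blast
next
  case (add G F W T)
  note g = wheel_tree_graph[OF add.hyps(1)] and w = is_wheel_graph[OF add.hyps(2)]
  obtain \<sigma>1 where s1: "planar_embedding G \<sigma>1" "dual_simple G \<sigma>1"
    "\<exists>K. d3_step\<^sup>*\<^sup>* (dual_graph G \<sigma>1) K \<and> complete_digraph 4 (with_proj K)"
    "\<forall>T\<in>F. \<exists>Q \<in> faces G \<sigma>1. directed_triangle T Q" using add.IH by blast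
  then obtain a b c where abc: "T = {a, b, c}" "{(a, b), (b, c), (c, a)} \<in> faces G \<sigma>1"
    using add.hyps(4) unfolding directed_triangle_def by metis
  obtain x y z where xyz: "T = {x, y, z}" "(x, y) \<in> parcs W" "(y, z) \<in> parcs W" "(z, x) \<in> parcs W"
    using add.hyps(5) by (rule trisE)
  have ne: "a \<noteq> b" "b \<noteq> c" "c \<noteq> a"
    using triangle_face_step(4-6)[OF planar_embeddingD(1)[OF s1(1)] g(1) abc(2)] .
  have adj: "(p, q) \<in> parcs W" if "p \<in> T" "q \<in> T" "p \<noteq> q" for p q
    using that xyz pair_graphD(4)[OF w(1)] by auto
  have arcs: "(a, b) \<in> parcs W" "(b, c) \<in> parcs W" "(c, a) \<in> parcs W" using adj ne abc(1) by auto
  \<comment> \<open>The orientation of the face of \<open>G\<close> decides how the wheel is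
    numbered: the same triangle has to appear reversed among the faces of \<open>W\<close>.\<close>
  from wheel_triangle[OF add.hyps(2) arcs] obtain n k where W: "wheel_at n k W"
    and S2: "{(b, a), (c, b), (a, c)} = {(k n, k (n - 1)), (k (n - 1), k 0), (k 0, k n)}" .
  obtain \<sigma>2 where s2: "planar_embedding W \<sigma>2"
    "\<And>i a. i < n \<Longrightarrow> a \<in> wheel_tri k n i \<Longrightarrow> face_of \<sigma>2 a = wheel_tri k n i"
    "\<And>a. a \<in> wheel_rim k n \<Longrightarrow> face_of \<sigma>2 a = wheel_rim k n"
    using wheel_at_planar_embedding[OF W] by blast
  have n: "3 \<le> n" using W by (simp add: wheel_at_def)
  have "cnext n (n - 1) = 0" using n by (simp add: cnext_if)
  then have "{(b, a), (c, b), (a, c)} = wheel_tri k n (n - 1)" unfolding S2 wheel_tri_def by simp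
  moreover have fW: "faces W \<sigma>2 = wheel_tri k n ` {..<n} \<union> {wheel_rim k n}"
    by (rule wheel_at_faces[OF W]) (simp_all add: s2(2,3))
  ultimately have T2: "{(b, a), (c, b), (a, c)} \<in> faces W \<sigma>2" using n by simp
  have V: "pverts G \<inter> pverts W = {a, b, c}" using add.hyps(3) abc(1) by simp
  obtain \<sigma> where s: "planar_embedding (gunion G W) \<sigma>"
    "\<And>e. e \<in> parcs G - {(a, b), (b, c), (c, a)} \<Longrightarrow> face_of \<sigma> e = face_of \<sigma>1 e"
    "\<And>e. e \<in> parcs W - {(b, a), (c, b), (a, c)} \<Longrightarrow> face_of \<sigma> e = face_of \<sigma>2 e"
    "faces (gunion G W) \<sigma> = (faces G \<sigma>1 - {{(a, b), (b, c), (c, a)}}) \<union> (faces W \<sigma>2 - {{(b, a), (c, b), (a, c)}})"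
    using planar_embedding_gunion[OF g(1) w(1) s1(1) s2(1) V abc(2) T2] by blast
  interpret glued_embedding G W \<sigma>1 \<sigma>2 \<sigma> a b c
    by (rule glued_embedding.intro[OF g(1) w(1) s1(1) s2(1) V abc(2) T2 s])
  interpret glued_wheel G W \<sigma>1 \<sigma>2 \<sigma> a b c n k
    by (unfold_locales) (fact W s2(2,3) S2 s1(2))+
  have "dual_simple W \<sigma>2" by (rule wheel_at_dual(2)[OF W]) (simp_all add: s2(2,3))
  then have "dual_simple (gunion G W) \<sigma>" by (rule dual_simple_glued[OF s1(2)])
  moreover have "\<exists>K. d3_step\<^sup>*\<^sup>* (dual_graph (gunion G W) \<sigma>) K \<and> complete_digraph 4 (with_proj K)"
    using dual_glued_reduces s1(3) by (meson rtranclp_trans)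
  \<comment> \<open>Only the two orientations of \<open>T\<close> cease to be faces.\<close>
  moreover have "\<exists>Q\<in>faces (gunion G W) \<sigma>. directed_triangle X Q" if X: "X \<in> (F - {T}) \<union> (tris W - {T})" for X
  proof -
    have dT: "directed_triangle T {(a, b), (b, c), (c, a)}" "directed_triangle T {(b, a), (c, b), (a, c)}"
      unfolding directed_triangle_def using abc(1) by blast+
    from X show ?thesis
    proof
      assume "X \<in> F - {T}"
      then obtain Q where Q: "Q \<in> faces G \<sigma>1" "directed_triangle X Q" "X \<noteq> T" using s1(4) by blast
      then have "Q \<noteq> {(a, b), (b, c), (c, a)}" using directed_triangle_unique[OF dT(1)] by metis
      then show ?thesis unfolding s(4) using Q(1,2) by (intro bexI[of _ Q] UnI1 DiffI) simp_all
    next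
      assume X: "X \<in> tris W - {T}"
      then have XT: "X \<in> tris W" "X \<noteq> T" by auto
      from wheel_at_tris[OF W XT(1)] obtain u v w where uvw:
        "X = {u, v, w}" "{(u, v), (v, w), (w, u)} \<in> faces W \<sigma>2" unfolding fW by metis
      then have dX: "directed_triangle X {(u, v), (v, w), (w, u)}"
        by (simp only: directed_triangleI)
      have "{(u, v), (v, w), (w, u)} \<noteq> {(b, a), (c, b), (a, c)}"
      proof
        assume eq: "{(u, v), (v, w), (w, u)} = {(b, a), (c, b), (a, c)}"
        then show False using directed_triangle_unique[OF dT(2)] dX XT(2) unfolding eq by metis
      qed
      then show ?thesis unfolding s(4)
        using dX uvw(2) by (intro bexI[of _ "{(u, v), (v, w), (w, u)}"] UnI2 DiffI) simp_all
    qed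
  qed
  ultimately show ?case using s(1) by blast
qed

section \<open>Gluing and trees of wheels\<close>

lemma tris_map_graph_eq:
  assumes "pair_graph G" "inj_on f (pverts G)"
  shows "tris (map_graph f G) = (`) f ` tris G"
proof
  show "tris (map_graph f G) \<subseteq> (`) f ` tris G"
  proof
    fix T assume "T \<in> tris (map_graph f G)"
    then obtain u v w where T: "T = {u, v, w}" and arcs: "(u, v) \<in> parcs (map_graph f G)"
      "(v, w) \<in> parcs (map_graph f G)" "(w, u) \<in> parcs (map_graph f G)" by (rule trisE)
    have "u \<in> f ` pverts G" "v \<in> f ` pverts G" "w \<in> f ` pverts G"
      using arcs pair_graphD(1)[OF pair_graph_map_graph[OF assms]] by (metis pverts_map_graph)+
    then obtain x y z where xyz: "x \<in> pverts G" "y \<in> pverts G" "z \<in> pverts G" "u = f x" "v = f y" "w = f z"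
      by blast
    then have "(x, y) \<in> parcs G" "(y, z) \<in> parcs G" "(z, x) \<in> parcs G"
      using arcs map_graph_arc_iff[OF assms] by metis+
    then have "{x, y, z} \<in> tris G" by (rule trisI)
    moreover have "T = f ` {x, y, z}" using T xyz by simp
    ultimately show "T \<in> (`) f ` tris G" by blast
  qed
qed (rule tris_map_graph)

lemma map_graph_gunion: "map_graph f (gunion G H) = gunion (map_graph f G) (map_graph f H)"
  by (simp add: map_graph_def gunion_def image_Un)

lemma image_diff_single:
  assumes "inj_on f V" "\<And>S. S \<in> F \<Longrightarrow> S \<subseteq> V" "T \<subseteq> V"
  shows "(`) f ` (F - {T}) = (`) f ` F - {f ` T}"
proof -
  have "f ` S = f ` T \<longleftrightarrow> S = T" if "S \<in> F" for S
    using inj_on_image_eq_iff[OF assms(1) assms(2)[OF that] assms(3)] .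
  then show ?thesis by blast
qed

lemma wheel_tree_map_graph:
  assumes "wheel_tree G F" "inj_on f (pverts G)"
  shows "wheel_tree (map_graph f G) ((`) f ` F)"
  using assms
proof (induction)
  case (wheel W)
  then show ?case
    using wheel_tree.wheel[OF is_wheel_map_graph] tris_map_graph_eq is_wheel_graph(1) by metis
next
  case (add G F W T)
  note g = wheel_tree_graph[OF add.hyps(1)] and w = is_wheel_graph[OF add.hyps(2)]
  have f: "inj_on f (pverts G \<union> pverts W)" using add.prems by simp
  then have fG: "inj_on f (pverts G)" and fW: "inj_on f (pverts W)" by (auto intro: inj_on_subset)
  have FV: "S \<subseteq> pverts G \<union> pverts W" if "S \<in> F \<or> S \<in> tris W" for S
    using that g(3) tris_card(2)[OF g(1)] tris_card(2)[OF w(1)] by blast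
  have TV: "T \<subseteq> pverts G \<union> pverts W" using add.hyps(3) by blast
  have "wheel_tree (gunion (map_graph f G) (map_graph f W))
      (((`) f ` F - {f ` T}) \<union> (tris (map_graph f W) - {f ` T}))"
  proof (rule wheel_tree.add)
    show "wheel_tree (map_graph f G) ((`) f ` F)" by (rule add.IH[OF fG])
    show "is_wheel (map_graph f W)" by (rule is_wheel_map_graph[OF add.hyps(2) fW])
    show "pverts (map_graph f G) \<inter> pverts (map_graph f W) = f ` T"
      using inj_on_image_Int[OF f, of "pverts G" "pverts W"] add.hyps(3) by simp
    show "f ` T \<in> (`) f ` F" using add.hyps(4) by blast
    show "f ` T \<in> tris (map_graph f W)" using add.hyps(5) tris_map_graph by blast
  qed
  moreover have "((`) f ` F - {f ` T}) \<union> (tris (map_graph f W) - {f ` T}) =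
      (`) f ` ((F - {T}) \<union> (tris W - {T}))"
    unfolding tris_map_graph_eq[OF w(1) fW] image_Un
    using image_diff_single[OF f _ TV, of F] image_diff_single[OF f _ TV, of "tris W"] FV by metis
  ultimately show ?case by (simp only: map_graph_gunion)
qed

lemma gunion_assoc: "gunion (gunion G H) K = gunion G (gunion H K)"
  and gunion_commute: "gunion G H = gunion H G"
  by (simp_all add: gunion_def Un_ac)

text \<open>Gluing along a triangle of the last wheel of the second tree is gluing that wheel first and
  then what is left of the second tree.\<close>

lemma wheel_tree_gunion:
  assumes "wheel_tree G2 F2" "wheel_tree G1 F1" "pverts G1 \<inter> pverts G2 = T" "T \<in> F1" "T \<in> F2"
  shows "wheel_tree (gunion G1 G2) ((F1 - {T}) \<union> (F2 - {T}))"
  using assms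
\<comment> \<open>In the second case below the induction hypothesis is applied to \<open>G1\<close>
  enlarged by \<open>W\<close> and to the triangle \<open>S\<close>, hence the
  generalisation.\<close>
proof (induction arbitrary: G1 F1 T)
  case (wheel W)
  then show ?case by (intro wheel_tree.add)
next
  case (add G F W S)
  note g = wheel_tree_graph[OF add.hyps(1)] and w = is_wheel_graph[OF add.hyps(2)]
    and g1 = wheel_tree_graph[OF add.prems(1)]
  have card1: "card X = 3 \<and> X \<subseteq> pverts G1" if "X \<in> F1" for X using that g1(3) tris_card[OF g1(1)] by blast
  have cardG: "card X = 3 \<and> X \<subseteq> pverts G" if "X \<in> F" for X using that g(3) tris_card[OF g(1)] by blast
  have cardW: "card X = 3 \<and> X \<subseteq> pverts W" if "X \<in> tris W" for X using that tris_card[OF w(1)] by blast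
  have eq3: "X = Y" if "card X = 3" "card Y = 3" "X \<subseteq> Y" for X Y :: "'a set"
    using that by (intro card_subset_eq) (auto intro: card_ge_0_finite)
  have S: "card S = 3" and T: "card T = 3" using cardG add.hyps(4) card1 add.prems(3) by auto
  have V: "pverts G1 \<inter> (pverts G \<union> pverts W) = T" using add.prems(2) by simp
  consider "T \<in> F" "T \<noteq> S" | "T \<in> tris W" "T \<noteq> S" using add.prems(4) by blast
  then show ?case
  proof cases
    case 1
    have "pverts G1 \<inter> pverts G = T" using V cardG[OF 1(1)] by blast
    then have tr: "wheel_tree (gunion G1 G) ((F1 - {T}) \<union> (F - {T}))"
      using add.IH[OF add.prems(1)] add.prems(3) 1(1) by blast
    \<comment> \<open>A triangle contained in another one equals it, so \<open>S\<close> cannot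
      belong to \<open>F1\<close> as well, and striking it out leaves \<open>F1\<close>
      intact.\<close>
    have SF1: "S \<notin> F1"
    proof
      assume "S \<in> F1"
      then have "S \<subseteq> T" using card1 cardG[OF add.hyps(4)] V by blast
      then show False using eq3[OF S T] 1(2) by blast
    qed
    have TW: "T \<notin> tris W"
    proof
      assume "T \<in> tris W"
      then have "T \<subseteq> S" using cardW cardG[OF 1(1)] add.hyps(3) by blast
      then show False using eq3[OF T S] 1(2) by blast
    qed
    have "wheel_tree (gunion (gunion G1 G) W) ((((F1 - {T}) \<union> (F - {T})) - {S}) \<union> (tris W - {S}))"
    proof (rule wheel_tree.add[OF tr add.hyps(2)])
      show "pverts (gunion G1 G) \<inter> pverts W = S"
        using V add.hyps(3) cardG[OF 1(1)] cardG[OF add.hyps(4)] cardW[OF add.hyps(5)] by auto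
      show "S \<in> (F1 - {T}) \<union> (F - {T})" using add.hyps(4) 1(2) by blast
    qed (rule add.hyps(5))
    moreover have "(((F1 - {T}) \<union> (F - {T})) - {S}) \<union> (tris W - {S}) =
        (F1 - {T}) \<union> ((F - {S}) \<union> (tris W - {S}) - {T})" using SF1 TW by blast
    ultimately show ?thesis by (simp only: gunion_assoc)
  next
    case 2
    have "pverts G1 \<inter> pverts W = T" using V cardW[OF 2(1)] by blast
    then have tr: "wheel_tree (gunion G1 W) ((F1 - {T}) \<union> (tris W - {T}))"
      using wheel_tree.add[OF add.prems(1) add.hyps(2)] add.prems(3) 2(1) by blast
    have SF1: "S \<notin> F1"
    proof
      assume "S \<in> F1"
      then have "S \<subseteq> T" using card1 cardG[OF add.hyps(4)] V by blast
      then show False using eq3[OF S T] 2(2) by blast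
    qed
    have TF: "T \<notin> F"
    proof
      assume "T \<in> F"
      then have "T \<subseteq> S" using cardG cardW[OF 2(1)] add.hyps(3) by blast
      then show False using eq3[OF T S] 2(2) by blast
    qed
    have "wheel_tree (gunion (gunion G1 W) G) ((((F1 - {T}) \<union> (tris W - {T})) - {S}) \<union> (F - {S}))"
    proof (rule add.IH[OF tr])
      show "pverts (gunion G1 W) \<inter> pverts G = S"
        using V add.hyps(3) cardW[OF 2(1)] cardG[OF add.hyps(4)] cardW[OF add.hyps(5)] by auto
      show "S \<in> (F1 - {T}) \<union> (tris W - {T})" using add.hyps(5) 2(2) by blast
    qed (rule add.hyps(4))
    moreover have "(((F1 - {T}) \<union> (tris W - {T})) - {S}) \<union> (F - {S}) =
        (F1 - {T}) \<union> ((F - {S}) \<union> (tris W - {S}) - {T})" using SF1 TF by blast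
    moreover have "gunion (gunion G1 W) G = gunion G1 (gunion G W)" by (simp add: gunion_def Un_ac)
    ultimately show ?thesis by (simp only:)
  qed
qed

section \<open>From gluings to trees of wheels and back\<close>

lemma triangular_faces_tris:
  assumes "pair_graph G" shows "triangular_faces G \<subseteq> tris G"
proof
  fix T assume "T \<in> triangular_faces G"
  then obtain u v w \<sigma> where T: "T = {u, v, w}" "planar_embedding G \<sigma>" "{(u, v), (v, w), (w, u)} \<in> faces G \<sigma>"
    unfolding triangular_faces_def by blast
  show "T \<in> tris G"
    unfolding T(1) by (rule trisI) (rule triangle_face_step(7-9)[OF planar_embeddingD(1)[OF T(2)] assms T(3)])+
qed

lemma glue_eq: "glue G1 T1 G2 T2 = gunion G1 (map_graph (identify T1 T2) G2)"
  by (simp add: glue_def gunion_def)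

lemma identify_simps:
  assumes "distinct [u', v', w']"
  shows "identify (u, v, w) (u', v', w') u' = u" "identify (u, v, w) (u', v', w') v' = v"
    "identify (u, v, w) (u', v', w') w' = w"
    "x \<notin> {u', v', w'} \<Longrightarrow> identify (u, v, w) (u', v', w') x = x"
  using assms by (auto simp: identify_def)

lemma identify_image:
  assumes "distinct [u', v', w']" "{u', v', w'} \<subseteq> V"
  shows "identify (u, v, w) (u', v', w') ` V = (V - {u', v', w'}) \<union> {u, v, w}"
proof -
  let ?i = "identify (u, v, w) (u', v', w')"
  note i = identify_simps[OF assms(1), of u v w]
  have "V = (V - {u', v', w'}) \<union> {u', v', w'}" using assms(2) by blast
  then have "?i ` V = ?i ` (V - {u', v', w'}) \<union> ?i ` {u', v', w'}" by (metis image_Un)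
  moreover have "?i ` (V - {u', v', w'}) = V - {u', v', w'}"
  proof -
    have "?i ` (V - {u', v', w'}) = (\<lambda>x. x) ` (V - {u', v', w'})"
    proof (rule image_cong[OF refl])
      fix x assume "x \<in> V - {u', v', w'}"
      then show "?i x = x" by (intro identify_simps(4)[OF assms(1)]) blast
    qed
    then show ?thesis by simp
  qed
  ultimately show ?thesis using i(1-3) by simp
qed

lemma identify_inj:
  assumes "distinct [u', v', w']" "distinct [u, v, w]" "{u, v, w} \<inter> V = {}"
  shows "inj_on (identify (u, v, w) (u', v', w')) V"
proof (rule inj_onI)
  fix x y assume "x \<in> V" "y \<in> V" "identify (u, v, w) (u', v', w') x = identify (u, v, w) (u', v', w') y"
  then show "x = y" using assms by (auto simp: identify_def split: if_splits)
qed

text \<open>A step of \<open>gluing\<close> is a union after renaming by \<open>identify\<close>.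
  Only an inclusion between \<open>F\<close> and \<open>F'\<close> is kept: \<open>gluing\<close>
  starts from facial triangles, \<open>wheel_tree\<close> from all triangles, and a step asks for
  membership only.\<close>

lemma gluing_wheel_tree:
  assumes "gluing M G F" "\<forall>W\<in>#M. is_wheel W"
  shows "\<exists>F'. wheel_tree G F' \<and> F \<subseteq> F'"
  using assms
proof induction
  case (single G)
  then have "is_wheel G" by simp
  then show ?case using wheel_tree.wheel triangular_faces_tris is_wheel_graph(1) by blast
next
  case (relabel M G F f)
  then show ?case using wheel_tree_map_graph by (meson image_mono)
next
  case (step M1 G1 F1 M2 G2 F2 u v w u' v' w')
  obtain F1' where F1': "wheel_tree G1 F1'" "F1 \<subseteq> F1'" using step.IH(1) step.prems by auto
  obtain F2' where F2': "wheel_tree G2 F2'" "F2 \<subseteq> F2'" using step.IH(2) step.prems by auto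
  let ?i = "identify (u, v, w) (u', v', w')" and ?T = "{u, v, w}" and ?T' = "{u', v', w'}"
  note g1 = wheel_tree_graph[OF F1'(1)] and g2 = wheel_tree_graph[OF F2'(1)]
  have T: "?T \<in> F1'" "?T' \<in> F2'" using step.hyps F1'(2) F2'(2) by blast+
  note c = tris_card[OF g1(1) subsetD[OF g1(3) T(1)]] tris_card[OF g2(1) subsetD[OF g2(3) T(2)]]
  then have d: "distinct [u, v, w]" "distinct [u', v', w']"
    by (auto simp: card_insert_if split: if_splits)
  have inj: "inj_on ?i (pverts G2)" by (rule identify_inj[OF d(2,1)]) (use c step.hyps(5) in blast)
  have iT: "?i ` ?T' = ?T" using identify_simps[OF d(2)] by simp
  have "wheel_tree (gunion G1 (map_graph ?i G2)) ((F1' - {?T}) \<union> ((`) ?i ` F2' - {?T}))"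
  proof (rule wheel_tree_gunion[OF wheel_tree_map_graph[OF F2'(1) inj] F1'(1)])
    show "pverts G1 \<inter> pverts (map_graph ?i G2) = ?T"
      using identify_image[OF d(2) c(4)] step.hyps(5) c(2) by auto
    show "?T \<in> F1'" by (rule T(1))
    show "?T \<in> (`) ?i ` F2'" using T(2) iT by blast
  qed
  moreover have "(`) ?i ` (F2' - {?T'}) = (`) ?i ` F2' - {?i ` ?T'}"
    by (rule image_diff_single[OF inj]) (use g2(3) tris_card(2)[OF g2(1)] c(4) in blast)+
  then have "(`) ?i ` (F2 - {?T'}) \<subseteq> (`) ?i ` F2' - {?T}" using F2'(2) unfolding iT by blast
  ultimately show ?case unfolding glue_eq using F1'(2) by blast
qed

lemma wheel_tree_polyhedral:
  assumes "wheel_tree G F" shows "polyhedral G" "F \<subseteq> triangular_faces G"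
proof -
  note g = wheel_tree_graph[OF assms]
  obtain \<sigma> where s: "planar_embedding G \<sigma>" "\<forall>T\<in>F. \<exists>Q \<in> faces G \<sigma>. directed_triangle T Q"
    using wheel_tree_embedding[OF assms] by blast
  then show "polyhedral G" using g by (auto simp: polyhedral_def)
  show "F \<subseteq> triangular_faces G"
  proof
    fix T assume "T \<in> F"
    then obtain Q where "Q \<in> faces G \<sigma>" "directed_triangle T Q" using s(2) by blast
    then show "T \<in> triangular_faces G"
      using s(1) unfolding directed_triangle_def triangular_faces_def by blast
  qed
qed

lemma wheel_tree_gluing:
  fixes G :: "nat pair_pre_digraph"
  assumes "wheel_tree G F"
  shows "\<exists>M F'. (\<forall>W\<in>#M. polyhedral W \<and> is_wheel W) \<and> gluing M G F' \<and> F \<subseteq> F'"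
  using assms
proof induction
  case (wheel W)
  then have "polyhedral W" "tris W \<subseteq> triangular_faces W"
    using wheel_tree_polyhedral[OF wheel_tree.wheel] by blast+
  then show ?case using wheel gluing.single[of W] by (intro exI[of _ "{#W#}"]) auto
next
  case (add G F W T)
  note g = wheel_tree_graph[OF add.hyps(1)] and w = is_wheel_graph[OF add.hyps(2)]
  obtain M F' where M: "\<forall>W\<in>#M. polyhedral W \<and> is_wheel W" "gluing M G F'" "F \<subseteq> F'" using add.IH by blast
  obtain u v w where uvw: "T = {u, v, w}" "(u, v) \<in> parcs W" "(v, w) \<in> parcs W" "(w, u) \<in> parcs W"
    using add.hyps(5) by (rule trisE)
  then have ne: "distinct [u, v, w]" using pair_graphD(3)[OF is_wheel_graph(1)[OF add.hyps(2)]] by auto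
  let ?V = "pverts G \<union> pverts W"
  \<comment> \<open>With this offset every shifted name exceeds all names in use.\<close>
  define b where "b = Suc (Max ?V)"
  define r where "r = (\<lambda>x. x + b)"
  have finV: "finite ?V" using pair_graph_finite(1)[OF g(1)] pair_graph_finite(1)[OF w(1)] by simp
  have r: "r x \<notin> ?V" for x
  proof
    assume "r x \<in> ?V"
    then have "r x \<le> Max ?V" by (rule Max_ge[OF finV])
    then show False by (simp add: r_def b_def)
  qed
  have rinj: "inj r" by (simp add: r_def inj_def)
  let ?W = "map_graph r W"
  let ?i = "identify (u, v, w) (r u, r v, r w)"
  have wW: "is_wheel ?W" by (rule is_wheel_map_graph[OF add.hyps(2) inj_on_subset[OF rinj]]) simp
  have pW: "polyhedral ?W" and tW: "tris ?W \<subseteq> triangular_faces ?W"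
    using wheel_tree_polyhedral[OF wheel_tree.wheel[OF wW]] by blast+
  have TW: "{r u, r v, r w} \<in> tris ?W" using tris_map_graph[of r W] add.hyps(5) uvw(1) by auto
  have TG: "{u, v, w} \<in> F" using add.hyps(4) uvw(1) by simp
  have dr: "distinct [r u, r v, r w]" using ne rinj by (auto simp: inj_def)
  have gl: "gluing (M + {#?W#}) (glue G (u, v, w) ?W (r u, r v, r w))
     ((F' - {{u, v, w}}) \<union> (`) ?i ` (triangular_faces ?W - {{r u, r v, r w}}))"
  proof (rule gluing.step[OF M(2) gluing.single[OF pW]])
    show "polyhedral G" "{u, v, w} \<in> triangular_faces G"
      using wheel_tree_polyhedral[OF add.hyps(1)] TG by blast+
    show "pverts G \<inter> pverts ?W = {}" using r by auto
    show "{u, v, w} \<in> F'" using TG M(3) by blast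
  qed (use pW tW TW in auto)
  \<comment> \<open>After the gluing the triangle carries the names from \<open>G\<close>;
    \<open>k\<close> shifts the other vertices of the copy back.\<close>
  define k where "k x = (if x \<in> ?V then x else x - b)" for x
  have kr: "k (r x) = x" for x using r[of x] by (simp add: k_def r_def)
  have kV: "k x = x" if "x \<in> ?V" for x using that by (simp add: k_def)
  have TV: "T \<subseteq> pverts G" "T \<subseteq> pverts W" using add.hyps(3) by blast+
  have ki: "k (?i (r x)) = x" for x
  proof (cases "x \<in> {u, v, w}")
    case True
    then have "?i (r x) = x" using identify_simps(1-3)[OF dr, of u v w] by auto
    moreover have "x \<in> ?V" using True TV uvw(1) by blast
    ultimately show ?thesis using kV by simp
  next
    case False
    then have "r x \<notin> {r u, r v, r w}" using rinj by (auto simp: inj_def)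
    then show ?thesis using identify_simps(4)[OF dr] kr by simp
  qed
  have "map_graph k (glue G (u, v, w) ?W (r u, r v, r w)) = gunion G W"
  proof -
    have "map_graph k (map_graph ?i ?W) = W"
      unfolding map_graph_comp by (rule map_graph_ident[OF pair_graph_wf[OF w(1)]]) (simp add: ki)
    moreover have "map_graph k G = G"
      by (rule map_graph_ident[OF pair_graph_wf[OF g(1)]]) (simp add: kV)
    ultimately show ?thesis by (simp add: glue_eq map_graph_gunion)
  qed
  moreover have "inj_on k (pverts (glue G (u, v, w) ?W (r u, r v, r w)))"
  proof (rule inj_onI)
    fix x y assume xy: "x \<in> pverts (glue G (u, v, w) ?W (r u, r v, r w))"
      "y \<in> pverts (glue G (u, v, w) ?W (r u, r v, r w))" "k x = k y"
    have "z \<in> pverts G \<or> (\<exists>z'\<in>pverts W - T. z = r z')" if "z \<in> pverts (glue G (u, v, w) ?W (r u, r v, r w))" for z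
    proof -
      have "z \<in> pverts G \<or> (\<exists>z'\<in>pverts W. z = ?i (r z'))" using that by (auto simp: glue_eq)
      moreover have "?i (r z') = r z'" if "z' \<notin> T" for z'
      proof -
        have "z' \<noteq> u" "z' \<noteq> v" "z' \<noteq> w" using that uvw(1) by auto
        then have "r z' \<notin> {r u, r v, r w}" using rinj by (auto dest: injD)
        then show ?thesis by (rule identify_simps(4)[OF dr])
      qed
      moreover have "?i (r z') \<in> pverts G" if "z' \<in> T" for z'
        using that identify_simps(1-3)[OF dr, of u v w] uvw(1) TV(1) by auto
      ultimately show ?thesis by blast
    qed
    then show "x = y"
      using xy kV kr add.hyps(3) by (metis DiffD1 DiffD2 IntI UnI1)
  qed
  ultimately have "gluing (M + {#?W#}) (gunion G W)
      ((`) k ` ((F' - {{u, v, w}}) \<union> (`) ?i ` (triangular_faces ?W - {{r u, r v, r w}})))" (is "gluing _ _ ?F")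
    using gluing.relabel[OF gl] by metis
  moreover have "(F - {T}) \<union> (tris W - {T}) \<subseteq> ?F"
  proof
    fix X assume "X \<in> (F - {T}) \<union> (tris W - {T})"
    then show "X \<in> ?F"
    proof
      assume X: "X \<in> F - {T}"
      then have "X \<subseteq> pverts G" using g(3) tris_card(2)[OF g(1)] by blast
      then have "k ` X = X" using kV by force
      moreover have "X \<in> F' - {{u, v, w}}" using X M(3) uvw(1) by blast
      ultimately show ?thesis by (metis UnI1 image_eqI)
    next
      assume X: "X \<in> tris W - {T}"
      have "r ` X \<in> triangular_faces ?W" using X tris_map_graph[of r W] tW by blast
      moreover have "r ` X \<noteq> r ` T" using X rinj by (simp add: inj_image_eq_iff)
      ultimately have "r ` X \<in> triangular_faces ?W - {{r u, r v, r w}}" using uvw(1) by simp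
      moreover have "k ` ?i ` r ` X = X" unfolding image_image by (simp add: ki)
      ultimately show ?thesis by (metis UnI2 image_eqI)
    qed
  qed
  moreover have "\<forall>X\<in>#M + {#?W#}. polyhedral X \<and> is_wheel X" using M(1) pW wW by auto
  ultimately show ?case by blast
qed

section \<open>Splitting a cubic vertex of a tree of wheels\<close>

lemma gsplit_gunion_left:
  assumes "f \<notin> pverts W" "pair_graph W"
  shows "gsplit (gunion G W) f a c g = gunion (gsplit G f a c g) W"
proof -
  have "(f, c) \<notin> parcs W" "(c, f) \<notin> parcs W" using assms pair_graphD(1,2) by fast+
  then show ?thesis by (auto simp: gsplit_def gunion_def)
qed

lemma gsplit_tris:
  assumes "T \<in> tris G" "f \<notin> T" shows "T \<in> tris (gsplit G f a c g)"
  using assms by (auto elim!: trisE intro!: trisI simp: gsplit_def)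

lemma gsplit_new_tris:
  assumes "pair_graph G" "(f, a) \<in> parcs G" "(f, b) \<in> parcs G" "(a, b) \<in> parcs G" "(a, c) \<in> parcs G"
    "distinct [a, b, c, f]"
  shows "{f, a, b} \<in> tris (gsplit G f a c g)" "{f, a, g} \<in> tris (gsplit G f a c g)"
    "{g, a, c} \<in> tris (gsplit G f a c g)"
  using assms pair_graphD(4)[OF assms(1)] by (auto intro!: trisI simp: gsplit_def)

lemma tris_adjacent:
  assumes "pair_graph G" "T \<in> tris G" "x \<in> T" "y \<in> T" "x \<noteq> y"
  shows "(x, y) \<in> parcs G"
  using assms(2)
proof (rule trisE)
  fix u v w assume "T = {u, v, w}" "(u, v) \<in> parcs G" "(v, w) \<in> parcs G" "(w, u) \<in> parcs G"
  then show ?thesis using assms(3-5) pair_graphD(4)[OF assms(1)] by auto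
qed

lemma wheel_tree_gsplit:
  assumes "wheel_tree G F" and "\<And>x. (f, x) \<in> parcs G \<longleftrightarrow> x = a \<or> x = b \<or> x = c"
    and "distinct [a, b, c]" "{f, a, b} \<in> F" "{f, a, c} \<in> F" "g \<notin> pverts G"
  shows "\<exists>F'. wheel_tree (gsplit G f a c g) F' \<and> {T \<in> F. f \<notin> T} \<subseteq> F' \<and>
    {{f, a, b}, {f, a, g}, {g, a, c}} \<subseteq> F'"
  using assms
proof induction
  case (wheel W)
  note w = is_wheel_graph[OF wheel.hyps]
  have fN: "(f, a) \<in> parcs W" "(f, b) \<in> parcs W" "(f, c) \<in> parcs W" using wheel.prems(1) by auto
  then have ne: "distinct [a, b, c, f]" using wheel.prems(2) pair_graphD(3)[OF w(1)] by auto
  have ab: "(a, b) \<in> parcs W" "(a, c) \<in> parcs W"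
    using tris_adjacent[OF w(1) wheel.prems(3), of a b] tris_adjacent[OF w(1) wheel.prems(4), of a c] ne by auto
  have "is_wheel (gsplit W f a c g)"
    by (rule is_wheel_gsplit[OF wheel.hyps wheel.prems(1,2) ab wheel.prems(5)])
  then have "wheel_tree (gsplit W f a c g) (tris (gsplit W f a c g))" by (rule wheel_tree.wheel)
  moreover have "{T \<in> tris W. f \<notin> T} \<subseteq> tris (gsplit W f a c g)"
    using gsplit_tris[of _ W f a c g] by auto
  ultimately show ?case using gsplit_new_tris[OF w(1) fN(1,2) ab ne, of g]
    by (intro exI[of _ "tris (gsplit W f a c g)"] conjI) simp_all
next
  case (add G F W T)
  note g = wheel_tree_graph[OF add.hyps(1)] and w = is_wheel_graph[OF add.hyps(2)]
  have T: "card T = 3" "T \<subseteq> pverts G" "T \<subseteq> pverts W"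
    using tris_card[OF w(1) add.hyps(5)] add.hyps(3) by auto
  have finT: "finite T" using T(1) card_ge_0_finite by force
  have N: "{x. (f, x) \<in> parcs G} \<union> {x. (f, x) \<in> parcs W} = {a, b, c}" using add.prems(1) by auto
  have fN: "(f, a) \<in> parcs G \<union> parcs W" "(f, b) \<in> parcs G \<union> parcs W" "(f, c) \<in> parcs G \<union> parcs W"
    using add.prems(1) by auto
  then have ne: "distinct [a, b, c, f]"
    using add.prems(2) pair_graphD(3)[OF w(1)] pair_graphD(3)[OF g(1)] by auto
  \<comment> \<open>A vertex of the gluing triangle has at least three neighbours on either side.
    With only three in all, these and \<open>f\<close> would be four common vertices, but only the
    three of \<open>T\<close> are common.\<close>
  have fT: "f \<notin> T"
  proof
    assume f: "f \<in> T"
    have fin: "finite {x. (f, x) \<in> parcs G}" "finite {x. (f, x) \<in> parcs W}"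
      by (rule pair_graph_finite_nbrs[OF g(1)], rule pair_graph_finite_nbrs[OF w(1)])
    have c3: "3 \<le> card {x. (f, x) \<in> parcs G}" "3 \<le> card {x. (f, x) \<in> parcs W}"
      using three_connected_degree[OF g(2,1)] three_connected_degree[OF w(2,1)] f T by blast+
    have "card {a, b, c} = 3" using add.prems(2) by simp
    then have "{x. (f, x) \<in> parcs G} = {a, b, c}" "{x. (f, x) \<in> parcs W} = {a, b, c}"
      using c3 N by (metis Un_upper1 Un_upper2 card_seteq finite.emptyI finite.insertI)+
    then have "{a, b, c} \<subseteq> pverts G" "{a, b, c} \<subseteq> pverts W"
      using pair_graphD(2)[OF g(1)] pair_graphD(2)[OF w(1)] by blast+
    then have "insert f {a, b, c} \<subseteq> T" using add.hyps(3) f by blast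
    then have "card (insert f {a, b, c}) \<le> card T" using finT by (rule card_mono[rotated])
    moreover have "card (insert f {a, b, c}) = 4" using ne by auto
    ultimately show False using T(1) by simp
  qed
  have vs: "g \<notin> pverts G" "g \<notin> pverts W" using add.prems(5) by auto
  show ?case
  proof (cases "f \<in> pverts G")
    case True
    then have fW: "f \<notin> pverts W" using fT add.hyps(3) by blast
    then have NG: "(f, x) \<in> parcs G \<longleftrightarrow> x = a \<or> x = b \<or> x = c" for x
      using add.prems(1)[of x] pair_graphD(1)[OF w(1), of f x] by auto
    have "X \<in> F" if "X \<in> (F - {T}) \<union> (tris W - {T})" "f \<in> X" for X
      using that fW tris_card(2)[OF w(1)] by blast
    then have FF: "{f, a, b} \<in> F" "{f, a, c} \<in> F" using add.prems(3,4) by blast+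
    obtain F' where F': "wheel_tree (gsplit G f a c g) F'" "{T \<in> F. f \<notin> T} \<subseteq> F'"
        "{{f, a, b}, {f, a, g}, {g, a, c}} \<subseteq> F'"
      using add.IH[OF NG add.prems(2) FF vs(1)] by blast
    have "wheel_tree (gunion (gsplit G f a c g) W) ((F' - {T}) \<union> (tris W - {T}))"
    proof (rule wheel_tree.add[OF F'(1) add.hyps(2)])
      show "pverts (gsplit G f a c g) \<inter> pverts W = T" using add.hyps(3) vs(2) by (auto simp: gsplit_def)
      show "T \<in> F'" using F'(2) add.hyps(4) fT by blast
    qed (rule add.hyps(5))
    moreover have "{X \<in> (F - {T}) \<union> (tris W - {T}). f \<notin> X} \<subseteq> (F' - {T}) \<union> (tris W - {T})"
      using F'(2) by blast
    moreover have "g \<notin> T" using vs(1) T(2) by blast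
    then have "{f, a, b} \<noteq> T" "{f, a, g} \<noteq> T" "{g, a, c} \<noteq> T" using fT by blast+
    then have "{{f, a, b}, {f, a, g}, {g, a, c}} \<subseteq> (F' - {T}) \<union> (tris W - {T})" using F'(3) by blast
    ultimately show ?thesis unfolding gsplit_gunion_left[OF fW w(1)] by blast
  next
    case False
    then have NW: "(f, x) \<in> parcs W \<longleftrightarrow> x = a \<or> x = b \<or> x = c" for x
      using add.prems(1)[of x] pair_graphD(1)[OF g(1), of f x] by auto
    have fN: "(f, a) \<in> parcs W" "(f, b) \<in> parcs W" using NW by auto
    have XW: "X \<in> tris W" if "X \<in> (F - {T}) \<union> (tris W - {T})" "f \<in> X" for X
      using that False g(3) tris_card(2)[OF g(1)] by blast
    have tW: "{f, a, b} \<in> tris W" "{f, a, c} \<in> tris W"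
      by (rule XW[OF add.prems(3)] XW[OF add.prems(4)], simp)+
    have ab: "(a, b) \<in> parcs W" "(a, c) \<in> parcs W"
      using tris_adjacent[OF w(1) tW(1), of a b] tris_adjacent[OF w(1) tW(2), of a c] ne by auto
    have wh: "is_wheel (gsplit W f a c g)"
      by (rule is_wheel_gsplit[OF add.hyps(2) NW add.prems(2) ab vs(2)])
    have "wheel_tree (gunion G (gsplit W f a c g)) ((F - {T}) \<union> (tris (gsplit W f a c g) - {T}))"
    proof (rule wheel_tree.add[OF add.hyps(1) wh])
      show "pverts G \<inter> pverts (gsplit W f a c g) = T" using add.hyps(3) vs(1) by (auto simp: gsplit_def)
      show "T \<in> tris (gsplit W f a c g)" by (rule gsplit_tris[OF add.hyps(5) fT])
    qed (rule add.hyps(4))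
    moreover have "gunion G (gsplit W f a c g) = gsplit (gunion G W) f a c g"
      using gsplit_gunion_left[OF False g(1), of W a c g] by (simp only: gunion_commute)
    moreover have "{X \<in> (F - {T}) \<union> (tris W - {T}). f \<notin> X} \<subseteq> (F - {T}) \<union> (tris (gsplit W f a c g) - {T})"
      using gsplit_tris[of _ W f a c g] by auto
    moreover have "g \<notin> T" using vs(1) T(2) by blast
    then have "{f, a, b} \<noteq> T" "{f, a, g} \<noteq> T" "{g, a, c} \<noteq> T" using fT by blast+
    then have "{{f, a, b}, {f, a, g}, {g, a, c}} \<subseteq> (F - {T}) \<union> (tris (gsplit W f a c g) - {T})"
      using gsplit_new_tris[OF w(1) fN ab ne, of g] by simp
    ultimately show ?thesis
      by (intro exI[of _ "(F - {T}) \<union> (tris (gsplit W f a c g) - {T})"] conjI) simp_all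
  qed
qed

section \<open>Planar duality\<close>

text \<open>Duality exchanges walking along a face with rotating about a vertex, so Euler's formula
  is the old one with vertices and faces exchanged. The condition \<open>out\<close> makes every
  vertex of \<open>G\<close> a face of the dual: it is the set of dual arcs of the arcs leaving the
  vertex.\<close>

lemma planar_dual_embedding:
  assumes g: "pair_graph G" and e: "planar_embedding G \<sigma>" and d: "dual_simple G \<sigma>"
    and conn: "Digraph_Component.connected (with_proj (dual_graph G \<sigma>))"
    and out: "\<And>v. v \<in> pverts G \<Longrightarrow> \<exists>a\<in>parcs G. fst a = v"
  obtains \<sigma>' f where "planar_embedding (dual_graph G \<sigma>) \<sigma>'" "inj_on f (pverts G)"
    "dual_graph (dual_graph G \<sigma>) \<sigma>' = map_graph f G"
proof -
  let ?H = "dual_graph G \<sigma>" and ?E = "parcs G"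
  note r = planar_embeddingD(1)[OF e] and h = pair_graph_dual_graph[OF g d]
  define s where "s a = (face_of \<sigma> a, face_of \<sigma> (prod.swap a))" for a
  have H: "parcs ?H = s ` ?E" by (simp add: parcs_dual_graph s_def)
  have inj: "inj_on s ?E" using d by (simp add: dual_simple_def s_def inj_on_def)
  have swap_s: "prod.swap (s a) = s (prod.swap a)" for a by (simp add: s_def)
  \<comment> \<open>Rotation about a dual vertex follows the boundary walk of the face;
    \<open>s\<close> transports arcs to dual arcs.\<close>
  define \<sigma>' where "\<sigma>' b = (if b \<in> parcs ?H then s (\<sigma> (prod.swap (the_inv_into ?E s b))) else b)" for b
  have \<sigma>': "\<sigma>' (s a) = s (\<sigma> (prod.swap a))" if "a \<in> ?E" for a
    using that by (simp add: \<sigma>'_def H the_inv_into_f_f[OF inj])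
  have rot: "rotation_system ?H \<sigma>'"
  proof (rule rotation_systemI[OF h])
    show "\<sigma>' b = b" if "b \<notin> parcs ?H" for b using that by (simp add: \<sigma>'_def)
    fix Q assume "Q \<in> pverts ?H"
    then obtain a where a: "a \<in> ?E" "Q = face_of \<sigma> a" by (auto simp: faces_def)
    have "{b \<in> parcs ?H. fst b = Q} = s ` face_of \<sigma> a"
    proof
      show "{b \<in> parcs ?H. fst b = Q} \<subseteq> s ` face_of \<sigma> a"
      proof
        fix b assume "b \<in> {b \<in> parcs ?H. fst b = Q}"
        then obtain x where x: "x \<in> ?E" "b = s x" "face_of \<sigma> x = face_of \<sigma> a" using a(2) by (auto simp: H s_def)
        then have "x \<in> face_of \<sigma> a" using face_of_cyclic(2)[OF r g x(1)] by simp
        then show "b \<in> s ` face_of \<sigma> a" using x(2) by blast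
      qed
      show "s ` face_of \<sigma> a \<subseteq> {b \<in> parcs ?H. fst b = Q}"
      proof
        fix b assume "b \<in> s ` face_of \<sigma> a"
        then obtain x where x: "x \<in> face_of \<sigma> a" "b = s x" by blast
        then have "x \<in> ?E" "face_of \<sigma> x = face_of \<sigma> a"
          using face_of_cyclic(3)[OF r g a(1)] face_of_eq[OF face_of_cyclic(1)[OF r g a(1)]] by auto
        then have "b \<in> parcs ?H" "fst b = Q" unfolding H using x(2) a(2) by (auto simp: s_def)
        then show "b \<in> {b \<in> parcs ?H. fst b = Q}" by simp
      qed
    qed
    moreover have "cyclic_on \<sigma>' (s ` face_of \<sigma> a)"
      by (rule cyclic_on_image[OF face_of_cyclic(1)[OF r g a(1)]])
        (use \<sigma>' face_of_cyclic(3)[OF r g a(1)] in auto)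
    ultimately show "cyclic_on \<sigma>' {b \<in> parcs ?H. fst b = Q}" by simp
  qed
  have face: "face_of \<sigma>' (s a) = s ` {x \<in> ?E. fst x = fst a}" if a: "a \<in> ?E" for a
  proof (rule face_of_eq)
    show "cyclic_on (\<sigma>' \<circ> prod.swap) (s ` {x \<in> ?E. fst x = fst a})"
    proof (rule cyclic_on_image[OF rotation_systemD(1)[OF r g a]])
      fix x assume "x \<in> {x \<in> ?E. fst x = fst a}"
      then show "(\<sigma>' \<circ> prod.swap) (s x) = s (\<sigma> x)"
        using \<sigma>'[OF swap_parcs[OF g, of x]] by (simp add: swap_s)
    qed
    show "s a \<in> s ` {x \<in> ?E. fst x = fst a}" using a by blast
  qed
  define f where "f v = s ` {x \<in> ?E. fst x = v}" for v
  have face_f: "face_of \<sigma>' (s a) = f (fst a)" if "a \<in> ?E" for a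
    using face[OF that] by (simp add: f_def)
  have f: "inj_on f (pverts G)"
  proof (rule inj_onI)
    fix v w assume "v \<in> pverts G" "w \<in> pverts G" "f v = f w"
    moreover obtain a where a: "a \<in> ?E" "fst a = v" using out calculation(1) by blast
    ultimately have "s a \<in> s ` {x \<in> ?E. fst x = w}" by (auto simp: f_def)
    then obtain x where "x \<in> ?E" "fst x = w" "s a = s x" by blast
    then show "v = w" using inj_onD[OF inj, of a x] a by simp
  qed
  have V: "fst ` ?E = pverts G"
  proof
    show "fst ` ?E \<subseteq> pverts G" using pair_graphD(1)[OF g] by auto
    show "pverts G \<subseteq> fst ` ?E" using out by (metis image_eqI subsetI)
  qed
  have faces: "faces ?H \<sigma>' = f ` pverts G"
    unfolding faces_def H V[symmetric] image_image using face_f by (rule image_cong[OF refl])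
  have "(\<lambda>b. (face_of \<sigma>' b, face_of \<sigma>' (prod.swap b))) ` parcs ?H = map_prod f f ` ?E"
    unfolding H image_image
  proof (rule image_cong[OF refl])
    fix a assume a: "a \<in> ?E"
    show "(face_of \<sigma>' (s a), face_of \<sigma>' (prod.swap (s a))) = map_prod f f a"
      using face_f[OF a] face_f[OF swap_parcs[OF g a]] by (simp add: swap_s prod_eq_iff)
  qed
  then have "dual_graph ?H \<sigma>' = map_graph f G"
    using faces by (simp add: dual_graph_def[of ?H] map_graph_def)
  moreover have "card (faces ?H \<sigma>') = card (pverts G)" unfolding faces by (rule card_image[OF f])
  moreover have "card (parcs ?H) = card ?E" unfolding H by (rule card_image[OF inj])
  ultimately show ?thesis
    using that[of \<sigma>' f] f rot conn planar_embeddingD(3)[OF e] by (simp add: planar_embedding_def)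
qed

section \<open>The reductions\<close>

lemma D3a_facts:
  assumes "pair_graph G" "\<forall>y\<in>{p, q, r}. out_degree (with_proj G) y = 3" "distinct [p, q, r]"
    "{(p, q), (q, r), (p, r)} \<subseteq> parcs G" "{(p, p'), (q, q'), (r, r')} \<subseteq> parcs G" "{p', q', r'} \<inter> {p, q, r} = {}"
  shows "(p, y) \<in> parcs G \<longleftrightarrow> y = q \<or> y = r \<or> y = p'" "(q, y) \<in> parcs G \<longleftrightarrow> y = p \<or> y = r \<or> y = q'"
    "(r, y) \<in> parcs G \<longleftrightarrow> y = p \<or> y = q \<or> y = r'"
proof -
  have "(q, p) \<in> parcs G" "(r, q) \<in> parcs G" "(r, p) \<in> parcs G" using assms(4) pair_graphD(4)[OF assms(1)] by auto
  then show "(p, y) \<in> parcs G \<longleftrightarrow> y = q \<or> y = r \<or> y = p'" "(q, y) \<in> parcs G \<longleftrightarrow> y = p \<or> y = r \<or> y = q'"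
    "(r, y) \<in> parcs G \<longleftrightarrow> y = p \<or> y = q \<or> y = r'"
    using assms(2-6) by (intro nbrs_eq_degree3[OF assms(1)]; auto)+
qed

text \<open>The third neighbours of \<open>p\<close> and \<open>r\<close> come from the degrees
  alone. They may coincide, as in a wheel with four spokes.\<close>

lemma D3b_facts:
  assumes "pair_graph G" "\<forall>y\<in>{p, q, r}. out_degree (with_proj G) y = 3" "distinct [p, q, r]"
    "{(p, q), (q, r)} \<subseteq> parcs G" "(p, r) \<notin> parcs G" "{(s, p), (s, q), (s, r)} \<subseteq> parcs G"
  obtains p' r' where "\<And>y. (p, y) \<in> parcs G \<longleftrightarrow> y = q \<or> y = s \<or> y = p'"
    "\<And>y. (q, y) \<in> parcs G \<longleftrightarrow> y = p \<or> y = r \<or> y = s"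
    "\<And>y. (r, y) \<in> parcs G \<longleftrightarrow> y = q \<or> y = s \<or> y = r'"
    "p' \<notin> {p, q, r, s}" "r' \<notin> {p, q, r, s}" "s \<notin> {p, q, r}"
proof -
  have rev: "(q, p) \<in> parcs G" "(r, q) \<in> parcs G" "(p, s) \<in> parcs G" "(q, s) \<in> parcs G" "(r, s) \<in> parcs G" "(r, p) \<notin> parcs G"
    using assms(4-6) pair_graphD(4)[OF assms(1)] by auto
  have s: "s \<noteq> p" "s \<noteq> q" "s \<noteq> r" using assms(6) pair_graphD(3)[OF assms(1)] by auto
  have third: "\<exists>y'. (y, y') \<in> parcs G \<and> y' \<noteq> q \<and> y' \<noteq> s" if "out_degree (with_proj G) y = 3" for y
  proof (rule ccontr)
    assume "\<not> ?thesis"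
    then have "{w. (y, w) \<in> parcs G} \<subseteq> {q, s}" by blast
    then have "card {w. (y, w) \<in> parcs G} \<le> card {q, s}" by (intro card_mono) auto
    then show False using that s by (simp add: out_degree_eq card_insert_if)
  qed
  obtain p' where p': "(p, p') \<in> parcs G" "p' \<noteq> q" "p' \<noteq> s" using third[of p] assms(2) by auto
  obtain r' where r': "(r, r') \<in> parcs G" "r' \<noteq> q" "r' \<noteq> s" using third[of r] assms(2) by auto
  show ?thesis
  proof (rule that[of p' r'])
    show "(p, y) \<in> parcs G \<longleftrightarrow> y = q \<or> y = s \<or> y = p'" "(q, y) \<in> parcs G \<longleftrightarrow> y = p \<or> y = r \<or> y = s"
      "(r, y) \<in> parcs G \<longleftrightarrow> y = q \<or> y = s \<or> y = r'" for y
      using assms(2-4) rev p' r' s by (intro nbrs_eq_degree3[OF assms(1)]; auto)+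
    show "p' \<notin> {p, q, r, s}" "r' \<notin> {p, q, r, s}" "s \<notin> {p, q, r}"
      using p' r' s assms(5) rev(6) pair_graphD(3)[OF assms(1)] by auto
  qed
qed

section \<open>Reductions under renaming\<close>

lemma d3_step_pair_graph:
  assumes "d3_step G G'" "pair_graph G" shows "pair_graph G'"
  using assms
proof cases
  case (D3a p q r p' q' r' x)
  define N where "N = {p', q', r'}"
  have N: "N \<subseteq> pverts G - {p, q, r}" using D3a pair_graphD(2)[OF assms(2)] by (auto simp: N_def)
  have x: "x \<notin> pverts G" by fact
  have arcs: "(a, b) \<in> parcs G' \<longleftrightarrow> ((a, b) \<in> parcs G \<and> a \<notin> {p, q, r} \<and> b \<notin> {p, q, r}) \<or>
      (a = x \<and> b \<in> N) \<or> (b = x \<and> a \<in> N)" for a b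
    unfolding D3a(1) N_def by auto
  define P where "P = {p, q, r}"
  have V: "pverts G' = insert x (pverts G - P)" using D3a(1) by (simp add: P_def)
  have arcs': "(a, b) \<in> parcs G' \<longleftrightarrow> ((a, b) \<in> parcs G \<and> a \<notin> P \<and> b \<notin> P) \<or> (a = x \<and> b \<in> N) \<or> (b = x \<and> a \<in> N)"
    for a b unfolding arcs P_def by simp
  have NP: "a \<in> pverts G" "a \<notin> P" "a \<noteq> x" if "a \<in> N" for a using that N x by (auto simp: P_def)
  have "finite (pverts G')" using pair_graph_finite(1)[OF assms(2)] V by simp
  moreover have "a \<in> pverts G' \<and> b \<in> pverts G' \<and> a \<noteq> b \<and> (b, a) \<in> parcs G'" if ab: "(a, b) \<in> parcs G'" for a b
  proof -
    consider "(a, b) \<in> parcs G" "a \<notin> P" "b \<notin> P" | "a = x" "b \<in> N" | "b = x" "a \<in> N"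
      using iffD1[OF arcs' ab] by blast
    then show ?thesis
    proof cases
      case 1 then show ?thesis using pair_graphD[OF assms(2) 1(1)] by (simp add: V arcs')
    next
      case 2 then show ?thesis using NP[of b] by (simp add: V arcs')
    next
      case 3 then show ?thesis using NP[of a] by (simp add: V arcs')
    qed
  qed
  ultimately show ?thesis unfolding pair_graph_iff by blast
next
  case (D3b p q r s)
  then show ?thesis
    unfolding D3b(1) pair_graph_iff using pair_graph_finite(1)[OF assms(2)] pair_graphD[OF assms(2)]
    by auto
qed

lemma out_degree_map_graph:
  assumes "pair_graph G" "inj_on f (pverts G)" "y \<in> pverts G"
  shows "out_degree (with_proj (map_graph f G)) (f y) = out_degree (with_proj G) y"
proof -
  have "{w. (f y, w) \<in> parcs (map_graph f G)} = f ` {w. (y, w) \<in> parcs G}"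
  proof
    show "{w. (f y, w) \<in> parcs (map_graph f G)} \<subseteq> f ` {w. (y, w) \<in> parcs G}"
    proof
      fix w assume "w \<in> {w. (f y, w) \<in> parcs (map_graph f G)}"
      then obtain u v where uv: "(u, v) \<in> parcs G" "f u = f y" "w = f v" by auto
      then have "u = y" using assms(2,3) pair_graphD(1)[OF assms(1)] by (auto dest: inj_onD)
      then show "w \<in> f ` {w. (y, w) \<in> parcs G}" using uv by blast
    qed
  qed force
  moreover have "inj_on f {w. (y, w) \<in> parcs G}"
    by (rule inj_on_subset[OF assms(2)]) (use pair_graphD(2)[OF assms(1)] in blast)
  ultimately show ?thesis by (simp add: out_degree_eq card_image)
qed

lemma image_Collect_filter:
  "(\<And>a. a \<in> E \<Longrightarrow> Q (f a) \<longleftrightarrow> P a) \<Longrightarrow> f ` {a \<in> E. P a} = {b \<in> f ` E. Q b}"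
  by auto

lemma map_graph_restrict:
  assumes "pair_graph G" "inj_on f (pverts G)" "X \<subseteq> pverts G" "\<And>v. v \<in> pverts G - X \<Longrightarrow> f' v = f v"
  shows "map_prod f' f' ` {a \<in> parcs G. fst a \<notin> X \<and> snd a \<notin> X} =
    {a \<in> parcs (map_graph f G). fst a \<notin> f ` X \<and> snd a \<notin> f ` X}"
proof -
  have mem: "f v \<in> f ` X \<longleftrightarrow> v \<in> X" if "v \<in> pverts G" for v
    using inj_on_image_mem_iff[OF assms(2) that assms(3)] .
  have "map_prod f' f' ` {a \<in> parcs G. fst a \<notin> X \<and> snd a \<notin> X} =
      map_prod f f ` {a \<in> parcs G. fst a \<notin> X \<and> snd a \<notin> X}"
  proof (rule image_cong[OF refl])
    fix a assume "a \<in> {a \<in> parcs G. fst a \<notin> X \<and> snd a \<notin> X}"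
    then show "map_prod f' f' a = map_prod f f a"
      using assms(4)[of "fst a"] assms(4)[of "snd a"] pair_graphD(1,2)[OF assms(1), of "fst a" "snd a"]
      by (simp add: prod_eq_iff)
  qed
  also have "\<dots> = {a \<in> parcs (map_graph f G). fst a \<notin> f ` X \<and> snd a \<notin> f ` X}"
  proof -
    have "fst (map_prod f f a) \<notin> f ` X \<and> snd (map_prod f f a) \<notin> f ` X \<longleftrightarrow> fst a \<notin> X \<and> snd a \<notin> X"
      if "a \<in> parcs G" for a
      using mem[of "fst a"] mem[of "snd a"] pair_graphD(1,2)[OF assms(1), of "fst a" "snd a"] that by simp
    then show ?thesis unfolding parcs_map_graph by (rule image_Collect_filter)
  qed
  finally show ?thesis .
qed

text \<open>D3a creates a vertex on which the value of \<open>f\<close> may collide with others, so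
  \<open>f\<close> is redirected there to a fresh value; this is where the target type must be
  infinite.\<close>

lemma d3_step_map_graph:
  fixes f :: "'a \<Rightarrow> 'b" and G :: "'a pair_pre_digraph"
  assumes "d3_step G G'" "pair_graph G" "inj_on f (pverts G)" "infinite (UNIV :: 'b set)"
  shows "\<exists>f'. inj_on f' (pverts G') \<and> d3_step (map_graph f G) (map_graph f' G')"
  using assms(1)
proof cases
  case (D3a p q r p' q' r' x)
  note g = assms(2) and inj = assms(3)
  have vs: "p \<in> pverts G" "q \<in> pverts G" "r \<in> pverts G" "p' \<in> pverts G" "q' \<in> pverts G" "r' \<in> pverts G"
    using D3a pair_graphD(2)[OF g] by auto
  have eq: "f y = f z \<longleftrightarrow> y = z" if "y \<in> pverts G" "z \<in> pverts G" for y z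
    using inj that by (auto simp: inj_on_eq_iff)
  obtain x' where x': "x' \<notin> f ` pverts G"
    using ex_new_if_finite[OF assms(4)] pair_graph_finite(1)[OF g] by blast
  define f' where "f' = f(x := x')"
  have f': "f' v = f v" if "v \<in> pverts G" for v using that D3a by (auto simp: f'_def)
  have fx: "f' x = x'" by (simp add: f'_def)
  have inj': "inj_on f' (pverts G')"
  proof (rule inj_on_subset)
    have "inj_on f' (pverts G)" using inj f' by (simp add: inj_on_def)
    moreover have "f' ` pverts G = f ` pverts G" by (rule image_cong[OF refl f'])
    ultimately show "inj_on f' (insert x (pverts G))" using x' fx by (auto simp: inj_on_insert)
    show "pverts G' \<subseteq> insert x (pverts G)" using D3a(1) by auto
  qed
  have "d3_step (map_graph f G)
     \<lparr> pverts = insert x' (pverts (map_graph f G) - {f p, f q, f r}),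
       parcs = {a \<in> parcs (map_graph f G). fst a \<notin> {f p, f q, f r} \<and> snd a \<notin> {f p, f q, f r}} \<union>
         {(x', f p'), (f p', x'), (x', f q'), (f q', x'), (x', f r'), (f r', x')} \<rparr>"
  proof (rule d3_step.D3a)
    show "{f p, f q, f r} \<subseteq> pverts (map_graph f G)" using vs by simp
    show "\<forall>y\<in>{f p, f q, f r}. out_degree (with_proj (map_graph f G)) y = 3"
      using D3a vs out_degree_map_graph[OF g inj] by auto
    show "distinct [f p, f q, f r]" "distinct [f p', f q', f r']" using D3a vs eq by auto
    show "{(f p, f q), (f q, f r), (f p, f r)} \<subseteq> parcs (map_graph f G)"
      "{(f p, f p'), (f q, f q'), (f r, f r')} \<subseteq> parcs (map_graph f G)"
      using D3a by (auto intro: rev_image_eqI)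
    show "{f p', f q', f r'} \<inter> {f p, f q, f r} = {}" using D3a vs eq by auto
    show "x' \<notin> pverts (map_graph f G)" using x' by simp
  qed
  moreover have "map_graph f' G' = \<lparr> pverts = insert x' (pverts (map_graph f G) - {f p, f q, f r}),
       parcs = {a \<in> parcs (map_graph f G). fst a \<notin> {f p, f q, f r} \<and> snd a \<notin> {f p, f q, f r}} \<union>
         {(x', f p'), (f p', x'), (x', f q'), (f q', x'), (x', f r'), (f r', x')} \<rparr>"
  proof -
    have sub: "{p, q, r} \<subseteq> pverts G" using vs by simp
    have "f' ` (pverts G - {p, q, r}) = f ` (pverts G - {p, q, r})"
      by (rule image_cong[OF refl]) (simp add: f')
    also have "\<dots> = f ` pverts G - f ` {p, q, r}" by (rule inj_on_image_set_diff[OF inj]) (use sub in auto)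
    finally have 1: "f' ` (pverts G - {p, q, r}) = pverts (map_graph f G) - {f p, f q, f r}" by simp
    have 2: "map_prod f' f' ` {a \<in> parcs G. fst a \<notin> {p, q, r} \<and> snd a \<notin> {p, q, r}} =
        {a \<in> parcs (map_graph f G). fst a \<notin> {f p, f q, f r} \<and> snd a \<notin> {f p, f q, f r}}"
      using map_graph_restrict[OF g inj sub, of f'] f' by simp
    have 3: "map_prod f' f' ` {(x, p'), (p', x), (x, q'), (q', x), (x, r'), (r', x)} =
        {(x', f p'), (f p', x'), (x', f q'), (f q', x'), (x', f r'), (f r', x')}"
      using f' vs fx by simp
    have "pverts (map_graph f' G') = insert x' (pverts (map_graph f G) - {f p, f q, f r})"
      unfolding pverts_map_graph[of f' G'] unfolding D3a(1) by (simp only: pair_pre_digraph.simps image_insert 1 fx)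
    moreover have "parcs (map_graph f' G') =
        {a \<in> parcs (map_graph f G). fst a \<notin> {f p, f q, f r} \<and> snd a \<notin> {f p, f q, f r}} \<union>
        {(x', f p'), (f p', x'), (x', f q'), (f q', x'), (x', f r'), (f r', x')}"
      unfolding parcs_map_graph[of f' G'] unfolding D3a(1) by (simp only: pair_pre_digraph.simps image_Un 2 3)
    ultimately show ?thesis by (cases "map_graph f' G'") (simp only: pair_pre_digraph.simps)
  qed
  ultimately show ?thesis using inj' by metis
next
  case (D3b p q r s)
  note g = assms(2) and inj = assms(3)
  have vs: "p \<in> pverts G" "q \<in> pverts G" "r \<in> pverts G" "s \<in> pverts G"
    using D3b pair_graphD(1)[OF g] by auto
  have eq: "f y = f z \<longleftrightarrow> y = z" if "y \<in> pverts G" "z \<in> pverts G" for y z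
    using inj that by (auto simp: inj_on_eq_iff)
  have "d3_step (map_graph f G)
     \<lparr> pverts = pverts (map_graph f G) - {f q},
       parcs = {a \<in> parcs (map_graph f G). fst a \<noteq> f q \<and> snd a \<noteq> f q} \<union> {(f p, f r), (f r, f p)} \<rparr>"
  proof (rule d3_step.D3b[where s = "f s"])
    show "{f p, f q, f r} \<subseteq> pverts (map_graph f G)" using vs by simp
    show "\<forall>y\<in>{f p, f q, f r}. out_degree (with_proj (map_graph f G)) y = 3"
      using D3b vs out_degree_map_graph[OF g inj] by auto
    show "distinct [f p, f q, f r]" using D3b vs eq by auto
    show "{(f p, f q), (f q, f r)} \<subseteq> parcs (map_graph f G)"
      "{(f s, f p), (f s, f q), (f s, f r)} \<subseteq> parcs (map_graph f G)"
      using D3b by (auto intro: rev_image_eqI)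
    show "(f p, f r) \<notin> parcs (map_graph f G)" using D3b map_graph_arc_iff[OF g inj vs(1,3)] by simp
  qed
  moreover have "map_graph f G' = \<lparr> pverts = pverts (map_graph f G) - {f q},
       parcs = {a \<in> parcs (map_graph f G). fst a \<noteq> f q \<and> snd a \<noteq> f q} \<union> {(f p, f r), (f r, f p)} \<rparr>"
  proof -
    have "f ` (pverts G - {q}) = f ` pverts G - f ` {q}"
      by (rule inj_on_image_set_diff[OF inj]) (use vs in auto)
    moreover have "map_prod f f ` {a \<in> parcs G. fst a \<noteq> q \<and> snd a \<noteq> q} =
        {a \<in> parcs (map_graph f G). fst a \<noteq> f q \<and> snd a \<noteq> f q}"
      using map_graph_restrict[OF g inj, of "{q}" f] vs by simp
    ultimately show ?thesis unfolding D3b(1) by (simp add: map_graph_def image_Un)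
  qed
  moreover have "inj_on f (pverts G')" by (rule inj_on_subset[OF inj]) (use D3b(1) in auto)
  ultimately show ?thesis by metis
qed

lemma d3_steps_map_graph:
  fixes f :: "'a \<Rightarrow> 'b" and G :: "'a pair_pre_digraph"
  assumes "d3_step\<^sup>*\<^sup>* G K" "pair_graph G" "inj_on f (pverts G)" "infinite (UNIV :: 'b set)"
  shows "\<exists>f'. inj_on f' (pverts K) \<and> d3_step\<^sup>*\<^sup>* (map_graph f G) (map_graph f' K) \<and> pair_graph K"
  using assms(1)
proof induction
  case base
  then show ?case using assms by blast
next
  case (step G' K)
  then show ?case using d3_step_map_graph[OF step.hyps(2) _ _ assms(4)] d3_step_pair_graph[OF step.hyps(2)]
    by (meson rtranclp.rtrancl_into_rtrancl)
qed

lemma complete_digraph_map_graph: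
  assumes "complete_digraph n (with_proj K)" "inj_on f (pverts K)"
  shows "complete_digraph n (with_proj (map_graph f K))"
proof -
  have K: "finite (pverts K)" "card (pverts K) = n" "parcs K = {(u, v). (u, v) \<in> pverts K \<times> pverts K \<and> u \<noteq> v}"
    using assms(1) unfolding complete_digraph_pair_def by blast+
  have "map_prod f f ` parcs K = {(u, v). (u, v) \<in> f ` pverts K \<times> f ` pverts K \<and> u \<noteq> v}"
  proof
    show "map_prod f f ` parcs K \<subseteq> {(u, v). (u, v) \<in> f ` pverts K \<times> f ` pverts K \<and> u \<noteq> v}"
      unfolding K(3) using assms(2) by (auto simp: inj_on_eq_iff)
    show "{(u, v). (u, v) \<in> f ` pverts K \<times> f ` pverts K \<and> u \<noteq> v} \<subseteq> map_prod f f ` parcs K"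
    proof
      fix a assume "a \<in> {(u, v). (u, v) \<in> f ` pverts K \<times> f ` pverts K \<and> u \<noteq> v}"
      then obtain x y where "x \<in> pverts K" "y \<in> pverts K" "a = (f x, f y)" "f x \<noteq> f y" by auto
      then show "a \<in> map_prod f f ` parcs K" unfolding K(3) by (intro image_eqI[of _ _ "(x, y)"]) auto
    qed
  qed
  then show ?thesis unfolding complete_digraph_pair_def using K card_image[OF assms(2)] by simp
qed

lemma complete_digraph_three_connected:
  assumes "complete_digraph 4 (with_proj K)" shows "three_connected K" "pair_graph K"
proof -
  have K: "finite (pverts K)" "card (pverts K) = 4" "parcs K = {(u, v). (u, v) \<in> pverts K \<times> pverts K \<and> u \<noteq> v}"
    using assms(1) unfolding complete_digraph_pair_def by blast+
  show g: "pair_graph K" using K(1) unfolding pair_graph_iff K(3) by auto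
  have "conn (parcs K) X" if "X \<subseteq> pverts K" for X
    unfolding conn_def
  proof (intro ballI)
    fix u v assume "u \<in> X" "v \<in> X"
    then have "u = v \<or> (u, v) \<in> parcs K \<inter> X \<times> X" using that by (auto simp: K(3))
    then show "(u, v) \<in> (parcs K \<inter> X \<times> X)\<^sup>*" by auto
  qed
  then show "three_connected K" unfolding three_connected_iff[OF g] using K(2) by auto
qed

section \<open>Reversed reductions preserve 3-connectivity\<close>

lemma rtrancl_restrict_sym:
  "sym E \<Longrightarrow> (a, b) \<in> (E \<inter> X \<times> X)\<^sup>* \<Longrightarrow> (b, a) \<in> (E \<inter> X \<times> X)\<^sup>*"
  using sym_rtrancl[of "E \<inter> X \<times> X"] by (auto simp: sym_def)

lemma conn_attach:
  assumes "sym E" "conn E Y" "Y \<subseteq> X" "\<And>v. v \<in> X \<Longrightarrow> \<exists>c\<in>Y. (v, c) \<in> (E \<inter> X \<times> X)\<^sup>*"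
  shows "conn E X"
proof -
  have sub: "(E \<inter> Y \<times> Y)\<^sup>* \<subseteq> (E \<inter> X \<times> X)\<^sup>*" by (rule rtrancl_mono) (use assms(3) in blast)
  show ?thesis unfolding conn_def
  proof (intro ballI)
    fix u v assume "u \<in> X" "v \<in> X"
    then obtain c d where "c \<in> Y" "(u, c) \<in> (E \<inter> X \<times> X)\<^sup>*" "d \<in> Y" "(v, d) \<in> (E \<inter> X \<times> X)\<^sup>*"
      using assms(4) by blast
    moreover have "(c, d) \<in> (E \<inter> X \<times> X)\<^sup>*" using calculation assms(2) sub by (auto simp: conn_def)
    ultimately show "(u, v) \<in> (E \<inter> X \<times> X)\<^sup>*" using rtrancl_restrict_sym[OF assms(1)] by (meson rtrancl_trans)
  qed
qed

lemma conn_restrict: "conn E' Y \<Longrightarrow> E' \<inter> Y \<times> Y \<subseteq> E \<Longrightarrow> conn E Y"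
  unfolding conn_def by (metis (no_types, lifting) Int_greatest Int_lower2 rtrancl_mono subsetD)

text \<open>Connectivity pulled back along a contraction: \<open>h\<close> chooses a representative
  for each vertex of the small graph, and the small graph's edges become paths of the large
  one.\<close>

lemma conn_lift:
  assumes "conn E' X'" "sym E" "\<And>a b. (a, b) \<in> E' \<Longrightarrow> a \<in> X' \<Longrightarrow> b \<in> X' \<Longrightarrow> (h a, h b) \<in> (E \<inter> X \<times> X)\<^sup>*"
    and "\<And>v. v \<in> X \<Longrightarrow> \<exists>c\<in>X'. (v, h c) \<in> (E \<inter> X \<times> X)\<^sup>*"
  shows "conn E X"
proof -
  have lift: "(h a, h b) \<in> (E \<inter> X \<times> X)\<^sup>*" if "(a, b) \<in> (E' \<inter> X' \<times> X')\<^sup>*" for a b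
    using that
  proof induction
    case (step b c)
    then have "(h b, h c) \<in> (E \<inter> X \<times> X)\<^sup>*" using assms(3) by blast
    then show ?case using step.IH by (rule rtrancl_trans[rotated])
  qed simp
  show ?thesis unfolding conn_def
  proof (intro ballI)
    fix u v assume "u \<in> X" "v \<in> X"
    then obtain c d where "c \<in> X'" "(u, h c) \<in> (E \<inter> X \<times> X)\<^sup>*" "d \<in> X'" "(v, h d) \<in> (E \<inter> X \<times> X)\<^sup>*"
      using assms(4) by blast
    moreover have "(h c, h d) \<in> (E \<inter> X \<times> X)\<^sup>*" using calculation assms(1) lift by (auto simp: conn_def)
    ultimately show "(u, v) \<in> (E \<inter> X \<times> X)\<^sup>*" using rtrancl_restrict_sym[OF assms(2)] by (meson rtrancl_trans)
  qed
qed

lemma card_ge_3_mem: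
  assumes "finite S" "card S < 3" "a \<in> S" "b \<in> S" "a \<noteq> b" "c \<in> S" shows "c = a \<or> c = b"
proof (rule ccontr)
  assume "\<not> ?thesis"
  then have "card {a, b, c} = 3" using assms(5) by auto
  moreover have "card {a, b, c} \<le> card S" using assms by (intro card_mono) auto
  ultimately show False using assms(2) by simp
qed

text \<open>The triangle is the vertex \<open>x\<close> blown up. If the cut misses the triangle,
  walks through \<open>x\<close> become walks through the triangle. If it meets the triangle,
  \<open>x\<close> is cut in \<open>G'\<close> instead, and the surviving corners are attached
  afterwards.\<close>

lemma three_connected_D3a_back:
  assumes g: "pair_graph G" and g': "pair_graph G'" and G': "three_connected G'"
    and V: "pverts G' = insert x (pverts G - {p, q, r})"
    and E: "parcs G' = {a \<in> parcs G. fst a \<notin> {p, q, r} \<and> snd a \<notin> {p, q, r}} \<union>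
               {(x, p'), (p', x), (x, q'), (q', x), (x, r'), (r', x)}"
    and vs: "{p, q, r} \<subseteq> pverts G" "distinct [p, q, r]" and tri: "{(p, q), (q, r), (p, r)} \<subseteq> parcs G"
    and out: "{(p, p'), (q, q'), (r, r')} \<subseteq> parcs G" "{p', q', r'} \<inter> {p, q, r} = {}" "distinct [p', q', r']"
    and x: "x \<notin> pverts G"
  shows "three_connected G"
proof -
  note symE = pair_graph_sym[OF g]
  have N: "p' \<in> pverts G" "q' \<in> pverts G" "r' \<in> pverts G" using out(1) pair_graphD(2)[OF g] by auto
  have all: "(p, q) \<in> parcs G" "(q, p) \<in> parcs G" "(q, r) \<in> parcs G" "(r, q) \<in> parcs G" "(p, r) \<in> parcs G"
    "(r, p) \<in> parcs G" "(p, p') \<in> parcs G" "(p', p) \<in> parcs G" "(q, q') \<in> parcs G" "(q', q) \<in> parcs G"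
    "(r, r') \<in> parcs G" "(r', r) \<in> parcs G"
    using tri out(1) pair_graphD(4)[OF g] by auto
  define C where "C = pverts G - {p, q, r}"
  have NC: "p' \<in> C" "q' \<in> C" "r' \<in> C" using N out(2) by (auto simp: C_def)
  have conn: "conn (parcs G) (pverts G - S)" if S: "S \<subseteq> pverts G" "card S < 3" for S
  proof -
    have finS: "finite S" using S(1) pair_graph_finite(1)[OF g] finite_subset by blast
    let ?X = "pverts G - S"
    let ?R = "(parcs G \<inter> ?X \<times> ?X)\<^sup>*"
    have one: "(a, b) \<in> ?R" if "(a, b) \<in> parcs G" "a \<notin> S" "b \<notin> S" for a b
      using that pair_graphD(1,2)[OF g] by blast
    show ?thesis
    proof (cases "S \<inter> {p, q, r} = {}")
      case True
      then have ns: "p \<notin> S" "q \<notin> S" "r \<notin> S" by auto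
      \<comment> \<open>The corner \<open>p\<close> represents the contracted triangle.\<close>
      define h where "h a = (if a = x then p else a)" for a
      have hv: "h a = a" if "a \<in> pverts G" for a using that x by (auto simp: h_def)
      have hx: "h x = p" by (simp add: h_def)
      show ?thesis
      proof (rule conn_lift[where E' = "parcs G'" and X' = "pverts G' - S" and h = h, OF _ symE])
        show "conn (parcs G') (pverts G' - S)" by (rule three_connectedD[OF G' g' S(2) finS])
        have px: "(p, p') \<in> ?R" if "p' \<notin> S" using that one all ns by blast
        have pq: "(p, q') \<in> ?R" if "q' \<notin> S"
          using one[OF all(1)] one[OF all(9)] that ns by (meson rtrancl_trans)
        have pr: "(p, r') \<in> ?R" if "r' \<notin> S"
          using one[OF all(5)] one[OF all(11)] that ns by (meson rtrancl_trans)
        fix a b assume ab: "(a, b) \<in> parcs G'" "a \<in> pverts G' - S" "b \<in> pverts G' - S"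
        have "(a, b) \<in> parcs G \<or> (a = x \<and> (b = p' \<or> b = q' \<or> b = r')) \<or> (b = x \<and> (a = p' \<or> a = q' \<or> a = r'))"
          using ab(1) unfolding E by auto
        then show "(h a, h b) \<in> ?R"
        proof (elim disjE conjE)
          assume "(a, b) \<in> parcs G"
          then show ?thesis using one[of a b] ab hv pair_graphD(1,2)[OF g] by auto
        qed (use px pq pr rtrancl_restrict_sym[OF symE] ab hx hv N in auto)
      next
        fix v assume v: "v \<in> ?X"
        show "\<exists>c\<in>pverts G' - S. (v, h c) \<in> ?R"
        proof (cases "v \<in> {p, q, r}")
          case True
          have "x \<in> pverts G' - S" using V x S(1) by auto
          moreover have "(v, p) \<in> ?R" using True one all ns by blast
          ultimately show ?thesis using hx by metis
        next
          case False
          then have "v \<in> pverts G' - S" "h v = v" using v V hv by auto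
          then show ?thesis by (metis rtrancl.rtrancl_refl)
        qed
      qed
    next
      case False
      \<comment> \<open>\<open>x\<close> replaces at least one deleted corner, so the cut does not
        grow.\<close>
      define S1 where "S1 = S - {p, q, r}"
      have "card S1 < card S" unfolding S1_def using False finS by (intro psubset_card_mono) auto
      then have "card (insert x S1) < 3" using S(2) finS by (simp add: S1_def card_insert_if)
      then have c': "conn (parcs G') (pverts G' - insert x S1)"
        using three_connectedD[OF G' g'] finS by (simp add: S1_def)
      have eq: "pverts G' - insert x S1 = C - S" using V x by (auto simp: S1_def C_def)
      have cC: "conn (parcs G) (C - S)"
        by (rule conn_restrict[OF c'[unfolded eq]]) (use x in \<open>auto simp: E C_def\<close>)
      \<comment> \<open>If the outside neighbour of the corner \<open>y\<close> is deleted, it and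
        one deleted corner use up the cut; the remaining corner and its outside neighbour survive
        and lead out.\<close>
      have key: "\<exists>c\<in>C - S. (y, c) \<in> ?R"
        if y: "y \<notin> S" "(y, y') \<in> parcs G" "(y, z) \<in> parcs G" "(z, z') \<in> parcs G" "(y, w) \<in> parcs G" "(w, w') \<in> parcs G"
          "y' \<in> C" "z' \<in> C" "w' \<in> C" "y' \<noteq> z'" "y' \<noteq> w'" "z \<in> S \<or> w \<in> S" "z \<notin> C" "w \<notin> C" "z \<noteq> w" for y y' z z' w w'
      proof (cases "y' \<in> S")
        case False
        then show ?thesis using one[OF y(2) y(1)] y(7) by blast
      next
        case True
        show ?thesis
        proof (cases "z \<in> S")
          case zS: True
          have "y' \<noteq> z" using y(7,13) by blast
          then have "w \<notin> S" "w' \<notin> S"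
            using card_ge_3_mem[OF finS S(2) True zS] y by blast+
          then have "(y, w') \<in> ?R" using one[OF y(5) y(1)] one[OF y(6)] by (meson rtrancl_trans)
          then show ?thesis using y(9) \<open>w' \<notin> S\<close> by blast
        next
          case zS: False
          then have wS: "w \<in> S" using y(12) by blast
          have "y' \<noteq> w" using y(7,14) by blast
          then have "z' \<notin> S" using card_ge_3_mem[OF finS S(2) True wS] y by blast
          then have "(y, z') \<in> ?R" using one[OF y(3) y(1) zS] one[OF y(4) zS] by (meson rtrancl_trans)
          then show ?thesis using y(8) \<open>z' \<notin> S\<close> by blast
        qed
      qed
      have nC: "p \<notin> C" "q \<notin> C" "r \<notin> C" by (simp_all add: C_def)
      have d: "p \<noteq> q" "q \<noteq> r" "p \<noteq> r" "p' \<noteq> q'" "p' \<noteq> r'" "q' \<noteq> r'" using vs(2) out(3) by auto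
      show ?thesis
      proof (rule conn_attach[OF symE cC])
        show "C - S \<subseteq> ?X" by (auto simp: C_def)
        fix v assume v: "v \<in> ?X"
        consider "v \<in> C - S" | "v = p" "p \<notin> S" | "v = q" "q \<notin> S" | "v = r" "r \<notin> S" using v by (auto simp: C_def)
        then show "\<exists>c\<in>C - S. (v, c) \<in> ?R"
        proof cases
          case 1 then show ?thesis by blast
        next
          case 2
          then have "q \<in> S \<or> r \<in> S" using False by blast
          then show ?thesis unfolding 2(1)
            using key[OF 2(2) all(7) all(1) all(9) all(5) all(11) NC(1,2,3)] d nC by blast
        next
          case 3
          then have "p \<in> S \<or> r \<in> S" using False by blast
          then show ?thesis unfolding 3(1)
            using key[OF 3(2) all(9) all(2) all(7) all(3) all(11) NC(2,1,3)] d nC by blast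
        next
          case 4
          then have "p \<in> S \<or> q \<in> S" using False by blast
          then show ?thesis unfolding 4(1)
            using key[OF 4(2) all(11) all(6) all(7) all(4) all(9) NC(3,1,2)] d nC by blast
        qed
      qed
    qed
  qed
  have "card {p, q, r, p'} = 4" using vs(2) out(2) by auto
  moreover have "card {p, q, r, p'} \<le> card (pverts G)"
    using vs(1) N by (intro card_mono pair_graph_finite(1)[OF g]) auto
  ultimately show ?thesis using conn by (simp add: three_connected_iff[OF g])
qed

text \<open>If \<open>q\<close> survives, the path through it replaces the new edge, and one of its
  three neighbours survives too. If \<open>q\<close> is deleted, the new edge has to be made useless
  in \<open>G'\<close>, which is done by deleting \<open>p\<close> there.\<close>

lemma three_connected_D3b_back:
  assumes g: "pair_graph G" and g': "pair_graph G'" and G': "three_connected G'"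
    and V: "pverts G' = pverts G - {q}"
    and E: "parcs G' = {a \<in> parcs G. fst a \<noteq> q \<and> snd a \<noteq> q} \<union> {(p, r), (r, p)}"
    and vs: "{p, q, r} \<subseteq> pverts G" "distinct [p, q, r]"
    and arcs: "(p, q) \<in> parcs G" "(q, r) \<in> parcs G" "(q, s) \<in> parcs G" "(p, s) \<in> parcs G" "(p, p') \<in> parcs G"
    and ne: "p' \<notin> {p, q, r, s}" "s \<notin> {p, q, r}"
  shows "three_connected G"
proof -
  note symE = pair_graph_sym[OF g]
  have rev: "(q, p) \<in> parcs G" using arcs(1) pair_graphD(4)[OF g] by blast
  have conn: "conn (parcs G) (pverts G - S)" if S: "S \<subseteq> pverts G" "card S < 3" for S
  proof -
    have finS: "finite S" using S(1) pair_graph_finite(1)[OF g] finite_subset by blast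
    let ?X = "pverts G - S"
    let ?R = "(parcs G \<inter> ?X \<times> ?X)\<^sup>*"
    have one: "(a, b) \<in> ?R" if "(a, b) \<in> parcs G" "a \<notin> S" "b \<notin> S" for a b
      using that pair_graphD(1,2)[OF g] by blast
    show ?thesis
    proof (cases "q \<in> S")
      case True
      \<comment> \<open>\<open>p\<close> takes the place of \<open>q\<close> in the cut. It is put
        back through \<open>s\<close> or \<open>p'\<close>, at most one of which is deleted besides
        \<open>q\<close>.\<close>
      define S1 where "S1 = insert p (S - {q})"
      have "card (S - {q}) < 2" using S(2) True finS by (simp add: card_Diff_singleton)
      then have "card S1 < 3" using finS by (simp add: S1_def card_insert_if)
      then have c': "conn (parcs G') (pverts G' - S1)" using three_connectedD[OF G' g'] finS by (simp add: S1_def)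
      have eq: "pverts G' - S1 = ?X - {p}" using V True by (auto simp: S1_def)
      have cC: "conn (parcs G) (?X - {p})" by (rule conn_restrict[OF c'[unfolded eq]]) (auto simp: E)
      show ?thesis
      proof (rule conn_attach[OF symE cC])
        fix v assume v: "v \<in> ?X"
        show "\<exists>c\<in>?X - {p}. (v, c) \<in> ?R"
        proof (cases "v = p")
          case vp: True
          have "q \<noteq> s" "q \<noteq> p'" "s \<noteq> p'" using ne by auto
          then have "s \<notin> S \<or> p' \<notin> S" using card_ge_3_mem[OF finS S(2) True, of s p'] by blast
          moreover have "s \<noteq> p" "p' \<noteq> p" using ne by auto
          ultimately show ?thesis
            using one[OF arcs(4)] one[OF arcs(5)] v vp pair_graphD(2)[OF g arcs(4)] pair_graphD(2)[OF g arcs(5)]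
            by blast
        next
          case False
          then show ?thesis using v by blast
        qed
      qed blast
    next
      case False
      have c': "conn (parcs G') (pverts G' - S)" by (rule three_connectedD[OF G' g' S(2) finS])
      have qs: "q \<noteq> s" "p \<noteq> q" "q \<noteq> r" "p \<noteq> r" "s \<noteq> p" "s \<noteq> r" using ne vs(2) by auto
      show ?thesis
      proof (rule conn_lift[where E' = "parcs G'" and X' = "pverts G' - S" and h = "\<lambda>a. a", OF c' symE])
        fix a b assume ab: "(a, b) \<in> parcs G'" "a \<in> pverts G' - S" "b \<in> pverts G' - S"
        have "(p, r) \<in> ?R" if "p \<notin> S" "r \<notin> S"
          using one[OF arcs(1)] one[OF arcs(2)] that False by (meson rtrancl_trans)
        moreover have "(a, b) \<in> parcs G \<or> (a = p \<and> b = r) \<or> (a = r \<and> b = p)" using ab(1) unfolding E by auto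
        ultimately show "(a, b) \<in> ?R" using ab one rtrancl_restrict_sym[OF symE] by auto
      next
        fix v assume v: "v \<in> ?X"
        show "\<exists>c\<in>pverts G' - S. (v, c) \<in> ?R"
        proof (cases "v = q")
          case True
          have "p \<notin> S \<or> r \<notin> S \<or> s \<notin> S" using card_ge_3_mem[OF finS S(2), of p r s] qs by blast
          moreover have "p \<in> pverts G'" "r \<in> pverts G'" "s \<in> pverts G'"
            using vs(1) qs V pair_graphD(2)[OF g arcs(3)] by auto
          ultimately show ?thesis
            unfolding True using one[OF rev False] one[OF arcs(2) False] one[OF arcs(3) False] by blast
        next
          case False
          then show ?thesis using v V by blast
        qed
      qed
    qed
  qed
  have "card {p, q, r, s} = 4" using vs(2) ne by auto
  moreover have "card {p, q, r, s} \<le> card (pverts G)"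
    using vs(1) pair_graphD(2)[OF g arcs(3)] by (intro card_mono pair_graph_finite(1)[OF g]) auto
  ultimately show ?thesis using conn by (simp add: three_connected_iff[OF g])
qed

lemma three_connected_d3_back:
  assumes "d3_step G G'" "pair_graph G" "three_connected G'" shows "three_connected G"
  using assms(1)
proof cases
  case (D3a p q r p' q' r' x)
  show ?thesis
    by (rule three_connected_D3a_back[OF assms(2) d3_step_pair_graph[OF assms(1,2)] assms(3) _ _ D3a(2,4-9)])
      (simp_all only: D3a(1) pair_pre_digraph.simps)
next
  case (D3b p q r s)
  obtain p' r' where f: "\<And>y. (p, y) \<in> parcs G \<longleftrightarrow> y = q \<or> y = s \<or> y = p'"
    "\<And>y. (q, y) \<in> parcs G \<longleftrightarrow> y = p \<or> y = r \<or> y = s"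
    "\<And>y. (r, y) \<in> parcs G \<longleftrightarrow> y = q \<or> y = s \<or> y = r'"
    "p' \<notin> {p, q, r, s}" "r' \<notin> {p, q, r, s}" "s \<notin> {p, q, r}"
    by (rule D3b_facts[OF assms(2) D3b(3-7)]) blast
  have arcs: "(p, q) \<in> parcs G" "(q, r) \<in> parcs G" "(q, s) \<in> parcs G" "(p, s) \<in> parcs G" "(p, p') \<in> parcs G"
    using f(1,2) by blast+
  show ?thesis
    by (rule three_connected_D3b_back[OF assms(2) d3_step_pair_graph[OF assms(1,2)] assms(3) _ _ D3b(2,4) arcs f(4,6)])
      (simp_all only: D3b(1) pair_pre_digraph.simps)
qed

text \<open>Connectivity is read off the end of the sequence: \<open>K4\<close> is 3-connected, and
  undoing a reduction preserves that.\<close>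

lemma d3_reducible_three_connected:
  assumes "d3_step\<^sup>*\<^sup>* G K" "complete_digraph 4 (with_proj K)" "pair_graph G" shows "three_connected G"
  using assms(1,3)
proof (induction rule: converse_rtranclp_induct)
  case base
  then show ?case using complete_digraph_three_connected(1)[OF assms(2)] by blast
next
  case (step G G')
  then show ?case using three_connected_d3_back d3_step_pair_graph by blast
qed

section \<open>The cycle space\<close>

abbreviation symdiff :: "'a set \<Rightarrow> 'a set \<Rightarrow> 'a set" where
  "symdiff A B \<equiv> (A - B) \<union> (B - A)"

lemma symdiff_Diff: "symdiff A B - C = symdiff (A - C) (B - C)"
  by blast

lemma odd_card_symdiff:
  assumes "finite A" "finite B" shows "odd (card (symdiff A B)) \<longleftrightarrow> odd (card A) \<noteq> odd (card B)"
proof -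
  have part: "card C = card (C - D) + card (C \<inter> D)" if "finite C" for C D :: "'a set"
  proof -
    have "card ((C - D) \<union> (C \<inter> D)) = card (C - D) + card (C \<inter> D)"
      by (rule card_Un_disjoint) (use that in auto)
    then show ?thesis by (simp only: Un_Diff_Int)
  qed
  have "card A = card (A - B) + card (A \<inter> B)" "card B = card (B - A) + card (A \<inter> B)"
    using part[OF assms(1), of B] part[OF assms(2), of A] by (simp_all only: Int_commute)
  moreover have "card (symdiff A B) = card (A - B) + card (B - A)"
    using assms by (intro card_Un_disjoint) auto
  ultimately show ?thesis by auto
qed

text \<open>\<open>P\<close> holds for as many \<open>a\<close> as it holds for \<open>s a\<close>,
  because \<open>s\<close> is a bijection of \<open>S\<close>; the arguments where the two differ
  form the symmetric difference of two equally large sets.\<close>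

lemma even_card_changes:
  fixes P :: "'a \<Rightarrow> bool"
  assumes "finite S" "s ` S = S"
  shows "even (card {a \<in> S. P a \<noteq> P (s a)})"
proof -
  have inj: "inj_on s S" using assms by (simp add: eq_card_imp_inj_on)
  let ?A = "{a \<in> S. P a}" and ?B = "{a \<in> S. P (s a)}"
  have "s ` ?B = ?A" using assms(2) by auto
  moreover have "card (s ` ?B) = card ?B" by (rule card_image[OF inj_on_subset[OF inj]]) blast
  ultimately have "card ?A = card ?B" by simp
  moreover have "symdiff ?A ?B = {a \<in> S. P a \<noteq> P (s a)}" by auto
  ultimately show ?thesis using odd_card_symdiff[of ?A ?B] assms(1) by simp
qed

text \<open>The boundary modulo 2: on a set of arcs closed under reversal, the arcs leaving
  \<open>v\<close> count the edges at \<open>v\<close>.\<close>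

definition arc_boundary :: "'a pair_pre_digraph \<Rightarrow> ('a \<times> 'a) set \<Rightarrow> 'a set" where
  "arc_boundary G X = {v \<in> pverts G. odd (card {a \<in> X. fst a = v})}"

text \<open>Edge sets encoded as arc sets closed under reversal; with \<open>symdiff\<close> they
  form a vector space over the field with two elements.\<close>

definition edge_sets :: "'a pair_pre_digraph \<Rightarrow> ('a \<times> 'a) set set" where
  "edge_sets G = {X. X \<subseteq> parcs G \<and> prod.swap ` X \<subseteq> X}"

lemma arc_boundary_symdiff:
  assumes "finite X" "finite Y"
  shows "arc_boundary G (symdiff X Y) = symdiff (arc_boundary G X) (arc_boundary G Y)"
proof -
  have "{a \<in> symdiff X Y. fst a = v} = symdiff {a \<in> X. fst a = v} {a \<in> Y. fst a = v}" for v by auto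
  then have "odd (card {a \<in> symdiff X Y. fst a = v}) \<longleftrightarrow>
      odd (card {a \<in> X. fst a = v}) \<noteq> odd (card {a \<in> Y. fst a = v})" for v
    using odd_card_symdiff[of "{a \<in> X. fst a = v}" "{a \<in> Y. fst a = v}"] assms by simp
  then show ?thesis unfolding arc_boundary_def by auto
qed

lemma edge_sets_symdiff: "X \<in> edge_sets G \<Longrightarrow> Y \<in> edge_sets G \<Longrightarrow> symdiff X Y \<in> edge_sets G"
proof -
  assume X: "X \<in> edge_sets G" and Y: "Y \<in> edge_sets G"
  have iff: "prod.swap a \<in> Z \<longleftrightarrow> a \<in> Z" if "Z \<in> edge_sets G" for a Z
    using that unfolding edge_sets_def by (metis (no_types, lifting) image_subset_iff mem_Collect_eq swap_swap)
  have "prod.swap a \<in> symdiff X Y" if "a \<in> symdiff X Y" for a using that iff[OF X] iff[OF Y] by blast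
  then show ?thesis using X Y unfolding edge_sets_def by blast
qed

lemma card_edge_sets:
  assumes "pair_graph G" shows "card (edge_sets G) = 2 ^ (card (parcs G) div 2)" "finite (edge_sets G)"
proof -
  let ?e = "\<lambda>(a, b). {a, b}" and ?U = "(\<lambda>(a, b). {a, b}) ` parcs G"
  have fin: "finite (parcs G)" by (rule pair_graph_finite(2)[OF assms])
  have e: "?e a = ?e b \<longleftrightarrow> b = a \<or> b = prod.swap a" for a b :: "'a \<times> 'a"
    by (cases a; cases b) (auto simp: doubleton_eq_iff)
  have "bij_betw (\<lambda>Y. {a \<in> parcs G. ?e a \<in> Y}) (Pow ?U) (edge_sets G)"
  proof (rule bij_betwI)
    show "(\<lambda>Y. {a \<in> parcs G. ?e a \<in> Y}) \<in> Pow ?U \<rightarrow> edge_sets G"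
    proof
      fix Y assume "Y \<in> Pow ?U"
      have "?e (prod.swap a) = ?e a" for a :: "'a \<times> 'a" using e by metis
      then show "{a \<in> parcs G. ?e a \<in> Y} \<in> edge_sets G"
        using swap_parcs[OF assms] unfolding edge_sets_def by auto
    qed
    show "(\<lambda>X. ?e ` X) \<in> edge_sets G \<rightarrow> Pow ?U" unfolding edge_sets_def by blast
    show "?e ` {a \<in> parcs G. ?e a \<in> Y} = Y" if "Y \<in> Pow ?U" for Y using that by blast
    show "{a \<in> parcs G. ?e a \<in> ?e ` X} = X" if X: "X \<in> edge_sets G" for X
    proof
      show "X \<subseteq> {a \<in> parcs G. ?e a \<in> ?e ` X}" using X unfolding edge_sets_def by blast
      show "{a \<in> parcs G. ?e a \<in> ?e ` X} \<subseteq> X"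
      proof
        fix a assume "a \<in> {a \<in> parcs G. ?e a \<in> ?e ` X}"
        then obtain b where "b \<in> X" "?e b = ?e a" by (metis (no_types, lifting) imageE mem_Collect_eq)
        then have "a = b \<or> a = prod.swap b" by (simp only: e)
        then show "a \<in> X" using X \<open>b \<in> X\<close> by (auto simp: edge_sets_def)
      qed
    qed
  qed
  then have "card (edge_sets G) = card (Pow ?U)" by (simp add: bij_betw_same_card)
  also have "\<dots> = 2 ^ (card (parcs G) div 2)" using fin card_parcs_eq[OF assms] by (simp add: card_Pow)
  finally show "card (edge_sets G) = 2 ^ (card (parcs G) div 2)" .
  show "finite (edge_sets G)" by (rule finite_subset[of _ "Pow (parcs G)"]) (use fin in \<open>auto simp: edge_sets_def\<close>)
qed

lemma arc_boundary_edge: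
  assumes "pair_graph G" "(u, w) \<in> parcs G"
  shows "arc_boundary G {(u, w), (w, u)} = {u, w}" "{(u, w), (w, u)} \<in> edge_sets G"
proof -
  note uw = pair_graphD[OF assms]
  have "{a \<in> {(u, w), (w, u)}. fst a = v} = (if v = u then {(u, w)} else if v = w then {(w, u)} else {})" for v
    using uw(3) by auto
  then show "arc_boundary G {(u, w), (w, u)} = {u, w}" using uw unfolding arc_boundary_def by auto
  show "{(u, w), (w, u)} \<in> edge_sets G" using uw assms(2) by (simp add: edge_sets_def)
qed

lemma finite_edge_set: "pair_graph G \<Longrightarrow> X \<in> edge_sets G \<Longrightarrow> finite X"
  using pair_graph_finite(2) unfolding edge_sets_def by (blast intro: finite_subset)

text \<open>A path from \<open>v0\<close> to \<open>u\<close> has boundary \<open>{u}\<close>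
  outside \<open>v0\<close>, and such paths generate everything. The base vertex is left out because
  by parity its membership is decided by the others.\<close>

lemma boundary_surj:
  assumes g: "pair_graph G" and c: "conn (parcs G) (pverts G)" and v0: "v0 \<in> pverts G"
    and S: "S \<subseteq> pverts G - {v0}"
  shows "\<exists>X\<in>edge_sets G. arc_boundary G X - {v0} = S"
proof -
  have path: "\<exists>X\<in>edge_sets G. arc_boundary G X - {v0} = {u} - {v0}" if "(v0, u) \<in> (parcs G \<inter> pverts G \<times> pverts G)\<^sup>*" for u
    using that
  proof induction
    case base
    have "{} \<in> edge_sets G" "arc_boundary G {} - {v0} = {v0} - {v0}" by (simp_all add: edge_sets_def arc_boundary_def)
    then show ?case by blast
  next
    case (step u w)
    then obtain X where X: "X \<in> edge_sets G" "arc_boundary G X - {v0} = {u} - {v0}" by blast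
    let ?Y = "{(u, w), (w, u)}"
    have uw: "(u, w) \<in> parcs G" "u \<noteq> w" using step.hyps(2) pair_graphD(3)[OF g] by auto
    note Y = arc_boundary_edge[OF g uw(1)]
    have "arc_boundary G (symdiff X ?Y) = symdiff (arc_boundary G X) {u, w}"
      using arc_boundary_symdiff[OF finite_edge_set[OF g X(1)], of ?Y G] Y(1) by simp
    then have "arc_boundary G (symdiff X ?Y) - {v0} = symdiff ({u} - {v0}) ({u, w} - {v0})"
      by (simp only: symdiff_Diff X(2))
    also have "\<dots> = {w} - {v0}" using uw(2) by auto
    finally have "arc_boundary G (symdiff X ?Y) - {v0} = {w} - {v0}" .
    then show ?case using edge_sets_symdiff[OF X(1) Y(2)] by blast
  qed
  have "finite S" using S pair_graph_finite(1)[OF g] finite_subset by blast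
  then show ?thesis using S
  proof (induction S)
    case empty
    have "{} \<in> edge_sets G" "arc_boundary G {} - {v0} = {}" by (simp_all add: edge_sets_def arc_boundary_def)
    then show ?case by blast
  next
    case (insert u S)
    then obtain X where X: "X \<in> edge_sets G" "arc_boundary G X - {v0} = S" by blast
    have u: "u \<in> pverts G" "u \<noteq> v0" using insert.prems by auto
    then have "(v0, u) \<in> (parcs G \<inter> pverts G \<times> pverts G)\<^sup>*" using c v0 by (simp add: conn_def)
    then obtain Y where Y: "Y \<in> edge_sets G" "arc_boundary G Y - {v0} = {u}" using path u by fastforce
    have "arc_boundary G (symdiff X Y) = symdiff (arc_boundary G X) (arc_boundary G Y)"
      by (rule arc_boundary_symdiff[OF finite_edge_set[OF g X(1)] finite_edge_set[OF g Y(1)]])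
    then have "arc_boundary G (symdiff X Y) - {v0} = symdiff S {u}" by (simp only: symdiff_Diff X(2) Y(2))
    also have "\<dots> = insert u S" using insert.hyps(2) by auto
    finally have "arc_boundary G (symdiff X Y) - {v0} = insert u S" .
    then show ?case using edge_sets_symdiff[OF X(1) Y(1)] by blast
  qed
qed

definition cycle_space :: "'a pair_pre_digraph \<Rightarrow> ('a \<times> 'a) set set" where
  "cycle_space G = {X \<in> edge_sets G. arc_boundary G X = {}}"

text \<open>Rank and nullity as a count: the translates of the cycle space by the representatives
  \<open>r S\<close> are disjoint. With Euler's formula the inequality is enough.\<close>

lemma card_cycle_space_le:
  assumes g: "pair_graph G" and c: "conn (parcs G) (pverts G)" and v0: "v0 \<in> pverts G"
  shows "2 ^ (card (pverts G) - 1) * card (cycle_space G) \<le> 2 ^ (card (parcs G) div 2)"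
proof -
  let ?P = "Pow (pverts G - {v0})"
  obtain r where r: "r S \<in> edge_sets G" "arc_boundary G (r S) - {v0} = S" if "S \<in> ?P" for S
    using boundary_surj[OF g c v0] by (metis PowD)
  let ?h = "\<lambda>(S, X). symdiff (r S) X"
  have "inj_on ?h (?P \<times> cycle_space G)"
  proof (rule inj_onI, clarify)
    fix S X S' X' assume a: "S \<subseteq> pverts G - {v0}" "S' \<subseteq> pverts G - {v0}" "X \<in> cycle_space G" "X' \<in> cycle_space G"
      "symdiff (r S) X = symdiff (r S') X'"
    have b: "arc_boundary G (symdiff (r S) X) - {v0} = S" if "S \<subseteq> pverts G - {v0}" "X \<in> cycle_space G" for S X
    proof -
      have X: "X \<in> edge_sets G" "arc_boundary G X = {}" using that(2) by (auto simp: cycle_space_def)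
      have S: "S \<in> ?P" using that(1) by blast
      show ?thesis
        using arc_boundary_symdiff[OF finite_edge_set[OF g r(1)[OF S]] finite_edge_set[OF g X(1)], of G] X(2) r(2)[OF S]
        by simp
    qed
    have "S = S'" using b[OF a(1,3)] b[OF a(2,4)] a(5) by simp
    moreover from this have "X = X'" using a(5) by blast
    ultimately show "S = S' \<and> X = X'" by blast
  qed
  moreover have "?h ` (?P \<times> cycle_space G) \<subseteq> edge_sets G"
    using r(1) edge_sets_symdiff by (auto simp: cycle_space_def)
  ultimately have "card (?P \<times> cycle_space G) \<le> card (edge_sets G)"
    using card_inj_on_le card_edge_sets(2)[OF g] by blast
  moreover have "card ?P = 2 ^ (card (pverts G) - 1)"
    using v0 pair_graph_finite(1)[OF g] by (simp add: card_Pow)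
  ultimately show ?thesis by (simp add: card_cartesian_product card_edge_sets(1)[OF g])
qed

section \<open>Face boundaries and triangles that bound a face\<close>

lemma conn_constant:
  assumes "conn E X" "u \<in> X" "v \<in> X" "\<And>a b. (a, b) \<in> E \<Longrightarrow> a \<in> X \<Longrightarrow> b \<in> X \<Longrightarrow> f a = f b"
  shows "f u = f v"
proof -
  have "f u = f v" if "(u, v) \<in> (E \<inter> X \<times> X)\<^sup>*" using that by induction (use assms(4) in auto)
  then show ?thesis using assms(1-3) by (simp add: conn_def)
qed

lemma cyclic_on_constant:
  assumes "cyclic_on s S" "a \<in> S" "b \<in> S" "\<And>x. x \<in> S \<Longrightarrow> f (s x) = f x"
  shows "f a = f b"
proof -
  have "{x \<in> S. f x = f a} = S"
    by (rule cyclic_on_subset_eq[OF assms(1)]) (use assms cyclic_on_inI[OF assms(1)] in auto)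
  then have "b \<in> {x \<in> S. f x = f a}" using assms(3) by (simp only:)
  then show ?thesis by simp
qed

text \<open>In a planar embedding the face boundaries span the cycle space modulo 2, by Euler's formula.\<close>

lemma cycle_is_boundary:
  assumes g: "pair_graph G" and e: "planar_embedding G \<sigma>" and X: "X \<in> cycle_space G" and ne: "parcs G \<noteq> {}"
  shows "\<exists>A. X = {a \<in> parcs G. (face_of \<sigma> a \<in> A) \<noteq> (face_of \<sigma> (prod.swap a) \<in> A)}"
proof -
  let ?E = "parcs G" and ?L = "face_of \<sigma>" and ?F = "faces G \<sigma>"
  let ?b = "\<lambda>A. {a \<in> ?E. (?L a \<in> A) \<noteq> (?L (prod.swap a) \<in> A)}"
  note r = planar_embeddingD(1)[OF e]
  have c: "pverts G \<noteq> {}" "conn ?E (pverts G)" using planar_embeddingD(2)[OF e] connected_iff[OF g] by blast+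
  then obtain v0 where v0: "v0 \<in> pverts G" by blast
  obtain a0 where a0: "a0 \<in> ?E" using ne by blast
  \<comment> \<open>The reverse of \<open>a\<close> and \<open>\<sigma> a\<close> lie on the same
    face, so in a turn around a vertex an edge of the boundary is a change of membership in
    \<open>A\<close>, and changes are even in number.\<close>
  have cyc: "?b A \<in> cycle_space G" for A
  proof -
    have "?b A \<in> edge_sets G" unfolding edge_sets_def using swap_parcs[OF g] by auto
    moreover have "even (card {a \<in> ?b A. fst a = v})" for v
    proof (cases "{a \<in> ?E. fst a = v} = {}")
      case True
      then have "{a \<in> ?b A. fst a = v} = {}" by blast
      then show ?thesis by (metis card.empty even_zero)
    next
      case False
      then have "cyclic_on \<sigma> {a \<in> ?E. fst a = v}" using rotation_systemD(1)[OF r g] by blast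
      then have "even (card {a \<in> {a \<in> ?E. fst a = v}. (?L a \<in> A) \<noteq> (?L (\<sigma> a) \<in> A)})"
        using pair_graph_finite(2)[OF g] by (intro even_card_changes cyclic_on_bij(1)) simp_all
      moreover have "{a \<in> {a \<in> ?E. fst a = v}. (?L a \<in> A) \<noteq> (?L (\<sigma> a) \<in> A)} = {a \<in> ?b A. fst a = v}"
        using face_of_swap[OF r g] by auto
      ultimately show ?thesis by simp
    qed
    ultimately show ?thesis by (simp add: cycle_space_def arc_boundary_def)
  qed
  \<comment> \<open>A set of faces and its complement have the same boundary; excluding the face of
    \<open>a0\<close> picks one of the two.\<close>
  let ?P = "Pow (?F - {?L a0})"
  have "inj_on ?b ?P"
  proof (rule inj_onI)
    fix A B assume AB: "A \<in> ?P" "B \<in> ?P" "?b A = ?b B"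
    \<comment> \<open>\<open>f\<close> marks the arcs whose face lies in just one of
      \<open>A\<close> and \<open>B\<close>. Equal boundaries make it invariant under reversal,
      hence under rotation, hence constant on the connected graph; and it is false at
      \<open>a0\<close>.\<close>
    define f where "f a \<longleftrightarrow> (?L a \<in> A) \<noteq> (?L a \<in> B)" for a
    have fs: "f (prod.swap a) = f a" if "a \<in> ?E" for a using AB(3) that unfolding f_def by blast
    have f\<sigma>: "f (\<sigma> a) = f a" if "a \<in> ?E" for a
      using fs[OF that] face_of_swap[OF r g that] by (simp add: f_def)
    have vert: "f a = f b" if "a \<in> ?E" "b \<in> ?E" "fst a = fst b" for a b
      by (rule cyclic_on_constant[OF rotation_systemD(1)[OF r g that(1)]]) (use that f\<sigma> in auto)
    define h where "h v \<longleftrightarrow> (\<exists>a\<in>?E. fst a = v \<and> f a)" for v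
    have h: "h (fst a) = f a" if "a \<in> ?E" for a using vert that unfolding h_def by metis
    have "h u = h v" if "u \<in> pverts G" "v \<in> pverts G" for u v
    proof (rule conn_constant[OF c(2) that])
      fix a b assume "(a, b) \<in> ?E"
      then show "h a = h b" using h[of "(a, b)"] h[of "(b, a)"] fs[of "(a, b)"] pair_graphD(4)[OF g] by auto
    qed
    moreover have fv: "fst a \<in> pverts G" if "a \<in> ?E" for a
      using pair_graphD(1)[OF g, of "fst a" "snd a"] that by simp
    moreover have "\<not> f a0" using AB(1,2) by (auto simp: f_def)
    ultimately have "\<not> f a" if "a \<in> ?E" for a using h[OF that] h[OF a0] fv[OF that] fv[OF a0] by metis
    then have "?L a \<in> A \<longleftrightarrow> ?L a \<in> B" if "a \<in> ?E" for a using that by (simp add: f_def)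
    moreover have "A \<subseteq> ?L ` ?E" "B \<subseteq> ?L ` ?E" using AB(1,2) by (auto simp: faces_def)
    ultimately show "A = B" by blast
  qed
  then have "card (?b ` ?P) = 2 ^ (card ?F - 1)"
    using a0 finite_faces[OF g] by (subst card_image) (auto simp: card_Pow faces_def)
  moreover have sub: "?b ` ?P \<subseteq> cycle_space G" using cyc by blast
  moreover have fin: "finite (cycle_space G)"
    by (rule finite_subset[OF _ card_edge_sets(2)[OF g]]) (auto simp: cycle_space_def)
  \<comment> \<open>By Euler's formula the exponent left for the cycle space is the number of faces
    minus one, which the boundaries already reach.\<close>
  moreover have "card (cycle_space G) \<le> 2 ^ (card ?F - 1)"
  proof -
    have "card (pverts G) > 0" using v0 pair_graph_finite(1)[OF g] by (auto simp: card_gt_0_iff)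
    moreover have "card ?F > 0" using a0 finite_faces[OF g, of \<sigma>] by (auto simp: card_gt_0_iff faces_def)
    ultimately have "card ?E div 2 = (card (pverts G) - 1) + (card ?F - 1)"
      using planar_embeddingD(3)[OF e] by linarith
    then have "2 ^ (card (pverts G) - 1) * card (cycle_space G) \<le> 2 ^ (card (pverts G) - 1) * 2 ^ (card ?F - 1)"
      using card_cycle_space_le[OF g c(2) v0] by (simp add: power_add)
    then show ?thesis by simp
  qed
  ultimately have "?b ` ?P = cycle_space G" using card_seteq[of "cycle_space G" "?b ` ?P"] by simp
  then have "X \<in> ?b ` ?P" using X by simp
  then show ?thesis by (rule imageE) (rule exI)
qed

text \<open>A combinatorial Jordan argument: the triangle is the boundary of a set \<open>A\<close>
  of faces, and since the other vertices are connected among themselves, all arcs starting at them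
  lie on one side. A face on the other side uses arcs of the triangle only and is the
  triangle.\<close>

lemma planar_triangle_face:
  assumes g: "pair_graph G" and e: "planar_embedding G \<sigma>"
    and tri: "(p, q) \<in> parcs G" "(q, r) \<in> parcs G" "(r, p) \<in> parcs G"
    and c: "conn (parcs G) (pverts G - {p, q, r})"
  shows "{(p, q), (q, r), (r, p)} \<in> faces G \<sigma> \<or> {(q, p), (p, r), (r, q)} \<in> faces G \<sigma>"
proof -
  let ?E = "parcs G" and ?L = "face_of \<sigma>"
  note rs = planar_embeddingD(1)[OF e]
  define X where "X = {(p, q), (q, p), (q, r), (r, q), (r, p), (p, r)}"
  have rev: "(q, p) \<in> ?E" "(r, q) \<in> ?E" "(p, r) \<in> ?E" using tri pair_graphD(4)[OF g] by blast+
  have ne: "p \<noteq> q" "q \<noteq> r" "r \<noteq> p" using tri pair_graphD(3)[OF g] by blast+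
  have XE: "X \<subseteq> ?E" using tri rev by (simp add: X_def)
  have "X \<in> edge_sets G" using XE by (auto simp: edge_sets_def X_def)
  moreover have "even (card {a \<in> X. fst a = v})" for v
  proof -
    have "{a \<in> X. fst a = v} = (if v = p then {(p, q), (p, r)} else if v = q then {(q, p), (q, r)}
        else if v = r then {(r, p), (r, q)} else {})"
      using ne by (auto simp: X_def)
    then show ?thesis using ne by simp
  qed
  ultimately have "X \<in> cycle_space G" by (simp add: cycle_space_def arc_boundary_def)
  then obtain A where A: "X = {a \<in> ?E. (?L a \<in> A) \<noteq> (?L (prod.swap a) \<in> A)}"
    using cycle_is_boundary[OF g e] tri(1) by blast
  define f where "f a \<longleftrightarrow> ?L a \<in> A" for a
  have fX: "a \<in> X \<longleftrightarrow> f a \<noteq> f (prod.swap a)" if "a \<in> ?E" for a using A that by (auto simp: f_def)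
  have X_ends: "fst a \<in> {p, q, r} \<and> snd a \<in> {p, q, r}" if "a \<in> X" for a using that by (auto simp: X_def)
  have f\<sigma>: "f (\<sigma> a) = f a" if "a \<in> ?E" "fst a \<notin> {p, q, r}" for a
    using fX[OF that(1)] X_ends[of a] that(2) face_of_swap[OF rs g that(1)] by (auto simp: f_def)
  have vert: "f a = f b" if "a \<in> ?E" "b \<in> ?E" "fst a = fst b" "fst a \<notin> {p, q, r}" for a b
    by (rule cyclic_on_constant[OF rotation_systemD(1)[OF rs g that(1)]]) (use that f\<sigma> in auto)
  define h where "h v \<longleftrightarrow> (\<exists>a\<in>?E. fst a = v \<and> f a)" for v
  have h: "h (fst a) = f a" if "a \<in> ?E" "fst a \<notin> {p, q, r}" for a using vert that unfolding h_def by metis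
  have hc: "h u = h v" if "u \<in> pverts G - {p, q, r}" "v \<in> pverts G - {p, q, r}" for u v
  proof (rule conn_constant[OF c that])
    fix a b assume ab: "(a, b) \<in> ?E" "a \<in> pverts G - {p, q, r}" "b \<in> pverts G - {p, q, r}"
    have "(a, b) \<notin> X" using X_ends[of "(a, b)"] ab(2) by auto
    then have "f (a, b) = f (b, a)" using fX[OF ab(1)] by simp
    moreover have "h a = f (a, b)" "h b = f (b, a)"
      using h[of "(a, b)"] h[of "(b, a)"] ab pair_graphD(4)[OF g] by auto
    ultimately show "h a = h b" by simp
  qed
  \<comment> \<open>The side of everything off the triangle. If no arc starts there, any value will
    do.\<close>
  obtain t where t: "\<And>a. a \<in> ?E \<Longrightarrow> fst a \<notin> {p, q, r} \<Longrightarrow> f a = t"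
  proof (cases "\<exists>a\<in>?E. fst a \<notin> {p, q, r}")
    case True
    then obtain a where a: "a \<in> ?E" "fst a \<notin> {p, q, r}" by blast
    have fv: "fst b \<in> pverts G" if "b \<in> ?E" for b
      using pair_graphD(1)[OF g, of "fst b" "snd b"] that by simp
    have "f b = f a" if "b \<in> ?E" "fst b \<notin> {p, q, r}" for b
      using h[OF that] h[OF a] hc[of "fst b" "fst a"] that a fv by auto
    then show ?thesis using that by blast
  next
    case False
    then show ?thesis using that by blast
  qed
  \<comment> \<open>If the head of such an arc were off the triangle, the reversed arc would lie on
    the side \<open>t\<close>, and an edge outside \<open>X\<close> has both its arcs on one
    side.\<close>
  have inX: "a \<in> X" if a: "a \<in> ?E" "f a \<noteq> t" for a
  proof -
    have "fst a \<in> {p, q, r}" using t[OF a(1)] a(2) by blast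
    moreover have "snd a \<in> {p, q, r}"
    proof (rule ccontr)
      assume n: "snd a \<notin> {p, q, r}"
      then have "a \<notin> X" using X_ends by blast
      then have "f a = f (prod.swap a)" using fX[OF a(1)] by blast
      moreover have "f (prod.swap a) = t" using t[OF swap_parcs[OF g a(1)]] n by simp
      ultimately show False using a(2) by simp
    qed
    moreover have "fst a \<noteq> snd a" using pair_graphD(3)[OF g, of "fst a" "snd a"] a(1) by simp
    ultimately show ?thesis by (cases a) (auto simp: X_def)
  qed
  have key: "{(x, y), (y, z), (z, x)} \<in> faces G \<sigma>"
    if xyz: "f (x, y) \<noteq> t" "distinct [x, y, z]" "{x, y, z} = {p, q, r}" for x y z
  proof -
    have all: "(a, b) \<in> ?E" if "a \<in> {x, y, z}" "b \<in> {x, y, z}" "a \<noteq> b" for a b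
      using that unfolding xyz(3) using tri rev by auto
    \<comment> \<open>The face walk stays on its side and hence on the triangle. It cannot turn
      back, because \<open>(b, a)\<close> would then be the only arc leaving
      \<open>b\<close>.\<close>
    have step: "\<sigma> (b, a) = (b, d) \<and> f (b, d) \<noteq> t"
      if abd: "f (a, b) \<noteq> t" "distinct [a, b, d]" "{a, b, d} = {p, q, r}" "(a, b) \<in> ?E" "(b, d) \<in> ?E" for a b d
    proof -
      have ba: "(b, a) \<in> ?E" using pair_graphD(4)[OF g abd(4)] .
      have fs: "f (\<sigma> (b, a)) = f (a, b)" using face_of_next[OF rs g abd(4)] by (simp add: f_def)
      then have "\<sigma> (b, a) \<in> X" using inX rotation_systemD(2)[OF rs g ba] abd(1) by simp
      moreover have "fst (\<sigma> (b, a)) = b" using rotation_systemD(3)[OF rs g ba] by simp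
      moreover have "\<sigma> (b, a) \<noteq> (b, a)"
      proof
        assume loop: "\<sigma> (b, a) = (b, a)"
        have cy: "cyclic_on \<sigma> {x \<in> ?E. fst x = b}" using rotation_systemD(1)[OF rs g ba] by simp
        have "{(b, a)} = {x \<in> ?E. fst x = b}"
          by (rule cyclic_on_subset_eq[OF cy]) (use ba loop in auto)
        then show False using abd(2,5) by auto
      qed
      ultimately obtain y where y: "\<sigma> (b, a) = (b, y)" "(b, y) \<in> X" "y \<noteq> a" by (metis prod.collapse)
      have "y \<in> {a, b, d}" using X_ends[OF y(2)] unfolding abd(3) by simp
      moreover have "y \<noteq> b" using y(2) XE pair_graphD(3)[OF g] by blast
      ultimately have "\<sigma> (b, a) = (b, d)" using y by simp
      then show ?thesis using fs abd(1) by simp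
    qed
    have sets: "{y, z, x} = {p, q, r}" "{z, x, y} = {p, q, r}" unfolding xyz(3)[symmetric] by blast+
    have d: "distinct [y, z, x]" "distinct [z, x, y]" using xyz(2) by auto
    have E: "(x, y) \<in> ?E" "(y, z) \<in> ?E" "(z, x) \<in> ?E" using xyz(2) by (auto intro!: all)
    have 1: "\<sigma> (y, x) = (y, z)" "f (y, z) \<noteq> t" using step[OF xyz E(1,2)] by blast+
    have 2: "\<sigma> (z, y) = (z, x)" "f (z, x) \<noteq> t" using step[OF 1(2) d(1) sets(1) E(2,3)] by blast+
    have 3: "\<sigma> (x, z) = (x, y)" using step[OF 2(2) d(2) sets(2) E(3,1)] by blast
    have "cyclic_on (\<sigma> \<circ> prod.swap) {(x, y), (y, z), (z, x)}"
      by (rule cyclic_on_three) (use 1 2 3 in simp_all)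
    then have "?L (x, y) = {(x, y), (y, z), (z, x)}" by (rule face_of_eq) simp
    moreover have "(x, y) \<in> ?E" using all xyz(2) by simp
    ultimately show ?thesis unfolding faces_def by (metis image_eqI)
  qed
  \<comment> \<open>An edge of the triangle has its two arcs on different sides, so one of them
    starts such a walk.\<close>
  have "(p, q) \<in> X" by (simp add: X_def)
  then have "f (p, q) \<noteq> f (q, p)" using fX[OF tri(1)] by simp
  then consider "f (p, q) \<noteq> t" | "f (q, p) \<noteq> t" by blast
  then show ?thesis
  proof cases
    case 1
    then show ?thesis using key[of p q r] ne by auto
  next
    case 2
    then show ?thesis using key[of q p r] ne by (auto simp: insert_commute)
  qed
qed

section \<open>Wheel trees are duals of reducible graphs\<close>

lemma digraph_iso_map_graph:
  assumes "pair_graph G" "inj_on f (pverts G)" "inj_on h (pverts G)"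
  shows "digraph_iso (with_proj (map_graph f G)) (with_proj (map_graph h G))"
proof -
  let ?i = "the_inv_into (pverts G) f"
  have 1: "map_graph (h \<circ> ?i) (map_graph f G) = map_graph h G"
    by (simp only: map_graph_comp[symmetric] map_graph_the_inv_into[OF pair_graph_wf[OF assms(1)] assms(2)])
  have 2: "inj_on (h \<circ> ?i) (pverts (map_graph f G))"
    using assms(2,3) by (simp add: comp_inj_on inj_on_the_inv_into the_inv_into_onto)
  show ?thesis
    unfolding digraph_iso_iff[OF pair_graph_wf[OF pair_graph_map_graph[OF assms(1,2)]]]
    by (rule exI[of _ "h \<circ> ?i"], rule conjI, rule 2, rule 1[symmetric])
qed

lemma dual_graph_map_graph:
  assumes g: "pair_graph G" and f: "inj_on f (pverts G)" and r: "rotation_system G \<sigma>"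
    and face: "\<And>a. a \<in> parcs G \<Longrightarrow> face_of \<sigma>' (map_prod f f a) = map_prod f f ` face_of \<sigma> a"
  shows "dual_graph (map_graph f G) \<sigma>' = map_graph ((`) (map_prod f f)) (dual_graph G \<sigma>)"
    "inj_on ((`) (map_prod f f)) (faces G \<sigma>)"
proof -
  have "(\<lambda>a. (face_of \<sigma>' (map_prod f f a), face_of \<sigma>' (prod.swap (map_prod f f a)))) ` parcs G =
      (\<lambda>a. map_prod ((`) (map_prod f f)) ((`) (map_prod f f)) (face_of \<sigma> a, face_of \<sigma> (prod.swap a))) ` parcs G"
  proof (rule image_cong[OF refl])
    fix a assume a: "a \<in> parcs G"
    have "prod.swap (map_prod f f a) = map_prod f f (prod.swap a)" by (cases a) simp
    then show "(face_of \<sigma>' (map_prod f f a), face_of \<sigma>' (prod.swap (map_prod f f a))) =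
        map_prod ((`) (map_prod f f)) ((`) (map_prod f f)) (face_of \<sigma> a, face_of \<sigma> (prod.swap a))"
      using face[OF a] face[OF swap_parcs[OF g a]] by simp
  qed
  moreover have "faces (map_graph f G) \<sigma>' = (`) (map_prod f f) ` faces G \<sigma>"
    unfolding faces_def parcs_map_graph image_image using face by (rule image_cong[OF refl])
  ultimately show "dual_graph (map_graph f G) \<sigma>' = map_graph ((`) (map_prod f f)) (dual_graph G \<sigma>)"
    unfolding dual_graph_def[of "map_graph f G"] map_graph_def[of "(`) (map_prod f f)"]
    by (simp only: pverts_dual_graph parcs_dual_graph parcs_map_graph image_image)
  show "inj_on ((`) (map_prod f f)) (faces G \<sigma>)"
  proof (rule inj_on_subset[OF inj_on_image_Pow[OF inj_on_map_prod_parcs[OF g f]]])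
    show "faces G \<sigma> \<subseteq> Pow (parcs G)" using face_of_cyclic(3)[OF r g] by (auto simp: faces_def)
  qed
qed

lemma wheel_tree_dual_reducible:
  assumes "wheel_tree G F"
  obtains H :: "nat pair_pre_digraph" and \<sigma> h where "d3_reducible H" "planar_embedding H \<sigma>"
    "inj_on h (pverts G)" "dual_graph H \<sigma> = map_graph h G"
proof -
  note g = wheel_tree_graph[OF assms]
  obtain \<sigma> K where s: "planar_embedding G \<sigma>" "dual_simple G \<sigma>"
    and K: "d3_step\<^sup>*\<^sup>* (dual_graph G \<sigma>) K" "complete_digraph 4 (with_proj K)"
    using wheel_tree_embedding[OF assms] by blast
  let ?H = "dual_graph G \<sigma>"
  note h = pair_graph_dual_graph[OF g(1) s(2)]
  \<comment> \<open>Reducibility yields 3-connectivity of the dual, and with it the connectedness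
    that an embedding of the dual requires.\<close>
  note h3 = d3_reducible_three_connected[OF K h]
  have out: "\<exists>a\<in>parcs G. fst a = v" if "v \<in> pverts G" for v
  proof -
    have "card {w. (v, w) \<in> parcs G} \<noteq> 0" using three_connected_degree[OF g(2,1) that] by simp
    then have "{w. (v, w) \<in> parcs G} \<noteq> {}" by (metis card.empty)
    then show ?thesis by force
  qed
  from planar_dual_embedding[OF g(1) s three_connected_connected[OF h3 h] out]
  obtain \<sigma>' f where f: "planar_embedding ?H \<sigma>'" "inj_on f (pverts G)" "dual_graph ?H \<sigma>' = map_graph f G" .
  obtain e :: "('a \<times> 'a) set \<Rightarrow> nat" where e: "inj_on e (pverts ?H)"
    using finite_imp_inj_to_nat_seg[OF pair_graph_finite(1)[OF h]] by blast
  from planar_embedding_map_graph[OF h e f(1)]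
  obtain \<sigma>'' where s'': "planar_embedding (map_graph e ?H) \<sigma>''"
    "\<And>a. a \<in> parcs ?H \<Longrightarrow> face_of \<sigma>'' (map_prod e e a) = map_prod e e ` face_of \<sigma>' a" by blast
  note D = dual_graph_map_graph[OF h e planar_embeddingD(1)[OF f(1)] s''(2)]
  have eq: "dual_graph (map_graph e ?H) \<sigma>'' = map_graph ((`) (map_prod e e) \<circ> f) G"
    using D(1) by (simp only: f(3) map_graph_comp)
  have "f ` pverts G = faces ?H \<sigma>'"
    using f(3) by (metis pverts_dual_graph pverts_map_graph)
  then have inj: "inj_on ((`) (map_prod e e) \<circ> f) (pverts G)"
    using comp_inj_on[OF f(2)] D(2) by metis
  obtain f' where "inj_on f' (pverts K)" "d3_step\<^sup>*\<^sup>* (map_graph e ?H) (map_graph f' K)"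
    using d3_steps_map_graph[OF K(1) h e] by blast
  then have "d3_reducible (map_graph e ?H)"
    unfolding d3_reducible_def
    using pair_graph_map_graph[OF h e] complete_digraph_map_graph[OF K(2)] by blast
  from that[OF this s''(1) inj eq] show ?thesis .
qed

section \<open>Face labellings\<close>

text \<open>Faces are sets of arcs and change with the arcs when a graph is reduced. Labels can be
  carried over, so that the duals before and after share vertices; \<open>label_graph\<close> is the
  dual drawn on labels.\<close>

definition face_labelling :: "'a pair_pre_digraph \<Rightarrow> ('a \<times> 'a \<Rightarrow> 'a \<times> 'a) \<Rightarrow> ('a \<times> 'a \<Rightarrow> 'b) \<Rightarrow> bool" where
  "face_labelling H \<sigma> L \<longleftrightarrow> (\<forall>a\<in>parcs H. \<forall>b\<in>parcs H. L a = L b \<longleftrightarrow> face_of \<sigma> a = face_of \<sigma> b)"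

definition label_graph :: "('a \<times> 'a \<Rightarrow> 'b) \<Rightarrow> 'a pair_pre_digraph \<Rightarrow> 'b pair_pre_digraph" where
  "label_graph L H = \<lparr> pverts = L ` parcs H, parcs = (\<lambda>a. (L a, L (prod.swap a))) ` parcs H \<rparr>"

text \<open>The labels of \<open>darts H x\<close> are the faces around \<open>x\<close>; for a
  cubic \<open>x\<close> they form its dual triangle.\<close>

definition darts :: "'a pair_pre_digraph \<Rightarrow> 'a \<Rightarrow> ('a \<times> 'a) set" where
  "darts H x = {a \<in> parcs H. fst a = x}"

text \<open>Vertices of degree three correspond to unused triangles; distinct vertices must get distinct
  ones so that gluing along one triangle leaves the others available.\<close>

definition wheel_dual :: "'a pair_pre_digraph \<Rightarrow> ('a \<times> 'a \<Rightarrow> 'a \<times> 'a) \<Rightarrow> bool" where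
  "wheel_dual H \<sigma> \<longleftrightarrow> (\<exists>(L :: 'a \<times> 'a \<Rightarrow> nat) F. face_labelling H \<sigma> L \<and> wheel_tree (label_graph L H) F \<and>
     (\<forall>x\<in>pverts H. card (darts H x) = 3 \<longrightarrow> L ` darts H x \<in> F) \<and>
     inj_on (\<lambda>x. L ` darts H x) {x \<in> pverts H. card (darts H x) = 3})"

lemma label_graph_simps [simp]:
  "pverts (label_graph L H) = L ` parcs H"
  "parcs (label_graph L H) = (\<lambda>a. (L a, L (prod.swap a))) ` parcs H"
  by (simp_all add: label_graph_def)

lemma out_degree_darts: "out_degree (with_proj H) x = card (darts H x)"
  by (simp add: out_degree_def out_arcs_with_proj darts_def)

lemma label_graph_dual_iso:
  assumes "face_labelling H \<sigma> L" "pair_graph H"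
  obtains f where "inj_on f (pverts (label_graph L H))" "dual_graph H \<sigma> = map_graph f (label_graph L H)"
proof -
  have eq: "L a = L b \<longleftrightarrow> face_of \<sigma> a = face_of \<sigma> b" if "a \<in> parcs H" "b \<in> parcs H" for a b
    using assms(1) that unfolding face_labelling_def by blast
  define f where "f n = face_of \<sigma> (SOME a. a \<in> parcs H \<and> L a = n)" for n
  have f: "f (L a) = face_of \<sigma> a" if a: "a \<in> parcs H" for a
  proof -
    let ?b = "SOME b. b \<in> parcs H \<and> L b = L a"
    have "?b \<in> parcs H \<and> L ?b = L a" by (rule someI[of _ a]) (use a in blast)
    then show ?thesis using eq[of ?b a] a by (simp add: f_def)
  qed
  show ?thesis
  proof (rule that)
    show "inj_on f (pverts (label_graph L H))"
      by (rule inj_onI) (use f eq in auto)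
    have "(\<lambda>a. (face_of \<sigma> a, face_of \<sigma> (prod.swap a))) ` parcs H = (\<lambda>a. (f (L a), f (L (prod.swap a)))) ` parcs H"
      by (rule image_cong[OF refl]) (use f swap_parcs[OF assms(2)] in simp)
    moreover have "face_of \<sigma> ` parcs H = (\<lambda>a. f (L a)) ` parcs H"
      by (rule image_cong[OF refl]) (use f in simp)
    ultimately show "dual_graph H \<sigma> = map_graph f (label_graph L H)"
      by (simp add: dual_graph_def map_graph_def faces_def image_image)
  qed
qed

text \<open>The face step of the reduced graph follows the old one and passes over at most one
  deleted arc at a time, so faces correspond. \<open>D\<close> may leave out arcs, namely those of a
  new face that has no single old counterpart.\<close>

lemma skip_faces:
  assumes r: "rotation_system H \<sigma>" and g: "pair_graph H"
    and D: "inj_on \<kappa> D" "\<kappa> ` D \<subseteq> parcs H" "\<And>b. b \<in> D \<Longrightarrow> \<sigma>' (prod.swap b) \<in> D"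
    and step: "\<And>b. b \<in> D \<Longrightarrow> \<kappa> (\<sigma>' (prod.swap b)) = \<sigma> (prod.swap (\<kappa> b)) \<or>
      (\<sigma> (prod.swap (\<kappa> b)) \<notin> \<kappa> ` D \<and> \<kappa> (\<sigma>' (prod.swap b)) = \<sigma> (prod.swap (\<sigma> (prod.swap (\<kappa> b)))))"
    and r': "rotation_system H' \<sigma>'" and g': "pair_graph H'" and D': "D \<subseteq> parcs H'"
    and bc: "b \<in> D" "c \<in> D"
  shows "face_of \<sigma>' b = face_of \<sigma>' c \<longleftrightarrow> face_of \<sigma> (\<kappa> b) = face_of \<sigma> (\<kappa> c)"
proof
  have E: "b \<in> parcs H'" "c \<in> parcs H'" "\<kappa> b \<in> parcs H" "\<kappa> c \<in> parcs H" using bc D' D(2) by auto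
  let ?p = "\<lambda>a. \<sigma> (prod.swap a)"
  have next_face: "?p a \<in> parcs H" "face_of \<sigma> (?p a) = face_of \<sigma> a" if "a \<in> parcs H" for a
    using rotation_systemD(2)[OF r g swap_parcs[OF g that]] face_of_swap[OF r g swap_parcs[OF g that]] by simp_all
  have move: "face_of \<sigma> (\<kappa> (\<sigma>' (prod.swap d))) = face_of \<sigma> (\<kappa> d)" if d: "d \<in> D" for d
  proof -
    have kd: "\<kappa> d \<in> parcs H" using d D(2) by blast
    show ?thesis
      using step[OF d] next_face(2)[OF kd] next_face(2)[OF next_face(1)[OF kd]] by (elim disjE conjE) (simp_all only:)
  qed
  have stay: "d \<in> D \<and> face_of \<sigma> (\<kappa> d) = face_of \<sigma> (\<kappa> b)" if "d \<in> face_of \<sigma>' b" for d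
    using that unfolding face_of_def[of \<sigma>']
  proof induction
    case base
    show ?case using move[OF bc(1)] D(3)[OF bc(1)] by simp
  next
    case (step d)
    then show ?case using move[of d] D(3)[of d] by simp
  qed
  { assume "face_of \<sigma>' b = face_of \<sigma>' c"
    then have "c \<in> face_of \<sigma>' b" using face_of_cyclic(2)[OF r' g' E(2)] by simp
    then show "face_of \<sigma> (\<kappa> b) = face_of \<sigma> (\<kappa> c)" using stay by simp }
  assume "face_of \<sigma> (\<kappa> b) = face_of \<sigma> (\<kappa> c)"
  then have c: "\<kappa> c \<in> face_of \<sigma> (\<kappa> b)" using face_of_cyclic(2)[OF r g E(4)] by simp
  let ?O = "face_of \<sigma>' b"
  have Onext: "\<sigma>' (prod.swap d) \<in> ?O" if "d \<in> ?O" for d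
    using cyclic_on_inI[OF face_of_cyclic(1)[OF r' g' E(1)] that] by simp
  \<comment> \<open>The images of a new walk, together with their immediate successors, are closed
    under the old face step and therefore fill an old face.\<close>
  have "\<kappa> ` ?O \<union> (\<lambda>d. ?p (\<kappa> d)) ` ?O = face_of \<sigma> (\<kappa> b)"
  proof (rule cyclic_on_subset_eq[OF face_of_cyclic(1)[OF r g E(3)]])
    show "\<kappa> ` ?O \<union> (\<lambda>d. ?p (\<kappa> d)) ` ?O \<subseteq> face_of \<sigma> (\<kappa> b)"
    proof -
      have "\<kappa> d \<in> face_of \<sigma> (\<kappa> b) \<and> ?p (\<kappa> d) \<in> face_of \<sigma> (\<kappa> b)" if "d \<in> ?O" for d
      proof -
        have d: "\<kappa> d \<in> parcs H" "face_of \<sigma> (\<kappa> d) = face_of \<sigma> (\<kappa> b)" using stay[OF that] D(2) by auto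
        then show ?thesis
          using face_of_cyclic(2)[OF r g d(1)] face_of_cyclic(2)[OF r g next_face(1)[OF d(1)]] next_face(2)[OF d(1)] by simp
      qed
      then show ?thesis by blast
    qed
    show "\<kappa> ` ?O \<union> (\<lambda>d. ?p (\<kappa> d)) ` ?O \<noteq> {}" using face_of_cyclic(2)[OF r' g' E(1)] by blast
    fix a assume "a \<in> \<kappa> ` ?O \<union> (\<lambda>d. ?p (\<kappa> d)) ` ?O"
    then consider d where "d \<in> ?O" "a = \<kappa> d" | d where "d \<in> ?O" "a = ?p (\<kappa> d)" by blast
    then show "(\<sigma> \<circ> prod.swap) a \<in> \<kappa> ` ?O \<union> (\<lambda>d. ?p (\<kappa> d)) ` ?O"
    proof cases
      case 1
      then show ?thesis by simp
    next
      case 2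
      have dD: "d \<in> D" using stay[OF 2(1)] by blast
      from assms(6)[OF dD] show ?thesis
      proof
        assume "\<kappa> (\<sigma>' (prod.swap d)) = ?p (\<kappa> d)"
        then have "(\<sigma> \<circ> prod.swap) a = ?p (\<kappa> (\<sigma>' (prod.swap d)))" using 2(2) by simp
        then show ?thesis using Onext[OF 2(1)] by blast
      next
        assume "?p (\<kappa> d) \<notin> \<kappa> ` D \<and> \<kappa> (\<sigma>' (prod.swap d)) = ?p (?p (\<kappa> d))"
        then have "(\<sigma> \<circ> prod.swap) a = \<kappa> (\<sigma>' (prod.swap d))" using 2(2) by simp
        then show ?thesis using Onext[OF 2(1)] by blast
      qed
    qed
  qed
  then consider d where "d \<in> ?O" "\<kappa> c = \<kappa> d" | d where "d \<in> ?O" "\<kappa> c = ?p (\<kappa> d)" using c by blast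
  then have "c \<in> ?O"
  proof cases
    case 1
    then have "c = d" using inj_onD[OF D(1)] bc(2) stay by blast
    then show ?thesis using 1(1) by simp
  next
    case 2
    have d: "d \<in> D" using stay[OF 2(1)] by blast
    have "?p (\<kappa> d) \<in> \<kappa> ` D" using 2(2) bc(2) by (metis image_eqI)
    then have "\<kappa> (\<sigma>' (prod.swap d)) = \<kappa> c" using assms(6)[OF d] 2(2) by metis
    then have "\<sigma>' (prod.swap d) = c" using inj_onD[OF D(1)] bc(2) D(3)[OF d] by blast
    then show ?thesis using Onext[OF 2(1)] by simp
  qed
  then show "face_of \<sigma>' b = face_of \<sigma>' c" using face_of_eq_iff[OF r' g' E(1,2)] by simp
qed

text \<open>\<open>\<kappa>\<close> sends arcs of a reduced graph to arcs of the original one; \<open>N\<close> holds the faces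
  that the reduction destroys.\<close>

lemma extend_labelling:
  assumes D: "\<kappa> ` D \<subseteq> parcs H"
    and iff: "\<And>b c. b \<in> D \<Longrightarrow> c \<in> D \<Longrightarrow> face_of \<sigma> (\<kappa> b) = face_of \<sigma> (\<kappa> c) \<longleftrightarrow> L' b = L' c"
    and cover: "\<And>a. a \<in> parcs H \<Longrightarrow> face_of \<sigma> a \<in> N \<or> (\<exists>b\<in>D. face_of \<sigma> a = face_of \<sigma> (\<kappa> b))"
    and disj: "\<And>b. b \<in> D \<Longrightarrow> face_of \<sigma> (\<kappa> b) \<notin> N"
    and new: "inj_on l N" "\<And>b Q. b \<in> D \<Longrightarrow> Q \<in> N \<Longrightarrow> l Q \<noteq> L' b"
  obtains L where "face_labelling H \<sigma> L" "\<And>a b. b \<in> D \<Longrightarrow> face_of \<sigma> a = face_of \<sigma> (\<kappa> b) \<Longrightarrow> L a = L' b"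
    "\<And>a. face_of \<sigma> a \<in> N \<Longrightarrow> L a = l (face_of \<sigma> a)"
proof -
  \<comment> \<open>Some arc of \<open>D\<close> on the same old face; by \<open>iff\<close> its
    label does not depend on the choice.\<close>
  define rep where "rep a = (SOME b. b \<in> D \<and> face_of \<sigma> a = face_of \<sigma> (\<kappa> b))" for a
  have rep: "rep a \<in> D \<and> face_of \<sigma> a = face_of \<sigma> (\<kappa> (rep a))" if "b \<in> D" "face_of \<sigma> a = face_of \<sigma> (\<kappa> b)" for a b
    unfolding rep_def by (rule someI[of _ b]) (use that in blast)
  define L where "L a = (if face_of \<sigma> a \<in> N then l (face_of \<sigma> a) else L' (rep a))" for a
  have old: "L a = L' b" if "b \<in> D" "face_of \<sigma> a = face_of \<sigma> (\<kappa> b)" for a b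
    using rep[OF that] iff[of "rep a" b] disj[OF that(1)] that by (simp add: L_def)
  have nw: "L a = l (face_of \<sigma> a)" if "face_of \<sigma> a \<in> N" for a using that by (simp add: L_def)
  have "L a = L b \<longleftrightarrow> face_of \<sigma> a = face_of \<sigma> b" if ab: "a \<in> parcs H" "b \<in> parcs H" for a b
  proof -
    consider "face_of \<sigma> a \<in> N" "face_of \<sigma> b \<in> N"
      | c where "face_of \<sigma> a \<in> N" "c \<in> D" "face_of \<sigma> b = face_of \<sigma> (\<kappa> c)"
      | c where "face_of \<sigma> b \<in> N" "c \<in> D" "face_of \<sigma> a = face_of \<sigma> (\<kappa> c)"
      | c d where "c \<in> D" "face_of \<sigma> a = face_of \<sigma> (\<kappa> c)" "d \<in> D" "face_of \<sigma> b = face_of \<sigma> (\<kappa> d)"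
      using cover[OF ab(1)] cover[OF ab(2)] by blast
    then show ?thesis
    proof cases
      case 1
      then show ?thesis using nw new(1) by (simp add: inj_on_eq_iff)
    next
      case 2
      then show ?thesis using nw[OF 2(1)] old[OF 2(2,3)] new(2)[OF 2(2,1)] disj[OF 2(2)] by metis
    next
      case 3
      then show ?thesis using nw[OF 3(1)] old[OF 3(2,3)] new(2)[OF 3(2,1)] disj[OF 3(2)] by metis
    next
      case 4
      then show ?thesis using old[OF 4(1,2)] old[OF 4(3,4)] iff[OF 4(1,3)] by simp
    qed
  qed
  then have "face_labelling H \<sigma> L" by (simp add: face_labelling_def)
  from that[OF this old nw] show ?thesis .
qed

lemma card_image_cong_iff:
  assumes "finite D" "\<And>b c. b \<in> D \<Longrightarrow> c \<in> D \<Longrightarrow> f b = f c \<longleftrightarrow> g b = g c"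
  shows "card (f ` D) = card (g ` D)"
proof (rule bij_betw_same_card)
  let ?r = "\<lambda>y. g (SOME b. b \<in> D \<and> f b = y)"
  have r: "?r (f b) = g b" if "b \<in> D" for b
  proof -
    have "(SOME c. c \<in> D \<and> f c = f b) \<in> D \<and> f (SOME c. c \<in> D \<and> f c = f b) = f b"
      by (rule someI[of _ b]) (use that in blast)
    then show ?thesis using assms(2)[of _ b] that by blast
  qed
  show "bij_betw ?r (f ` D) (g ` D)" unfolding bij_betw_def
  proof
    show "inj_on ?r (f ` D)"
    proof (rule inj_onI)
      fix x y assume "x \<in> f ` D" "y \<in> f ` D" "?r x = ?r y"
      then obtain b c where "b \<in> D" "x = f b" "c \<in> D" "y = f c" by blast
      then show "x = y" using \<open>?r x = ?r y\<close> r assms(2) by metis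
    qed
    show "?r ` f ` D = g ` D" unfolding image_image using r by (rule image_cong[OF refl])
  qed
qed

lemma directed_triangle_arc:
  "directed_triangle S Q \<Longrightarrow> u \<in> S \<Longrightarrow> z \<in> S \<Longrightarrow> u \<noteq> z \<Longrightarrow> (u, z) \<in> Q \<or> (z, u) \<in> Q"
  unfolding directed_triangle_def by auto

lemma directed_triangle_out: "directed_triangle S Q \<Longrightarrow> u \<in> S \<Longrightarrow> \<exists>z. (u, z) \<in> Q"
  unfolding directed_triangle_def by auto

text \<open>No triangle of \<open>K4\<close> separates, so under any embedding all four bound faces.
  The face \<open>T v\<close> opposite \<open>v\<close> plays the part of \<open>v\<close> in the
  dual: an edge lies between the faces opposite the two vertices off it, so any two faces are
  adjacent.\<close>

lemma K4_wheel_dual: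
  assumes K: "complete_digraph 4 (with_proj H)" and e: "planar_embedding H \<sigma>"
  shows "wheel_dual H \<sigma>"
proof -
  let ?V = "pverts H"
  have fin: "finite ?V" and cV: "card ?V = 4" and "parcs H = {(u, v). (u, v) \<in> ?V \<times> ?V \<and> u \<noteq> v}"
    using K unfolding complete_digraph_pair_def by blast+
  then have E: "(a, b) \<in> parcs H \<longleftrightarrow> a \<in> ?V \<and> b \<in> ?V \<and> a \<noteq> b" for a b by simp
  have g: "pair_graph H" unfolding pair_graph_iff using fin E by blast
  note r = planar_embeddingD(1)[OF e]
  have three: "\<exists>p q s. ?V - {v} = {p, q, s} \<and> p \<noteq> q \<and> q \<noteq> s \<and> p \<noteq> s" if "v \<in> ?V" for v
  proof -
    have "card (?V - {v}) = 3" using cV fin that by simp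
    then show ?thesis unfolding card_3_iff by blast
  qed
  have "\<exists>Q\<in>faces H \<sigma>. directed_triangle (?V - {v}) Q" if v: "v \<in> ?V" for v
  proof -
    obtain p q s where pqs: "?V - {v} = {p, q, s}" "p \<noteq> q" "q \<noteq> s" "p \<noteq> s" using three[OF v] by blast
    have mem: "p \<in> ?V" "q \<in> ?V" "s \<in> ?V" using pqs(1) by blast+
    have "?V - {p, q, s} = {v}" using pqs(1) v by blast
    then have "conn (parcs H) (?V - {p, q, s})" by (simp add: conn_def)
    then have "{(p, q), (q, s), (s, p)} \<in> faces H \<sigma> \<or> {(q, p), (p, s), (s, q)} \<in> faces H \<sigma>"
      using pqs mem E by (intro planar_triangle_face[OF g e]) auto
    moreover have "directed_triangle {p, q, s} {(q, p), (p, s), (s, q)}"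
      using directed_triangleI[of q p s] by (simp only: insert_commute[of q p])
    ultimately show ?thesis unfolding pqs(1) using directed_triangleI[of p q s] by (elim disjE) (erule rev_bexI, assumption)+
  qed
  then obtain T where T: "\<And>v. v \<in> ?V \<Longrightarrow> T v \<in> faces H \<sigma>" "\<And>v. v \<in> ?V \<Longrightarrow> directed_triangle (?V - {v}) (T v)"
    by metis
  have injT: "v = w" if "v \<in> ?V" "w \<in> ?V" "T v = T w" for v w
    using directed_triangle_unique[OF T(2)[OF that(1)], of "?V - {w}"] T(2)[OF that(2)] that by auto
  have inT: "face_of \<sigma> a = T v \<longleftrightarrow> a \<in> T v" if "a \<in> parcs H" "v \<in> ?V" for a v
    by (rule faces_disjoint[OF r g T(1)[OF that(2)] that(1)])
  have key: "(face_of \<sigma> (u, z) = T v \<and> face_of \<sigma> (z, u) = T w) \<or> (face_of \<sigma> (u, z) = T w \<and> face_of \<sigma> (z, u) = T v)"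
    if uz: "u \<in> ?V" "z \<in> ?V" "u \<noteq> z" and vw: "v \<in> ?V" "w \<in> ?V" "v \<noteq> w" "v \<noteq> u" "v \<noteq> z" "w \<noteq> u" "w \<noteq> z" for u z v w
  proof -
    have arcs: "(u, z) \<in> parcs H" "(z, u) \<in> parcs H" using uz E by auto
    have in_face: "face_of \<sigma> (u, z) = T y \<or> face_of \<sigma> (z, u) = T y" if y: "y \<in> ?V" "y \<noteq> u" "y \<noteq> z" for y
    proof -
      have "(u, z) \<in> T y \<or> (z, u) \<in> T y" by (rule directed_triangle_arc[OF T(2)[OF y(1)]]) (use uz y in auto)
      then show ?thesis by (simp only: inT[OF arcs(1) y(1)] inT[OF arcs(2) y(1)])
    qed
    have "T v \<noteq> T w" using injT vw by blast
    then show ?thesis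
      using in_face[OF vw(1,4,5)] in_face[OF vw(2,6,7)] by (cases "face_of \<sigma> (u, z) = T v") simp_all
  qed
  have others: "\<exists>v w. v \<in> ?V \<and> w \<in> ?V \<and> v \<noteq> w \<and> v \<noteq> a \<and> v \<noteq> b \<and> w \<noteq> a \<and> w \<noteq> b"
    if "a \<in> ?V" "b \<in> ?V" "a \<noteq> b" for a b
  proof -
    have "card (?V - {a, b}) = 2" using cV fin that by (simp add: card_Diff_subset)
    then obtain v w where "?V - {a, b} = {v, w}" "v \<noteq> w" unfolding card_2_iff by blast
    then show ?thesis by blast
  qed
  obtain i :: "('a \<times> 'a) set \<Rightarrow> nat" where i: "inj_on i (faces H \<sigma>)"
    using finite_imp_inj_to_nat_seg[OF finite_faces[OF g]] by blast
  define L where "L a = i (face_of \<sigma> a)" for a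
  define k where "k v = i (T v)" for v
  have L: "face_labelling H \<sigma> L"
    unfolding face_labelling_def L_def using i by (auto simp: inj_on_eq_iff faces_def)
  have k: "k v = k w \<longleftrightarrow> v = w" if "v \<in> ?V" "w \<in> ?V" for v w
    using injT[OF that] inj_onD[OF i _ T(1)[OF that(1)] T(1)[OF that(2)]] by (auto simp: k_def)
  then have kinj: "inj_on k ?V" by (auto intro: inj_onI)
  have Lk: "\<exists>v w. v \<in> ?V \<and> w \<in> ?V \<and> v \<noteq> w \<and> v \<noteq> fst a \<and> L a = k v \<and> L (prod.swap a) = k w" if "a \<in> parcs H" for a
  proof -
    obtain u z where a: "a = (u, z)" by (cases a)
    then have uz: "u \<in> ?V" "z \<in> ?V" "u \<noteq> z" using that E by auto
    then obtain v w where vw: "v \<in> ?V" "w \<in> ?V" "v \<noteq> w" "v \<noteq> u" "v \<noteq> z" "w \<noteq> u" "w \<noteq> z" using others by blast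
    from key[OF uz vw] show ?thesis
    proof
      assume "face_of \<sigma> (u, z) = T v \<and> face_of \<sigma> (z, u) = T w"
      then show ?thesis using vw by (intro exI[of _ v] exI[of _ w]) (simp add: a L_def k_def)
    next
      assume "face_of \<sigma> (u, z) = T w \<and> face_of \<sigma> (z, u) = T v"
      then show ?thesis using vw by (intro exI[of _ w] exI[of _ v]) (simp add: a L_def k_def)
    qed
  qed
  have dart: "k w \<in> L ` darts H v" if vw: "v \<in> ?V" "w \<in> ?V" "v \<noteq> w" for v w
  proof -
    obtain z where z: "(v, z) \<in> T w" using directed_triangle_out[OF T(2)[OF vw(2)], of v] vw by auto
    then have "(v, z) \<in> parcs H" using faces_eq_face_of(3)[OF r g T(1)[OF vw(2)] z] by blast
    moreover from this have "L (v, z) = k w" using inT[of "(v, z)" w] z vw(2) by (simp add: L_def k_def)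
    ultimately show ?thesis by (force simp: darts_def)
  qed
  have darts: "L ` darts H v = k ` (?V - {v})" if v: "v \<in> ?V" for v
  proof
    show "L ` darts H v \<subseteq> k ` (?V - {v})"
    proof
      fix n assume "n \<in> L ` darts H v"
      then obtain a where "a \<in> parcs H" "fst a = v" "n = L a" by (auto simp: darts_def)
      then show "n \<in> k ` (?V - {v})" using Lk by blast
    qed
    show "k ` (?V - {v}) \<subseteq> L ` darts H v" using dart[OF v] by blast
  qed
  have W: "pverts (label_graph L H) = k ` ?V"
  proof
    show "pverts (label_graph L H) \<subseteq> k ` ?V" using Lk by fastforce
    show "k ` ?V \<subseteq> pverts (label_graph L H)"
    proof
      fix n assume "n \<in> k ` ?V"
      then obtain w where w: "w \<in> ?V" "n = k w" by blast
      obtain p where "p \<in> ?V" "p \<noteq> w" using three[OF w(1)] by blast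
      then show "n \<in> pverts (label_graph L H)" using dart[of p w] w by (auto simp: darts_def)
    qed
  qed
  have WE: "(k v, k w) \<in> parcs (label_graph L H)" if vw: "v \<in> ?V" "w \<in> ?V" "v \<noteq> w" for v w
  proof -
    obtain u z where uz: "u \<in> ?V" "z \<in> ?V" "u \<noteq> z" "u \<noteq> v" "u \<noteq> w" "z \<noteq> v" "z \<noteq> w" using others[OF vw] by blast
    have "(L (u, z) = k v \<and> L (z, u) = k w) \<or> (L (z, u) = k v \<and> L (u, z) = k w)"
      using key[OF uz(1-3) vw] uz by (auto simp: L_def k_def)
    moreover have "(u, z) \<in> parcs H" "(z, u) \<in> parcs H" using uz E by auto
    ultimately show ?thesis by force
  qed
  have "parcs (label_graph L H) = {(a, b). a \<in> pverts (label_graph L H) \<and> b \<in> pverts (label_graph L H) \<and> a \<noteq> b}"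
  proof
    show "parcs (label_graph L H) \<subseteq> {(a, b). a \<in> pverts (label_graph L H) \<and> b \<in> pverts (label_graph L H) \<and> a \<noteq> b}"
    proof
      fix x assume "x \<in> parcs (label_graph L H)"
      then obtain a where a: "a \<in> parcs H" "x = (L a, L (prod.swap a))" by auto
      obtain v w where "v \<in> ?V" "w \<in> ?V" "v \<noteq> w" "L a = k v" "L (prod.swap a) = k w" using Lk[OF a(1)] by blast
      then show "x \<in> {(a, b). a \<in> pverts (label_graph L H) \<and> b \<in> pverts (label_graph L H) \<and> a \<noteq> b}"
        unfolding W using a(2) k by simp
    qed
    show "{(a, b). a \<in> pverts (label_graph L H) \<and> b \<in> pverts (label_graph L H) \<and> a \<noteq> b} \<subseteq> parcs (label_graph L H)"
      unfolding W using WE by blast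
  qed
  moreover obtain h where h: "bij_betw h {..3::nat} ?V"
  proof -
    have "{0..<4} = {..3::nat}" by auto
    then show ?thesis using ex_bij_betw_nat_finite[OF fin] that unfolding cV by metis
  qed
  moreover have "(k \<circ> h) ` {..3} = k ` ?V" "inj_on (k \<circ> h) {..3}"
    using h kinj comp_inj_on[of h "{..3}" k] unfolding bij_betw_def image_comp[symmetric] by simp_all
  ultimately have "wheel_at 3 (k \<circ> h) (label_graph L H)" unfolding wheel_at_3 W by blast
  then have wh: "is_wheel (label_graph L H)" using is_wheel_iff by blast
  have "L ` darts H x \<in> tris (label_graph L H)" if x: "x \<in> ?V" for x
  proof -
    obtain p q s where pqs: "?V - {x} = {p, q, s}" "p \<noteq> q" "q \<noteq> s" "p \<noteq> s" using three[OF x] by blast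
    have mem: "p \<in> ?V" "q \<in> ?V" "s \<in> ?V" using pqs(1) by blast+
    have "L ` darts H x = {k p, k q, k s}" unfolding darts[OF x] pqs(1) by simp
    then show ?thesis using trisI[OF WE WE WE] mem pqs by metis
  qed
  moreover have "inj_on (\<lambda>x. L ` darts H x) {x \<in> ?V. card (darts H x) = 3}"
  proof (rule inj_onI)
    fix x y assume xy: "x \<in> {x \<in> ?V. card (darts H x) = 3}" "y \<in> {x \<in> ?V. card (darts H x) = 3}"
      "L ` darts H x = L ` darts H y"
    then have "k ` (?V - {x}) = k ` (?V - {y})" using darts by simp
    then have "?V - {x} = ?V - {y}" using inj_on_image_eq_iff[OF kinj, of "?V - {x}" "?V - {y}"] by blast
    then show "x = y" using xy by blast
  qed
  ultimately show ?thesis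
    unfolding wheel_dual_def using L wheel_tree.wheel[OF wh] by blast
qed

section \<open>Duals of reducible graphs are wheel trees\<close>

lemma darts_three:
  assumes "\<And>y. (v, y) \<in> parcs H \<longleftrightarrow> y = a \<or> y = b \<or> y = c"
  shows "darts H v = {(v, a), (v, b), (v, c)}"
  unfolding darts_def by (auto simp: assms)

lemma cyclic_on_darts:
  assumes "rotation_system H \<sigma>" "pair_graph H" "a \<in> parcs H"
  shows "cyclic_on \<sigma> (darts H (fst a))"
  using rotation_systemD(1)[OF assms] by (simp add: darts_def)

text \<open>A cyclic order of three elements is known once one of its steps is known.\<close>

lemma rotation_three:
  assumes r: "rotation_system H \<sigma>" and g: "pair_graph H"
    and nb: "\<And>y. (v, y) \<in> parcs H \<longleftrightarrow> y = a \<or> y = b \<or> y = c" and d: "distinct [a, b, c]"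
    and s: "\<sigma> (v, a) = (v, b)"
  shows "\<sigma> (v, b) = (v, c)" "\<sigma> (v, c) = (v, a)"
proof -
  have va: "(v, a) \<in> parcs H" by (simp add: nb)
  have cyc: "cyclic_on \<sigma> {(v, a), (v, b), (v, c)}"
    using cyclic_on_darts[OF r g va] darts_three[OF nb] by simp
  have b: "\<sigma> (v, b) \<in> {(v, a), (v, b), (v, c)}" and c: "\<sigma> (v, c) \<in> {(v, a), (v, b), (v, c)}"
    by (rule cyclic_on_inI[OF cyc]; simp)+
  have eq: "\<sigma> x = \<sigma> y \<longleftrightarrow> x = y" if "x \<in> {(v, a), (v, b), (v, c)}" "y \<in> {(v, a), (v, b), (v, c)}" for x y
    using cyclic_on_bij(2)[OF cyc] that by (rule inj_on_eq_iff)
  have "\<sigma> (v, b) \<noteq> (v, a)"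
  proof
    assume ba: "\<sigma> (v, b) = (v, a)"
    have "{(v, a), (v, b)} = {(v, a), (v, b), (v, c)}"
      by (rule cyclic_on_subset_eq[OF cyc]) (use s ba in auto)
    then have "(v, c) \<in> {(v, a), (v, b)}" by (metis insertI1 insertI2)
    then show False using d by auto
  qed
  moreover have "\<sigma> (v, b) \<noteq> (v, b)" using eq[of "(v, a)" "(v, b)"] s d by simp
  ultimately show vb: "\<sigma> (v, b) = (v, c)" using b by simp
  have "\<sigma> (v, c) \<noteq> (v, b)" using eq[of "(v, a)" "(v, c)"] s d by simp
  moreover have "\<sigma> (v, c) \<noteq> (v, c)" using eq[of "(v, b)" "(v, c)"] vb d by simp
  ultimately show "\<sigma> (v, c) = (v, a)" using c by simp
qed

text \<open>Cuts one element out of a cycle by redirecting its predecessor. Under D3b this happens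
  at \<open>s\<close>, which loses its arc to \<open>q\<close>.\<close>

lemma cyclic_on_remove:
  assumes "cyclic_on f S" "c \<in> S" "S \<noteq> {c}" "\<And>a. a \<in> S - {c} \<Longrightarrow> f' a = (if f a = c then f c else f a)"
  shows "cyclic_on f' (S - {c})"
proof (rule cyclic_onI)
  show "S - {c} \<noteq> {}" using assms(2,3) by blast
  show "f' a \<in> S - {c}" if a: "a \<in> S - {c}" for a
  proof (cases "f a = c")
    case True
    have "f c \<noteq> c" using inj_onD[OF cyclic_on_bij(2)[OF assms(1)], of a c] True a assms(2) by auto
    then show ?thesis using assms(4)[OF a] True cyclic_on_inI[OF assms(1,2)] by simp
  next
    case False
    then show ?thesis using assms(4)[OF a] cyclic_on_inI[OF assms(1), of a] a by simp
  qed
  fix A assume A: "A \<subseteq> S - {c}" "A \<noteq> {}" "\<And>a. a \<in> A \<Longrightarrow> f' a \<in> A"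
  have "A \<union> ({c} \<inter> f ` A) = S"
  proof (rule cyclic_on_subset_eq[OF assms(1)])
    show "A \<union> ({c} \<inter> f ` A) \<subseteq> S" using A(1) assms(2) by blast
    show "A \<union> ({c} \<inter> f ` A) \<noteq> {}" using A(2) by blast
    fix a assume "a \<in> A \<union> ({c} \<inter> f ` A)"
    then consider "a \<in> A" "f a = c" | "a \<in> A" "f a \<noteq> c" | d where "a = c" "d \<in> A" "f d = c" by blast
    then show "f a \<in> A \<union> ({c} \<inter> f ` A)"
    proof cases
      case 1
      then show ?thesis by blast
    next
      case 2
      then have "f' a = f a" using assms(4)[of a] A(1) by auto
      then show ?thesis using A(3)[OF 2(1)] by simp
    next
      case 3
      then have "f' d = f c" using assms(4)[of d] A(1) by auto
      then show ?thesis using A(3)[OF 3(2)] 3(1) by simp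
    qed
  qed
  then show "S - {c} \<subseteq> A" by blast
qed

lemma K4_is_wheel:
  assumes "finite (pverts W)" "card (pverts W) = 4" "parcs W = {(a, b). a \<in> pverts W \<and> b \<in> pverts W \<and> a \<noteq> b}"
  shows "is_wheel W"
proof -
  have "{0..<4} = {..3::nat}" by auto
  then obtain h where "bij_betw h {..3::nat} (pverts W)"
    using ex_bij_betw_nat_finite[OF assms(1)] unfolding assms(2) by metis
  then have "wheel_at 3 h W" using assms(3) unfolding wheel_at_3 bij_betw_def by blast
  then show ?thesis using is_wheel_iff by blast
qed

lemma D3a_wheel_dual:
  assumes g: "pair_graph H" and e: "planar_embedding H \<sigma>" and g': "pair_graph H'"
    and c': "Digraph_Component.connected (with_proj H')"
    and V: "pverts H' = insert x (pverts H - {p, q, r})"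
    and E: "\<And>a b. (a, b) \<in> parcs H' \<longleftrightarrow> ((a, b) \<in> parcs H \<and> a \<notin> {p, q, r} \<and> b \<notin> {p, q, r}) \<or>
      (a = x \<and> (b = p' \<or> b = q' \<or> b = r')) \<or> (b = x \<and> (a = p' \<or> a = q' \<or> a = r'))"
    and nb: "\<And>y. (p, y) \<in> parcs H \<longleftrightarrow> y = q \<or> y = r \<or> y = p'"
      "\<And>y. (q, y) \<in> parcs H \<longleftrightarrow> y = p \<or> y = r \<or> y = q'"
      "\<And>y. (r, y) \<in> parcs H \<longleftrightarrow> y = p \<or> y = q \<or> y = r'"
    and ne: "p \<noteq> q" "q \<noteq> r" "p \<noteq> r" "p' \<notin> {p, q, r}" "q' \<notin> {p, q, r}" "r' \<notin> {p, q, r}"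
      "p' \<noteq> q'" "q' \<noteq> r'" "p' \<noteq> r'" "x \<notin> pverts H"
    and T0: "{(p, q), (q, r), (r, p)} \<in> faces H \<sigma>"
    and IH: "\<And>\<sigma>'. planar_embedding H' \<sigma>' \<Longrightarrow> wheel_dual H' \<sigma>'"
  shows "wheel_dual H \<sigma>"
proof -
  note rs = planar_embeddingD(1)[OF e]
  define S where "S = {p, q, r}"
  have Spqr: "p \<in> S" "q \<in> S" "r \<in> S" and SE: "y \<in> S \<Longrightarrow> y = p \<or> y = q \<or> y = r" for y by (auto simp: S_def)
  have nS: "p' \<notin> S" "q' \<notin> S" "r' \<notin> S" using ne by (auto simp: S_def)
  have arcs: "(p, q) \<in> parcs H" "(q, p) \<in> parcs H" "(q, r) \<in> parcs H" "(r, q) \<in> parcs H" "(p, r) \<in> parcs H"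
    "(r, p) \<in> parcs H" "(p, p') \<in> parcs H" "(q, q') \<in> parcs H" "(r, r') \<in> parcs H"
    by (simp_all add: nb)
  have arcs': "(p', p) \<in> parcs H" "(q', q) \<in> parcs H" "(r', r) \<in> parcs H"
    using arcs pair_graphD(4)[OF g] by blast+
  have xS: "x \<notin> S" and SV: "S \<subseteq> pverts H" using ne(10) arcs pair_graphD(1)[OF g] by (auto simp: S_def)
  have xp: "x \<noteq> p'" "x \<noteq> q'" "x \<noteq> r'" using ne(10) arcs' pair_graphD(1)[OF g] by blast+
  \<comment> \<open>\<open>A\<close> holds the three arcs leaving the triangle, and \<open>h\<close>
    gives the corner of an outside neighbour; the value elsewhere is a default.\<close>
  define A where "A = {(p, p'), (q, q'), (r, r')}"
  define h where "h v = (if v = p' then p else if v = q' then q else r)" for v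
  have A1: "u \<in> S \<and> v \<notin> S \<and> (u, v) \<in> parcs H \<and> h v = u \<and> v \<noteq> x \<and> (v, u) \<in> parcs H" if "(u, v) \<in> A" for u v
    using that Spqr nS arcs arcs' ne xp by (auto simp: A_def h_def)
  have A2: "(u, v) \<in> A" if uv: "(u, v) \<in> parcs H" "u \<in> S" "v \<notin> S" for u v
    using SE[OF uv(2)] uv(1,3) Spqr nb by (auto simp: A_def)
  have E': "(a, b) \<in> parcs H' \<longleftrightarrow> ((a, b) \<in> parcs H \<and> a \<notin> S \<and> b \<notin> S) \<or> (a = x \<and> (h b, b) \<in> A) \<or> (b = x \<and> (h a, a) \<in> A)"
    for a b unfolding E S_def A_def h_def using ne by auto
  have V': "pverts H' = insert x (pverts H - S)" using V by (simp add: S_def)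
  \<comment> \<open>The arcs not inside the triangle. \<open>\<kappa>\<close> replaces
    \<open>x\<close> by the right corner, \<open>\<rho>\<close> collapses corners to
    \<open>x\<close>; they are inverse to each other between \<open>parcs H'\<close> and
    \<open>Out\<close>.\<close>
  define Out where "Out = {a \<in> parcs H. fst a \<notin> S \<or> snd a \<notin> S}"
  define \<kappa> where "\<kappa> a = (if fst a = x then (h (snd a), snd a) else if snd a = x then (fst a, h (fst a)) else a)" for a
  define \<rho> where "\<rho> a = (if fst a \<in> S then (x, snd a) else if snd a \<in> S then (fst a, x) else a)" for a
  have inx: "a \<noteq> x" "b \<noteq> x" if "(a, b) \<in> parcs H" for a b using pair_graphD(1,2)[OF g that] ne(10) by auto
  have k1: "\<kappa> a \<in> Out \<and> \<rho> (\<kappa> a) = a \<and> \<kappa> (prod.swap a) = prod.swap (\<kappa> a)" if "a \<in> parcs H'" for a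
  proof -
    obtain u v where a: "a = (u, v)" by (cases a)
    have uv: "(u, v) \<in> parcs H'" using that a by simp
    consider "(u, v) \<in> parcs H" "u \<notin> S" "v \<notin> S" | "u = x" "(h v, v) \<in> A" | "v = x" "(h u, u) \<in> A"
      using uv E' by blast
    then show ?thesis
    proof cases
      case 1
      then show ?thesis using inx[OF 1(1)] by (simp add: a \<kappa>_def \<rho>_def Out_def)
    next
      case 2
      then show ?thesis using A1[OF 2(2)] by (simp add: a \<kappa>_def \<rho>_def Out_def)
    next
      case 3
      then show ?thesis using A1[OF 3(2)] by (simp add: a \<kappa>_def \<rho>_def Out_def)
    qed
  qed
  have k2: "\<rho> a \<in> parcs H' \<and> \<kappa> (\<rho> a) = a" if "a \<in> Out" for a
  proof -
    obtain u v where a: "a = (u, v)" by (cases a)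
    have uv: "(u, v) \<in> parcs H" "u \<notin> S \<or> v \<notin> S" using that a by (auto simp: Out_def)
    consider "u \<notin> S" "v \<notin> S" | "u \<in> S" "v \<notin> S" "(u, v) \<in> A" | "v \<in> S" "u \<notin> S" "(v, u) \<in> A"
      using uv(2) A2[OF uv(1)] A2[OF pair_graphD(4)[OF g uv(1)]] by blast
    then show ?thesis
    proof cases
      case 1
      then show ?thesis using inx[OF uv(1)] uv(1) E' by (simp add: a \<kappa>_def \<rho>_def)
    next
      case 2
      then show ?thesis using A1[OF 2(3)] E' by (simp add: a \<kappa>_def \<rho>_def)
    next
      case 3
      then show ?thesis using A1[OF 3(3)] E' by (simp add: a \<kappa>_def \<rho>_def)
    qed
  qed
  have inj\<kappa>: "inj_on \<kappa> (parcs H')" by (rule inj_on_inverseI[of _ \<rho>]) (use k1 in blast)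
  have im\<kappa>: "\<kappa> ` parcs H' = Out"
  proof
    show "Out \<subseteq> \<kappa> ` parcs H'" using k2 by (metis image_eqI subsetI)
  qed (use k1 in blast)
  have OutE: "Out \<subseteq> parcs H" by (auto simp: Out_def)
  note s0 = triangle_face_step[OF rs g T0]
  have sp: "\<sigma> (p, q) = (p, p')" "\<sigma> (p, p') = (p, r)"
    by (rule rotation_three[OF rs g, of p r q p']; use nb ne s0 in auto)+
  have sq: "\<sigma> (q, r) = (q, q')" "\<sigma> (q, q') = (q, p)"
    by (rule rotation_three[OF rs g, of q p r q']; use nb ne s0 in auto)+
  have sr: "\<sigma> (r, p) = (r, r')" "\<sigma> (r, r') = (r, q)"
    by (rule rotation_three[OF rs g, of r q p r']; use nb ne s0 in auto)+
  \<comment> \<open>The rotation leaves \<open>Out\<close> only from one of the three outward arcs;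
    one face step further it reaches the outward arc of the next corner.\<close>
  have skip: "\<sigma> (prod.swap (\<sigma> a)) \<in> Out" if a: "a \<in> Out" "\<sigma> a \<notin> Out" for a
  proof -
    have aE: "a \<in> parcs H" using a(1) OutE by blast
    have "fst (\<sigma> a) \<in> S" using rotation_systemD(2)[OF rs g aE] a(2) by (auto simp: Out_def)
    then have "fst a \<in> S" using rotation_systemD(3)[OF rs g aE] by simp
    then have "a \<in> A" using A2[of "fst a" "snd a"] aE a(1) by (simp add: Out_def)
    then have "a = (p, p') \<or> a = (q, q') \<or> a = (r, r')" by (simp add: A_def)
    moreover have "(p, p') \<in> Out" "(q, q') \<in> Out" "(r, r') \<in> Out" using arcs nS by (simp_all add: Out_def)
    ultimately show ?thesis using sp sq sr by auto
  qed
  define \<sigma>' where "\<sigma>' a = (if a \<in> parcs H' then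
      if \<sigma> (\<kappa> a) \<in> Out then \<rho> (\<sigma> (\<kappa> a)) else \<rho> (\<sigma> (prod.swap (\<sigma> (\<kappa> a)))) else a)" for a
  have k\<sigma>': "\<sigma>' a \<in> parcs H' \<and> (if \<sigma> (\<kappa> a) \<in> Out then \<kappa> (\<sigma>' a) = \<sigma> (\<kappa> a) else \<kappa> (\<sigma>' a) = \<sigma> (prod.swap (\<sigma> (\<kappa> a))))"
    if "a \<in> parcs H'" for a
    using k2 skip[of "\<kappa> a"] k1[OF that] that by (auto simp: \<sigma>'_def)
  have xarcs: "(x, p') \<in> parcs H'" "(x, q') \<in> parcs H'" "(x, r') \<in> parcs H'"
    "(p', x) \<in> parcs H'" "(q', x) \<in> parcs H'" "(r', x) \<in> parcs H'" by (simp_all add: E)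
  have \<kappa>x: "\<kappa> (x, p') = (p, p')" "\<kappa> (x, q') = (q, q')" "\<kappa> (x, r') = (r, r')"
    "\<kappa> (p', x) = (p', p)" "\<kappa> (q', x) = (q', q)" "\<kappa> (r', x) = (r', r)"
    using xp ne by (auto simp: \<kappa>_def h_def)
  have \<sigma>'x: "\<sigma>' (x, p') = (x, r')" "\<sigma>' (x, q') = (x, p')" "\<sigma>' (x, r') = (x, q')"
    using xarcs \<kappa>x sp sq sr Spqr nS by (simp_all add: \<sigma>'_def Out_def \<rho>_def)
  have dx: "darts H' x = {(x, p'), (x, r'), (x, q')}"
  proof (rule darts_three)
    fix y
    have "(x, y) \<notin> parcs H" using inx by blast
    then show "(x, y) \<in> parcs H' \<longleftrightarrow> y = p' \<or> y = r' \<or> y = q'" using xp by (auto simp: E[of x y])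
  qed
  have keep: "a \<in> Out" if "a \<in> darts H y" "y \<notin> S" for a y using that by (auto simp: darts_def Out_def)
  have fst\<rho>: "fst (\<rho> a) = fst a" if "fst a \<notin> S" for a using that by (simp add: \<rho>_def)
  have dy: "darts H' y = \<rho> ` darts H y" if y: "y \<in> pverts H'" "y \<noteq> x" for y
  proof
    have yS: "y \<notin> S" using y V' by auto
    show "darts H' y \<subseteq> \<rho> ` darts H y"
    proof
      fix b assume "b \<in> darts H' y"
      then have b: "b \<in> parcs H'" "fst b = y" by (auto simp: darts_def)
      then have "fst (\<kappa> b) = y" using y(2) by (simp add: \<kappa>_def)
      then have "\<kappa> b \<in> darts H y" using k1[OF b(1)] OutE by (auto simp: darts_def)
      then show "b \<in> \<rho> ` darts H y" using k1[OF b(1)] by (metis image_eqI)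
    qed
    show "\<rho> ` darts H y \<subseteq> darts H' y"
    proof
      fix b assume "b \<in> \<rho> ` darts H y"
      then obtain a where a: "a \<in> darts H y" "b = \<rho> a" by blast
      then show "b \<in> darts H' y" using k2[OF keep[OF a(1) yS]] fst\<rho>[of a] yS by (simp add: darts_def)
    qed
  qed
  have rs': "rotation_system H' \<sigma>'"
  proof (rule rotation_systemI[OF g'])
    show "\<sigma>' a = a" if "a \<notin> parcs H'" for a using that by (simp add: \<sigma>'_def)
    fix y assume y: "y \<in> pverts H'" "{a \<in> parcs H'. fst a = y} \<noteq> {}"
    have "cyclic_on \<sigma>' (darts H' y)"
    proof (cases "y = x")
      case True
      then show ?thesis unfolding True dx by (intro cyclic_on_three \<sigma>'x)
    next
      case False
      then have yS: "y \<notin> S" using y(1) V' by auto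
      have "darts H' y \<noteq> {}" using y(2) by (simp add: darts_def)
      then have "darts H y \<noteq> {}" using dy[OF y(1) False] by auto
      then obtain a where a: "a \<in> parcs H" "fst a = y" by (auto simp: darts_def)
      show ?thesis unfolding dy[OF y(1) False]
      proof (rule cyclic_on_image)
        show cyc: "cyclic_on \<sigma> (darts H y)" using cyclic_on_darts[OF rs g a(1)] a(2) by simp
        fix b assume b: "b \<in> darts H y"
        have "\<sigma> b \<in> Out" using keep[OF cyclic_on_inI[OF cyc b] yS] .
        then show "\<sigma>' (\<rho> b) = \<rho> (\<sigma> b)" using k2[OF keep[OF b yS]] by (simp add: \<sigma>'_def)
      qed
    qed
    then show "cyclic_on \<sigma>' {a \<in> parcs H'. fst a = y}" by (simp add: darts_def)
  qed
  have iff: "face_of \<sigma>' b = face_of \<sigma>' c \<longleftrightarrow> face_of \<sigma> (\<kappa> b) = face_of \<sigma> (\<kappa> c)"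
    if bc: "b \<in> parcs H'" "c \<in> parcs H'" for b c
  proof (rule skip_faces[OF rs g inj\<kappa> _ _ _ rs' g' subset_refl bc])
    show "\<kappa> ` parcs H' \<subseteq> parcs H" using im\<kappa> OutE by simp
    fix d assume d: "d \<in> parcs H'"
    note sd = swap_parcs[OF g' d]
    show "\<sigma>' (prod.swap d) \<in> parcs H'" using k\<sigma>'[OF sd] by blast
    have ks: "\<kappa> (prod.swap d) = prod.swap (\<kappa> d)" using k1[OF d] by blast
    show "\<kappa> (\<sigma>' (prod.swap d)) = \<sigma> (prod.swap (\<kappa> d)) \<or> \<sigma> (prod.swap (\<kappa> d)) \<notin> \<kappa> ` parcs H' \<and>
        \<kappa> (\<sigma>' (prod.swap d)) = \<sigma> (prod.swap (\<sigma> (prod.swap (\<kappa> d))))"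
      using k\<sigma>'[OF sd] unfolding ks im\<kappa> by (auto split: if_splits)
  qed
  let ?T0 = "{(p, q), (q, r), (r, p)}"
  have inT0: "face_of \<sigma> a = ?T0 \<longleftrightarrow> a \<in> ?T0" if "a \<in> parcs H" for a
    by (rule faces_disjoint[OF rs g T0 that])
  \<comment> \<open>The outer side of each edge of the triangle belongs to a face that also has an
    arc in \<open>Out\<close>, so that face survives.\<close>
  have rev: "face_of \<sigma> (p, r) = face_of \<sigma> (p', p)" "face_of \<sigma> (q, p) = face_of \<sigma> (q', q)"
    "face_of \<sigma> (r, q) = face_of \<sigma> (r', r)"
    using face_of_next[OF rs g arcs'(1)] face_of_next[OF rs g arcs'(2)] face_of_next[OF rs g arcs'(3)] sp sq sr by simp_all
  have inner: "a = (p, q) \<or> a = (q, p) \<or> a = (q, r) \<or> a = (r, q) \<or> a = (p, r) \<or> a = (r, p)"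
    if "a \<in> parcs H" "a \<notin> Out" for a
  proof -
    obtain u v where a: "a = (u, v)" by (cases a)
    have "u \<in> S" "v \<in> S" "u \<noteq> v" using that a pair_graphD(3)[OF g, of u v] by (auto simp: Out_def)
    then show ?thesis using SE[of u] SE[of v] a by auto
  qed
  have EO: "parcs H = Out \<union> {(p, q), (q, p), (q, r), (r, q), (r, p), (p, r)}"
  proof
    show "parcs H \<subseteq> Out \<union> {(p, q), (q, p), (q, r), (r, q), (r, p), (p, r)}"
    proof
      fix a assume "a \<in> parcs H"
      then show "a \<in> Out \<union> {(p, q), (q, p), (q, r), (r, q), (r, p), (p, r)}"
        using inner[of a] by (cases "a \<in> Out") auto
    qed
  qed (use OutE arcs in simp)
  have cover: "face_of \<sigma> a \<in> {?T0} \<or> (\<exists>b\<in>parcs H'. face_of \<sigma> a = face_of \<sigma> (\<kappa> b))" if a: "a \<in> parcs H" for a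
  proof (cases "a \<in> Out")
    case True
    then show ?thesis using k2[OF True] by metis
  next
    case False
    consider "a \<in> ?T0" | "a = (p, r)" | "a = (q, p)" | "a = (r, q)" using inner[OF a False] by auto
    then show ?thesis
    proof cases
      case 1
      then show ?thesis using inT0[OF a] by simp
    next
      case 2
      then show ?thesis using rev(1) xarcs(4) \<kappa>x(4) by metis
    next
      case 3
      then show ?thesis using rev(2) xarcs(5) \<kappa>x(5) by metis
    next
      case 4
      then show ?thesis using rev(3) xarcs(6) \<kappa>x(6) by metis
    qed
  qed
  have disj: "face_of \<sigma> (\<kappa> b) \<notin> {?T0}" if "b \<in> parcs H'" for b
  proof -
    have "\<kappa> b \<in> Out" using k1[OF that] by blast
    moreover have "a \<notin> Out" if "a \<in> ?T0" for a using that Spqr by (auto simp: Out_def)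
    ultimately show ?thesis using inT0[of "\<kappa> b"] OutE by blast
  qed
  have cardF: "card (faces H \<sigma>) = card (faces H' \<sigma>') + 1"
  proof -
    have "faces H \<sigma> = insert ?T0 ((\<lambda>b. face_of \<sigma> (\<kappa> b)) ` parcs H')"
    proof
      show "faces H \<sigma> \<subseteq> insert ?T0 ((\<lambda>b. face_of \<sigma> (\<kappa> b)) ` parcs H')"
      proof
        fix Q assume "Q \<in> faces H \<sigma>"
        then obtain a where a: "a \<in> parcs H" "Q = face_of \<sigma> a" by (auto simp: faces_def)
        from cover[OF a(1)] show "Q \<in> insert ?T0 ((\<lambda>b. face_of \<sigma> (\<kappa> b)) ` parcs H')"
          unfolding a(2) by (elim disjE) (simp, blast)
      qed
      have "face_of \<sigma> (\<kappa> b) \<in> faces H \<sigma>" if "b \<in> parcs H'" for b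
        using k1[OF that] OutE by (auto simp: faces_def)
      then show "insert ?T0 ((\<lambda>b. face_of \<sigma> (\<kappa> b)) ` parcs H') \<subseteq> faces H \<sigma>"
        using T0 by (simp add: image_subset_iff)
    qed
    moreover have "?T0 \<notin> (\<lambda>b. face_of \<sigma> (\<kappa> b)) ` parcs H'" using disj by blast
    moreover have "card (faces H' \<sigma>') = card ((\<lambda>b. face_of \<sigma> (\<kappa> b)) ` parcs H')"
      unfolding faces_def by (rule card_image_cong_iff[OF pair_graph_finite(2)[OF g'] iff])
    ultimately show ?thesis using pair_graph_finite(2)[OF g'] by simp
  qed
  have cardE: "card (parcs H) = card (parcs H') + 6"
  proof -
    let ?I = "{(p, q), (q, p), (q, r), (r, q), (r, p), (p, r)}"
    have "Out \<inter> ?I = {}" using Spqr by (auto simp: Out_def)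
    moreover have "card ?I = 6" using ne(1-3) by simp
    moreover have "finite Out" using finite_subset[OF OutE pair_graph_finite(2)[OF g]] .
    ultimately have "card (parcs H) = card Out + 6" unfolding EO using card_Un_disjoint[of Out ?I] by simp
    then show ?thesis using card_image[OF inj\<kappa>] im\<kappa> by simp
  qed
  have "card S = 3" using ne(1-3) by (simp add: S_def)
  moreover have "card (pverts H - S) = card (pverts H) - card S" by (rule card_Diff_subset[OF _ SV]) (simp add: S_def)
  moreover have "card S \<le> card (pverts H)" by (rule card_mono[OF pair_graph_finite(1)[OF g] SV])
  ultimately have cardV: "card (pverts H) = card (pverts H') + 2"
    using pair_graph_finite(1)[OF g] ne(10) by (simp add: V')
  \<comment> \<open>Two vertices, one face and three edges are lost, so Euler's formula
    persists.\<close>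
  have e': "planar_embedding H' \<sigma>'"
    using planar_embeddingD(3)[OF e] c' rs' by (simp add: planar_embedding_def cardF cardE cardV)
  from IH[OF e'] obtain L' :: "'a \<times> 'a \<Rightarrow> nat" and F where L': "face_labelling H' \<sigma>' L'"
    and F: "wheel_tree (label_graph L' H') F"
    and F3: "\<And>y. y \<in> pverts H' \<Longrightarrow> card (darts H' y) = 3 \<Longrightarrow> L' ` darts H' y \<in> F"
    and Finj: "inj_on (\<lambda>x. L' ` darts H' x) {x \<in> pverts H'. card (darts H' x) = 3}"
    unfolding wheel_dual_def by blast
  let ?G = "label_graph L' H'"
  note wg = wheel_tree_graph[OF F]
  have L'eq: "L' b = L' c \<longleftrightarrow> face_of \<sigma>' b = face_of \<sigma>' c" if "b \<in> parcs H'" "c \<in> parcs H'" for b c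
    using L' that unfolding face_labelling_def by blast
  obtain t where t: "t \<notin> L' ` parcs H'"
    using ex_new_if_finite[of "L' ` parcs H'"] pair_graph_finite(2)[OF g'] by auto
  obtain L where L: "face_labelling H \<sigma> L"
    and Lold: "\<And>a b. b \<in> parcs H' \<Longrightarrow> face_of \<sigma> a = face_of \<sigma> (\<kappa> b) \<Longrightarrow> L a = L' b"
    and Lnew: "\<And>a. face_of \<sigma> a \<in> {?T0} \<Longrightarrow> L a = t"
  proof (rule extend_labelling[of \<kappa> "parcs H'" H \<sigma> L' "{?T0}" "\<lambda>_. t"])
    show "\<kappa> ` parcs H' \<subseteq> parcs H" using im\<kappa> OutE by simp
    show "(face_of \<sigma> (\<kappa> b) = face_of \<sigma> (\<kappa> c)) = (L' b = L' c)" if "b \<in> parcs H'" "c \<in> parcs H'" for b c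
      using iff[OF that] L'eq[OF that] by simp
    show "t \<noteq> L' b" if "b \<in> parcs H'" for b using t that by blast
  qed (use cover disj in \<open>simp_all\<close>)
  define a1 where "a1 = L' (x, p')"
  define a2 where "a2 = L' (x, q')"
  define a3 where "a3 = L' (x, r')"
  \<comment> \<open>A face arriving at \<open>x\<close> leaves it along the next outward arc, so the
    arcs towards \<open>x\<close> carry the same three labels.\<close>
  have L'in: "L' (p', x) = a3" "L' (q', x) = a1" "L' (r', x) = a2"
    using face_of_next[OF rs' g' xarcs(4)] face_of_next[OF rs' g' xarcs(5)] face_of_next[OF rs' g' xarcs(6)]
      L'eq xarcs unfolding \<sigma>'x a1_def a2_def a3_def by simp_all
  have Lk: "L (\<kappa> b) = L' b" if "b \<in> parcs H'" for b by (rule Lold[OF that refl])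
  have Ltri: "L (p, q) = t" "L (q, r) = t" "L (r, p) = t"
    by (rule Lnew; use inT0[OF arcs(1)] inT0[OF arcs(3)] inT0[OF arcs(6)] in simp)+
  have Lrev: "L (p, r) = a3" "L (q, p) = a1" "L (r, q) = a2"
    using Lold[OF xarcs(4), of "(p, r)"] Lold[OF xarcs(5), of "(q, p)"] Lold[OF xarcs(6), of "(r, q)"] rev \<kappa>x L'in by simp_all
  have Lout: "L (p, p') = a1" "L (q, q') = a2" "L (r, r') = a3"
    using Lk[OF xarcs(1)] Lk[OF xarcs(2)] Lk[OF xarcs(3)] \<kappa>x by (simp_all add: a1_def a2_def a3_def)
  define T where "T = {a1, a2, a3}"
  have xd: "x \<in> pverts H'" "card (darts H' x) = 3" using V' dx ne by auto
  have "L' ` darts H' x = T" unfolding dx T_def a1_def a2_def a3_def by auto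
  then have TF: "T \<in> F" using F3[OF xd] by simp
  then have Ttri: "T \<in> tris ?G" using wg(3) by blast
  have Tc: "card T = 3" "T \<subseteq> L' ` parcs H'" using tris_card[OF wg(1) Ttri] by simp_all
  have tT: "t \<notin> T" using Tc(2) t by blast
  have ad: "a1 \<noteq> a2" "a2 \<noteq> a3" "a1 \<noteq> a3" using Tc(1) by (auto simp: T_def card_insert_if split: if_splits)
  have ta: "t \<noteq> a1" "t \<noteq> a2" "t \<noteq> a3" using tT by (auto simp: T_def)
  \<comment> \<open>The tetrahedron on \<open>T\<close> with apex \<open>t\<close>.\<close>
  define W :: "nat pair_pre_digraph" where
    "W = \<lparr> pverts = insert t T, parcs = {(a, b). a \<in> insert t T \<and> b \<in> insert t T \<and> a \<noteq> b} \<rparr>"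
  have W: "is_wheel W"
    by (rule K4_is_wheel) (use Tc tT in \<open>simp_all add: W_def T_def\<close>)
  have Wt: "T \<in> tris W" "{t, a3, a1} \<in> tris W" "{t, a1, a2} \<in> tris W" "{t, a2, a3} \<in> tris W"
    unfolding T_def by (rule trisI; use ad ta in \<open>simp add: W_def T_def\<close>)+
  have GW: "pverts ?G \<inter> pverts W = T" using t Tc(2) by (auto simp: W_def)
  let ?N = "{(t, a1), (a1, t), (t, a2), (a2, t), (t, a3), (a3, t)}"
  \<comment> \<open>Arcs outside the triangle keep their dual edges, and the six inner arcs
    contribute the edges between \<open>t\<close> and \<open>T\<close>. The edges of
    \<open>W\<close> inside \<open>T\<close> are already there, because \<open>T\<close> is a
    triangle of \<open>?G\<close>.\<close>
  have eqG: "label_graph L H = gunion ?G W"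
  proof -
    have LE: "L ` parcs H = insert t (L' ` parcs H')"
    proof
      show "L ` parcs H \<subseteq> insert t (L' ` parcs H')"
      proof
        fix n assume "n \<in> L ` parcs H"
        then obtain a where a: "a \<in> parcs H" "n = L a" by blast
        from cover[OF a(1)] show "n \<in> insert t (L' ` parcs H')" using Lnew[of a] Lold[of _ a] a(2) by blast
      qed
      have "L' b \<in> L ` parcs H" if "b \<in> parcs H'" for b
        using Lk[OF that] k1[OF that] OutE by (metis image_eqI subsetD)
      moreover have "t \<in> L ` parcs H" using Ltri(1) arcs(1) by (metis image_eqI)
      ultimately show "insert t (L' ` parcs H') \<subseteq> L ` parcs H" by blast
    qed
    have LO: "(\<lambda>a. (L a, L (prod.swap a))) ` Out = parcs ?G"
    proof -
      have "(\<lambda>a. (L a, L (prod.swap a))) ` Out = (\<lambda>b. (L (\<kappa> b), L (prod.swap (\<kappa> b)))) ` parcs H'"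
        unfolding im\<kappa>[symmetric] image_image ..
      also have "\<dots> = (\<lambda>b. (L' b, L' (prod.swap b))) ` parcs H'"
      proof (rule image_cong[OF refl])
        fix b assume b: "b \<in> parcs H'"
        have "prod.swap (\<kappa> b) = \<kappa> (prod.swap b)" using k1[OF b] by simp
        then show "(L (\<kappa> b), L (prod.swap (\<kappa> b))) = (L' b, L' (prod.swap b))"
          using Lk[OF b] Lk[OF swap_parcs[OF g' b]] by simp
      qed
      finally show ?thesis by simp
    qed
    have 1: "(\<lambda>a. (L a, L (prod.swap a))) ` parcs H = parcs ?G \<union> ?N"
      by (simp only: EO image_Un LO image_insert image_empty swap_simp Ltri Lrev)
    have adj: "(a, b) \<in> parcs ?G" if "a \<in> T" "b \<in> T" "a \<noteq> b" for a b by (rule tris_adjacent[OF wg(1) Ttri that])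
    have WN: "parcs W = {(a, b). a \<in> T \<and> b \<in> T \<and> a \<noteq> b} \<union> ?N" using ta by (auto simp: W_def T_def)
    have 2: "parcs ?G \<union> parcs W = parcs ?G \<union> ?N" unfolding WN using adj by blast
    have 3: "pverts ?G \<union> pverts W = insert t (L' ` parcs H')" using Tc(2) by (auto simp: W_def)
    show ?thesis
      unfolding gunion_def 2 3 unfolding label_graph_def[of L H] LE 1 ..
  qed
  define F' where "F' = (F - {T}) \<union> (tris W - {T})"
  have wt: "wheel_tree (label_graph L H) F'" unfolding eqG F'_def by (rule wheel_tree.add[OF F W GW TF Wt(1)])
  \<comment> \<open>The dual triangle of a cubic vertex. Those of the corners contain
    \<open>t\<close> and come from \<open>W\<close>; the others are old and differ from
    \<open>T\<close>, which belonged to \<open>x\<close>.\<close>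
  define \<Phi> where "\<Phi> y = L ` darts H y" for y
  have \<Phi>3: "\<Phi> p = {t, a3, a1}" "\<Phi> q = {t, a1, a2}" "\<Phi> r = {t, a2, a3}"
    unfolding \<Phi>_def darts_three[OF nb(1)] darts_three[OF nb(2)] darts_three[OF nb(3)]
    using Ltri Lrev Lout by auto
  have \<Phi>y: "\<Phi> y = L' ` darts H' y" "card (darts H' y) = card (darts H y)" "y \<in> pverts H'" "y \<noteq> x"
    if y: "y \<in> pverts H" "y \<notin> S" for y
  proof -
    show yx: "y \<in> pverts H'" "y \<noteq> x" using y V' ne(10) by auto
    have "inj_on \<rho> (darts H y)" by (rule inj_on_inverseI[of _ \<kappa>]) (use k2 keep[OF _ y(2)] in blast)
    then show "card (darts H' y) = card (darts H y)" unfolding dy[OF yx] by (rule card_image)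
    show "\<Phi> y = L' ` darts H' y" unfolding \<Phi>_def dy[OF yx] image_image
    proof (rule image_cong[OF refl])
      fix a assume "a \<in> darts H y"
      then show "L a = L' (\<rho> a)" using k2[OF keep[OF _ y(2)], of a] Lk[of "\<rho> a"] by simp
    qed
  qed
  have \<Phi>t: "t \<notin> \<Phi> y" if "y \<in> pverts H" "y \<notin> S" for y
    unfolding \<Phi>y(1)[OF that] using t by (auto simp: darts_def)
  have "\<Phi> y \<in> F'" if y: "y \<in> pverts H" "card (darts H y) = 3" for y
  proof (cases "y \<in> S")
    case True
    have "\<Phi> y \<in> tris W" "t \<in> \<Phi> y" using SE[OF True] \<Phi>3 Wt by auto
    then show ?thesis using tT by (auto simp: F'_def)
  next
    case False
    note y' = \<Phi>y[OF y(1) False]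
    have "\<Phi> y \<in> F" using F3[OF y'(3)] y' y(2) by simp
    moreover have "\<Phi> y \<noteq> T"
    proof
      assume "\<Phi> y = T"
      then have "L' ` darts H' y = L' ` darts H' x" using y'(1) \<open>L' ` darts H' x = T\<close> by simp
      then have "y = x" by (rule inj_onD[OF Finj]) (use y' y(2) xd in simp_all)
      then show False using y'(4) by simp
    qed
    ultimately show ?thesis by (simp add: F'_def)
  qed
  moreover have "inj_on \<Phi> {y \<in> pverts H. card (darts H y) = 3}"
  proof (rule inj_onI)
    fix y z assume yz: "y \<in> {y \<in> pverts H. card (darts H y) = 3}" "z \<in> {y \<in> pverts H. card (darts H y) = 3}" "\<Phi> y = \<Phi> z"
    have tS: "t \<in> \<Phi> y" if "y \<in> S" for y using SE[OF that] \<Phi>3 by auto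
    consider "y \<in> S" "z \<in> S" | "y \<notin> S" "z \<notin> S" using tS \<Phi>t yz by fastforce
    then show "y = z"
    proof cases
      case 1
      have "a2 \<notin> \<Phi> p" "a3 \<notin> \<Phi> q" "a1 \<notin> \<Phi> r" "a3 \<in> \<Phi> p" "a1 \<in> \<Phi> p" "a1 \<in> \<Phi> q" "a2 \<in> \<Phi> q" "a2 \<in> \<Phi> r" "a3 \<in> \<Phi> r"
        unfolding \<Phi>3 using ad ta by auto
      then show ?thesis using SE[OF 1(1)] SE[OF 1(2)] yz(3) by metis
    next
      case 2
      then show ?thesis using \<Phi>y[of y] \<Phi>y[of z] yz inj_onD[OF Finj, of y z] by simp
    qed
  qed
  ultimately show ?thesis
    unfolding wheel_dual_def \<Phi>_def using L wt by blast
qed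

text \<open>In \<open>H'\<close> the vertices \<open>p\<close>, \<open>r\<close>, \<open>s\<close>
  bound a face, which \<open>q\<close> divides into the two triangles \<open>T1\<close> and
  \<open>T2\<close>. In the dual this splits a cubic vertex \<open>f\<close> into \<open>f\<close>
  and \<open>n\<close>, that is, it is a \<open>gsplit\<close>; the face \<open>a1\<close> across
  the edge from \<open>p\<close> to \<open>r\<close> has the role of the hub.\<close>

lemma D3b_wheel_dual:
  assumes g: "pair_graph H" and e: "planar_embedding H \<sigma>" and g': "pair_graph H'" and tc': "three_connected H'"
    and V: "pverts H' = pverts H - {q}"
    and E: "\<And>a b. (a, b) \<in> parcs H' \<longleftrightarrow> ((a, b) \<in> parcs H \<and> a \<noteq> q \<and> b \<noteq> q) \<or> (a = p \<and> b = r) \<or> (a = r \<and> b = p)"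
    and nb: "\<And>y. (p, y) \<in> parcs H \<longleftrightarrow> y = q \<or> y = s \<or> y = p'"
      "\<And>y. (q, y) \<in> parcs H \<longleftrightarrow> y = p \<or> y = r \<or> y = s"
      "\<And>y. (r, y) \<in> parcs H \<longleftrightarrow> y = q \<or> y = s \<or> y = r'"
    and ne: "p \<noteq> q" "q \<noteq> r" "p \<noteq> r" "s \<noteq> p" "s \<noteq> q" "s \<noteq> r" "p' \<notin> {p, q, r, s}" "r' \<notin> {p, q, r, s}"
    and T1: "{(p, q), (q, s), (s, p)} \<in> faces H \<sigma>" and T2: "{(q, r), (r, s), (s, q)} \<in> faces H \<sigma>"
    and IH: "\<And>\<sigma>'. planar_embedding H' \<sigma>' \<Longrightarrow> wheel_dual H' \<sigma>'"
  shows "wheel_dual H \<sigma>"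
proof -
  note rs = planar_embeddingD(1)[OF e]
  have p': "p' \<noteq> p" "p' \<noteq> q" "p' \<noteq> r" "p' \<noteq> s" "r' \<noteq> p" "r' \<noteq> q" "r' \<noteq> r" "r' \<noteq> s" using ne(7,8) by auto
  have arcs: "(p, q) \<in> parcs H" "(q, p) \<in> parcs H" "(q, r) \<in> parcs H" "(r, q) \<in> parcs H" "(q, s) \<in> parcs H"
    "(p, s) \<in> parcs H" "(r, s) \<in> parcs H" "(p, p') \<in> parcs H" "(r, r') \<in> parcs H"
    by (simp_all add: nb)
  have arcs_s: "(s, q) \<in> parcs H" "(s, p) \<in> parcs H" "(s, r) \<in> parcs H"
    using arcs pair_graphD(4)[OF g] by blast+
  have npr: "(p, r) \<notin> parcs H" "(r, p) \<notin> parcs H" using ne p' by (simp_all add: nb)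
  have to_q: "u = p \<or> u = r \<or> u = s" if "(u, q) \<in> parcs H" for u using pair_graphD(4)[OF g that] nb(2) by simp
  note s1 = triangle_face_step[OF rs g T1] and s2 = triangle_face_step[OF rs g T2]
  have sq: "\<sigma> (q, s) = (q, r)" "\<sigma> (q, r) = (q, p)"
    by (rule rotation_three[OF rs g, of q p s r]; use nb ne s1 s2 in auto)+
  have sp: "\<sigma> (p, q) = (p, p')" "\<sigma> (p, p') = (p, s)"
    by (rule rotation_three[OF rs g, of p s q p']; use nb ne p' s1 in auto)+
  have sr: "\<sigma> (r, s) = (r, r')" "\<sigma> (r, r') = (r, q)"
    by (rule rotation_three[OF rs g, of r q s r']; use nb ne p' s2 in auto)+
  \<comment> \<open>The arcs that survive in \<open>H'\<close>. Those from \<open>p\<close> and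
    \<open>r\<close> into \<open>q\<close> stand for the two arcs of the new edge, as
    \<open>\<kappa>\<close> and \<open>\<rho>\<close> express; \<open>(s, q)\<close> and the arcs
    out of \<open>q\<close> have no counterpart.\<close>
  define Out where "Out = {a \<in> parcs H. fst a \<noteq> q \<and> a \<noteq> (s, q)}"
  define \<kappa> where "\<kappa> a = (if a = (p, r) then (p, q) else if a = (r, p) then (r, q) else a)" for a
  define \<rho> where "\<rho> a = (if a = (p, q) then (p, r) else if a = (r, q) then (r, p) else a)" for a
  have OutE: "Out \<subseteq> parcs H" by (auto simp: Out_def)
  have k1: "\<kappa> a \<in> Out \<and> \<rho> (\<kappa> a) = a \<and> fst (\<kappa> a) = fst a" if "a \<in> parcs H'" for a
  proof -
    obtain u v where a: "a = (u, v)" by (cases a)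
    have uv: "(u, v) \<in> parcs H'" using that a by simp
    consider "(u, v) \<in> parcs H" "u \<noteq> q" "v \<noteq> q" | "u = p" "v = r" | "u = r" "v = p"
      using iffD1[OF E uv] by blast
    then show ?thesis
    proof cases
      case 1
      have "(u, v) \<noteq> (p, r)" "(u, v) \<noteq> (r, p)" using 1(1) npr by metis+
      then have "\<kappa> a = a" unfolding a \<kappa>_def by (simp only: if_False)
      moreover have "\<rho> a = a" unfolding a \<rho>_def using 1(3) by simp
      moreover have "a \<in> Out" unfolding a Out_def using 1 by simp
      ultimately show ?thesis by simp
    next
      case 2
      then show ?thesis using arcs ne by (simp add: a \<kappa>_def \<rho>_def Out_def)
    next
      case 3
      then show ?thesis using arcs ne by (simp add: a \<kappa>_def \<rho>_def Out_def)
    qed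
  qed
  have kr: "\<kappa> (\<rho> a) = a" if "a \<in> parcs H" for a
    using that npr ne by (auto simp: \<kappa>_def \<rho>_def)
  have k2: "\<rho> a \<in> parcs H' \<and> fst (\<rho> a) = fst a" if "a \<in> Out" for a
  proof -
    obtain u v where a: "a = (u, v)" by (cases a)
    have uv: "(u, v) \<in> parcs H" "u \<noteq> q" "(u, v) \<noteq> (s, q)" using that a by (auto simp: Out_def)
    consider "a = (p, q)" | "a = (r, q)" | "v \<noteq> q" using to_q[of u] uv a by auto
    then show ?thesis
    proof cases
      case 1
      then show ?thesis by (simp add: \<rho>_def E)
    next
      case 2
      then show ?thesis by (simp add: \<rho>_def E)
    next
      case 3
      then show ?thesis using uv by (simp add: a \<rho>_def E)
    qed
  qed
  have inj\<kappa>: "inj_on \<kappa> (parcs H')" by (rule inj_on_inverseI[of _ \<rho>]) (use k1 in blast)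
  have im\<kappa>: "\<kappa> ` parcs H' = Out"
  proof
    show "Out \<subseteq> \<kappa> ` parcs H'"
    proof
      fix a assume "a \<in> Out"
      then show "a \<in> \<kappa> ` parcs H'" using k2[of a] kr[of a] OutE by (metis image_eqI subsetD)
    qed
  qed (use k1 in blast)
  \<comment> \<open>The old rotation up to renaming, except at \<open>s\<close>, where the arc to
    \<open>q\<close>, between those to \<open>r\<close> and \<open>p\<close>, is passed
    over.\<close>
  define \<sigma>' where "\<sigma>' a = (if a \<in> parcs H' then if a = (s, r) then (s, p) else \<rho> (\<sigma> (\<kappa> a)) else a)" for a
  have E'arcs: "(p, r) \<in> parcs H'" "(r, p) \<in> parcs H'" "(p, s) \<in> parcs H'" "(s, p) \<in> parcs H'" "(r, s) \<in> parcs H'"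
    "(s, r) \<in> parcs H'" "(p, p') \<in> parcs H'" "(r, r') \<in> parcs H'"
    using arcs arcs_s ne p' by (simp_all add: E)
  have \<sigma>'v: "\<sigma>' (r, p) = (r, s)" "\<sigma>' (s, r) = (s, p)" "\<sigma>' (p, s) = (p, r)" "\<sigma>' (p, r) = (p, p')" "\<sigma>' (r, s) = (r, r')"
    using E'arcs ne p' sp sr s1(3) s2(1) by (simp_all add: \<sigma>'_def \<kappa>_def \<rho>_def)
  have keep: "a \<in> Out" if "a \<in> darts H y" "y \<noteq> q" "y \<noteq> s" for a y using that by (auto simp: darts_def Out_def)
  have dy: "darts H' y = \<rho> ` darts H y" if y: "y \<noteq> q" "y \<noteq> s" for y
  proof
    show "darts H' y \<subseteq> \<rho> ` darts H y"
    proof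
      fix b assume "b \<in> darts H' y"
      then have b: "b \<in> parcs H'" "fst b = y" by (auto simp: darts_def)
      then have "\<kappa> b \<in> darts H y" using k1[OF b(1)] OutE by (auto simp: darts_def)
      then show "b \<in> \<rho> ` darts H y" using k1[OF b(1)] by (metis image_eqI)
    qed
    show "\<rho> ` darts H y \<subseteq> darts H' y"
    proof
      fix b assume "b \<in> \<rho> ` darts H y"
      then obtain a where a: "a \<in> darts H y" "b = \<rho> a" by blast
      then show "b \<in> darts H' y" using k2[OF keep[OF a(1) y]] by (simp add: darts_def)
    qed
  qed
  have ds: "darts H' s = darts H s - {(s, q)}"
    using ne by (auto simp: darts_def E)
  have rs': "rotation_system H' \<sigma>'"
  proof (rule rotation_systemI[OF g'])
    show "\<sigma>' a = a" if "a \<notin> parcs H'" for a using that by (simp add: \<sigma>'_def)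
    fix y assume y: "y \<in> pverts H'" "{a \<in> parcs H'. fst a = y} \<noteq> {}"
    have "cyclic_on \<sigma>' (darts H' y)"
    proof (cases "y = s")
      case True
      have cyc: "cyclic_on \<sigma> (darts H s)" using cyclic_on_darts[OF rs g arcs_s(1)] by simp
      have sin: "(s, q) \<in> darts H s" "(s, r) \<in> darts H s" "(s, p) \<in> darts H s" using arcs_s by (simp_all add: darts_def)
      show ?thesis unfolding True ds
      proof (rule cyclic_on_remove[OF cyc sin(1)])
        show "darts H s \<noteq> {(s, q)}" using sin(3) ne by auto
        fix a assume a: "a \<in> darts H s - {(s, q)}"
        then have aE: "a \<in> parcs H'" "fst a = s" using ds by (auto simp: darts_def)
        show "\<sigma>' a = (if \<sigma> a = (s, q) then \<sigma> (s, q) else \<sigma> a)"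
        proof (cases "a = (s, r)")
          case True
          then show ?thesis using \<sigma>'v(2) s2(2) s1(2) by simp
        next
          case False
          have "\<sigma> a \<noteq> (s, q)" using inj_onD[OF cyclic_on_bij(2)[OF cyc], of a "(s, r)"] s2(2) a sin(2) False by auto
          moreover have "fst (\<sigma> a) = s" using cyclic_on_inI[OF cyc, of a] a by (simp add: darts_def)
          then have "\<rho> (\<sigma> a) = \<sigma> a" using ne by (auto simp: \<rho>_def)
          moreover have "\<kappa> a = a" using aE(2) ne by (auto simp: \<kappa>_def)
          ultimately show ?thesis using False aE(1) by (simp add: \<sigma>'_def)
        qed
      qed
    next
      case False
      have yq: "y \<noteq> q" using y(1) V by auto
      have "darts H' y \<noteq> {}" using y(2) by (simp add: darts_def)
      then have "darts H y \<noteq> {}" using dy[OF yq False] by auto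
      then obtain a where a: "a \<in> parcs H" "fst a = y" by (auto simp: darts_def)
      show ?thesis unfolding dy[OF yq False]
      proof (rule cyclic_on_image)
        show "cyclic_on \<sigma> (darts H y)" using cyclic_on_darts[OF rs g a(1)] a(2) by simp
        fix b assume b: "b \<in> darts H y"
        then have bE: "b \<in> parcs H" "fst b = y" by (simp_all add: darts_def)
        note kb = k2[OF keep[OF b yq False]]
        then have "\<rho> b \<noteq> (s, r)" using bE(2) False by auto
        then show "\<sigma>' (\<rho> b) = \<rho> (\<sigma> b)" using kb kr[OF bE(1)] by (simp add: \<sigma>'_def)
      qed
    qed
    then show "cyclic_on \<sigma>' {a \<in> parcs H'. fst a = y}" by (simp add: darts_def)
  qed
  let ?f0 = "{(p, r), (r, s), (s, p)}"
  have f0: "face_of \<sigma>' (p, r) = ?f0"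
    by (rule face_of_eq[OF cyclic_on_three]) (simp_all add: \<sigma>'v)
  then have f0F: "?f0 \<in> faces H' \<sigma>'" using E'arcs(1) unfolding faces_def by (metis image_eqI)
  have inf0: "face_of \<sigma>' b = ?f0 \<longleftrightarrow> b \<in> ?f0" if "b \<in> parcs H'" for b
    by (rule faces_disjoint[OF rs' g' f0F that])
  define B where "B = ?f0"
  have inB: "face_of \<sigma>' b = B \<longleftrightarrow> b \<in> B" if "b \<in> parcs H'" for b unfolding B_def by (rule inf0[OF that])
  \<comment> \<open>The face \<open>B\<close> stands for two old faces, so \<open>skip_faces\<close>
    is applied to the remaining arcs only.\<close>
  define D where "D = parcs H' - B"
  have DE: "D \<subseteq> parcs H'" by (auto simp: D_def)
  have Dn: "d \<noteq> (p, r)" "d \<noteq> (r, s)" "d \<noteq> (s, p)" if "d \<in> D" for d using that by (auto simp: D_def B_def)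
  have DI: "d \<in> D" if "d \<in> parcs H'" "d \<noteq> (p, r)" "d \<noteq> (r, s)" "d \<noteq> (s, p)" for d using that by (simp add: D_def B_def)
  have injD: "inj_on \<kappa> D" by (rule inj_on_subset[OF inj\<kappa> DE])
  have kD: "\<kappa> ` D \<subseteq> parcs H" using im\<kappa> OutE DE by blast
  have closed: "\<sigma>' (prod.swap d) \<in> D" if d: "d \<in> D" for d
  proof -
    have dE: "d \<in> parcs H'" using d DE by blast
    note sd = swap_parcs[OF g' dE]
    have "face_of \<sigma>' (\<sigma>' (prod.swap d)) = face_of \<sigma>' d" using face_of_swap[OF rs' g' sd] by simp
    then have "\<sigma>' (prod.swap d) \<notin> B"
      using inB[OF dE] inB[OF rotation_systemD(2)[OF rs' g' sd]] d by (simp add: D_def)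
    then show ?thesis using rotation_systemD(2)[OF rs' g' sd] by (simp add: D_def)
  qed
  have iff: "face_of \<sigma>' b = face_of \<sigma>' c \<longleftrightarrow> face_of \<sigma> (\<kappa> b) = face_of \<sigma> (\<kappa> c)" if bc: "b \<in> D" "c \<in> D" for b c
  proof (rule skip_faces[OF rs g injD kD closed _ rs' g' DE bc])
    fix d assume d: "d \<in> D"
    then have dE: "d \<in> parcs H'" using DE by blast
    note sd = swap_parcs[OF g' dE]
    show "\<kappa> (\<sigma>' (prod.swap d)) = \<sigma> (prod.swap (\<kappa> d)) \<or> \<sigma> (prod.swap (\<kappa> d)) \<notin> \<kappa> ` D \<and>
        \<kappa> (\<sigma>' (prod.swap d)) = \<sigma> (prod.swap (\<sigma> (prod.swap (\<kappa> d))))"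
    proof (cases "d = (r, p)")
      \<comment> \<open>The one place where an arc is passed over: the old walk goes from
        \<open>(r, q)\<close> through \<open>(q, p)\<close> to \<open>(p, p')\<close>, the new one
        from \<open>(r, p)\<close> to \<open>(p, p')\<close> directly.\<close>
      case True
      have kd: "\<kappa> (r, p) = (r, q)" using ne by (simp add: \<kappa>_def)
      have "(q, p) \<notin> Out" by (simp add: Out_def)
      then have "(q, p) \<notin> \<kappa> ` D" using im\<kappa> DE by blast
      moreover have "\<kappa> (p, p') = (p, p')" using p' ne by (simp add: \<kappa>_def)
      ultimately show ?thesis unfolding True by (simp add: kd \<sigma>'v(4) sq sp)
    next
      case False
      have sw: "prod.swap d = (u, v) \<longleftrightarrow> d = (v, u)" for u v by (cases d) auto
      have kd: "\<kappa> d = d" using False Dn(1)[OF d] by (simp add: \<kappa>_def)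
      have "prod.swap d \<noteq> (p, r)" "prod.swap d \<noteq> (r, p)" "prod.swap d \<noteq> (s, r)"
        using False Dn[OF d] by (simp_all add: sw)
      then have "\<kappa> (prod.swap d) = prod.swap d" "\<sigma>' (prod.swap d) = \<rho> (\<sigma> (\<kappa> (prod.swap d)))"
        using sd by (simp_all add: \<kappa>_def \<sigma>'_def)
      moreover from this have "prod.swap d \<in> parcs H" using k1[OF sd] OutE by auto
      then have "\<kappa> (\<rho> (\<sigma> (prod.swap d))) = \<sigma> (prod.swap d)" using kr rotation_systemD(2)[OF rs g] by blast
      ultimately show ?thesis using kd by simp
    qed
  qed
  let ?T1 = "{(p, q), (q, s), (s, p)}" and ?T2 = "{(q, r), (r, s), (s, q)}"
  have inT1: "face_of \<sigma> a = ?T1 \<longleftrightarrow> a \<in> ?T1" if "a \<in> parcs H" for a by (rule faces_disjoint[OF rs g T1 that])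
  have inT2: "face_of \<sigma> a = ?T2 \<longleftrightarrow> a \<in> ?T2" if "a \<in> parcs H" for a by (rule faces_disjoint[OF rs g T2 that])
  have T12: "?T1 \<noteq> ?T2"
  proof
    assume "?T1 = ?T2"
    then have "(p, q) \<in> ?T2" by (metis insertI1)
    then show False using ne by auto
  qed
  have rev: "face_of \<sigma> (q, p) = face_of \<sigma> (r, q)" using face_of_next[OF rs g arcs(4)] sq(2) by simp
  have \<kappa>v: "\<kappa> (r, p) = (r, q)" "\<kappa> (p, s) = (p, s)" "\<kappa> (s, r) = (s, r)" "\<kappa> (p, p') = (p, p')" "\<kappa> (r, r') = (r, r')"
    using ne p' by (auto simp: \<kappa>_def)
  have Dv: "(r, p) \<in> D" "(p, s) \<in> D" "(s, r) \<in> D" "(p, p') \<in> D" "(r, r') \<in> D"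
    by (rule DI; use E'arcs ne p' in auto)+
  have cover: "face_of \<sigma> a \<in> {?T1, ?T2} \<or> (\<exists>b\<in>D. face_of \<sigma> a = face_of \<sigma> (\<kappa> b))" if a: "a \<in> parcs H" for a
  proof (cases "a \<in> ?T1 \<or> a \<in> ?T2")
    case True
    then have "face_of \<sigma> a = ?T1 \<or> face_of \<sigma> a = ?T2" by (simp only: inT1[OF a] inT2[OF a])
    then show ?thesis by (elim disjE; intro disjI1; simp only: insert_iff simp_thms)
  next
    case False
    show ?thesis
    proof (cases "a = (q, p)")
      case True
      then show ?thesis using rev Dv(1) \<kappa>v(1) by metis
    next
      case nqp: False
      have "a \<in> Out"
      proof (rule ccontr)
        assume "a \<notin> Out"
        then have "fst a = q \<or> a = (s, q)" using a by (auto simp: Out_def)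
        then show False
        proof
          assume "fst a = q"
          then have "snd a = p \<or> snd a = r \<or> snd a = s" using a nb(2)[of "snd a"] by (metis prod.collapse)
          then show False using False nqp \<open>fst a = q\<close> by (cases a) auto
        qed (use False in simp)
      qed
      then have "\<rho> a \<in> parcs H'" using k2 by blast
      moreover have "\<rho> a \<noteq> (p, r)" "\<rho> a \<noteq> (r, s)" "\<rho> a \<noteq> (s, p)"
        using False kr[OF a] a npr ne by (auto simp: \<rho>_def)
      ultimately have "\<rho> a \<in> D" by (rule DI)
      then show ?thesis using kr[OF a] by metis
    qed
  qed
  have disj: "face_of \<sigma> (\<kappa> b) \<notin> {?T1, ?T2}" if b: "b \<in> D" for b
  proof -
    have bE: "b \<in> parcs H'" using b DE by blast
    note kb = k1[OF bE]
    have kbE: "\<kappa> b \<in> parcs H" using kb OutE by blast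
    have "\<kappa> b \<noteq> (q, s)" "\<kappa> b \<noteq> (q, r)" "\<kappa> b \<noteq> (s, q)" using kb by (auto simp: Out_def)
    moreover have "\<rho> (p, q) = (p, r)" "\<rho> (s, p) = (s, p)" "\<rho> (r, s) = (r, s)" using ne by (auto simp: \<rho>_def)
    then have "\<kappa> b \<noteq> (p, q)" "\<kappa> b \<noteq> (s, p)" "\<kappa> b \<noteq> (r, s)" using kb Dn[OF b] by metis+
    ultimately show ?thesis using inT1[OF kbE] inT2[OF kbE] by simp
  qed
  let ?X = "(\<lambda>b. face_of \<sigma> (\<kappa> b)) ` D"
  have finD: "finite D" by (rule finite_subset[OF DE pair_graph_finite(2)[OF g']])
  \<comment> \<open>\<open>?f0\<close> is traded for \<open>?T1\<close> and \<open>?T2\<close>; all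
    other faces correspond.\<close>
  have cardF: "card (faces H \<sigma>) = card (faces H' \<sigma>') + 1"
  proof -
    have "faces H \<sigma> = insert ?T1 (insert ?T2 ?X)"
    proof
      show "faces H \<sigma> \<subseteq> insert ?T1 (insert ?T2 ?X)"
      proof
        fix Q assume "Q \<in> faces H \<sigma>"
        then obtain a where a: "a \<in> parcs H" "Q = face_of \<sigma> a" by (auto simp: faces_def)
        from cover[OF a(1)] show "Q \<in> insert ?T1 (insert ?T2 ?X)"
        proof
          assume "face_of \<sigma> a \<in> {?T1, ?T2}"
          then show ?thesis unfolding a(2) by (elim insertE emptyE) (simp_all only: insert_iff simp_thms)
        next
          assume "\<exists>b\<in>D. face_of \<sigma> a = face_of \<sigma> (\<kappa> b)"
          then have "Q \<in> ?X" unfolding a(2) by blast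
          then show ?thesis by (intro insertI2)
        qed
      qed
      have "face_of \<sigma> (\<kappa> b) \<in> faces H \<sigma>" if "b \<in> D" for b using kD that by (auto simp: faces_def)
      then show "insert ?T1 (insert ?T2 ?X) \<subseteq> faces H \<sigma>" using T1 T2 by (simp add: image_subset_iff)
    qed
    moreover have "?T1 \<notin> ?X" "?T2 \<notin> ?X" using disj by blast+
    ultimately have 1: "card (faces H \<sigma>) = card ?X + 2" using finD T12 by (simp add: card_insert_if)
    have "faces H' \<sigma>' = insert ?f0 (face_of \<sigma>' ` D)"
    proof
      show "faces H' \<sigma>' \<subseteq> insert ?f0 (face_of \<sigma>' ` D)"
      proof
        fix Q assume "Q \<in> faces H' \<sigma>'"
        then obtain a where a: "a \<in> parcs H'" "Q = face_of \<sigma>' a" by (auto simp: faces_def)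
        show "Q \<in> insert ?f0 (face_of \<sigma>' ` D)"
        proof (cases "a \<in> B")
          case True
          then have "Q = ?f0" using inB[OF a(1)] a(2) by (simp only: B_def)
          then show ?thesis by (simp only: insertI1)
        next
          case False
          then show ?thesis using a by (simp add: D_def)
        qed
      qed
      show "insert ?f0 (face_of \<sigma>' ` D) \<subseteq> faces H' \<sigma>'" using f0F DE by (auto simp: faces_def)
    qed
    moreover have "?f0 \<notin> face_of \<sigma>' ` D"
    proof
      assume "?f0 \<in> face_of \<sigma>' ` D"
      then obtain b where b: "b \<in> D" "face_of \<sigma>' b = ?f0" by (metis imageE)
      then have "b \<in> B" using inB[of b] DE unfolding B_def by blast
      then show False using b(1) by (simp add: D_def)
    qed
    ultimately have 2: "card (faces H' \<sigma>') = card (face_of \<sigma>' ` D) + 1" using finD by simp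
    have "card (face_of \<sigma>' ` D) = card ?X" by (rule card_image_cong_iff[OF finD iff])
    then show ?thesis using 1 2 by simp
  qed
  have cardE: "card (parcs H) = card (parcs H') + 4"
  proof -
    let ?I = "{(q, p), (q, r), (q, s), (s, q)}"
    have "parcs H = Out \<union> ?I"
    proof
      show "parcs H \<subseteq> Out \<union> ?I"
      proof
        fix a assume a: "a \<in> parcs H"
        obtain u v where uv: "a = (u, v)" by (cases a)
        show "a \<in> Out \<union> ?I" using a nb(2)[of v] uv by (cases "u = q") (auto simp: Out_def)
      qed
    qed (use OutE arcs arcs_s in simp)
    moreover have "Out \<inter> ?I = {}" by (auto simp: Out_def)
    moreover have "card ?I = 4" using ne by simp
    moreover have "finite Out" using finite_subset[OF OutE pair_graph_finite(2)[OF g]] .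
    ultimately have "card (parcs H) = card Out + 4" using card_Un_disjoint[of Out ?I] by simp
    then show ?thesis using card_image[OF inj\<kappa>] im\<kappa> by simp
  qed
  have qV: "q \<in> pverts H" using pair_graphD(1)[OF g arcs(2)] .
  have cardV: "card (pverts H) = card (pverts H') + 1"
    unfolding V using card_Suc_Diff1[OF pair_graph_finite(1)[OF g] qV] by simp
  \<comment> \<open>One vertex, one face and two edges are lost, so Euler's formula
    persists.\<close>
  have e': "planar_embedding H' \<sigma>'"
    using planar_embeddingD(3)[OF e] three_connected_connected[OF tc' g'] rs'
    by (simp add: planar_embedding_def cardF cardE cardV)
  from IH[OF e'] obtain L' :: "'a \<times> 'a \<Rightarrow> nat" and F where L': "face_labelling H' \<sigma>' L'"
    and F: "wheel_tree (label_graph L' H') F"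
    and F3: "\<And>y. y \<in> pverts H' \<Longrightarrow> card (darts H' y) = 3 \<Longrightarrow> L' ` darts H' y \<in> F"
    and Finj: "inj_on (\<lambda>x. L' ` darts H' x) {x \<in> pverts H'. card (darts H' x) = 3}"
    unfolding wheel_dual_def by blast
  let ?G = "label_graph L' H'"
  note wg = wheel_tree_graph[OF F]
  have L'eq: "L' b = L' c \<longleftrightarrow> face_of \<sigma>' b = face_of \<sigma>' c" if "b \<in> parcs H'" "c \<in> parcs H'" for b c
    using L' that unfolding face_labelling_def by blast
  define f where "f = L' (p, r)"
  define a1 where "a1 = L' (r, p)"
  define b1 where "b1 = L' (p, s)"
  define c1 where "c1 = L' (s, r)"
  have isf: "L' b = f \<longleftrightarrow> b \<in> ?f0" if "b \<in> parcs H'" for b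
    unfolding f_def L'eq[OF that E'arcs(1)] f0 by (rule inf0[OF that])
  have L'f: "L' (p, r) = f" "L' (r, s) = f" "L' (s, p) = f" using isf E'arcs by simp_all
  have Df: "L' b \<noteq> f" if "b \<in> D" for b using isf[of b] that DE by (auto simp: D_def B_def)
  have L'x: "L' (p, p') = a1" "L' (r, r') = c1"
    unfolding a1_def c1_def
    using face_of_next[OF rs' g' E'arcs(2)] face_of_next[OF rs' g' E'arcs(6)] L'eq E'arcs unfolding \<sigma>'v by simp_all
  have fnb: "(f, y) \<in> parcs ?G \<longleftrightarrow> y = a1 \<or> y = b1 \<or> y = c1" for y
  proof
    assume "(f, y) \<in> parcs ?G"
    then obtain d where d: "d \<in> parcs H'" "L' d = f" "y = L' (prod.swap d)" by auto
    then have "d \<in> ?f0" using isf by blast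
    then show "y = a1 \<or> y = b1 \<or> y = c1" using d(3) by (auto simp: a1_def b1_def c1_def)
  next
    have "(L' b, L' (prod.swap b)) \<in> parcs ?G" if "b \<in> parcs H'" for b using that by simp
    from this[OF E'arcs(1)] this[OF E'arcs(4)] this[OF E'arcs(5)]
    show "y = a1 \<or> y = b1 \<or> y = c1 \<Longrightarrow> (f, y) \<in> parcs ?G"
      using L'f by (auto simp: a1_def b1_def c1_def)
  qed
  have fV: "f \<in> pverts ?G" using E'arcs(1) by (auto simp: f_def)
  have "{y. (f, y) \<in> parcs ?G} = {a1, b1, c1}" using fnb by blast
  \<comment> \<open>The three labels around \<open>f\<close> are distinct because the tree of wheels
    is 3-connected.\<close>
  then have "3 \<le> card {a1, b1, c1}" using three_connected_degree[OF wg(2,1) fV] by simp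
  then have abc: "a1 \<noteq> b1" "a1 \<noteq> c1" "b1 \<noteq> c1" by (auto simp: card_insert_if split: if_splits)
  have fne: "f \<noteq> a1" "f \<noteq> b1" "f \<noteq> c1" using fnb pair_graphD(3)[OF wg(1)] by blast+
  have pV: "p \<in> pverts H'" "r \<in> pverts H'" using pair_graphD(1,2)[OF g' E'arcs(1)] .
  have dp: "darts H' p = {(p, r), (p, s), (p, p')}" and dr: "darts H' r = {(r, p), (r, s), (r, r')}"
    by (rule darts_three; use nb ne p' in \<open>auto simp: E\<close>)+
  \<comment> \<open>\<open>p\<close> and \<open>r\<close> are cubic in \<open>H'\<close> too, and
    their dual triangles are the two that \<open>wheel_tree_gsplit\<close> asks for.\<close>
  have "card (darts H' p) = 3" "card (darts H' r) = 3" unfolding dp dr using ne p' by auto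
  then have "L' ` darts H' p \<in> F" "L' ` darts H' r \<in> F" using F3 pV by blast+
  moreover have "L' ` darts H' p = {f, a1, b1}" "L' ` darts H' r = {f, a1, c1}"
    unfolding dp dr using L'f L'x by (auto simp: a1_def b1_def)
  ultimately have FF: "{f, a1, b1} \<in> F" "{f, a1, c1} \<in> F" by simp_all
  obtain n where n: "n \<notin> L' ` parcs H'"
    using ex_new_if_finite[of "L' ` parcs H'"] pair_graph_finite(2)[OF g'] by auto
  have nne: "n \<noteq> f" "n \<noteq> a1" "n \<noteq> b1" "n \<noteq> c1" using n E'arcs by (auto simp: f_def a1_def b1_def c1_def)
  obtain F' where F': "wheel_tree (gsplit ?G f a1 c1 n) F'" "{T \<in> F. f \<notin> T} \<subseteq> F'"
    "{{f, a1, b1}, {f, a1, n}, {n, a1, c1}} \<subseteq> F'"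
  proof -
    have "distinct [a1, b1, c1]" "n \<notin> pverts ?G" using abc n by simp_all
    then show ?thesis using wheel_tree_gsplit[OF F fnb _ FF] that by blast
  qed
  \<comment> \<open>\<open>?T1\<close> inherits the label \<open>f\<close> of the divided face, and
    \<open>?T2\<close> gets the new label \<open>n\<close>.\<close>
  obtain L where L: "face_labelling H \<sigma> L"
    and Lold: "\<And>a b. b \<in> D \<Longrightarrow> face_of \<sigma> a = face_of \<sigma> (\<kappa> b) \<Longrightarrow> L a = L' b"
    and Lnew: "\<And>a. face_of \<sigma> a \<in> {?T1, ?T2} \<Longrightarrow> L a = (if face_of \<sigma> a = ?T1 then f else n)"
  proof -
    note goal = that
    show thesis
    proof (rule extend_labelling[of \<kappa> D H \<sigma> L' "{?T1, ?T2}" "\<lambda>Q. if Q = ?T1 then f else n"])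
    show "\<kappa> ` D \<subseteq> parcs H" by (rule kD)
    show "(face_of \<sigma> (\<kappa> b) = face_of \<sigma> (\<kappa> c)) = (L' b = L' c)" if "b \<in> D" "c \<in> D" for b c
      using iff[OF that] L'eq[of b c] that DE by blast
    show "inj_on (\<lambda>Q. if Q = ?T1 then f else n) {?T1, ?T2}" using T12 nne by (simp add: inj_on_def)
    show "(if Q = ?T1 then f else n) \<noteq> L' b" if "b \<in> D" for b Q
    proof -
      have "n \<noteq> L' b" using n that DE by blast
      then show ?thesis using Df[OF that] by simp
    qed
    show "face_of \<sigma> a \<in> {?T1, ?T2} \<or> (\<exists>b\<in>D. face_of \<sigma> a = face_of \<sigma> (\<kappa> b))" if "a \<in> parcs H" for a
      by (rule cover[OF that])
    show "face_of \<sigma> (\<kappa> b) \<notin> {?T1, ?T2}" if "b \<in> D" for b by (rule disj[OF that])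
    show thesis if "face_labelling H \<sigma> L" "\<And>a b. b \<in> D \<Longrightarrow> face_of \<sigma> a = face_of \<sigma> (\<kappa> b) \<Longrightarrow> L a = L' b"
      "\<And>a. face_of \<sigma> a \<in> {?T1, ?T2} \<Longrightarrow> L a = (if face_of \<sigma> a = ?T1 then f else n)" for L
      by (rule goal) (fact that)+
    qed
  qed
  have Lk: "L (\<kappa> b) = L' b" if "b \<in> D" for b by (rule Lold[OF that refl])
  have L1: "L a = f" if "a \<in> parcs H" "a \<in> ?T1" for a
  proof -
    note face = iffD2[OF inT1[OF that(1)] that(2)]
    have "L a = (if face_of \<sigma> a = ?T1 then f else n)" by (rule Lnew) (simp only: face insert_iff simp_thms)
    then show ?thesis by (simp only: face if_True simp_thms)
  qed
  have L2: "L a = n" if "a \<in> parcs H" "a \<in> ?T2" for a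
  proof -
    note face = iffD2[OF inT2[OF that(1)] that(2)]
    have "L a = (if face_of \<sigma> a = ?T1 then f else n)" by (rule Lnew) (simp only: face insert_iff simp_thms)
    then show ?thesis by (simp only: face not_sym[OF T12] if_False simp_thms)
  qed
  have Lv: "L (p, q) = f" "L (q, s) = f" "L (s, p) = f" "L (q, r) = n" "L (r, s) = n" "L (s, q) = n"
    using L1 L2 arcs arcs_s by simp_all
  have Lw: "L (q, p) = a1" "L (r, q) = a1" "L (p, s) = b1" "L (s, r) = c1" "L (p, p') = a1" "L (r, r') = c1"
    using Lold[OF Dv(1), of "(q, p)"] Lk[OF Dv(1)] Lk[OF Dv(2)] Lk[OF Dv(3)] Lk[OF Dv(4)] Lk[OF Dv(5)] rev L'x
    by (simp_all add: \<kappa>v a1_def b1_def c1_def)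
  have if_val: "z = (if P then u else v) \<Longrightarrow> z = u \<or> z = v" for z u v :: nat and P by (cases P) simp_all
  have eqG: "label_graph L H = gsplit ?G f a1 c1 n"
  proof -
    \<comment> \<open>The arcs with neither side on \<open>?f0\<close>; their dual edges are the
      same before and after.\<close>
    define D2 where "D2 = {d \<in> D. prod.swap d \<in> D}"
    let ?l = "\<lambda>d. (L d, L (prod.swap d))" and ?l' = "\<lambda>d. (L' d, L' (prod.swap d))"
    have D2E: "d \<in> parcs H \<and> \<kappa> d = d" if "d \<in> D2" for d
    proof -
      have d: "d \<in> D" "prod.swap d \<in> D" using that by (simp_all add: D2_def)
      have "d \<noteq> (r, p)" using Dn(1)[OF d(2)] by auto
      then have "\<kappa> d = d" using Dn(1)[OF d(1)] by (simp add: \<kappa>_def)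
      moreover have "\<kappa> d \<in> parcs H" using kD d(1) by blast
      ultimately show ?thesis by simp
    qed
    have split': "a \<in> D2 \<or> a \<in> ?f0 \<or> prod.swap a \<in> ?f0" if "a \<in> parcs H'" for a
      using that swap_parcs[OF g' that] unfolding D2_def D_def B_def[symmetric] by blast
    have EE': "parcs H' = D2 \<union> {(p, r), (r, p), (r, s), (s, r), (s, p), (p, s)}"
    proof
      show "parcs H' \<subseteq> D2 \<union> {(p, r), (r, p), (r, s), (s, r), (s, p), (p, s)}"
      proof
        fix a assume "a \<in> parcs H'"
        from split'[OF this] show "a \<in> D2 \<union> {(p, r), (r, p), (r, s), (s, r), (s, p), (p, s)}"
          by (cases a) auto
      qed
      have "D2 \<subseteq> parcs H'" using DE by (auto simp: D2_def)
      then show "D2 \<union> {(p, r), (r, p), (r, s), (s, r), (s, p), (p, s)} \<subseteq> parcs H'" using E'arcs by simp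
    qed
    have EE: "parcs H = D2 \<union> {(p, q), (q, p), (s, p), (p, s)} \<union> {(q, s), (s, q), (r, s), (s, r), (q, r), (r, q)}"
    proof
      show "parcs H \<subseteq> D2 \<union> {(p, q), (q, p), (s, p), (p, s)} \<union> {(q, s), (s, q), (r, s), (s, r), (q, r), (r, q)}"
      proof
        fix a assume a: "a \<in> parcs H"
        obtain u v where uv: "a = (u, v)" by (cases a)
        show "a \<in> D2 \<union> {(p, q), (q, p), (s, p), (p, s)} \<union> {(q, s), (s, q), (r, s), (s, r), (q, r), (r, q)}"
        proof (cases "u = q \<or> v = q")
          case True
          then show ?thesis using a nb(2)[of v] to_q[of u] uv by auto
        next
          case False
          then have "a \<in> parcs H'" using a uv by (simp add: E)
          from split'[OF this] show ?thesis using a npr uv by auto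
        qed
      qed
      show "D2 \<union> {(p, q), (q, p), (s, p), (p, s)} \<union> {(q, s), (s, q), (r, s), (s, r), (q, r), (r, q)} \<subseteq> parcs H"
        using D2E arcs arcs_s by auto
    qed
    define R where "R = ?l' ` D2"
    have lR: "?l ` D2 = R" unfolding R_def
    proof (rule image_cong[OF refl])
      fix d assume d: "d \<in> D2"
      then have sd: "prod.swap d \<in> D2" by (simp add: D2_def)
      have "L d = L' d" "L (prod.swap d) = L' (prod.swap d)"
        using Lk[of d] Lk[of "prod.swap d"] D2E[OF d] D2E[OF sd] d sd by (simp_all add: D2_def)
      then show "?l d = ?l' d" by simp
    qed
    let ?P = "{(f, a1), (a1, f), (f, b1), (b1, f)}" and ?C = "{(f, c1), (c1, f)}"
      and ?N = "{(f, n), (n, f), (n, c1), (c1, n), (n, a1), (a1, n)}"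
    have G: "parcs ?G = R \<union> ?P \<union> ?C"
    proof -
      have "parcs ?G = ?l' ` (D2 \<union> {(p, r), (r, p), (r, s), (s, r), (s, p), (p, s)})"
        using EE' by (simp only: label_graph_simps)
      also have "\<dots> = R \<union> {(f, a1), (a1, f), (f, c1), (c1, f), (f, b1), (b1, f)}"
        by (simp only: image_Un R_def[symmetric] image_insert image_empty swap_simp L'f a1_def[symmetric] b1_def[symmetric] c1_def[symmetric])
      also have "\<dots> = R \<union> ?P \<union> ?C" by blast
      finally show ?thesis .
    qed
    have "parcs (label_graph L H) = R \<union> ?P \<union> ?N"
    proof -
      have "parcs (label_graph L H) = ?l ` (D2 \<union> {(p, q), (q, p), (s, p), (p, s)} \<union> {(q, s), (s, q), (r, s), (s, r), (q, r), (r, q)})"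
        using EE by (simp only: label_graph_simps)
      also have "\<dots> = R \<union> {(f, a1), (a1, f), (f, b1), (b1, f)} \<union> {(f, n), (n, f), (n, c1), (c1, n), (n, a1), (a1, n)}"
        by (simp only: image_Un lR image_insert image_empty swap_simp Lv Lw)
      finally show ?thesis .
    qed
    also have "\<dots> = (parcs ?G - ?C) \<union> ?N"
    proof -
      have "R \<inter> ?C = {}"
      proof -
        have "fst x \<noteq> f" "snd x \<noteq> f" if x: "x \<in> R" for x
        proof -
          obtain d where d: "d \<in> D" "prod.swap d \<in> D" "x = (L' d, L' (prod.swap d))"
            using x unfolding R_def D2_def by blast
          show "fst x \<noteq> f" "snd x \<noteq> f" using Df[OF d(1)] Df[OF d(2)] d(3) by simp_all
        qed
        then show ?thesis by fastforce
      qed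
      moreover have "?P \<inter> ?C = {}" using abc fne by auto
      ultimately have "(R \<union> ?P \<union> ?C) - ?C = R \<union> ?P" by (simp only: Un_Diff Diff_cancel Un_empty_right Diff_triv)
      then show ?thesis unfolding G by (simp only:)
    qed
    finally have 1: "parcs (label_graph L H) = (parcs ?G - ?C) \<union> ?N" .
    have "L ` parcs H = insert n (L' ` parcs H')"
    proof
      show "L ` parcs H \<subseteq> insert n (L' ` parcs H')"
      proof
        fix m assume "m \<in> L ` parcs H"
        then obtain a where a: "a \<in> parcs H" "m = L a" by blast
        from cover[OF a(1)] show "m \<in> insert n (L' ` parcs H')"
        proof
          assume "face_of \<sigma> a \<in> {?T1, ?T2}"
          from Lnew[OF this] have "m = f \<or> m = n" unfolding a(2) by (rule if_val)
          then show ?thesis using fV by auto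
        next
          assume "\<exists>b\<in>D. face_of \<sigma> a = face_of \<sigma> (\<kappa> b)"
          then show ?thesis using Lold a(2) DE by blast
        qed
      qed
      have "L' b \<in> L ` parcs H" if b: "b \<in> parcs H'" for b
      proof (cases "b \<in> D")
        case True
        then show ?thesis using Lk[OF True] kD by (metis image_eqI image_subset_iff)
      next
        case False
        then have "L' b = f" using isf[OF b] b by (simp add: D_def B_def)
        then show ?thesis using Lv(1) arcs(1) by (metis image_eqI)
      qed
      moreover have "n \<in> L ` parcs H" using Lv(4) arcs(3) by (metis image_eqI)
      ultimately show "insert n (L' ` parcs H') \<subseteq> L ` parcs H" by blast
    qed
    then have 2: "pverts (label_graph L H) = insert n (pverts ?G)" by simp
    show ?thesis unfolding gsplit_def 1[symmetric] 2[symmetric] by (simp add: label_graph_def)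
  qed
  have wt: "wheel_tree (label_graph L H) F'" unfolding eqG by (rule F'(1))
  define \<Phi> where "\<Phi> y = L ` darts H y" for y
  have \<Phi>3: "\<Phi> p = {f, a1, b1}" "\<Phi> q = {f, a1, n}" "\<Phi> r = {n, a1, c1}"
    unfolding \<Phi>_def darts_three[OF nb(1)] darts_three[OF nb(2)] darts_three[OF nb(3)]
    using Lv Lw by auto
  \<comment> \<open>\<open>s\<close> has degree at least three in \<open>H'\<close> and one edge
    more in \<open>H\<close>, so it is not cubic there and no dual triangle is due for it.\<close>
  have s4: "card (darts H s) \<noteq> 3"
  proof -
    have sV: "s \<in> pverts H'" using pair_graphD(1)[OF g' E'arcs(4)] .
    have "3 \<le> card (darts H' s)"
      using three_connected_degree[OF tc' g' sV] by (simp add: out_degree_darts[symmetric] out_degree_eq)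
    moreover have "(s, q) \<in> darts H s" "finite (darts H s)"
      using arcs_s pair_graph_finite(2)[OF g] by (simp_all add: darts_def)
    then have "card (darts H s) = Suc (card (darts H' s))" unfolding ds by (metis card_Suc_Diff1)
    ultimately show ?thesis by simp
  qed
  have \<Phi>y: "\<Phi> y = L' ` darts H' y" "darts H' y = darts H y" "y \<in> pverts H'" "f \<notin> \<Phi> y" "n \<notin> \<Phi> y"
    if y: "y \<in> pverts H" "y \<noteq> p" "y \<noteq> q" "y \<noteq> r" "y \<noteq> s" for y
  proof -
    show "y \<in> pverts H'" using y V by simp
    show d: "darts H' y = darts H y"
    proof -
      have "(y, b) \<in> parcs H' \<longleftrightarrow> (y, b) \<in> parcs H" for b using to_q[of y] y by (auto simp: E)
      then show ?thesis unfolding darts_def by auto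
    qed
    have dD: "a \<in> D \<and> \<kappa> a = a" if "a \<in> darts H' y" for a
    proof -
      have "a \<in> parcs H'" "fst a = y" using that by (simp_all add: darts_def)
      then show ?thesis using y by (auto simp: D_def B_def \<kappa>_def)
    qed
    show eq: "\<Phi> y = L' ` darts H' y" unfolding \<Phi>_def d[symmetric]
    proof (rule image_cong[OF refl])
      fix a assume "a \<in> darts H' y"
      then show "L a = L' a" using dD[of a] Lk[of a] by simp
    qed
    show "f \<notin> \<Phi> y" unfolding eq using dD Df by blast
    show "n \<notin> \<Phi> y" unfolding eq using dD DE n by blast
  qed
  have "\<Phi> y \<in> F'" if y: "y \<in> pverts H" "card (darts H y) = 3" for y
  proof -
    consider "y = p \<or> y = q \<or> y = r" | "y \<noteq> p" "y \<noteq> q" "y \<noteq> r" "y \<noteq> s" using y(2) s4 by blast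
    then show ?thesis
    proof cases
      case 1
      then show ?thesis using F'(3) \<Phi>3 by auto
    next
      case 2
      note y' = \<Phi>y[OF y(1) 2]
      have "\<Phi> y \<in> F" using F3[OF y'(3)] y' y(2) by simp
      then show ?thesis using F'(2) y'(4) by blast
    qed
  qed
  moreover have "inj_on \<Phi> {y \<in> pverts H. card (darts H y) = 3}"
  proof (rule inj_onI)
    fix y z assume yz: "y \<in> {y \<in> pverts H. card (darts H y) = 3}" "z \<in> {y \<in> pverts H. card (darts H y) = 3}" "\<Phi> y = \<Phi> z"
    \<comment> \<open>Which of \<open>f\<close> and \<open>n\<close> belong to its dual triangle
      tells each of \<open>p\<close>, \<open>q\<close>, \<open>r\<close> from the other two, and
      from all further cubic vertices, whose triangles contain neither.\<close>
    have marks: "f \<in> \<Phi> p" "n \<notin> \<Phi> p" "f \<in> \<Phi> q" "n \<in> \<Phi> q" "f \<notin> \<Phi> r" "n \<in> \<Phi> r"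
      unfolding \<Phi>3 using fne nne by auto
    have ys: "y \<noteq> s" "z \<noteq> s" "y \<in> pverts H" "z \<in> pverts H" using yz s4 by auto
    have m: "f \<in> \<Phi> y \<longleftrightarrow> f \<in> \<Phi> z" "n \<in> \<Phi> y \<longleftrightarrow> n \<in> \<Phi> z" using yz(3) by simp_all
    consider "y = p" | "y = q" | "y = r" | "y \<noteq> p" "y \<noteq> q" "y \<noteq> r" by blast
    then show "y = z"
    proof cases
      case 4
      note y' = \<Phi>y[OF ys(3) 4 ys(1)]
      have z: "z \<noteq> p" "z \<noteq> q" "z \<noteq> r" using marks m y'(4,5) by auto
      note z' = \<Phi>y[OF ys(4) z ys(2)]
      show ?thesis using inj_onD[OF Finj, of y z] y' z' yz by simp
    qed (use marks m \<Phi>y(4,5)[OF ys(4) _ _ _ ys(2)] in blast)+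
  qed
  ultimately show ?thesis
    unfolding wheel_dual_def \<Phi>_def using L wt by blast
qed

section \<open>Triangles that do not separate, and the induction over reductions\<close>

lemma conn_remove_leaf:
  assumes "conn E X" "sym E" "(r, r) \<notin> E" "\<And>y. (r, y) \<in> E \<Longrightarrow> y \<in> X \<Longrightarrow> y = w"
  shows "conn E (X - {r})"
  unfolding conn_def
proof (intro ballI)
  fix u v assume uv: "u \<in> X - {r}" "v \<in> X - {r}"
  have "(u, if z = r then w else z) \<in> (E \<inter> (X - {r}) \<times> (X - {r}))\<^sup>*" if "(u, z) \<in> (E \<inter> X \<times> X)\<^sup>*" for z
    using that
  proof induction
    case base
    then show ?case using uv by simp
  next
    case (step y z)
    then have yz: "(y, z) \<in> E" "(z, y) \<in> E" "y \<in> X" "z \<in> X" using assms(2) by (auto dest: symD)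
    consider "z = r" | "z \<noteq> r" "y = r" | "z \<noteq> r" "y \<noteq> r" by blast
    then show ?case
    proof cases
      case 1
      then have "y = w" "y \<noteq> r" using assms(3,4) yz by auto
      then show ?thesis using step.IH 1 by simp
    next
      case 2
      then have "z = w" using assms(4) yz by auto
      then show ?thesis using step.IH 2 by simp
    next
      case 3
      then have "(y, z) \<in> E \<inter> (X - {r}) \<times> (X - {r})" using yz by blast
      then show ?thesis using step.IH 3 by (simp add: rtrancl_into_rtrancl)
    qed
  qed
  from this[of v] show "(u, v) \<in> (E \<inter> (X - {r}) \<times> (X - {r}))\<^sup>*"
    using assms(1) uv by (auto simp: conn_def)
qed

text \<open>Two deleted vertices leave a 3-connected graph connected, and then a cubic third corner
  hangs on the rest by at most one edge.\<close>

lemma conn_minus_triangle: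
  assumes g: "pair_graph G" and c: "three_connected G" and leaf: "\<And>y. (r, y) \<in> parcs G \<longleftrightarrow> y = p \<or> y = q \<or> y = w"
  shows "conn (parcs G) (pverts G - {p, q, r})"
proof -
  have "card {p, q} < 3" by (simp add: card_insert_if)
  then have "conn (parcs G) (pverts G - {p, q})" using three_connectedD[OF c g] by blast
  then have "conn (parcs G) (pverts G - {p, q} - {r})"
    by (rule conn_remove_leaf[OF _ pair_graph_sym[OF g]]) (use pair_graphD(3)[OF g] leaf in auto)
  moreover have "pverts G - {p, q} - {r} = pverts G - {p, q, r}" by blast
  ultimately show ?thesis by simp
qed

text \<open>\<open>planar_triangle_face\<close> leaves the orientation of the faces open. The
  mirrored case is the same statement with two vertices exchanged: \<open>p\<close> and
  \<open>q\<close> for D3a, \<open>p\<close> and \<open>r\<close> for D3b.\<close>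

lemma d3_step_wheel_dual:
  assumes step: "d3_step H H'" and g: "pair_graph H" and c: "three_connected H" and c': "three_connected H'"
    and e: "planar_embedding H \<sigma>" and IH: "\<And>\<sigma>'. planar_embedding H' \<sigma>' \<Longrightarrow> wheel_dual H' \<sigma>'"
  shows "wheel_dual H \<sigma>"
  using step
proof cases
  case (D3a p q r p' q' r' x)
  note g' = d3_step_pair_graph[OF step g]
  note nb = D3a_facts[OF g D3a(3-7)]
  have ne: "p \<noteq> q" "q \<noteq> r" "p \<noteq> r" "p' \<notin> {p, q, r}" "q' \<notin> {p, q, r}" "r' \<notin> {p, q, r}"
    "p' \<noteq> q'" "q' \<noteq> r'" "p' \<noteq> r'" "x \<notin> pverts H"
    using D3a(4,7,8,9) by auto
  have V: "pverts H' = insert x (pverts H - {p, q, r})" using D3a(1) by simp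
  have E: "(a, b) \<in> parcs H' \<longleftrightarrow> ((a, b) \<in> parcs H \<and> a \<notin> {p, q, r} \<and> b \<notin> {p, q, r}) \<or>
      (a = x \<and> (b = p' \<or> b = q' \<or> b = r')) \<or> (b = x \<and> (a = p' \<or> a = q' \<or> a = r'))" for a b
    unfolding D3a(1) by auto
  have tri: "(p, q) \<in> parcs H" "(q, r) \<in> parcs H" "(r, p) \<in> parcs H" by (simp_all add: nb)
  note conn' = three_connected_connected[OF c' g']
  from planar_triangle_face[OF g e tri conn_minus_triangle[OF g c nb(3)]] show ?thesis
  proof
    assume T: "{(p, q), (q, r), (r, p)} \<in> faces H \<sigma>"
    show ?thesis by (rule D3a_wheel_dual[OF g e g' conn' V E nb ne T IH])
  next
    assume T: "{(q, p), (p, r), (r, q)} \<in> faces H \<sigma>"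
    have perm: "{q, p, r} = {p, q, r}" by blast
    show ?thesis
    proof (rule D3a_wheel_dual[OF g e g' conn' _ _ nb(2) nb(1) _ _ _ _ _ _ _ _ _ _ ne(10) T IH])
      show "pverts H' = insert x (pverts H - {q, p, r})" unfolding perm by (rule V)
      show "(a, b) \<in> parcs H' \<longleftrightarrow> ((a, b) \<in> parcs H \<and> a \<notin> {q, p, r} \<and> b \<notin> {q, p, r}) \<or>
          (a = x \<and> (b = q' \<or> b = p' \<or> b = r')) \<or> (b = x \<and> (a = q' \<or> a = p' \<or> a = r'))" for a b
        unfolding perm using E[of a b] by blast
      show "(r, y) \<in> parcs H \<longleftrightarrow> y = q \<or> y = p \<or> y = r'" for y using nb(3)[of y] by blast
    qed (use ne in auto)
  qed
next
  case (D3b p q r s)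
  note g' = d3_step_pair_graph[OF step g]
  obtain p' r' where f: "\<And>y. (p, y) \<in> parcs H \<longleftrightarrow> y = q \<or> y = s \<or> y = p'"
    "\<And>y. (q, y) \<in> parcs H \<longleftrightarrow> y = p \<or> y = r \<or> y = s"
    "\<And>y. (r, y) \<in> parcs H \<longleftrightarrow> y = q \<or> y = s \<or> y = r'"
    "p' \<notin> {p, q, r, s}" "r' \<notin> {p, q, r, s}" "s \<notin> {p, q, r}"
    by (rule D3b_facts[OF g D3b(3-7)]) blast
  have ne: "p \<noteq> q" "q \<noteq> r" "p \<noteq> r" "s \<noteq> p" "s \<noteq> q" "s \<noteq> r" using D3b(4) f(6) by auto
  have V: "pverts H' = pverts H - {q}" using D3b(1) by simp
  have E: "(a, b) \<in> parcs H' \<longleftrightarrow> ((a, b) \<in> parcs H \<and> a \<noteq> q \<and> b \<noteq> q) \<or> (a = p \<and> b = r) \<or> (a = r \<and> b = p)" for a b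
    unfolding D3b(1) by auto
  have arcs: "(p, q) \<in> parcs H" "(q, s) \<in> parcs H" "(p, s) \<in> parcs H" "(q, r) \<in> parcs H" "(r, s) \<in> parcs H"
    by (simp_all add: f)
  then have sarcs: "(s, p) \<in> parcs H" "(s, q) \<in> parcs H" using pair_graphD(4)[OF g] by blast+
  have perm: "{q, s, p} = {p, q, s}" "{q, s, r} = {q, r, s}" by blast+
  note rs = planar_embeddingD(1)[OF e]
  have same: "Q = R" if "Q \<in> faces H \<sigma>" "R \<in> faces H \<sigma>" "a \<in> Q" "a \<in> R" for Q R a
    using faces_eq_face_of(1)[OF rs g that(1,3)] faces_eq_face_of(1)[OF rs g that(2,4)] by simp
  have "{(p, q), (q, s), (s, p)} \<in> faces H \<sigma> \<or> {(q, p), (p, s), (s, q)} \<in> faces H \<sigma>"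
    by (rule planar_triangle_face[OF g e arcs(1,2) sarcs(1) conn_minus_triangle[OF g c f(1), unfolded perm]])
  moreover have "{(q, r), (r, s), (s, q)} \<in> faces H \<sigma> \<or> {(r, q), (q, s), (s, r)} \<in> faces H \<sigma>"
    by (rule planar_triangle_face[OF g e arcs(4,5) sarcs(2) conn_minus_triangle[OF g c f(3), unfolded perm]])
  ultimately show ?thesis
  proof (elim disjE)
    assume 1: "{(p, q), (q, s), (s, p)} \<in> faces H \<sigma>" "{(q, r), (r, s), (s, q)} \<in> faces H \<sigma>"
    show ?thesis by (rule D3b_wheel_dual[OF g e g' c' V E f(1-3) ne f(4,5) 1 IH])
  next
    assume 2: "{(q, p), (p, s), (s, q)} \<in> faces H \<sigma>" "{(r, q), (q, s), (s, r)} \<in> faces H \<sigma>"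
    show ?thesis
    proof (rule D3b_wheel_dual[OF g e g' c' V _ f(3) _ f(1) _ _ _ _ _ _ _ _ 2(2,1) IH])
      show "(a, b) \<in> parcs H' \<longleftrightarrow> ((a, b) \<in> parcs H \<and> a \<noteq> q \<and> b \<noteq> q) \<or> (a = r \<and> b = p) \<or> (a = p \<and> b = r)" for a b
        using E[of a b] by blast
      show "(q, y) \<in> parcs H \<longleftrightarrow> y = r \<or> y = p \<or> y = s" for y using f(2)[of y] by blast
    qed (use ne f(4,5) in auto)
  next
    \<comment> \<open>With mixed orientations both faces would contain the same arc between
      \<open>q\<close> and \<open>s\<close> and so coincide, which their other arcs exclude.\<close>
    assume 3: "{(p, q), (q, s), (s, p)} \<in> faces H \<sigma>" "{(r, q), (q, s), (s, r)} \<in> faces H \<sigma>"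
    have "{(p, q), (q, s), (s, p)} = {(r, q), (q, s), (s, r)}" by (rule same[OF 3, of "(q, s)"]) simp_all
    then have "(p, q) \<in> {(r, q), (q, s), (s, r)}" by (metis insertI1)
    then show ?thesis using ne by auto
  next
    assume 4: "{(q, p), (p, s), (s, q)} \<in> faces H \<sigma>" "{(q, r), (r, s), (s, q)} \<in> faces H \<sigma>"
    have "{(q, p), (p, s), (s, q)} = {(q, r), (r, s), (s, q)}" by (rule same[OF 4, of "(s, q)"]) simp_all
    then have "(q, p) \<in> {(q, r), (r, s), (s, q)}" by (metis insertI1)
    then show ?thesis using ne by auto
  qed
qed

text \<open>3-connectivity is available only from the end of the sequence, so it is derived anew for
  each graph instead of being carried forward.\<close>

lemma d3_reducible_wheel_dual:
  assumes "d3_step\<^sup>*\<^sup>* H K" "complete_digraph 4 (with_proj K)" "pair_graph H" "planar_embedding H \<sigma>"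
  shows "wheel_dual H \<sigma>"
  using assms(1,3,4)
proof (induction arbitrary: \<sigma> rule: converse_rtranclp_induct)
  case base
  then show ?case using K4_wheel_dual[OF assms(2)] by blast
next
  case (step H H')
  note g' = d3_step_pair_graph[OF step.hyps(1) step.prems(1)]
  have "three_connected H'" by (rule d3_reducible_three_connected[OF step.hyps(2) assms(2) g'])
  moreover from this have "three_connected H" by (rule three_connected_d3_back[OF step.hyps(1) step.prems(1)])
  ultimately show ?case
    by (intro d3_step_wheel_dual[OF step.hyps(1) step.prems(1) _ _ step.prems(2)] step.IH[OF g'])
qed

theorem theorem9:
  fixes G :: "'a pair_pre_digraph"
  assumes "pair_graph G"
  shows "(\<exists>H :: nat pair_pre_digraph. d3_reducible H \<and> is_planar_dual H G) \<longleftrightarrow>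
         (\<exists>M :: nat pair_pre_digraph multiset.
            (\<forall>W \<in># M. polyhedral W \<and> is_wheel W) \<and> glued_from M G)"
proof
  assume "\<exists>H :: nat pair_pre_digraph. d3_reducible H \<and> is_planar_dual H G"
  then obtain H :: "nat pair_pre_digraph" and \<sigma> K where h: "pair_graph H" "d3_step\<^sup>*\<^sup>* H K" "complete_digraph 4 (with_proj K)"
    and e: "planar_embedding H \<sigma>" and iso: "digraph_iso (with_proj (dual_graph H \<sigma>)) (with_proj G)"
    unfolding d3_reducible_def is_planar_dual_def by blast
  obtain L :: "nat \<times> nat \<Rightarrow> nat" and F where L: "face_labelling H \<sigma> L" and F: "wheel_tree (label_graph L H) F"
    using d3_reducible_wheel_dual[OF h(2,3,1) e] unfolding wheel_dual_def by blast
  let ?G = "label_graph L H"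
  note g = wheel_tree_graph(1)[OF F]
  from label_graph_dual_iso[OF L h(1)] obtain f where f: "inj_on f (pverts ?G)" "dual_graph H \<sigma> = map_graph f ?G" .
  note d = pair_graph_wf[OF pair_graph_map_graph[OF g f(1)]]
  obtain k where k: "inj_on k (pverts (map_graph f ?G))" "G = map_graph k (map_graph f ?G)"
    using iso unfolding f(2) digraph_iso_iff[OF d] by blast
  \<comment> \<open>The tree of wheels lives on labels, which are numbers as
    \<open>wheel_tree_gluing\<close> requires; an isomorphism leads from there through the dual to
    \<open>G\<close>.\<close>
  have "inj_on (k \<circ> f) (pverts ?G)" using comp_inj_on[OF f(1)] k(1) by simp
  moreover have "G = map_graph (k \<circ> f) ?G" using k(2) by (simp only: map_graph_comp)
  ultimately have "digraph_iso (with_proj ?G) (with_proj G)"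
    unfolding digraph_iso_iff[OF pair_graph_wf[OF g]] by blast
  then show "\<exists>M :: nat pair_pre_digraph multiset. (\<forall>W \<in># M. polyhedral W \<and> is_wheel W) \<and> glued_from M G"
    using wheel_tree_gluing[OF F] unfolding glued_from_def by blast
next
  assume "\<exists>M :: nat pair_pre_digraph multiset. (\<forall>W \<in># M. polyhedral W \<and> is_wheel W) \<and> glued_from M G"
  then obtain M :: "nat pair_pre_digraph multiset" and G' F where M: "\<forall>W \<in># M. is_wheel W" "gluing M G' F"
    and iso: "digraph_iso (with_proj G') (with_proj G)"
    unfolding glued_from_def by blast
  obtain F' where F': "wheel_tree G' F'" using gluing_wheel_tree[OF M(2,1)] by blast
  note g = wheel_tree_graph(1)[OF F']
  obtain k where k: "inj_on k (pverts G')" "G = map_graph k G'"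
    using iso unfolding digraph_iso_iff[OF pair_graph_wf[OF g]] by blast
  from wheel_tree_dual_reducible[OF F'] obtain H :: "nat pair_pre_digraph" and \<sigma> h where
    "d3_reducible H" "planar_embedding H \<sigma>" "inj_on h (pverts G')" "dual_graph H \<sigma> = map_graph h G'" .
  moreover from this have "digraph_iso (with_proj (dual_graph H \<sigma>)) (with_proj G)"
    using digraph_iso_map_graph[OF g _ k(1)] k(2) by simp
  ultimately show "\<exists>H :: nat pair_pre_digraph. d3_reducible H \<and> is_planar_dual H G"
    unfolding is_planar_dual_def by blast
qed

end
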